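(* (Chaos decomposition I.) Let $\mathcal H$ be the complexification of a real Hilbert space $\mathcal H_{\mathbb R}$ and let $\{\xi_i:i\in\Xi\}$ be an orthonormal basis of $\mathcal H$, where $\Xi=[d]$ or $\Xi=\mathbb N$. Let $\Delta(\Xi^n)=\{\mathbf u\in\Xi^n:u(1)\le u(2)\le\dots\le u(n)\}$ and $\xi_{\mathbf u}=\xi_{u(1)}\otimes\dots\otimes\xi_{u(n)}$. (a) There is a decomposition $$\overline{\mathcal{TP}}(\mathcal H)=\bigoplus_{n=0}^\infty\bigoplus_{\mathbf u\in\Delta(\Xi^n)}Z(\mathbb C[S_0(n)]:\ker(\mathbf u))\otimes_s(\xi_{u(1)}\otimes\dots\otimes\xi_{u(n)})$$ (for infinite $\Xi$ the sum over $\mathbf u$, for fixed $n$, is understood as a closed direct sum in $\mathbb C[S_0(n)]\otimes\mathcal H^{\otimes n}$). If $q\in\mathcal Z$, this decomposition is orthogonal with respect to $\langle\cdot,\cdot\rangle_q$. (b) Let $q=1/N$, $N\in\mathbb N$. Any $A\in\mathcal F_{1/N}(\mathcal H)$ has a unique decomposition $$A=\sum_{n=0}^\infty\sum_{\mathbf u\in\Delta(\Xi^n)}\eta_{\mathbf u}\otimes_s\xi_{\mathbf u},$$ where $\eta_{\mathbf u}\in Z(\mathbb C[S_0(n)]:\ker(\mathbf u))$ for $n<N$ and $\eta_{\mathbf u}\in Z(\mathbb C[S_0(n)]:\ker(\mathbf u))\cap\mathbb C[S_0(n)]_{\le N}$ for $n\ge N$, and $$\langle A,A\rangle_q=\sum_{n=0}^\infty\sum_{\mathbf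 u\in\Delta(\Xi^n)}\ker(\mathbf u)!\,\chi_q[\eta_{\mathbf u}^*\eta_{\mathbf u}]<\infty,$$ where $\pi!=\prod_{V\in\pi}|V|!$. (c) For each $n$, for all sufficiently large $N$, $\mathbb C[S_0(n)]\otimes_s\mathcal H^{\otimes n}$ is complete with respect to the $\frac1N$-norm (the norm induced by $\langle\cdot,\cdot\rangle_{1/N}$).
   Context: $[n]=\{1,\dots,n\}$, $[0,n]=\{0,\dots,n\}$; $S(n)$, $S_0(n)$ are the permutation groups of $[n]$, $[0,n]$, with $S(n)\subset S_0(n)$ the permutations fixing $0$. For $\alpha\in S_0(n)$, $|\alpha|=(n+1)-\#\text{cycles}(\alpha)$ (fixed points are cycles). The adjoint on $\mathbb C[S_0(n)]$ is the antilinear extension of $\alpha^*=\alpha^{-1}$; $\chi_q$ is the linear extension of $\chi_q(\alpha)=q^{|\alpha|}$ (with $0^0=1$). $\mathcal Z=\{0\}\cup\{\pm1/N:N\in\mathbb N\}$. $\mathcal H^{\otimes n}$ is the Hilbert space tensor power. For $\sigma\in S(n)$, $U_\sigma(h_1\otimes\dots\otimes h_n)=h_{\sigma^{-1}(1)}\otimes\dots\otimes h_{\sigma^{-1}(n)}$, extended isometrically, and $\alpha\otimes_sF=\frac1{n!}\sum_{\sigma\in S(n)}\sigma\alpha\sigma^{-1}\otimes U_\sigma F$ (extended bilinearly). $\mathbb C[S_0(n)]\otimes_s\mathcal H^{\otimes n}$ is the image of $\mathbb C[S_0(n)]\otimes\mathcal H^{\otimes n}$ under this symmetrization, and $\overline{\mathcal{TP}}(\mathcal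 H)=\bigoplus_{n\ge0}\mathbb C[S_0(n)]\otimes_s\mathcal H^{\otimes n}$ (algebraic direct sum over $n$, the $n=0$ term being $\mathbb C$). The $q$-inner product is the sesquilinear form (linear in the first argument) $\langle\alpha\otimes F,\beta\otimes G\rangle_q=\delta_{n=k}\sum_{\sigma\in S(n)}\chi_q(\alpha\sigma\beta^{-1}\sigma^{-1})\langle F,U_\sigma G\rangle_{\mathcal H^{\otimes n}}$ for $\alpha\in S_0(n)$, $\beta\in S_0(k)$, $F\in\mathcal H^{\otimes n}$, $G\in\mathcal H^{\otimes k}$, restricted to $\overline{\mathcal{TP}}(\mathcal H)$; it is positive semi-definite for $q\in\mathcal Z$. $\mathcal F_q(\mathcal H)$ is the Hilbert space completion of the quotient of $\overline{\mathcal{TP}}(\mathcal H)$ by the kernel of $\langle\cdot,\cdot\rangle_q$; elements of $\overline{\mathcal{TP}}(\mathcal H)$ are identified with their classes. For $\mathbf u\in\Delta(\Xi^n)$, $\ker(\mathbf u)$ is the interval partition $(I_1,\dots,I_k)$ of $[n]$ in which $i,j$ are in the same block iff $u(i)=u(j)$. For an interval partition $\pi=(I_1,\dots,I_k)$ of $[n]$, $Z(\mathbb C[S_0(n)]:\pi)$ is the centralizer in $\mathbb C[S_0(n)]$ of the subgroup $S(I_1)\times\dots\times S(I_k)\subset S(n)\subset S_0(n)$. $\mathbb C[S_0(n)]_{\le N}$ is the sum of the two-sided ideals (minimal, isomorphic to full matrix algebras in the Wedderburn decomposition) of $\mathbb C[S_0(n)]$ corresponding to irreducible representations indexed by partitions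 $\lambda$ of $n+1$ with at most $N$ parts. *)

theory Defs
  imports
    "HOL-Analysis.Analysis"
    "HOL-Library.Function_Algebras"
    "HOL-Combinatorics.Permutations"
    "HOL-Combinatorics.Orbits"
begin

section \<open>Complex Hilbert spaces and complexification\<close>

text \<open>The complex inner product is linear in its first argument.\<close>

class complex_hilbert_space = real_inner + complete_space +
  fixes scaleC :: "complex \<Rightarrow> 'a \<Rightarrow> 'a"  (infixr \<open>*\<^sub>C\<close> 75)
    and cinner :: "'a \<Rightarrow> 'a \<Rightarrow> complex"
  assumes scaleC_add_right: "c *\<^sub>C (x + y) = c *\<^sub>C x + c *\<^sub>C y"
    and scaleC_add_left: "(c + d) *\<^sub>C x = c *\<^sub>C x + d *\<^sub>C x"
    and scaleC_scaleC: "c *\<^sub>C (d *\<^sub>C x) = (c * d) *\<^sub>C x"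
    and scaleC_of_real: "complex_of_real r *\<^sub>C x = scaleR r x"
    and cinner_commute: "cinner x y = cnj (cinner y x)"
    and cinner_add_left: "cinner (x + y) z = cinner x z + cinner y z"
    and cinner_scaleC_left: "cinner (c *\<^sub>C x) y = c * cinner x y"
    and Re_cinner: "Re (cinner x y) = inner x y"

abbreviation cspan :: "'a::complex_hilbert_space set \<Rightarrow> 'a set" where
  "cspan \<equiv> module.span scaleC"

abbreviation clinear :: "('a::complex_hilbert_space \<Rightarrow> 'b::complex_hilbert_space) \<Rightarrow> bool" where
  "clinear \<equiv> Vector_Spaces.linear scaleC scaleC"

text \<open>\<open>Cpx x y\<close> stands for \<open>x + \<i>y\<close>.\<close>

datatype 'a complexification = Cpx (re_part: 'a) (im_part: 'a)

lemma complexification_eqI: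
  "re_part z = re_part w \<Longrightarrow> im_part z = im_part w \<Longrightarrow> z = w"
  by (cases z; cases w) simp

instantiation complexification :: (real_inner) real_inner
begin

definition zero_complexification :: "'a complexification" where
  "0 = Cpx 0 0"
definition plus_complexification :: "'a complexification \<Rightarrow> 'a complexification \<Rightarrow> 'a complexification" where
  "z + w = Cpx (re_part z + re_part w) (im_part z + im_part w)"
definition minus_complexification :: "'a complexification \<Rightarrow> 'a complexification \<Rightarrow> 'a complexification" where
  "z - w = Cpx (re_part z - re_part w) (im_part z - im_part w)"
definition uminus_complexification :: "'a complexification \<Rightarrow> 'a complexification" where
  "- z = Cpx (- re_part z) (- im_part z)"
definition scaleR_complexification :: "real \<Rightarrow> 'a complexification \<Rightarrow> 'a complexification" where
  "scaleR r z = Cpx (scaleR r (re_part z)) (scaleR r (im_part z))"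
definition inner_complexification :: "'a complexification \<Rightarrow> 'a complexification \<Rightarrow> real" where
  "inner z w = inner (re_part z) (re_part w) + inner (im_part z) (im_part w)"
definition norm_complexification :: "'a complexification \<Rightarrow> real" where
  "norm (z :: 'a complexification) = sqrt (inner z z)"
definition sgn_complexification :: "'a complexification \<Rightarrow> 'a complexification" where
  "sgn (z :: 'a complexification) = scaleR (inverse (norm z)) z"
definition dist_complexification :: "'a complexification \<Rightarrow> 'a complexification \<Rightarrow> real" where
  "dist (z :: 'a complexification) w = norm (z - w)"
definition uniformity_complexification :: "('a complexification \<times> 'a complexification) filter" where
  "uniformity = (INF e\<in>{0<..}. principal {(z :: 'a complexification, w). dist z w < e})"
definition open_complexification :: "'a complexification set \<Rightarrow> bool" where
  "open (U :: 'a complexification set) \<longleftrightarrow>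
     (\<forall>z\<in>U. eventually (\<lambda>(z', w). z' = z \<longrightarrow> w \<in> U) uniformity)"

lemmas complexification_defs =
  zero_complexification_def plus_complexification_def minus_complexification_def
  uminus_complexification_def scaleR_complexification_def inner_complexification_def

instance
proof
  fix x y z :: "'a complexification" and a b :: real and U :: "'a complexification set"
  show "x + y + z = x + (y + z)" "x + y = y + x" "0 + x = x" "- x + x = 0" "x - y = x + - y"
    by (simp_all add: complexification_defs algebra_simps complexification_eqI)
  show "a *\<^sub>R (x + y) = a *\<^sub>R x + a *\<^sub>R y" "(a + b) *\<^sub>R x = a *\<^sub>R x + b *\<^sub>R x"
    "a *\<^sub>R b *\<^sub>R x = (a * b) *\<^sub>R x" "1 *\<^sub>R x = x"
    by (simp_all add: complexification_defs algebra_simps)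
  show "inner x y = inner y x" "inner (x + y) z = inner x z + inner y z"
    "inner (a *\<^sub>R x) y = a * inner x y" "0 \<le> inner x x"
    by (simp_all add: complexification_defs inner_commute inner_add_left algebra_simps)
  show "inner x x = 0 \<longleftrightarrow> x = 0"
    by (cases x) (simp add: complexification_defs add_nonneg_eq_0_iff)
qed (simp_all only: norm_complexification_def sgn_complexification_def dist_complexification_def
       uniformity_complexification_def open_complexification_def)

end

lemma norm_complexification_le:
  "norm z \<le> norm (re_part z) + norm (im_part z)"
  unfolding norm_complexification_def inner_complexification_def
  by (simp add: dot_square_norm sqrt_sum_squares_le_sum)

lemma norm_parts_le:
  "norm (re_part z) \<le> norm z" "norm (im_part z) \<le> norm z"
  unfolding norm_complexification_def inner_complexification_def
  by (simp_all add: dot_square_norm real_le_rsqrt)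

instance complexification :: ("{real_inner,complete_space}") complete_space
proof
  fix X :: "nat \<Rightarrow> 'a complexification"
  assume X: "Cauchy X"
  have parts: "dist (re_part z) (re_part w) \<le> dist z w" "dist (im_part z) (im_part w) \<le> dist z w"
    for z w :: "'a complexification"
    using norm_parts_le[of "z - w"] by (simp_all add: dist_norm minus_complexification_def)
  have Cauchy_part: "Cauchy (\<lambda>n. f (X n))"
    if f: "\<And>z w. dist (f z) (f w) \<le> dist z w" for f :: "'a complexification \<Rightarrow> 'a"
  proof (rule metric_CauchyI)
    fix e :: real
    assume "0 < e"
    then obtain M where M: "\<And>m n. M \<le> m \<Longrightarrow> M \<le> n \<Longrightarrow> dist (X m) (X n) < e"
      using metric_CauchyD[OF X] by metis
    show "\<exists>M. \<forall>m\<ge>M. \<forall>n\<ge>M. dist (f (X m)) (f (X n)) < e"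
      using le_less_trans[OF f M] by (intro exI[of _ M]) simp
  qed
  obtain a where a: "(\<lambda>n. re_part (X n)) \<longlonglongrightarrow> a"
    using Cauchy_convergent[OF Cauchy_part[OF parts(1)]] unfolding convergent_def by blast
  obtain b where b: "(\<lambda>n. im_part (X n)) \<longlonglongrightarrow> b"
    using Cauchy_convergent[OF Cauchy_part[OF parts(2)]] unfolding convergent_def by blast
  have lim: "(\<lambda>n. norm (re_part (X n) - a) + norm (im_part (X n) - b)) \<longlonglongrightarrow> 0"
    using tendsto_add[OF tendsto_norm_zero[OF LIM_zero[OF a]] tendsto_norm_zero[OF LIM_zero[OF b]]]
    by simp
  have le: "norm (X n - Cpx a b) \<le> norm (re_part (X n) - a) + norm (im_part (X n) - b)" for n
    using norm_complexification_le[of "X n - Cpx a b"] by (simp add: minus_complexification_def)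
  have "(\<lambda>n. X n - Cpx a b) \<longlonglongrightarrow> 0"
    by (rule Lim_null_comparison[OF _ lim]) (rule always_eventually, rule allI, rule le)
  then show "convergent X"
    using LIM_zero_cancel convergent_def by blast
qed

instantiation complexification :: ("{real_inner,complete_space}") complex_hilbert_space
begin

definition scaleC_complexification :: "complex \<Rightarrow> 'a complexification \<Rightarrow> 'a complexification" where
  "c *\<^sub>C z = Cpx (Re c *\<^sub>R re_part z - Im c *\<^sub>R im_part z) (Re c *\<^sub>R im_part z + Im c *\<^sub>R re_part z)"
definition cinner_complexification :: "'a complexification \<Rightarrow> 'a complexification \<Rightarrow> complex" where
  "cinner z w = Complex (inner (re_part z) (re_part w) + inner (im_part z) (im_part w))
                        (inner (im_part z) (re_part w) - inner (re_part z) (im_part w))"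

instance
proof
  fix x y z :: "'a complexification" and c d :: complex and r :: real
  show "c *\<^sub>C (x + y) = c *\<^sub>C x + c *\<^sub>C y" "(c + d) *\<^sub>C x = c *\<^sub>C x + d *\<^sub>C x"
    "c *\<^sub>C d *\<^sub>C x = (c * d) *\<^sub>C x" "complex_of_real r *\<^sub>C x = r *\<^sub>R x"
    by (simp_all add: scaleC_complexification_def complexification_defs algebra_simps)
  show "cinner x y = cnj (cinner y x)" "cinner (x + y) z = cinner x z + cinner y z"
    "cinner (c *\<^sub>C x) y = c * cinner x y" "Re (cinner x y) = inner x y"
    by (simp_all add: scaleC_complexification_def cinner_complexification_def complexification_defs
        complex_eq_iff inner_commute inner_add_left inner_diff_left algebra_simps)
qed

end

definition orthonormal_basis :: "nat set \<Rightarrow> (nat \<Rightarrow> 'a::complex_hilbert_space) \<Rightarrow> bool" where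
  "orthonormal_basis \<Xi> \<xi> \<longleftrightarrow>
     (\<forall>i\<in>\<Xi>. \<forall>j\<in>\<Xi>. cinner (\<xi> i) (\<xi> j) = of_bool (i = j)) \<and> closure (cspan (\<xi> ` \<Xi>)) = UNIV"


section \<open>Sums and completeness with respect to a seminorm\<close>

definition sums_wrt :: "('b::ab_group_add \<Rightarrow> real) \<Rightarrow> ('i \<Rightarrow> 'b) \<Rightarrow> 'i set \<Rightarrow> 'b \<Rightarrow> bool" where
  "sums_wrt nrm v I x \<longleftrightarrow> ((\<lambda>F. nrm (x - sum v F)) \<longlongrightarrow> 0) (finite_subsets_at_top I)"

definition Cauchy_wrt :: "('b::ab_group_add \<Rightarrow> real) \<Rightarrow> (nat \<Rightarrow> 'b) \<Rightarrow> bool" where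
  "Cauchy_wrt nrm X \<longleftrightarrow> (\<forall>e>0. \<exists>M. \<forall>j\<ge>M. \<forall>k\<ge>M. nrm (X j - X k) < e)"

definition complete_wrt :: "('b::ab_group_add \<Rightarrow> real) \<Rightarrow> 'b set \<Rightarrow> bool" where
  "complete_wrt nrm W \<longleftrightarrow>
     (\<forall>X. (\<forall>k. X k \<in> W) \<and> Cauchy_wrt nrm X \<longrightarrow> (\<exists>x\<in>W. (\<lambda>k. nrm (X k - x)) \<longlonglongrightarrow> 0))"

text \<open>The closure, inside the normed space \<open>E\<close>, of the algebraic sum of the subspaces \<open>V i\<close>.\<close>

definition closed_sum ::
  "('b::ab_group_add \<Rightarrow> real) \<Rightarrow> 'b set \<Rightarrow> ('i \<Rightarrow> 'b set) \<Rightarrow> 'i set \<Rightarrow> 'b set" where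
  "closed_sum nrm E V I =
     {x \<in> E. \<forall>e>0. \<exists>F v. finite F \<and> F \<subseteq> I \<and> (\<forall>i\<in>F. v i \<in> V i) \<and> nrm (x - sum v F) < e}"

text \<open>Every element of the closed sum is the (unconditionally convergent) sum of a unique family
  of components. For finite \<open>I\<close> this is the usual notion of an internal direct sum.\<close>

definition closed_sum_direct ::
  "('b::ab_group_add \<Rightarrow> real) \<Rightarrow> 'b set \<Rightarrow> ('i \<Rightarrow> 'b set) \<Rightarrow> 'i set \<Rightarrow> bool" where
  "closed_sum_direct nrm E V I \<longleftrightarrow>
     (\<forall>x\<in>closed_sum nrm E V I.
        \<exists>!v. (\<forall>i\<in>I. v i \<in> V i) \<and> (\<forall>i. i \<notin> I \<longrightarrow> v i = 0) \<and> sums_wrt nrm v I x)"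

definition alg_direct_sum :: "(nat \<Rightarrow> 'b::zero set) \<Rightarrow> (nat \<Rightarrow> 'b) set" where
  "alg_direct_sum W = {A. (\<forall>n. A n \<in> W n) \<and> finite {n. A n \<noteq> 0}}"

definition in_degree :: "nat \<Rightarrow> 'b::zero \<Rightarrow> nat \<Rightarrow> 'b" where
  "in_degree n x = (\<lambda>m. if m = n then x else 0)"


section \<open>The group algebra of the permutations of \<open>{0..n}\<close>\<close>

type_synonym perm = "nat \<Rightarrow> nat"
type_synonym galg = "perm \<Rightarrow> complex"

definition Sym :: "nat \<Rightarrow> perm set" where
  "Sym n = {\<sigma>. \<sigma> permutes {1..n}}"

definition Sym0 :: "nat \<Rightarrow> perm set" where
  "Sym0 n = {\<sigma>. \<sigma> permutes {0..n}}"

text \<open>The orbits of \<open>\<alpha>\<close> on \<open>{0..n}\<close> are its cycles, fixed points included.\<close>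

definition perm_length :: "nat \<Rightarrow> perm \<Rightarrow> nat" where
  "perm_length n \<alpha> = (n + 1) - card (orbit \<alpha> ` {0..n})"

definition group_algebra :: "nat \<Rightarrow> galg set" where
  "group_algebra n = {a. \<forall>\<alpha>. \<alpha> \<notin> Sym0 n \<longrightarrow> a \<alpha> = 0}"

definition single :: "perm \<Rightarrow> galg" where
  "single \<alpha> = (\<lambda>\<gamma>. if \<gamma> = \<alpha> then 1 else 0)"

text \<open>Not the pointwise product that the type class instance on functions provides.\<close>

definition gmult :: "nat \<Rightarrow> galg \<Rightarrow> galg \<Rightarrow> galg" where
  "gmult n a b = (\<lambda>\<gamma>. \<Sum>\<alpha>\<in>Sym0 n. a \<alpha> * b (inv \<alpha> \<circ> \<gamma>))"

definition gadjoint :: "nat \<Rightarrow> galg \<Rightarrow> galg" where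
  "gadjoint n a = (\<lambda>\<alpha>. if \<alpha> \<in> Sym0 n then cnj (a (inv \<alpha>)) else 0)"

definition chi_perm :: "real \<Rightarrow> nat \<Rightarrow> perm \<Rightarrow> complex" where
  "chi_perm q n \<alpha> = complex_of_real (q ^ perm_length n \<alpha>)"

definition chi :: "real \<Rightarrow> nat \<Rightarrow> galg \<Rightarrow> complex" where
  "chi q n a = (\<Sum>\<alpha>\<in>Sym0 n. a \<alpha> * chi_perm q n \<alpha>)"

definition Zparam :: "real set" where
  "Zparam = {0} \<union> {1 / real N | N. N \<ge> 1} \<union> {- 1 / real N | N. N \<ge> 1}"


subsection \<open>Kernels of index tuples and centralizers\<close>

definition increasing_tuples :: "nat set \<Rightarrow> nat \<Rightarrow> (nat \<Rightarrow> nat) set" where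
  "increasing_tuples \<Xi> n = {u \<in> {1..n} \<rightarrow>\<^sub>E \<Xi>. mono_on {1..n} u}"

definition ker_partition :: "nat \<Rightarrow> (nat \<Rightarrow> nat) \<Rightarrow> nat set set" where
  "ker_partition n u = {{j\<in>{1..n}. u j = u i} | i. i \<in> {1..n}}"

definition partition_fact :: "nat set set \<Rightarrow> nat" where
  "partition_fact \<pi> = (\<Prod>V\<in>\<pi>. fact (card V))"

text \<open>The subgroup \<open>S(I\<^sub>1) \<times> \<dots> \<times> S(I\<^sub>k)\<close> of \<open>S(n)\<close>.\<close>

definition young_subgroup :: "nat \<Rightarrow> nat set set \<Rightarrow> perm set" where
  "young_subgroup n \<pi> = {\<sigma>\<in>Sym n. \<forall>V\<in>\<pi>. \<sigma> ` V = V}"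

definition centralizer :: "nat \<Rightarrow> nat set set \<Rightarrow> galg set" where
  "centralizer n \<pi> =
     {\<eta>\<in>group_algebra n. \<forall>\<sigma>\<in>young_subgroup n \<pi>. gmult n (single \<sigma>) \<eta> = gmult n \<eta> (single \<sigma>)}"


subsection \<open>The ideal of shapes with at most \<open>N\<close> parts\<close>

definition partition_of :: "nat list \<Rightarrow> nat \<Rightarrow> bool" where
  "partition_of \<mu> m \<longleftrightarrow> sorted_wrt (\<ge>) \<mu> \<and> 0 \<notin> set \<mu> \<and> sum_list \<mu> = m"

text \<open>Row and column (counted from 0) of the entry \<open>i\<close> in the tableau of shape \<open>\<mu>\<close> that is
  filled row by row with \<open>0, 1, 2, \<dots>\<close>.\<close>

definition tableau_row :: "nat list \<Rightarrow> nat \<Rightarrow> nat" where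
  "tableau_row \<mu> i = (LEAST r. i < sum_list (take (Suc r) \<mu>))"

definition tableau_col :: "nat list \<Rightarrow> nat \<Rightarrow> nat" where
  "tableau_col \<mu> i = i - sum_list (take (tableau_row \<mu> i) \<mu>)"

definition row_stabilizer :: "nat \<Rightarrow> nat list \<Rightarrow> perm set" where
  "row_stabilizer n \<mu> = {\<sigma>\<in>Sym0 n. \<forall>i\<in>{0..n}. tableau_row \<mu> (\<sigma> i) = tableau_row \<mu> i}"

definition col_stabilizer :: "nat \<Rightarrow> nat list \<Rightarrow> perm set" where
  "col_stabilizer n \<mu> = {\<sigma>\<in>Sym0 n. \<forall>i\<in>{0..n}. tableau_col \<mu> (\<sigma> i) = tableau_col \<mu> i}"

definition young_symmetrizer :: "nat \<Rightarrow> nat list \<Rightarrow> galg" where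
  "young_symmetrizer n \<mu> =
     gmult n (\<Sum>\<sigma>\<in>row_stabilizer n \<mu>. single \<sigma>)
             (\<Sum>\<sigma>\<in>col_stabilizer n \<mu>. (\<lambda>\<gamma>. of_int (sign \<sigma>) * single \<sigma> \<gamma>))"

text \<open>The irreducible representation indexed by \<open>\<mu>\<close>, realised as the left ideal generated by the
  Young symmetrizer. The one-row shape gives the trivial representation.\<close>

definition specht_module :: "nat \<Rightarrow> nat list \<Rightarrow> galg set" where
  "specht_module n \<mu> = {gmult n a (young_symmetrizer n \<mu>) | a. a \<in> group_algebra n}"

definition two_sided_ideal :: "nat \<Rightarrow> galg set \<Rightarrow> bool" where
  "two_sided_ideal n I \<longleftrightarrow> I \<subseteq> group_algebra n \<and> 0 \<in> I \<and> (\<forall>a\<in>I. \<forall>b\<in>I. a + b \<in> I) \<and>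
     (\<forall>a\<in>I. \<forall>x\<in>group_algebra n. gmult n x a \<in> I \<and> gmult n a x \<in> I)"

definition minimal_ideal :: "nat \<Rightarrow> galg set \<Rightarrow> bool" where
  "minimal_ideal n I \<longleftrightarrow> two_sided_ideal n I \<and> I \<noteq> {0} \<and>
     (\<forall>J. two_sided_ideal n J \<and> J \<subseteq> I \<longrightarrow> J = {0} \<or> J = I)"

text \<open>The minimal two-sided ideals are the Wedderburn components of the group algebra; the one
  corresponding to an irreducible representation is the one that does not annihilate it.\<close>

definition ideal_of_shape :: "nat \<Rightarrow> nat list \<Rightarrow> galg set \<Rightarrow> bool" where
  "ideal_of_shape n \<mu> I \<longleftrightarrow>
     minimal_ideal n I \<and> (\<exists>a\<in>I. \<exists>v\<in>specht_module n \<mu>. gmult n a v \<noteq> 0)"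

definition group_algebra_le :: "nat \<Rightarrow> nat \<Rightarrow> galg set" where
  "group_algebra_le n N =
     {sum x M | x M. finite M \<and>
        (\<forall>I\<in>M. x I \<in> I \<and> (\<exists>\<mu>. partition_of \<mu> (n + 1) \<and> length \<mu> \<le> N \<and> ideal_of_shape n \<mu> I))}"


section \<open>Tensor powers\<close>

text \<open>\<open>\<tau> n h\<close> is the elementary tensor \<open>h 1 \<otimes> \<dots> \<otimes> h n\<close>. The predicate says that, for every \<open>n\<close>, the
  closed span of the elementary tensors is the Hilbert space tensor power of degree \<open>n\<close>, which
  these conditions determine up to a unique unitary.\<close>

definition tensor_power ::
  "(nat \<Rightarrow> (nat \<Rightarrow> 'a) \<Rightarrow> 't::complex_hilbert_space) \<Rightarrow> nat \<Rightarrow> 't set" where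
  "tensor_power \<tau> n = closure (cspan (range (\<tau> n)))"

definition hilbert_tensor_powers ::
  "(nat \<Rightarrow> (nat \<Rightarrow> 'a::complex_hilbert_space) \<Rightarrow> 't::complex_hilbert_space) \<Rightarrow> bool" where
  "hilbert_tensor_powers \<tau> \<longleftrightarrow>
     (\<forall>n h g. (\<forall>i\<in>{1..n}. h i = g i) \<longrightarrow> \<tau> n h = \<tau> n g) \<and>
     (\<forall>n h. \<forall>i\<in>{1..n}. clinear (\<lambda>x. \<tau> n (h(i := x)))) \<and>
     (\<forall>n h g. cinner (\<tau> n h) (\<tau> n g) = (\<Prod>i=1..n. cinner (h i) (g i)))"

text \<open>\<open>U\<^sub>\<sigma>\<close>: the isometric linear extension, with value \<open>0\<close> outside the tensor power so that the
  description is unique.\<close>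

definition perm_op ::
  "(nat \<Rightarrow> (nat \<Rightarrow> 'a) \<Rightarrow> 't::complex_hilbert_space) \<Rightarrow> nat \<Rightarrow> perm \<Rightarrow> 't \<Rightarrow> 't" where
  "perm_op \<tau> n \<sigma> = (THE U.
     (\<forall>h. U (\<tau> n h) = \<tau> n (\<lambda>i. h (inv \<sigma> i))) \<and>
     (\<forall>F\<in>tensor_power \<tau> n. \<forall>G\<in>tensor_power \<tau> n. \<forall>c. U (c *\<^sub>C F + G) = c *\<^sub>C U F + U G) \<and>
     (\<forall>F\<in>tensor_power \<tau> n. norm (U F) = norm F) \<and>
     (\<forall>F. F \<notin> tensor_power \<tau> n \<longrightarrow> U F = 0))"

text \<open>\<open>\<complex>[S\<^sub>0(n)] \<otimes> X\<close> is encoded by the coefficient functions of \<open>\<Sum>\<^sub>\<alpha> \<alpha> \<otimes> X\<^sub>\<alpha>\<close> with respect to the basis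
  \<open>S\<^sub>0(n)\<close>.\<close>

definition alg_tensor ::
  "(nat \<Rightarrow> (nat \<Rightarrow> 'a) \<Rightarrow> 't::complex_hilbert_space) \<Rightarrow> nat \<Rightarrow> (perm \<Rightarrow> 't) set" where
  "alg_tensor \<tau> n =
     {X. (\<forall>\<alpha>\<in>Sym0 n. X \<alpha> \<in> tensor_power \<tau> n) \<and> (\<forall>\<alpha>. \<alpha> \<notin> Sym0 n \<longrightarrow> X \<alpha> = 0)}"

definition alg_tensor_norm :: "nat \<Rightarrow> (perm \<Rightarrow> 't::complex_hilbert_space) \<Rightarrow> real" where
  "alg_tensor_norm n X = sqrt (\<Sum>\<alpha>\<in>Sym0 n. (norm (X \<alpha>))\<^sup>2)"

text \<open>The linear extension of \<open>\<alpha> \<otimes> F \<mapsto> \<alpha> \<otimes>\<^sub>s F = (1/n!) \<Sum>\<^sub>\<sigma> \<sigma>\<alpha>\<sigma>\<^sup>-\<^sup>1 \<otimes> U\<^sub>\<sigma> F\<close>: the coefficient at \<open>\<beta>\<close> comes from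
  \<open>\<alpha> = \<sigma>\<^sup>-\<^sup>1\<beta>\<sigma>\<close>.\<close>

definition symmetrize ::
  "(nat \<Rightarrow> (nat \<Rightarrow> 'a) \<Rightarrow> 't::complex_hilbert_space) \<Rightarrow> nat \<Rightarrow> (perm \<Rightarrow> 't) \<Rightarrow> perm \<Rightarrow> 't" where
  "symmetrize \<tau> n X =
     (\<lambda>\<beta>. (1 / fact n) *\<^sub>R (\<Sum>\<sigma>\<in>Sym n. perm_op \<tau> n \<sigma> (X (inv \<sigma> \<circ> \<beta> \<circ> \<sigma>))))"

definition stensor ::
  "(nat \<Rightarrow> (nat \<Rightarrow> 'a) \<Rightarrow> 't::complex_hilbert_space) \<Rightarrow> nat \<Rightarrow> galg \<Rightarrow> 't \<Rightarrow> perm \<Rightarrow> 't" where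
  "stensor \<tau> n \<eta> F = symmetrize \<tau> n (\<lambda>\<alpha>. \<eta> \<alpha> *\<^sub>C F)"

definition sym_tensor ::
  "(nat \<Rightarrow> (nat \<Rightarrow> 'a) \<Rightarrow> 't::complex_hilbert_space) \<Rightarrow> nat \<Rightarrow> (perm \<Rightarrow> 't) set" where
  "sym_tensor \<tau> n = symmetrize \<tau> n ` alg_tensor \<tau> n"

definition TP ::
  "(nat \<Rightarrow> (nat \<Rightarrow> 'a) \<Rightarrow> 't::complex_hilbert_space) \<Rightarrow> (nat \<Rightarrow> perm \<Rightarrow> 't) set" where
  "TP \<tau> = alg_direct_sum (sym_tensor \<tau>)"

definition basis_tensor ::
  "(nat \<Rightarrow> (nat \<Rightarrow> 'a) \<Rightarrow> 't) \<Rightarrow> (nat \<Rightarrow> 'a) \<Rightarrow> nat \<Rightarrow> (nat \<Rightarrow> nat) \<Rightarrow> 't" where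
  "basis_tensor \<tau> \<xi> n u = \<tau> n (\<lambda>i. \<xi> (u i))"

definition chaos_component ::
  "(nat \<Rightarrow> (nat \<Rightarrow> 'a) \<Rightarrow> 't::complex_hilbert_space) \<Rightarrow> (nat \<Rightarrow> 'a) \<Rightarrow> nat \<Rightarrow> (nat \<Rightarrow> nat) \<Rightarrow> (perm \<Rightarrow> 't) set"
  where
  "chaos_component \<tau> \<xi> n u =
     {stensor \<tau> n \<eta> (basis_tensor \<tau> \<xi> n u) | \<eta>. \<eta> \<in> centralizer n (ker_partition n u)}"


section \<open>The \<open>q\<close>-inner product and the \<open>q\<close>-Fock space\<close>

definition q_inner ::
  "(nat \<Rightarrow> (nat \<Rightarrow> 'a) \<Rightarrow> 't::complex_hilbert_space) \<Rightarrow> real \<Rightarrow>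
   (nat \<Rightarrow> perm \<Rightarrow> 't) \<Rightarrow> (nat \<Rightarrow> perm \<Rightarrow> 't) \<Rightarrow> complex" where
  "q_inner \<tau> q A B = (\<Sum>n | A n \<noteq> 0. \<Sum>\<alpha>\<in>Sym0 n. \<Sum>\<beta>\<in>Sym0 n. \<Sum>\<sigma>\<in>Sym n.
     chi_perm q n (\<alpha> \<circ> \<sigma> \<circ> inv \<beta> \<circ> inv \<sigma>) * cinner (A n \<alpha>) (perm_op \<tau> n \<sigma> (B n \<beta>)))"

definition q_norm ::
  "(nat \<Rightarrow> (nat \<Rightarrow> 'a) \<Rightarrow> 't::complex_hilbert_space) \<Rightarrow> real \<Rightarrow> (nat \<Rightarrow> perm \<Rightarrow> 't) \<Rightarrow> real" where
  "q_norm \<tau> q A = sqrt (Re (q_inner \<tau> q A A))"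

text \<open>The completion of \<open>TP\<close> modulo the kernel of the form: Cauchy sequences for the seminorm
  modulo sequences whose difference tends to \<open>0\<close>. The kernel is divided out in the same step.\<close>

definition fock_Cauchy ::
  "(nat \<Rightarrow> (nat \<Rightarrow> 'a) \<Rightarrow> 't::complex_hilbert_space) \<Rightarrow> real \<Rightarrow> (nat \<Rightarrow> nat \<Rightarrow> perm \<Rightarrow> 't) set" where
  "fock_Cauchy \<tau> q = {X. (\<forall>k. X k \<in> TP \<tau>) \<and> Cauchy_wrt (q_norm \<tau> q) X}"

definition fock_rel ::
  "(nat \<Rightarrow> (nat \<Rightarrow> 'a) \<Rightarrow> 't::complex_hilbert_space) \<Rightarrow> real \<Rightarrow>
   ((nat \<Rightarrow> nat \<Rightarrow> perm \<Rightarrow> 't) \<times> (nat \<Rightarrow> nat \<Rightarrow> perm \<Rightarrow> 't)) set" where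
  "fock_rel \<tau> q = {(X, Y). X \<in> fock_Cauchy \<tau> q \<and> Y \<in> fock_Cauchy \<tau> q \<and>
     (\<lambda>k. q_norm \<tau> q (X k - Y k)) \<longlonglongrightarrow> 0}"

definition fock_space ::
  "(nat \<Rightarrow> (nat \<Rightarrow> 'a) \<Rightarrow> 't::complex_hilbert_space) \<Rightarrow> real \<Rightarrow> (nat \<Rightarrow> nat \<Rightarrow> perm \<Rightarrow> 't) set set" where
  "fock_space \<tau> q = fock_Cauchy \<tau> q // fock_rel \<tau> q"

definition fock_embed ::
  "(nat \<Rightarrow> (nat \<Rightarrow> 'a) \<Rightarrow> 't::complex_hilbert_space) \<Rightarrow> real \<Rightarrow>
   (nat \<Rightarrow> perm \<Rightarrow> 't) \<Rightarrow> (nat \<Rightarrow> nat \<Rightarrow> perm \<Rightarrow> 't) set" where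
  "fock_embed \<tau> q A = fock_rel \<tau> q `` {\<lambda>_. A}"

definition fock_diff ::
  "(nat \<Rightarrow> (nat \<Rightarrow> 'a) \<Rightarrow> 't::complex_hilbert_space) \<Rightarrow> real \<Rightarrow>
   (nat \<Rightarrow> nat \<Rightarrow> perm \<Rightarrow> 't) set \<Rightarrow> (nat \<Rightarrow> nat \<Rightarrow> perm \<Rightarrow> 't) set \<Rightarrow> (nat \<Rightarrow> nat \<Rightarrow> perm \<Rightarrow> 't) set" where
  "fock_diff \<tau> q \<A> \<B> = fock_rel \<tau> q `` {\<lambda>k. (SOME X. X \<in> \<A>) k - (SOME Y. Y \<in> \<B>) k}"

definition fock_inner ::
  "(nat \<Rightarrow> (nat \<Rightarrow> 'a) \<Rightarrow> 't::complex_hilbert_space) \<Rightarrow> real \<Rightarrow>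
   (nat \<Rightarrow> nat \<Rightarrow> perm \<Rightarrow> 't) set \<Rightarrow> (nat \<Rightarrow> nat \<Rightarrow> perm \<Rightarrow> 't) set \<Rightarrow> complex" where
  "fock_inner \<tau> q \<A> \<B> = lim (\<lambda>k. q_inner \<tau> q ((SOME X. X \<in> \<A>) k) ((SOME Y. Y \<in> \<B>) k))"

definition fock_norm ::
  "(nat \<Rightarrow> (nat \<Rightarrow> 'a) \<Rightarrow> 't::complex_hilbert_space) \<Rightarrow> real \<Rightarrow>
   (nat \<Rightarrow> nat \<Rightarrow> perm \<Rightarrow> 't) set \<Rightarrow> real" where
  "fock_norm \<tau> q \<A> = sqrt (Re (fock_inner \<tau> q \<A> \<A>))"

text \<open>\<open>\<A>\<close> is the norm-convergent unordered sum, in the Fock space, of the classes of the \<open>v i\<close>.\<close>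

definition fock_sums ::
  "(nat \<Rightarrow> (nat \<Rightarrow> 'a) \<Rightarrow> 't::complex_hilbert_space) \<Rightarrow> real \<Rightarrow>
   ('i \<Rightarrow> nat \<Rightarrow> perm \<Rightarrow> 't) \<Rightarrow> 'i set \<Rightarrow> (nat \<Rightarrow> nat \<Rightarrow> perm \<Rightarrow> 't) set \<Rightarrow> bool" where
  "fock_sums \<tau> q v I \<A> \<longleftrightarrow>
     ((\<lambda>F. fock_norm \<tau> q (fock_diff \<tau> q \<A> (fock_embed \<tau> q (sum v F)))) \<longlongrightarrow> 0)
       (finite_subsets_at_top I)"

text \<open>Coefficient families \<open>\<eta>\<close> are set to \<open>0\<close> off the index set, so that uniqueness is meaningful.\<close>

definition chaos_coeffs :: "nat set \<Rightarrow> nat \<Rightarrow> (nat \<Rightarrow> (nat \<Rightarrow> nat) \<Rightarrow> galg) set" where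
  "chaos_coeffs \<Xi> N = {\<eta>.
     (\<forall>n. \<forall>u\<in>increasing_tuples \<Xi> n. \<eta> n u \<in> centralizer n (ker_partition n u) \<and>
        (n \<ge> N \<longrightarrow> \<eta> n u \<in> group_algebra_le n N)) \<and>
     (\<forall>n u. u \<notin> increasing_tuples \<Xi> n \<longrightarrow> \<eta> n u = 0)}"

end

theory Submission
  imports Defs
begin

text \<open>The proof rests on one formula. For \<open>q = 1/N\<close> and a permutation \<open>\<gamma>\<close> of \<open>{0..n}\<close>, the number
  \<open>N\<^sup>n\<^sup>+\<^sup>1 \<chi>\<^sub>q(\<gamma>)\<close> counts the words \<open>g : {0..n} \<rightarrow> {0..N-1}\<close> with \<open>g \<circ> \<gamma> = g\<close>, because such a word is constant
  on the cycles of \<open>\<gamma>\<close>. In \<open>\<chi>\<^sub>q(\<alpha>\<beta>\<^sup>-\<^sup>1)\<close> the condition reads \<open>g \<circ> \<alpha> = g \<circ> \<beta>\<close>; sorting by the common value \<open>h\<close> of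
  both sides turns the \<open>q\<close>-inner product of symmetric tensors into a sum over pairs of words of the products
  of the word sums \<open>\<Sum>{X\<^sub>\<alpha> | g \<circ> \<alpha> = h}\<close> (\<open>words_form\<close>, \<open>qdeg_words\<close>). So the form is positive semi-definite, and
  on the group algebra its null space is the two-sided ideal \<open>tensor_kernel\<close> of the elements that act as \<open>0\<close> on words in
  \<open>N\<close> letters, that is, on the tensor power \<open>n + 1\<close> of \<open>\<complex>\<^sup>N\<close>.

  The representation theory that is needed says that this ideal is complementary to \<open>\<complex>[S\<^sub>0(n)]\<^sub>\<le>\<^sub>N\<close>
  (\<open>group_algebra_split\<close>, \<open>group_algebra_le_Int_kernel\<close>). Minimal ideals are tested with row symmetrizers and
  column antisymmetrizers. By the dominance order different partitions give different minimal ideals; since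
  minimal ideals contain linearly independent class functions, there are no others
  (\<open>minimal_ideal_partition\<close>). If a shape has at most \<open>N\<close> rows, its row function is itself a word in \<open>N\<close>
  letters, so its ideal acts nontrivially on words; conversely, the first column of the tableau of an ideal
  that acts nontrivially carries pairwise different letters, so there are at most \<open>N\<close> rows.

  Part (a): a symmetric tensor is determined by its coordinates \<open>coord n X u\<close> at the basis tensors of increasing
  tuples \<open>u\<close>, since the other basis tensors are permutations of these. The permutations that fix \<open>u\<close> force
  this coordinate into the centralizer, and the component of \<open>X\<close> at \<open>u\<close> is the partial Fourier sum of \<open>X\<close> over the
  orbit of \<open>u\<close>. Different orbits involve orthogonal basis tensors, whence orthogonality.

  Part (b): a chaos component modulo null vectors is a finite-dimensional, hence complete, space, and the
  complement of the kernel provides unique coefficients for it (\<open>nrm_chaos_vec_eq_0\<close>, \<open>chaos_vec_complete\<close>). The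
  components are orthogonal, the projections onto finitely many of them are best approximations
  (\<open>proj_coeff_best\<close>), and by part (a) these approximations converge (\<open>proj_coeff_density\<close>). The
  orthogonal expansion then extends to the completion as for Hilbert spaces.

  Part (c): if \<open>N > n\<close>, an injective word turns word sums into single coefficients, so that the
  \<open>q\<close>-norm is equivalent to the Hilbert norm on the tensors of degree \<open>n\<close> (\<open>coefficient_le_degree_norm\<close>).\<close>


section \<open>The group algebra\<close>

lemma sum_fun_apply: "(sum f A) x = (\<Sum>i\<in>A. f i x)"
  by (induction A rule: infinite_finite_induct) auto

definition fscale :: "complex \<Rightarrow> ('x \<Rightarrow> complex) \<Rightarrow> 'x \<Rightarrow> complex" where
  "fscale c f = (\<lambda>x. c * f x)"

lemma fscale_apply [simp]: "fscale c f x = c * f x"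
  by (simp add: fscale_def)

global_interpretation fvs: vector_space "fscale :: complex \<Rightarrow> ('x \<Rightarrow> complex) \<Rightarrow> 'x \<Rightarrow> complex"
  by unfold_locales (auto simp: fun_eq_iff algebra_simps)

subsection \<open>Permutations of an initial segment\<close>

lemma comp_inv_simps:
  assumes "bij s"
  shows "inv s \<circ> s = id" "s \<circ> inv s = id" "inv s \<circ> (s \<circ> x) = x" "s \<circ> (inv s \<circ> x) = x"
    "inv (inv s) = s"
proof -
  have i: "inj s" and s: "surj s" using assms by (auto simp: bij_def)
  show "inv s \<circ> s = id" "s \<circ> inv s = id" "inv s \<circ> (s \<circ> x) = x" "s \<circ> (inv s \<circ> x) = x"
    "inv (inv s) = s"
    using i s by (simp_all add: comp_assoc[symmetric] inv_o_cancel surj_iff[symmetric] inv_inv_eq assms)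
      (simp_all add: fun_eq_iff surj_f_inv_f)
qed

lemma bij_Sym0: "\<sigma> \<in> Sym0 n \<Longrightarrow> bij \<sigma>"
  by (auto simp: Sym0_def permutes_bij)

lemma Sym_subset_Sym0: "\<sigma> \<in> Sym n \<Longrightarrow> \<sigma> \<in> Sym0 n"
  unfolding Sym_def Sym0_def by (auto intro: permutes_subset)

lemma bij_Sym: "\<sigma> \<in> Sym n \<Longrightarrow> bij \<sigma>"
  by (rule bij_Sym0[OF Sym_subset_Sym0])

lemma finite_Sym0 [simp]: "finite (Sym0 n)"
  by (simp add: Sym0_def finite_permutations)

lemma finite_Sym [simp]: "finite (Sym n)"
  by (simp add: Sym_def finite_permutations)

lemma card_Sym: "card (Sym n) = fact n"
  by (simp add: Sym_def card_permutations)

lemma Sym0_id [simp]: "id \<in> Sym0 n" and Sym_id [simp]: "id \<in> Sym n"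
  by (auto simp: Sym0_def Sym_def permutes_id)

lemma Sym0_comp: "\<sigma> \<in> Sym0 n \<Longrightarrow> \<tau> \<in> Sym0 n \<Longrightarrow> \<sigma> \<circ> \<tau> \<in> Sym0 n"
  and Sym_comp: "\<sigma> \<in> Sym n \<Longrightarrow> \<tau> \<in> Sym n \<Longrightarrow> \<sigma> \<circ> \<tau> \<in> Sym n"
  by (auto simp: Sym0_def Sym_def intro: permutes_compose)

lemma Sym0_inv: "\<sigma> \<in> Sym0 n \<Longrightarrow> inv \<sigma> \<in> Sym0 n"
  and Sym_inv: "\<sigma> \<in> Sym n \<Longrightarrow> inv \<sigma> \<in> Sym n"
  by (auto simp: Sym0_def Sym_def intro: permutes_inv)

lemma Sym0_comp_iff:
  assumes "\<sigma> \<in> Sym0 n"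
  shows "\<sigma> \<circ> \<gamma> \<in> Sym0 n \<longleftrightarrow> \<gamma> \<in> Sym0 n" "\<gamma> \<circ> \<sigma> \<in> Sym0 n \<longleftrightarrow> \<gamma> \<in> Sym0 n"
proof -
  note b = bij_Sym0[OF assms]
  show "\<sigma> \<circ> \<gamma> \<in> Sym0 n \<longleftrightarrow> \<gamma> \<in> Sym0 n"
    using Sym0_comp[OF assms] Sym0_comp[OF Sym0_inv[OF assms], of "\<sigma> \<circ> \<gamma>"]
    by (auto simp: comp_inv_simps[OF b])
  show "\<gamma> \<circ> \<sigma> \<in> Sym0 n \<longleftrightarrow> \<gamma> \<in> Sym0 n"
    using Sym0_comp[OF _ assms] Sym0_comp[OF _ Sym0_inv[OF assms], of "\<gamma> \<circ> \<sigma>"]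
    by (auto simp: comp_assoc comp_inv_simps[OF b])
qed

lemma Sym0_in: "\<sigma> \<in> Sym0 n \<Longrightarrow> i \<in> {0..n} \<longleftrightarrow> \<sigma> i \<in> {0..n}"
  using permutes_in_image[of \<sigma> "{0..n}" i] by (simp add: Sym0_def)

lemma sum_Sym0_left: "\<sigma> \<in> Sym0 n \<Longrightarrow> (\<Sum>\<alpha>\<in>Sym0 n. f (\<sigma> \<circ> \<alpha>)) = (\<Sum>\<alpha>\<in>Sym0 n. f \<alpha>)"
  unfolding Sym0_def using setum_permutations_compose_left[of \<sigma> "{0..n}" f] by simp

lemma sum_Sym0_right: "\<sigma> \<in> Sym0 n \<Longrightarrow> (\<Sum>\<alpha>\<in>Sym0 n. f (\<alpha> \<circ> \<sigma>)) = (\<Sum>\<alpha>\<in>Sym0 n. f \<alpha>)"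
  unfolding Sym0_def using sum_permutations_compose_right[of \<sigma> "{0..n}" f] by simp

lemma sum_Sym0_inv: "(\<Sum>\<alpha>\<in>Sym0 n. f (inv \<alpha>)) = (\<Sum>\<alpha>\<in>Sym0 n. f \<alpha>)"
  unfolding Sym0_def by (rule sum_permutations_inverse[symmetric])

lemma sum_Sym_left: "\<sigma> \<in> Sym n \<Longrightarrow> (\<Sum>\<alpha>\<in>Sym n. f (\<sigma> \<circ> \<alpha>)) = (\<Sum>\<alpha>\<in>Sym n. f \<alpha>)"
  unfolding Sym_def using setum_permutations_compose_left[of \<sigma> "{1..n}" f] by simp

lemma sum_Sym0_conj:
  assumes "\<sigma> \<in> Sym0 n"
  shows "(\<Sum>\<alpha>\<in>Sym0 n. f (\<sigma> \<circ> \<alpha> \<circ> inv \<sigma>)) = (\<Sum>\<alpha>\<in>Sym0 n. f \<alpha>)"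
  using sum_Sym0_left[OF assms, of "\<lambda>\<alpha>. f (\<alpha> \<circ> inv \<sigma>)"]
    sum_Sym0_right[OF Sym0_inv[OF assms], of f] by simp


subsection \<open>Convolution and adjoint\<close>

lemma group_algebra_zero [simp]: "0 \<in> group_algebra n"
  and group_algebra_add: "a \<in> group_algebra n \<Longrightarrow> b \<in> group_algebra n \<Longrightarrow> a + b \<in> group_algebra n"
  and group_algebra_diff: "a \<in> group_algebra n \<Longrightarrow> b \<in> group_algebra n \<Longrightarrow> a - b \<in> group_algebra n"
  and group_algebra_scale: "a \<in> group_algebra n \<Longrightarrow> fscale c a \<in> group_algebra n"
  and single_in_group_algebra: "\<sigma> \<in> Sym0 n \<Longrightarrow> single \<sigma> \<in> group_algebra n"
  by (auto simp: group_algebra_def single_def)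

lemma group_algebra_sum: "(\<And>i. i \<in> A \<Longrightarrow> f i \<in> group_algebra n) \<Longrightarrow> sum f A \<in> group_algebra n"
  by (induction A rule: infinite_finite_induct) (auto intro: group_algebra_add)

lemma group_algebra_expand:
  assumes "a \<in> group_algebra n"
  shows "a = (\<Sum>\<alpha>\<in>Sym0 n. fscale (a \<alpha>) (single \<alpha>))"
  using assms
  by (intro ext) (auto simp: sum_fun_apply single_def group_algebra_def if_distrib[of "(*) _"] cong: if_cong)

lemma gmult_closed:
  assumes "b \<in> group_algebra n" shows "gmult n a b \<in> group_algebra n"
  using assms unfolding group_algebra_def gmult_def
  by (auto intro!: sum.neutral simp: Sym0_comp_iff Sym0_inv)

lemma gmult_assoc: "gmult n (gmult n a b) c = gmult n a (gmult n b c)"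
proof
  fix \<gamma>
  have "gmult n (gmult n a b) c \<gamma> =
      (\<Sum>\<alpha>\<in>Sym0 n. \<Sum>\<beta>\<in>Sym0 n. a \<alpha> * b (inv \<alpha> \<circ> \<beta>) * c (inv \<beta> \<circ> \<gamma>))"
    unfolding gmult_def by (subst sum.swap) (simp add: sum_distrib_right)
  also have "\<dots> = (\<Sum>\<alpha>\<in>Sym0 n. \<Sum>\<beta>\<in>Sym0 n. a \<alpha> * b \<beta> * c (inv (\<alpha> \<circ> \<beta>) \<circ> \<gamma>))"
  proof (rule sum.cong[OF refl])
    fix \<alpha> assume \<alpha>: "\<alpha> \<in> Sym0 n"
    show "(\<Sum>\<beta>\<in>Sym0 n. a \<alpha> * b (inv \<alpha> \<circ> \<beta>) * c (inv \<beta> \<circ> \<gamma>)) =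
        (\<Sum>\<beta>\<in>Sym0 n. a \<alpha> * b \<beta> * c (inv (\<alpha> \<circ> \<beta>) \<circ> \<gamma>))"
      using sum_Sym0_left[OF \<alpha>, of "\<lambda>\<beta>. a \<alpha> * b (inv \<alpha> \<circ> \<beta>) * c (inv \<beta> \<circ> \<gamma>)"]
      by (simp add: comp_inv_simps[OF bij_Sym0[OF \<alpha>]])
  qed
  also have "\<dots> = gmult n a (gmult n b c) \<gamma>"
    unfolding gmult_def sum_distrib_left
    by (intro sum.cong refl) (simp add: o_inv_distrib bij_Sym0 comp_assoc)
  finally show "gmult n (gmult n a b) c \<gamma> = gmult n a (gmult n b c) \<gamma>" .
qed

lemma gmult_add_left: "gmult n (a + b) c = gmult n a c + gmult n b c"
  and gmult_add_right: "gmult n c (a + b) = gmult n c a + gmult n c b"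
  and gmult_diff_left: "gmult n (a - b) c = gmult n a c - gmult n b c"
  and gmult_diff_right: "gmult n c (a - b) = gmult n c a - gmult n c b"
  and gmult_scale_left: "gmult n (fscale s a) c = fscale s (gmult n a c)"
  and gmult_scale_right: "gmult n c (fscale s a) = fscale s (gmult n c a)"
  and gmult_zero_left [simp]: "gmult n 0 c = 0"
  and gmult_zero_right [simp]: "gmult n c 0 = 0"
  by (auto simp: gmult_def fun_eq_iff algebra_simps sum.distrib sum_subtractf sum_distrib_left)

lemma gmult_sum_left: "gmult n (sum f A) c = (\<Sum>i\<in>A. gmult n (f i) c)"
  by (induction A rule: infinite_finite_induct)
    (simp_all only: sum.infinite sum.empty sum.insert gmult_add_left gmult_zero_left not_False_eq_True)

lemma gmult_sum_right: "gmult n c (sum f A) = (\<Sum>i\<in>A. gmult n c (f i))"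
  by (induction A rule: infinite_finite_induct)
    (simp_all only: sum.infinite sum.empty sum.insert gmult_add_right gmult_zero_right not_False_eq_True)

lemma gmult_single_left:
  assumes "\<sigma> \<in> Sym0 n"
  shows "gmult n (single \<sigma>) a \<gamma> = a (inv \<sigma> \<circ> \<gamma>)"
  using assms by (simp add: gmult_def single_def if_distrib[of "\<lambda>x. x * _"] cong: if_cong)

lemma inv_comp_eq_iff:
  fixes \<alpha> \<sigma> \<gamma> :: perm
  assumes b: "bij \<alpha>" "bij \<sigma>"
  shows "inv \<alpha> \<circ> \<gamma> = \<sigma> \<longleftrightarrow> \<alpha> = \<gamma> \<circ> inv \<sigma>"
proof
    assume "inv \<alpha> \<circ> \<gamma> = \<sigma>"
    then have "\<alpha> \<circ> (inv \<alpha> \<circ> \<gamma>) \<circ> inv \<sigma> = \<alpha> \<circ> \<sigma> \<circ> inv \<sigma>" by simp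
    then show "\<alpha> = \<gamma> \<circ> inv \<sigma>" by (simp add: comp_inv_simps b comp_assoc)
  next
    assume "\<alpha> = \<gamma> \<circ> inv \<sigma>"
    then have "inv \<alpha> \<circ> (\<alpha> \<circ> \<sigma>) = inv \<alpha> \<circ> (\<gamma> \<circ> inv \<sigma> \<circ> \<sigma>)" by simp
    then show "inv \<alpha> \<circ> \<gamma> = \<sigma>" by (simp add: comp_inv_simps b comp_assoc)
qed

lemma gmult_single_right:
  assumes "\<sigma> \<in> Sym0 n" "a \<in> group_algebra n"
  shows "gmult n a (single \<sigma>) \<gamma> = a (\<gamma> \<circ> inv \<sigma>)"
proof -
  have "gmult n a (single \<sigma>) \<gamma> = (\<Sum>\<alpha>\<in>Sym0 n. if \<alpha> = \<gamma> \<circ> inv \<sigma> then a \<alpha> else 0)"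
    unfolding gmult_def single_def
    using assms by (intro sum.cong) (auto simp: inv_comp_eq_iff bij_Sym0)
  also have "\<dots> = a (\<gamma> \<circ> inv \<sigma>)"
    using assms(2) by (auto simp: group_algebra_def)
  finally show ?thesis .
qed

lemma gmult_one_left: "gmult n (single id) a = a"
  by (rule ext) (simp add: gmult_single_left[OF Sym0_id])

lemma gmult_single_single:
  "\<sigma> \<in> Sym0 n \<Longrightarrow> \<rho> \<in> Sym0 n \<Longrightarrow> gmult n (single \<sigma>) (single \<rho>) = single (\<sigma> \<circ> \<rho>)"
  by (rule ext) (simp add: gmult_single_left, auto simp: single_def comp_inv_simps bij_Sym0)

lemma gadjoint_closed [simp]: "gadjoint n a \<in> group_algebra n"
  by (auto simp: gadjoint_def group_algebra_def)

lemma gadjoint_gadjoint: "a \<in> group_algebra n \<Longrightarrow> gadjoint n (gadjoint n a) = a"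
  by (auto simp: gadjoint_def group_algebra_def fun_eq_iff Sym0_inv comp_inv_simps bij_Sym0)

lemma gadjoint_gmult:
  assumes "a \<in> group_algebra n" "b \<in> group_algebra n"
  shows "gadjoint n (gmult n a b) = gmult n (gadjoint n b) (gadjoint n a)"
proof
  fix \<gamma>
  show "gadjoint n (gmult n a b) \<gamma> = gmult n (gadjoint n b) (gadjoint n a) \<gamma>"
  proof (cases "\<gamma> \<in> Sym0 n")
    case False
    then show ?thesis
      using gmult_closed[OF gadjoint_closed[of n a], of "gadjoint n b"]
      by (simp add: gadjoint_def group_algebra_def)
  next
    case True
    note g = bij_Sym0[OF True]
    have "gadjoint n (gmult n a b) \<gamma> = (\<Sum>\<alpha>\<in>Sym0 n. cnj (a \<alpha>) * cnj (b (inv \<alpha> \<circ> inv \<gamma>)))"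
      using True by (simp add: gadjoint_def gmult_def)
    also have "\<dots> = (\<Sum>\<alpha>\<in>Sym0 n. cnj (a (inv \<gamma> \<circ> \<alpha>)) * cnj (b (inv (inv \<gamma> \<circ> \<alpha>) \<circ> inv \<gamma>)))"
      by (rule sum_Sym0_left[OF Sym0_inv[OF True], symmetric])
    also have "\<dots> = gmult n (gadjoint n b) (gadjoint n a) \<gamma>"
      unfolding gmult_def gadjoint_def using True
      by (intro sum.cong)
        (auto simp: Sym0_inv Sym0_comp Sym0_comp_iff o_inv_distrib bij_imp_bij_inv g bij_Sym0 comp_inv_simps comp_assoc)
    finally show ?thesis .
  qed
qed

lemma gmult_self_adjoint_at_id:
  "gmult n a (gadjoint n a) id = (\<Sum>\<alpha>\<in>Sym0 n. complex_of_real ((cmod (a \<alpha>))\<^sup>2))"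
  unfolding gmult_def gadjoint_def
  by (intro sum.cong) (auto simp: Sym0_inv comp_inv_simps bij_Sym0 simp flip: complex_norm_square)

lemma sum_cmod_sq_eq_0:
  assumes "(\<Sum>\<alpha>\<in>Sym0 n. complex_of_real ((cmod (a \<alpha>))\<^sup>2)) = 0" "a \<in> group_algebra n"
  shows "a = 0"
proof -
  have "(\<Sum>\<alpha>\<in>Sym0 n. (cmod (a \<alpha>))\<^sup>2) = 0"
    using assms(1) unfolding of_real_sum[symmetric] of_real_eq_0_iff .
  then have "\<forall>\<alpha>\<in>Sym0 n. a \<alpha> = 0"
    by (subst (asm) sum_nonneg_eq_0_iff) auto
  then show ?thesis
    using assms(2) by (auto simp: group_algebra_def fun_eq_iff)
qed

text \<open>The involution is proper, because the coefficient of \<open>aa\<^sup>*\<close> at the identity is the sum of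
  the squared moduli of the coefficients of \<open>a\<close>. This replaces semisimplicity arguments below.\<close>

lemma gmult_adjoint_eq_0: "a \<in> group_algebra n \<Longrightarrow> gmult n a (gadjoint n a) = 0 \<Longrightarrow> a = 0"
  using gmult_self_adjoint_at_id[of n a] sum_cmod_sq_eq_0[of a n] by simp

text \<open>If \<open>abb\<^sup>* = 0\<close>, then \<open>(ab)(ab)\<^sup>* = 0\<close>, and the involution is proper.\<close>

lemma gmult_gadjoint_left_eq_0:
  assumes "a \<in> group_algebra n" "b \<in> group_algebra n" "gmult n a (gmult n b (gadjoint n b)) = 0"
  shows "gmult n a b = 0"
proof (rule gmult_adjoint_eq_0)
  show "gmult n a b \<in> group_algebra n" by (simp add: gmult_closed assms)
  show "gmult n (gmult n a b) (gadjoint n (gmult n a b)) = 0"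
    using assms by (simp add: gadjoint_gmult) (metis gmult_assoc gmult_zero_left)
qed


section \<open>Two-sided ideals\<close>

definition ga_inner :: "nat \<Rightarrow> galg \<Rightarrow> galg \<Rightarrow> complex" where
  "ga_inner n a b = (\<Sum>\<alpha>\<in>Sym0 n. a \<alpha> * cnj (b \<alpha>))"

lemma ga_inner_add_left: "ga_inner n (a + b) c = ga_inner n a c + ga_inner n b c"
  and ga_inner_diff_left: "ga_inner n (a - b) c = ga_inner n a c - ga_inner n b c"
  and ga_inner_scale_left: "ga_inner n (fscale s a) c = s * ga_inner n a c"
  and ga_inner_add_right: "ga_inner n c (a + b) = ga_inner n c a + ga_inner n c b"
  and ga_inner_scale_right: "ga_inner n c (fscale s a) = cnj s * ga_inner n c a"
  and ga_inner_zero [simp]: "ga_inner n 0 c = 0" "ga_inner n c 0 = 0"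
  by (auto simp: ga_inner_def algebra_simps sum.distrib sum_subtractf sum_distrib_left)

lemma ga_inner_eq_gmult: "ga_inner n a b = gmult n a (gadjoint n b) id"
  unfolding ga_inner_def gmult_def gadjoint_def
  by (intro sum.cong) (auto simp: Sym0_inv comp_inv_simps bij_Sym0)

lemma ga_inner_self_eq_0: "a \<in> group_algebra n \<Longrightarrow> ga_inner n a a = 0 \<Longrightarrow> a = 0"
  unfolding ga_inner_eq_gmult gmult_self_adjoint_at_id by (rule sum_cmod_sq_eq_0)

lemma gmult_at_id_commute: "gmult n a b id = gmult n b a id"
proof -
  have "gmult n a b id = (\<Sum>\<alpha>\<in>Sym0 n. a (inv \<alpha>) * b (inv (inv \<alpha>)))"
    unfolding gmult_def comp_id by (rule sum_Sym0_inv[symmetric])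
  also have "\<dots> = gmult n b a id"
    unfolding gmult_def comp_id by (intro sum.cong) (auto simp: comp_inv_simps bij_Sym0)
  finally show ?thesis .
qed

lemma ga_inner_gmult_right_left:
  assumes "x \<in> group_algebra n" "b \<in> group_algebra n"
  shows "ga_inner n (gmult n a x) b = ga_inner n a (gmult n b (gadjoint n x))"
  using assms by (simp add: ga_inner_eq_gmult gadjoint_gmult gadjoint_gadjoint gmult_assoc)

lemma ga_inner_gmult_left_left:
  assumes "x \<in> group_algebra n" "b \<in> group_algebra n"
  shows "ga_inner n (gmult n x a) b = ga_inner n a (gmult n (gadjoint n x) b)"
  using assms gmult_at_id_commute[of n x "gmult n a (gadjoint n b)"]
  by (simp add: ga_inner_eq_gmult gadjoint_gmult gadjoint_gadjoint gmult_assoc)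

definition ga_perp :: "nat \<Rightarrow> galg set \<Rightarrow> galg set" where
  "ga_perp n W = {a\<in>group_algebra n. \<forall>b\<in>W. ga_inner n a b = 0}"

lemma ga_inner_span:
  assumes "\<And>b. b \<in> B \<Longrightarrow> ga_inner n a b = 0" "v \<in> fvs.span B"
  shows "ga_inner n a v = 0"
  using assms(2)
proof (induction rule: fvs.span_induct_alt)
  case base
  show ?case by (rule ga_inner_zero)
next
  case (step c x y)
  then show ?case by (simp only: ga_inner_add_right ga_inner_scale_right assms(1) mult_zero_right add_0)
qed

lemma orth_decomp_span:
  assumes "finite B" "B \<subseteq> group_algebra n" "x \<in> group_algebra n"
  shows "\<exists>w\<in>fvs.span B. \<exists>w'\<in>group_algebra n. x = w + w' \<and> (\<forall>b\<in>B. ga_inner n w' b = 0)"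
  using assms
proof (induction B arbitrary: x)
  case empty
  then have "x = 0 + x" "0 \<in> fvs.span {}" by (simp_all only: add_0 fvs.span_zero)
  with empty show ?case by blast
next
  case (insert b B)
  then have bGA: "b \<in> group_algebra n" by simp
  obtain wb b' where b: "wb \<in> fvs.span B" "b' \<in> group_algebra n" "b = wb + b'"
    and b'B: "\<And>c. c \<in> B \<Longrightarrow> ga_inner n b' c = 0"
    using insert.IH[of b] insert.prems by blast
  obtain w w' where w: "w \<in> fvs.span B" "w' \<in> group_algebra n" "x = w + w'"
    and w'B: "\<And>c. c \<in> B \<Longrightarrow> ga_inner n w' c = 0"
    using insert.IH[of x] insert.prems by blast
  have sub: "fvs.span B \<subseteq> fvs.span (insert b B)" by (rule fvs.span_mono) auto
  define c where "c = (if b' = 0 then 0 else ga_inner n w' b' / ga_inner n b' b')"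
  define w'' where "w'' = w' - fscale c b'"
  have "w'' \<in> group_algebra n"
    unfolding w''_def by (intro group_algebra_diff group_algebra_scale w b)
  moreover have "x = (w + fscale c (b - wb)) + w''"
    unfolding w''_def using w b by simp
  moreover have "w + fscale c (b - wb) \<in> fvs.span (insert b B)"
    by (intro fvs.span_add fvs.span_scale fvs.span_diff subsetD[OF sub] w b fvs.span_base) simp
  moreover have w''B: "ga_inner n w'' e = 0" if "e \<in> B" for e
    using that w'B b'B by (simp add: w''_def ga_inner_diff_left ga_inner_scale_left)
  moreover have "ga_inner n w'' b' = 0"
    using ga_inner_self_eq_0[OF b(2)] by (auto simp: w''_def c_def ga_inner_diff_left ga_inner_scale_left)
  then have "ga_inner n w'' b = 0"
    using ga_inner_span[OF w''B b(1)] b(3) by (simp add: ga_inner_add_right)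
  ultimately show ?case by blast
qed

lemma group_algebra_subset_span: "group_algebra n \<subseteq> fvs.span (single ` Sym0 n)"
proof
  fix a assume "a \<in> group_algebra n"
  then have *: "a = (\<Sum>\<alpha>\<in>Sym0 n. fscale (a \<alpha>) (single \<alpha>))" by (rule group_algebra_expand)
  show "a \<in> fvs.span (single ` Sym0 n)"
    by (subst *) (intro fvs.span_sum fvs.span_scale fvs.span_base imageI)
qed

lemma subspace_basis:
  assumes "W \<subseteq> group_algebra n"
  obtains B where "finite B" "B \<subseteq> W" "fvs.independent B" "W \<subseteq> fvs.span B"
proof -
  obtain B where B: "B \<subseteq> W" "fvs.independent B" "W \<subseteq> fvs.span B"
    by (rule fvs.maximal_independent_subset)
  moreover have "B \<subseteq> fvs.span (single ` Sym0 n)"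
    using B(1) assms group_algebra_subset_span by blast
  then have "finite B"
    using fvs.independent_span_bound[OF _ B(2), of "single ` Sym0 n"] by simp
  ultimately show ?thesis using that by blast
qed

lemma orth_decomp:
  assumes "fvs.subspace W" "W \<subseteq> group_algebra n" "x \<in> group_algebra n"
  obtains w w' where "w \<in> W" "w' \<in> ga_perp n W" "x = w + w'"
proof -
  obtain B where B: "finite B" "B \<subseteq> W" "W \<subseteq> fvs.span B"
    using subspace_basis[OF assms(2)] by metis
  obtain w w' where w: "w \<in> fvs.span B" "w' \<in> group_algebra n" "x = w + w'"
    and *: "\<And>b. b \<in> B \<Longrightarrow> ga_inner n w' b = 0"
    using orth_decomp_span[OF B(1) _ assms(3)] B(2) assms(2) by blast
  have "w \<in> W" using w(1) fvs.span_minimal[OF B(2) assms(1)] by blast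
  moreover have "w' \<in> ga_perp n W" using ga_inner_span[OF *] B(3) w(2) by (auto simp: ga_perp_def)
  ultimately show ?thesis using w(3) that by blast
qed

lemma subspace_subset_dim_eq:
  assumes "K \<subseteq> W" "W \<subseteq> group_algebra n" "fvs.subspace K" "fvs.dim W \<le> fvs.dim K"
  shows "K = W"
proof -
  obtain B where B: "finite B" "B \<subseteq> K" "fvs.independent B" "K \<subseteq> fvs.span B"
    by (rule subspace_basis[of K n]) (use assms in auto)
  obtain C where C: "B \<subseteq> C" "C \<subseteq> W" "fvs.independent C" "W \<subseteq> fvs.span C"
    using fvs.maximal_independent_subset_extend[of B W] B assms(1) by blast
  have "finite C"
    using fvs.independent_span_bound[OF _ C(3), of "single ` Sym0 n"]
      C(2) assms(2) group_algebra_subset_span[of n] by auto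
  moreover have "card C = fvs.dim W" "card B = fvs.dim K"
    using fvs.basis_card_eq_dim[OF C(2,4,3)] fvs.basis_card_eq_dim[OF B(2,4,3)] by auto
  ultimately have "B = C" using card_subset_eq[OF _ C(1)] card_mono[OF _ C(1)] assms(4) by auto
  then show ?thesis using C(4) fvs.span_minimal[OF B(2) assms(3)] assms(1) by blast
qed

lemma ideal_closed:
  assumes "two_sided_ideal n I" "a \<in> I"
  shows "a \<in> group_algebra n"
    "b \<in> I \<Longrightarrow> a + b \<in> I"
    "x \<in> group_algebra n \<Longrightarrow> gmult n x a \<in> I"
    "x \<in> group_algebra n \<Longrightarrow> gmult n a x \<in> I"
    "fscale c a \<in> I"
proof -
  show "a \<in> group_algebra n" "b \<in> I \<Longrightarrow> a + b \<in> I" "x \<in> group_algebra n \<Longrightarrow> gmult n x a \<in> I"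
    "x \<in> group_algebra n \<Longrightarrow> gmult n a x \<in> I"
    using assms by (auto simp: two_sided_ideal_def)
  have "gmult n (fscale c (single id)) a \<in> I"
    using assms by (auto simp: two_sided_ideal_def group_algebra_scale single_in_group_algebra)
  then show "fscale c a \<in> I" by (simp add: gmult_scale_left gmult_one_left)
qed

lemma ideal_subspace:
  assumes "two_sided_ideal n I" shows "fvs.subspace I"
proof (rule fvs.subspaceI)
  show "0 \<in> I" using assms by (simp add: two_sided_ideal_def)
qed (use ideal_closed[OF assms] in auto)

lemma ideal_sum_closed:
  assumes "two_sided_ideal n I" "\<And>i. i \<in> A \<Longrightarrow> f i \<in> I" shows "sum f A \<in> I"
  using fvs.subspace_sum[OF ideal_subspace[OF assms(1)]] assms(2) by blast

text \<open>By linearity, multiplication only has to be tested on group elements.\<close>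

lemma two_sided_idealI:
  assumes "I \<subseteq> group_algebra n" "fvs.subspace I"
    "\<And>a \<sigma>. a \<in> I \<Longrightarrow> \<sigma> \<in> Sym0 n \<Longrightarrow> gmult n (single \<sigma>) a \<in> I"
    "\<And>a \<sigma>. a \<in> I \<Longrightarrow> \<sigma> \<in> Sym0 n \<Longrightarrow> gmult n a (single \<sigma>) \<in> I"
  shows "two_sided_ideal n I"
  unfolding two_sided_ideal_def
proof (intro conjI ballI)
  fix a x assume a: "a \<in> I" and x: "x \<in> group_algebra n"
  note e = group_algebra_expand[OF x]
  show "gmult n x a \<in> I"
    by (subst e) (auto simp: gmult_sum_left gmult_scale_left
      intro!: fvs.subspace_sum[OF assms(2)] fvs.subspace_scale[OF assms(2)] assms(3) a)
  show "gmult n a x \<in> I"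
    by (subst e) (auto simp: gmult_sum_right gmult_scale_right
      intro!: fvs.subspace_sum[OF assms(2)] fvs.subspace_scale[OF assms(2)] assms(4) a)
qed (use assms fvs.subspace_0 fvs.subspace_add in auto)

text \<open>Multiplication by a group element is unitary, with the inverse element as its adjoint.\<close>

lemma ideal_ga_perp:
  assumes "two_sided_ideal n I" shows "two_sided_ideal n (ga_perp n I)"
  unfolding two_sided_ideal_def
proof (intro conjI ballI)
  fix a x assume a: "a \<in> ga_perp n I" and x: "x \<in> group_algebra n"
  have xx: "gmult n (gadjoint n x) b \<in> I" "gmult n b (gadjoint n x) \<in> I" if "b \<in> I" for b
    using ideal_closed[OF assms that] by auto
  show "gmult n x a \<in> ga_perp n I" "gmult n a x \<in> ga_perp n I"
    using a x xx ideal_closed(1)[OF assms]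
    by (simp_all add: ga_perp_def ga_inner_gmult_left_left[OF x] ga_inner_gmult_right_left[OF x] gmult_closed)
qed (auto simp: ga_perp_def ga_inner_add_left group_algebra_add)

text \<open>Among the nonzero ideals inside \<open>J\<close>, one of least dimension is minimal.\<close>

lemma minimal_ideal_exists:
  assumes "two_sided_ideal n J" "J \<noteq> {0}"
  obtains I where "minimal_ideal n I" "I \<subseteq> J"
proof -
  define P where "P I \<longleftrightarrow> two_sided_ideal n I \<and> I \<noteq> {0} \<and> I \<subseteq> J" for I
  have "P J" using assms by (simp add: P_def)
  then obtain I where I: "P I" and min: "\<And>K. P K \<Longrightarrow> fvs.dim I \<le> fvs.dim K"
    using ex_has_least_nat[of P J fvs.dim] by blast
  have GA: "I \<subseteq> group_algebra n" using I by (auto simp: P_def two_sided_ideal_def)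
  have "K = {0} \<or> K = I" if K: "two_sided_ideal n K" "K \<subseteq> I" for K
  proof (rule disjCI)
    assume "K \<noteq> I"
    then have "\<not> P K"
      using subspace_subset_dim_eq[OF K(2) GA ideal_subspace[OF K(1)]] min by blast
    then show "K = {0}" using K I by (auto simp: P_def)
  qed
  then have "minimal_ideal n I" using I by (auto simp: minimal_ideal_def P_def)
  then show ?thesis using I that by (auto simp: P_def)
qed

definition ideal_sum :: "galg set set \<Rightarrow> galg set" where
  "ideal_sum \<M> = {sum x M | x M. finite M \<and> (\<forall>I\<in>M. I \<in> \<M> \<and> x I \<in> I)}"

lemma ideal_sumI:
  "finite M \<Longrightarrow> (\<And>I. I \<in> M \<Longrightarrow> I \<in> \<M>) \<Longrightarrow> (\<And>I. I \<in> M \<Longrightarrow> x I \<in> I) \<Longrightarrow> sum x M \<in> ideal_sum \<M>"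
  by (auto simp: ideal_sum_def)

lemma ideal_subset_ideal_sum: "I \<in> \<M> \<Longrightarrow> I \<subseteq> ideal_sum \<M>"
proof
  fix a assume "I \<in> \<M>" "a \<in> I"
  then have "sum (\<lambda>_. a) {I} \<in> ideal_sum \<M>" by (intro ideal_sumI) auto
  then show "a \<in> ideal_sum \<M>" by simp
qed

lemma two_sided_ideal_ideal_sum:
  assumes "\<And>I. I \<in> \<M> \<Longrightarrow> two_sided_ideal n I"
  shows "two_sided_ideal n (ideal_sum \<M>)"
  unfolding two_sided_ideal_def
proof (intro conjI ballI)
  show "ideal_sum \<M> \<subseteq> group_algebra n"
    using ideal_closed(1)[OF assms] by (auto simp: ideal_sum_def intro!: group_algebra_sum)
  show "0 \<in> ideal_sum \<M>" using ideal_sumI[of "{}" \<M>] by simp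
next
  fix a b assume "a \<in> ideal_sum \<M>" "b \<in> ideal_sum \<M>"
  then obtain x M y L where
    a: "a = sum x M" "finite M" "\<And>I. I \<in> M \<Longrightarrow> I \<in> \<M> \<and> x I \<in> I" and
    b: "b = sum y L" "finite L" "\<And>I. I \<in> L \<Longrightarrow> I \<in> \<M> \<and> y I \<in> I"
    unfolding ideal_sum_def by blast
  define z where "z I = (if I \<in> M then x I else 0) + (if I \<in> L then y I else 0)" for I
  have "a + b = sum z (M \<union> L)"
    using a(1,2) b(1,2) by (simp add: z_def sum.distrib Int_absorb1 flip: sum.inter_restrict)
  also have "\<dots> \<in> ideal_sum \<M>"
  proof (rule ideal_sumI)
    fix I assume "I \<in> M \<union> L"
    then have "two_sided_ideal n I" using a(3) b(3) assms by blast
    moreover from this have "0 \<in> I" by (simp add: two_sided_ideal_def)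
    ultimately show "z I \<in> I" using a(3) b(3) by (auto simp: z_def intro: ideal_closed(2))
  qed (use a b in auto)
  finally show "a + b \<in> ideal_sum \<M>" .
next
  fix a x assume "a \<in> ideal_sum \<M>" and x: "x \<in> group_algebra n"
  then obtain y M where a: "a = sum y M" "finite M" "\<And>I. I \<in> M \<Longrightarrow> I \<in> \<M> \<and> y I \<in> I"
    unfolding ideal_sum_def by blast
  show "gmult n x a \<in> ideal_sum \<M>" unfolding a(1) gmult_sum_right
    using a(2,3) assms x by (intro ideal_sumI) (auto intro: ideal_closed)
  show "gmult n a x \<in> ideal_sum \<M>" unfolding a(1) gmult_sum_left
    using a(2,3) assms x by (intro ideal_sumI) (auto intro: ideal_closed)
qed

text \<open>Otherwise the orthogonal complement would contain a minimal ideal orthogonal to itself.\<close>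

lemma ideal_sum_eq_group_algebra:
  assumes "\<And>I. I \<in> \<M> \<Longrightarrow> two_sided_ideal n I"
    and "\<And>I. minimal_ideal n I \<Longrightarrow> \<exists>K\<in>\<M>. I \<subseteq> K"
  shows "ideal_sum \<M> = group_algebra n"
proof -
  let ?J = "ideal_sum \<M>"
  have J: "two_sided_ideal n ?J" using assms(1) by (rule two_sided_ideal_ideal_sum)
  have zero: "ga_perp n ?J = {0}"
  proof (rule ccontr)
    assume "ga_perp n ?J \<noteq> {0}"
    then obtain I where I: "minimal_ideal n I" "I \<subseteq> ga_perp n ?J"
      using minimal_ideal_exists[OF ideal_ga_perp[OF J]] by blast
    have "I \<subseteq> ?J" using assms(2)[OF I(1)] ideal_subset_ideal_sum by blast
    then have "ga_inner n a a = 0" "a \<in> group_algebra n" if "a \<in> I" for a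
      using I(2) that by (auto simp: ga_perp_def)
    then have "I \<subseteq> {0}" using ga_inner_self_eq_0 by blast
    then show False using I(1) by (auto simp: minimal_ideal_def two_sided_ideal_def)
  qed
  have "x \<in> ?J" if "x \<in> group_algebra n" for x
    using orth_decomp[OF ideal_subspace[OF J] _ that] zero J
    by (metis add.right_neutral singletonD two_sided_ideal_def)
  then show ?thesis using J by (auto simp: two_sided_ideal_def)
qed

text \<open>The product lies in the intersection of two different minimal ideals.\<close>

lemma minimal_ideal_prod_zero:
  assumes "minimal_ideal n I" "minimal_ideal n K" "I \<noteq> K" "x \<in> I" "y \<in> K"
  shows "gmult n x y = 0"
proof -
  have I: "two_sided_ideal n I" and K: "two_sided_ideal n K"
    using assms by (auto simp: minimal_ideal_def)
  have "two_sided_ideal n (I \<inter> K)" using I K by (auto simp: two_sided_ideal_def)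
  then have "I \<inter> K = {0} \<or> I \<inter> K = I" "I \<inter> K = {0} \<or> I \<inter> K = K"
    using assms by (auto simp: minimal_ideal_def)
  then have "I \<inter> K = {0}" using assms(3) by auto
  moreover have "gmult n x y \<in> I \<inter> K"
    using ideal_closed[OF I assms(4)] ideal_closed[OF K assms(5)] by auto
  ultimately show ?thesis by blast
qed

text \<open>Minimal ideals are prime: the annihilator inside \<open>I\<close> of \<open>p I\<close> is an ideal, hence \<open>0\<close> or \<open>I\<close>.\<close>

lemma minimal_ideal_prime:
  assumes I: "minimal_ideal n I" and p: "p \<in> group_algebra n" and r: "r \<in> group_algebra n"
    and y: "y \<in> I" "gmult n p y \<noteq> 0" and z: "z \<in> I" "gmult n z r \<noteq> 0"
  shows "\<exists>\<sigma>\<in>Sym0 n. gmult n p (gmult n (single \<sigma>) r) \<noteq> 0"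
proof (rule ccontr)
  assume "\<not> ?thesis"
  then have s0: "gmult n p (gmult n (single \<sigma>) r) = 0" if "\<sigma> \<in> Sym0 n" for \<sigma> using that by blast
  have x0: "gmult n p (gmult n x r) = 0" if "x \<in> group_algebra n" for x
    by (subst group_algebra_expand[OF that])
      (simp add: gmult_sum_left gmult_scale_left gmult_sum_right gmult_scale_right s0 fun_eq_iff sum_fun_apply)
  have I2: "two_sided_ideal n I" using I by (simp add: minimal_ideal_def)
  define J where "J = {w\<in>I. \<forall>v\<in>I. gmult n (gmult n p v) w = 0}"
  have "two_sided_ideal n J"
    unfolding two_sided_ideal_def
  proof (intro conjI ballI)
    show "J \<subseteq> group_algebra n" "0 \<in> J" using I2 by (auto simp: J_def two_sided_ideal_def)
    fix a b x assume a: "a \<in> J" and x: "x \<in> group_algebra n"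
    show "gmult n a x \<in> J" using a x by (auto simp: J_def ideal_closed[OF I2]) (simp flip: gmult_assoc)
    show "gmult n x a \<in> J" unfolding J_def
    proof (intro CollectI conjI ballI)
      show "gmult n x a \<in> I" using a x by (auto simp: J_def ideal_closed[OF I2])
      fix v assume "v \<in> I"
      then have "gmult n (gmult n p (gmult n v x)) a = 0" using a x ideal_closed[OF I2] by (auto simp: J_def)
      then show "gmult n (gmult n p v) (gmult n x a) = 0" by (simp add: gmult_assoc)
    qed
  qed (auto simp: J_def ideal_closed[OF I2] gmult_add_right)
  moreover have "gmult n z r \<in> J"
  proof -
    have "gmult n (gmult n p v) (gmult n z r) = 0" if "v \<in> I" for v
      using x0[of "gmult n v z"] ideal_closed[OF I2] that z(1) by (simp add: gmult_assoc)
    then show ?thesis using z(1) r ideal_closed[OF I2] by (auto simp: J_def)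
  qed
  then have "J \<noteq> {0}" using z(2) by auto
  ultimately have "J = I" using I by (auto simp: minimal_ideal_def J_def)
  moreover have yG: "y \<in> group_algebra n" using ideal_closed[OF I2 y(1)] by simp
  have "gmult n (gadjoint n y) y \<in> I" using ideal_closed[OF I2 y(1)] by simp
  ultimately have "gmult n (gmult n p y) (gmult n (gadjoint n y) (gadjoint n (gadjoint n y))) = 0"
    using y(1) by (auto simp: J_def gadjoint_gadjoint[OF yG])
  then have "gmult n (gmult n p y) (gadjoint n y) = 0"
    by (rule gmult_gadjoint_left_eq_0[rotated 2]) (simp_all add: gmult_closed yG)
  then have "gmult n p (gmult n y (gadjoint n y)) = 0" by (simp add: gmult_assoc)
  then have "gmult n p y = 0" by (rule gmult_gadjoint_left_eq_0[OF p yG])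
  then show False using y(2) by simp
qed


section \<open>Row symmetrizers and column antisymmetrizers\<close>

text \<open>Functions \<open>g\<close> and \<open>h\<close> are read as words. For \<open>g = h\<close> the fiber is a stabilizer, for instance the row
  stabilizer of a tableau if \<open>g\<close> is its row function.\<close>

definition fiber :: "nat \<Rightarrow> (nat \<Rightarrow> 'c) \<Rightarrow> (nat \<Rightarrow> 'c) \<Rightarrow> perm set" where
  "fiber n g h = {\<alpha>\<in>Sym0 n. \<forall>i\<in>{0..n}. g (\<alpha> i) = h i}"

text \<open>The matrix coefficients of the action of permutations on words. They occur in two roles: as products
  with row symmetrizers, and as the quantities on which the \<open>q\<close>-inner product at \<open>q = 1/N\<close> depends.\<close>

definition wsum :: "nat \<Rightarrow> (nat \<Rightarrow> 'c) \<Rightarrow> (nat \<Rightarrow> 'c) \<Rightarrow> (perm \<Rightarrow> 'v::comm_monoid_add) \<Rightarrow> 'v" where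
  "wsum n g h X = sum X (fiber n g h)"

definition stab_sum :: "nat \<Rightarrow> (nat \<Rightarrow> 'c) \<Rightarrow> galg" where
  "stab_sum n f = (\<Sum>\<sigma>\<in>fiber n f f. single \<sigma>)"

definition alt_sum :: "nat \<Rightarrow> (nat \<Rightarrow> 'c) \<Rightarrow> galg" where
  "alt_sum n f = (\<Sum>\<sigma>\<in>fiber n f f. (\<lambda>\<gamma>. of_int (sign \<sigma>) * single \<sigma> \<gamma>))"

lemma young_symmetrizer_eq:
  "young_symmetrizer n \<mu> = gmult n (stab_sum n (tableau_row \<mu>)) (alt_sum n (tableau_col \<mu>))"
  by (simp add: young_symmetrizer_def stab_sum_def alt_sum_def row_stabilizer_def col_stabilizer_def fiber_def)

lemma finite_fiber [simp]: "finite (fiber n g h)"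
  by (simp add: fiber_def)

lemma Sym0_inv_apply:
  assumes "\<sigma> \<in> Sym0 n"
  shows "inv \<sigma> (\<sigma> i) = i" "\<sigma> (inv \<sigma> i) = i"
  using assms by (auto simp: Sym0_def permutes_inverses)

lemma Sym0_le_iff: "\<sigma> \<in> Sym0 n \<Longrightarrow> \<sigma> i \<le> n \<longleftrightarrow> i \<le> n"
  using Sym0_in[of \<sigma> n i] by simp

lemma fiber_comp_left: 
  assumes "\<sigma> \<in> Sym0 n"
  shows "\<sigma> \<circ> \<beta> \<in> fiber n g h \<longleftrightarrow> \<beta> \<in> fiber n (g \<circ> \<sigma>) h"
  using assms by (auto simp: fiber_def Sym0_comp_iff)

lemma fiber_comp_right: 
  assumes "\<sigma> \<in> Sym0 n"
  shows "\<beta> \<circ> \<sigma> \<in> fiber n g h \<longleftrightarrow> \<beta> \<in> fiber n g (h \<circ> inv \<sigma>)"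
proof -
  have "(\<forall>i\<in>{0..n}. g (\<beta> (\<sigma> i)) = h i) \<longleftrightarrow> (\<forall>i\<in>{0..n}. g (\<beta> i) = h (inv \<sigma> i))"
  proof safe
    fix i assume *: "\<forall>i\<in>{0..n}. g (\<beta> (\<sigma> i)) = h i" and i: "i \<in> {0..n}"
    have "inv \<sigma> i \<in> {0..n}" using i Sym0_in[OF Sym0_inv[OF assms], of i] by blast
    then show "g (\<beta> i) = h (inv \<sigma> i)" using * Sym0_inv_apply[OF assms] by metis
  next
    fix i assume *: "\<forall>i\<in>{0..n}. g (\<beta> i) = h (inv \<sigma> i)" and i: "i \<in> {0..n}"
    have "\<sigma> i \<in> {0..n}" using i Sym0_in[OF assms, of i] by blast
    then show "g (\<beta> (\<sigma> i)) = h i" using * Sym0_inv_apply[OF assms] by metis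
  qed
  then show ?thesis using assms by (simp add: fiber_def Sym0_comp_iff)
qed

lemma fiber_inv: "\<beta> \<in> fiber n g h \<Longrightarrow> inv \<beta> \<in> fiber n h g"
proof -
  assume b: "\<beta> \<in> fiber n g h"
  then have "\<beta> \<in> Sym0 n" by (simp add: fiber_def)
  with b show ?thesis
    by (auto simp: fiber_def Sym0_inv) (metis Sym0_in Sym0_inv Sym0_inv_apply(2) atLeastAtMost_iff le0)
qed

lemma wsum_comp_left:
  assumes "\<sigma> \<in> Sym0 n"
  shows "wsum n g h (\<lambda>\<alpha>. X (inv \<sigma> \<circ> \<alpha>)) = wsum n (g \<circ> \<sigma>) h X"
  unfolding wsum_def
  by (rule sum.reindex_bij_witness[of _ "\<lambda>\<beta>. \<sigma> \<circ> \<beta>" "\<lambda>\<alpha>. inv \<sigma> \<circ> \<alpha>"])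
    (simp_all add: comp_inv_simps[OF bij_Sym0[OF assms]] fiber_comp_left[OF assms] flip: fiber_comp_left[OF assms])

lemma wsum_comp_right:
  assumes "\<sigma> \<in> Sym0 n"
  shows "wsum n g h (\<lambda>\<alpha>. X (\<alpha> \<circ> inv \<sigma>)) = wsum n g (h \<circ> inv \<sigma>) X"
  unfolding wsum_def
  by (rule sum.reindex_bij_witness[of _ "\<lambda>\<beta>. \<beta> \<circ> \<sigma>" "\<lambda>\<alpha>. \<alpha> \<circ> inv \<sigma>"])
    (simp_all add: comp_assoc comp_inv_simps[OF bij_Sym0[OF assms]] flip: fiber_comp_right[OF assms])

lemma wsum_inv: "wsum n g h (\<lambda>\<alpha>. X (inv \<alpha>)) = wsum n h g X"
  unfolding wsum_def
proof (rule sum.reindex_bij_witness[of _ inv inv])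
  fix \<alpha> assume "\<alpha> \<in> fiber n g h"
  then show "inv (inv \<alpha>) = \<alpha>" "inv \<alpha> \<in> fiber n h g" "X (inv \<alpha>) = X (inv \<alpha>)"
    using fiber_inv by (auto simp: fiber_def comp_inv_simps bij_Sym0)
next
  fix \<alpha> assume "\<alpha> \<in> fiber n h g"
  then show "inv (inv \<alpha>) = \<alpha>" "inv \<alpha> \<in> fiber n g h"
    using fiber_inv by (auto simp: fiber_def comp_inv_simps bij_Sym0)
qed

lemma gmult_uminus_right: "gmult n c (- a) = - gmult n c a"
  using gmult_diff_right[of n c 0 a] by simp

lemma fscale_minus_self: "x = fscale (-1) x \<Longrightarrow> x = 0"
  by (rule ext, drule fun_cong) simp

lemma stab_sum_closed: "stab_sum n f \<in> group_algebra n"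
  unfolding stab_sum_def
  by (intro group_algebra_sum single_in_group_algebra) (simp add: fiber_def)

lemma alt_sum_eq: "alt_sum n f = (\<Sum>\<sigma>\<in>fiber n f f. fscale (of_int (sign \<sigma>)) (single \<sigma>))"
  by (simp add: alt_sum_def fscale_def)

lemma alt_sum_closed: "alt_sum n f \<in> group_algebra n"
  unfolding alt_sum_eq
  by (intro group_algebra_sum group_algebra_scale single_in_group_algebra) (simp add: fiber_def)

lemma alt_sum_apply: "alt_sum n f \<alpha> = (if \<alpha> \<in> fiber n f f then of_int (sign \<alpha>) else 0)"
  unfolding alt_sum_eq sum_fun_apply
  by (simp add: single_def if_distrib[of "(*) _"] cong: if_cong)

lemma gmult_stab_sum:
  assumes "\<gamma> \<in> Sym0 n"
  shows "gmult n (stab_sum n f) a \<gamma> = wsum n f (f \<circ> \<gamma>) a"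
proof -
  have "gmult n (stab_sum n f) a \<gamma> = (\<Sum>\<sigma>\<in>fiber n f f. gmult n (single \<sigma>) a \<gamma>)"
    by (simp add: stab_sum_def gmult_sum_left sum_fun_apply)
  also have "\<dots> = (\<Sum>\<sigma>\<in>fiber n f f. a (inv \<sigma> \<circ> \<gamma>))"
    by (intro sum.cong) (auto simp: gmult_single_left fiber_def)
  also have "\<dots> = wsum n f f (\<lambda>\<alpha>. a (\<alpha> \<circ> inv (inv \<gamma>)))"
    using wsum_inv[of n f f "\<lambda>\<alpha>. a (\<alpha> \<circ> \<gamma>)"]
    by (simp add: wsum_def comp_inv_simps[OF bij_Sym0[OF assms]])
  also have "\<dots> = wsum n f (f \<circ> \<gamma>) a"
    unfolding wsum_comp_right[OF Sym0_inv[OF assms]] by (simp add: comp_inv_simps[OF bij_Sym0[OF assms]])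
  finally show ?thesis .
qed

lemma stab_sum_absorb:
  assumes "t \<in> fiber n f f"
  shows "gmult n (stab_sum n f) (single t) = stab_sum n f"
proof -
  have t: "t \<in> Sym0 n" using assms by (simp add: fiber_def)
  note b = bij_Sym0[OF t]
  have it: "inv t \<in> fiber n f f" by (rule fiber_inv[OF assms])
  have comp: "\<sigma> \<circ> s \<in> fiber n f f" if "\<sigma> \<in> fiber n f f" "s \<in> fiber n f f" for \<sigma> s
    using that by (auto simp: fiber_def Sym0_comp Sym0_le_iff)
  have "gmult n (stab_sum n f) (single t) = (\<Sum>\<sigma>\<in>fiber n f f. single (\<sigma> \<circ> t))"
    unfolding stab_sum_def gmult_sum_left
    by (intro sum.cong refl gmult_single_single t) (simp add: fiber_def)
  also have "\<dots> = stab_sum n f"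
    unfolding stab_sum_def
    by (rule sum.reindex_bij_witness[of _ "\<lambda>\<sigma>. \<sigma> \<circ> inv t" "\<lambda>\<sigma>. \<sigma> \<circ> t"])
      (simp_all add: comp comp_assoc comp_inv_simps[OF b] assms it)
  finally show ?thesis .
qed

lemma alt_sum_absorb:
  assumes "t \<in> fiber n f f"
  shows "gmult n (single t) (alt_sum n f) = fscale (of_int (sign t)) (alt_sum n f)"
proof -
  have t: "t \<in> Sym0 n" using assms by (simp add: fiber_def)
  note b = bij_Sym0[OF t]
  have it: "inv t \<in> fiber n f f" by (rule fiber_inv[OF assms])
  have perm: "permutation \<sigma>" if "\<sigma> \<in> Sym0 n" for \<sigma>
    using that permutation_permutes unfolding Sym0_def by blast
  have comp: "\<sigma> \<circ> s \<in> fiber n f f" if "\<sigma> \<in> fiber n f f" "s \<in> fiber n f f" for \<sigma> s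
    using that by (auto simp: fiber_def Sym0_comp Sym0_le_iff)
  show ?thesis
  proof
    fix \<gamma>
    have "inv t \<circ> \<gamma> \<in> fiber n f f \<longleftrightarrow> \<gamma> \<in> fiber n f f"
      using comp[OF it, of \<gamma>] comp[OF assms, of "inv t \<circ> \<gamma>"] by (auto simp: comp_inv_simps[OF b])
    moreover have "sign (inv t \<circ> \<gamma>) = sign t * sign \<gamma>" if "\<gamma> \<in> fiber n f f"
      using that by (simp add: sign_compose perm Sym0_inv t fiber_def sign_inverse)
    ultimately show "gmult n (single t) (alt_sum n f) \<gamma> = fscale (of_int (sign t)) (alt_sum n f) \<gamma>"
      by (simp add: gmult_single_left t alt_sum_apply)
  qed
qed

lemma transpose_Sym0: "i \<in> {0..n} \<Longrightarrow> j \<in> {0..n} \<Longrightarrow> Transposition.transpose i j \<in> Sym0 n"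
  by (simp add: Sym0_def permutes_swap_id)

lemma transpose_fiber:
  "i \<in> {0..n} \<Longrightarrow> j \<in> {0..n} \<Longrightarrow> f i = f j \<Longrightarrow> Transposition.transpose i j \<in> fiber n f f"
  by (simp add: fiber_def transpose_Sym0) (metis transpose_eq_iff)

text \<open>The classical reason for which symmetrizers and antisymmetrizers annihilate each other: the
  transposition of two points that share a row and a column changes the sign of the product.\<close>

lemma stab_alt_conflict:
  assumes \<sigma>: "\<sigma> \<in> Sym0 n" and ij: "i \<in> {0..n}" "j \<in> {0..n}" "i \<noteq> j"
    and r: "r i = r j" and c: "c (inv \<sigma> i) = c (inv \<sigma> j)"
  shows "gmult n (stab_sum n r) (gmult n (single \<sigma>) (alt_sum n c)) = 0" (is "?x = 0")
proof -
  let ?t = "Transposition.transpose i j" and ?t' = "Transposition.transpose (inv \<sigma> i) (inv \<sigma> j)"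
  have in': "inv \<sigma> i \<in> {0..n}" "inv \<sigma> j \<in> {0..n}"
    using ij(1,2) by (simp_all add: Sym0_le_iff Sym0_inv[OF \<sigma>])
  have ne: "inv \<sigma> i \<noteq> inv \<sigma> j"
    using ij(3) Sym0_inv_apply(2)[OF \<sigma>, of i] Sym0_inv_apply(2)[OF \<sigma>, of j] by auto
  have t: "?t \<in> fiber n r r" "?t' \<in> fiber n c c"
    by (rule transpose_fiber[OF ij(1,2) r]) (rule transpose_fiber[OF in' c])
  have comm: "?t \<circ> \<sigma> = \<sigma> \<circ> ?t'"
  proof
    fix x
    have "\<sigma> x = i \<longleftrightarrow> x = inv \<sigma> i" "\<sigma> x = j \<longleftrightarrow> x = inv \<sigma> j"
      using Sym0_inv_apply[OF \<sigma>] by metis+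
    then show "(?t \<circ> \<sigma>) x = (\<sigma> \<circ> ?t') x"
      using Sym0_inv_apply(2)[OF \<sigma>] by (simp add: Transposition.transpose_def)
  qed
  have tS: "?t \<in> Sym0 n" "?t' \<in> Sym0 n" using t by (auto simp: fiber_def)
  have "?x = gmult n (gmult n (stab_sum n r) (single ?t)) (gmult n (single \<sigma>) (alt_sum n c))"
    using stab_sum_absorb[OF t(1)] by simp
  also have "\<dots> = gmult n (stab_sum n r) (gmult n (gmult n (single ?t) (single \<sigma>)) (alt_sum n c))"
    by (simp add: gmult_assoc)
  also have "gmult n (single ?t) (single \<sigma>) = gmult n (single \<sigma>) (single ?t')"
    using gmult_single_single tS \<sigma> comm by simp
  also have "gmult n (stab_sum n r) (gmult n (gmult n (single \<sigma>) (single ?t')) (alt_sum n c)) = fscale (-1) ?x"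
    using ne by (simp add: gmult_assoc alt_sum_absorb[OF t(2)] sign_swap_id gmult_scale_right gmult_uminus_right)
  finally show ?thesis by (rule fscale_minus_self)
qed


subsection \<open>Tableaux of partitions\<close>

text \<open>Rows and columns identify \<open>{0..n}\<close> with the cells of the Young diagram, so that rows and columns
  can be counted there.\<close>

definition cells :: "nat list \<Rightarrow> (nat \<times> nat) set" where
  "cells \<mu> = {(r, j). r < length \<mu> \<and> j < \<mu> ! r}"

definition col_height :: "nat list \<Rightarrow> nat \<Rightarrow> nat" where
  "col_height \<mu> j = card {r. r < length \<mu> \<and> j < \<mu> ! r}"

lemma sum_take_Suc: "r < length \<mu> \<Longrightarrow> sum_list (take (Suc r) \<mu>) = sum_list (take r \<mu>) + (\<mu> ! r :: nat)"
  by (simp add: take_Suc_conv_app_nth)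

lemma sum_take_mono: "k \<le> l \<Longrightarrow> sum_list (take k \<mu>) \<le> (sum_list (take l \<mu>) :: nat)"
proof -
  assume "k \<le> l"
  then have "take l \<mu> = take k \<mu> @ take (l - k) (drop k \<mu>)"
    by (metis le_add_diff_inverse take_add)
  then show ?thesis by simp
qed

lemma tableau_row_unique:
  assumes "r < length \<mu>" "sum_list (take r \<mu>) \<le> i" "i < sum_list (take (Suc r) \<mu>)"
  shows "tableau_row \<mu> i = r"
  unfolding tableau_row_def
proof (rule Least_equality)
  fix y assume "i < sum_list (take (Suc y) \<mu>)"
  then show "r \<le> y" using assms(2) sum_take_mono[of "Suc y" r \<mu>] by linarith
qed fact

lemma tableau_rowcol:
  assumes "partition_of \<mu> (n + 1)" "i \<in> {0..n}"
  shows "tableau_row \<mu> i < length \<mu>" "tableau_col \<mu> i < \<mu> ! tableau_row \<mu> i"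
    "i = sum_list (take (tableau_row \<mu> i) \<mu>) + tableau_col \<mu> i"
proof -
  let ?r = "tableau_row \<mu> i"
  have ex: "i < sum_list (take (Suc (length \<mu>)) \<mu>)"
    using assms by (simp add: partition_of_def)
  have 1: "i < sum_list (take (Suc ?r) \<mu>)"
    unfolding tableau_row_def by (rule LeastI[where P = "\<lambda>r. i < sum_list (take (Suc r) \<mu>)", OF ex])
  have 2: "sum_list (take ?r \<mu>) \<le> i"
  proof (cases ?r)
    case (Suc r)
    then have "\<not> i < sum_list (take (Suc r) \<mu>)"
      unfolding tableau_row_def using not_less_Least[of r "\<lambda>r. i < sum_list (take (Suc r) \<mu>)"] by simp
    then show ?thesis using Suc by simp
  qed simp
  show 3: "?r < length \<mu>"
  proof (rule ccontr)
    assume "\<not> ?r < length \<mu>"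
    then have "sum_list (take ?r \<mu>) = n + 1" using assms(1) by (simp add: partition_of_def)
    then show False using 2 assms(2) by simp
  qed
  show "tableau_col \<mu> i < \<mu> ! ?r" "i = sum_list (take ?r \<mu>) + tableau_col \<mu> i"
    using 1 2 sum_take_Suc[OF 3] by (auto simp: tableau_col_def)
qed

lemma tableau_inverse:
  assumes "partition_of \<mu> (n + 1)" "r < length \<mu>" "j < \<mu> ! r"
  shows "sum_list (take r \<mu>) + j \<in> {0..n}"
    "tableau_row \<mu> (sum_list (take r \<mu>) + j) = r" "tableau_col \<mu> (sum_list (take r \<mu>) + j) = j"
proof -
  let ?i = "sum_list (take r \<mu>) + j"
  have "?i < sum_list (take (Suc r) \<mu>)" using assms sum_take_Suc[of r \<mu>] by simp
  moreover have "sum_list (take (Suc r) \<mu>) \<le> sum_list (take (length \<mu>) \<mu>)"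
    using assms by (intro sum_take_mono) simp
  ultimately show "?i \<in> {0..n}" using assms(1) by (simp add: partition_of_def)
  show r: "tableau_row \<mu> ?i = r"
    using assms sum_take_Suc[of r \<mu>] by (intro tableau_row_unique) auto
  show "tableau_col \<mu> ?i = j" by (simp add: tableau_col_def r)
qed

lemma bij_tableau:
  assumes "partition_of \<mu> (n + 1)"
  shows "bij_betw (\<lambda>i. (tableau_row \<mu> i, tableau_col \<mu> i)) {0..n} (cells \<mu>)"
  by (rule bij_betw_byWitness[where f' = "\<lambda>(r, j). sum_list (take r \<mu>) + j"])
    (use tableau_rowcol[OF assms] tableau_inverse[OF assms] in \<open>auto simp: cells_def\<close>)

text \<open>The parts decrease, so a column meets an initial segment of the rows.\<close>

lemma column_initial_segment:
  assumes "partition_of \<mu> (n + 1)"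
  shows "{r. r < length \<mu> \<and> j < \<mu> ! r} = {..<col_height \<mu> j}"
proof -
  let ?S = "{r. r < length \<mu> \<and> j < \<mu> ! r}"
  have down: "s \<in> ?S" if "r \<in> ?S" "s \<le> r" for r s
    using that assms sorted_wrt_nth_less[of "(\<ge>)" \<mu> s r]
    by (cases "s = r") (auto simp: partition_of_def)
  have fin: "finite ?S" by simp
  have "?S = {..<card ?S}"
  proof (cases "?S = {}")
    case False
    have "?S = {..Max ?S}"
      using Max_in[OF fin False] Max_ge[OF fin] down by blast
    then show ?thesis by (metis card_atMost lessThan_Suc_atMost)
  next
    case True
    then have "card ?S = 0" by (simp only: card.empty)
    then show ?thesis using True by (simp only: lessThan_0)
  qed
  then show ?thesis by (simp add: col_height_def)
qed

lemma cells_iff: 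
  assumes "partition_of \<mu> (n + 1)"
  shows "(r, j) \<in> cells \<mu> \<longleftrightarrow> r < col_height \<mu> j"
  using column_initial_segment[OF assms, of j] by (auto simp: cells_def)

lemma card_row_less:
  assumes "partition_of \<mu> (n + 1)"
  shows "card {i\<in>{0..n}. tableau_row \<mu> i < k} = sum_list (take k \<mu>)"
proof -
  have le: "sum_list (take k \<mu>) \<le> n + 1"
    using assms sum_take_mono[of k "max k (length \<mu>)" \<mu>] by (simp add: partition_of_def)
  have "{i\<in>{0..n}. tableau_row \<mu> i < k} = {..<sum_list (take k \<mu>)}"
  proof safe
    fix i assume i: "i \<in> {0..n}" "tableau_row \<mu> i < k"
    have "i < sum_list (take (Suc (tableau_row \<mu> i)) \<mu>)"
      using tableau_rowcol[OF assms i(1)] sum_take_Suc[of "tableau_row \<mu> i" \<mu>] by linarith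
    then show "i < sum_list (take k \<mu>)" using i(2) sum_take_mono[of "Suc (tableau_row \<mu> i)" k \<mu>] by linarith
  next
    fix i assume i: "i < sum_list (take k \<mu>)"
    then show i2: "i \<in> {0..n}" using le by simp
    show "tableau_row \<mu> i < k"
      using tableau_rowcol(3)[OF assms i2] i sum_take_mono[of k "tableau_row \<mu> i" \<mu>] by linarith
  qed
  then show ?thesis by simp
qed

lemma card_row_less_col:
  assumes "partition_of \<mu> (n + 1)"
  shows "card {i\<in>{0..n}. tableau_row \<mu> i < k \<and> tableau_col \<mu> i = j} = min k (col_height \<mu> j)"
proof -
  have *: "r < col_height \<mu> j \<longleftrightarrow> r < length \<mu> \<and> j < \<mu> ! r" for r j
    using column_initial_segment[OF assms, of j] by blast
  have "bij_betw (tableau_row \<mu>) {i\<in>{0..n}. tableau_row \<mu> i < k \<and> tableau_col \<mu> i = j} {..<min k (col_height \<mu> j)}"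
    by (rule bij_betw_byWitness[where f' = "\<lambda>r. sum_list (take r \<mu>) + j"])
      (use tableau_rowcol(1,2)[OF assms] tableau_inverse[OF assms] in \<open>auto simp: * simp flip: tableau_rowcol(3)[OF assms]\<close>)
  then show ?thesis by (simp add: bij_betw_same_card)
qed

lemma card_col:
  assumes "partition_of \<mu> (n + 1)"
  shows "card {i\<in>{0..n}. tableau_col \<mu> i = j} = col_height \<mu> j"
proof -
  have "{i\<in>{0..n}. tableau_col \<mu> i = j} = {i\<in>{0..n}. tableau_row \<mu> i < length \<mu> \<and> tableau_col \<mu> i = j}"
    using tableau_rowcol(1)[OF assms] by blast
  moreover have "col_height \<mu> j \<le> length \<mu>"
    unfolding col_height_def using card_mono[of "{..<length \<mu>}" "{r. r < length \<mu> \<and> j < \<mu> ! r}"] by auto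
  ultimately show ?thesis using card_row_less_col[OF assms, of "length \<mu>" j] by simp
qed

text \<open>A filling of the rows of \<open>\<mu>\<close> by column labels of \<open>\<nu>\<close> without repetition in a row: at most
  \<open>min k h\<close> entries of the first \<open>k\<close> rows can go to a column of height \<open>h\<close>.\<close>

lemma dominance:
  fixes c :: "nat \<Rightarrow> nat"
  assumes \<mu>: "partition_of \<mu> (n + 1)" and \<nu>: "partition_of \<nu> (n + 1)"
    and inj: "inj_on (\<lambda>i. (tableau_row \<mu> i, c i)) {0..n}"
    and c: "\<And>j. card {i\<in>{0..n}. c i = j} = col_height \<nu> j"
  shows "sum_list (take k \<mu>) \<le> sum_list (take k \<nu>)"
    and "sum_list (take k \<mu>) = sum_list (take k \<nu>) \<Longrightarrow>
      card {i\<in>{0..n}. tableau_row \<mu> i < k \<and> c i = j} = min k (col_height \<nu> j)"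
proof -
  define m where "m j = card {i\<in>{0..n}. tableau_row \<mu> i < k \<and> c i = j}" for j
  \<comment> \<open>A finite set of labels that contains all columns in use, and \<open>j\<close> for the second claim.\<close>
  define J where "J = insert j (c ` {0..n} \<union> tableau_col \<nu> ` {0..n})"
  have fin: "finite J" by (simp add: J_def)
  have le: "m j \<le> min k (col_height \<nu> j)" for j
  proof -
    have "m j \<le> card {..<k}" unfolding m_def
      using inj by (intro card_inj_on_le[of "tableau_row \<mu>"]) (auto simp: inj_on_def)
    moreover have "m j \<le> card {i\<in>{0..n}. c i = j}" unfolding m_def by (rule card_mono) auto
    ultimately show ?thesis using c by simp
  qed
  have "sum_list (take k \<mu>) = card {i\<in>{0..n}. tableau_row \<mu> i < k}" by (rule card_row_less[OF \<mu>, symmetric])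
  also have "\<dots> = (\<Sum>j\<in>J. m j)" unfolding m_def
    by (subst card_UN_disjoint[symmetric]) (auto simp: fin J_def intro!: arg_cong[where f = card])
  finally have s1: "sum_list (take k \<mu>) = (\<Sum>j\<in>J. m j)" .
  have "sum_list (take k \<nu>) = card {i\<in>{0..n}. tableau_row \<nu> i < k}" by (rule card_row_less[OF \<nu>, symmetric])
  also have "\<dots> = (\<Sum>j\<in>J. min k (col_height \<nu> j))" unfolding card_row_less_col[OF \<nu>, symmetric]
    by (subst card_UN_disjoint[symmetric]) (auto simp: fin J_def intro!: arg_cong[where f = card])
  finally have s2: "sum_list (take k \<nu>) = (\<Sum>j\<in>J. min k (col_height \<nu> j))" .
  show "sum_list (take k \<mu>) \<le> sum_list (take k \<nu>)"
    unfolding s1 s2 by (intro sum_mono le)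
  assume "sum_list (take k \<mu>) = sum_list (take k \<nu>)"
  then show "card {i\<in>{0..n}. tableau_row \<mu> i < k \<and> c i = j} = min k (col_height \<nu> j)"
    unfolding s1 s2 m_def[symmetric]
    by (intro sum_mono_inv[where I = J, OF _ le]) (auto simp: fin J_def)
qed

lemma card_col_perm:
  assumes "partition_of \<mu> (n + 1)" "\<sigma> \<in> Sym0 n"
  shows "card {i\<in>{0..n}. tableau_col \<mu> (inv \<sigma> i) = j} = col_height \<mu> j"
proof -
  have "bij_betw \<sigma> {i\<in>{0..n}. tableau_col \<mu> i = j} {i\<in>{0..n}. tableau_col \<mu> (inv \<sigma> i) = j}"
    by (rule bij_betw_byWitness[where f' = "inv \<sigma>"])
      (auto simp: Sym0_le_iff Sym0_inv assms(2) Sym0_inv_apply[OF assms(2)])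
  from bij_betw_same_card[OF this] show ?thesis using card_col[OF assms(1), of j] by simp
qed

lemma stab_alt_nonzero_inj:
  assumes "\<sigma> \<in> Sym0 n" "gmult n (stab_sum n r) (gmult n (single \<sigma>) (alt_sum n c)) \<noteq> 0"
  shows "inj_on (\<lambda>i. (r i, c (inv \<sigma> i))) {0..n}"
proof (rule inj_onI, rule ccontr)
  fix i j assume "i \<in> {0..n}" "j \<in> {0..n}" "(r i, c (inv \<sigma> i)) = (r j, c (inv \<sigma> j))" "i \<noteq> j"
  then show False using stab_alt_conflict[OF assms(1), of i j r c] assms(2) by blast
qed

lemma partition_dominance_antisym:
  assumes "partition_of \<mu> m" "partition_of \<nu> m"
    and "\<And>k. sum_list (take k \<mu>) = sum_list (take k \<nu>)"
  shows "\<mu> = \<nu>"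
proof -
  have *: "length \<mu> \<le> length \<nu>"
    if "partition_of \<mu> m" "partition_of \<nu> m" "\<And>k. sum_list (take k \<mu>) = sum_list (take k \<nu>)" for \<mu> \<nu>
  proof (rule ccontr)
    assume l: "\<not> length \<mu> \<le> length \<nu>"
    then have "sum_list (take (length \<nu>) \<mu>) = m" using that by (simp add: partition_of_def)
    moreover have "sum_list (take (Suc (length \<nu>)) \<mu>) = m" using that by (simp add: partition_of_def)
    moreover have "\<mu> ! length \<nu> \<noteq> 0" using that(1) l by (auto simp: partition_of_def in_set_conv_nth)
    ultimately show False using sum_take_Suc[of "length \<nu>" \<mu>] l by simp
  qed
  have len: "length \<mu> = length \<nu>" using *[of \<mu> \<nu>] *[of \<nu> \<mu>] assms by simp
  show ?thesis
  proof (rule nth_equalityI[OF len])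
    fix i assume "i < length \<mu>"
    then show "\<mu> ! i = \<nu> ! i"
      using sum_take_Suc[of i \<mu>] sum_take_Suc[of i \<nu>] assms(3)[of i] assms(3)[of "Suc i"] len by simp
  qed
qed

text \<open>A nonzero product labels the entries of \<open>\<mu>\<close> by columns of \<open>\<nu>\<close> without repetition in a row.\<close>

lemma stab_alt_dominance:
  assumes "partition_of \<mu> (n + 1)" "partition_of \<nu> (n + 1)" "\<sigma> \<in> Sym0 n"
    and "gmult n (stab_sum n (tableau_row \<mu>)) (gmult n (single \<sigma>) (alt_sum n (tableau_col \<nu>))) \<noteq> 0"
  shows "sum_list (take k \<mu>) \<le> sum_list (take k \<nu>)"
  by (rule dominance(1)[OF assms(1,2) stab_alt_nonzero_inj[OF assms(3,4)]])
    (rule card_col_perm[OF assms(2,3)])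

text \<open>Von Neumann's lemma: in the absence of a conflict \<open>\<sigma>\<close> is the product of a row and a column
  permutation, since the labels in each row are forced to be those of the tableau itself.\<close>

lemma stab_alt_multiple:
  assumes \<mu>: "partition_of \<mu> (n + 1)" and \<sigma>: "\<sigma> \<in> Sym0 n"
  shows "\<exists>s. gmult n (stab_sum n (tableau_row \<mu>)) (gmult n (single \<sigma>) (alt_sum n (tableau_col \<mu>)))
     = fscale s (young_symmetrizer n \<mu>)" (is "\<exists>s. ?x = _")
proof (cases "?x = 0")
  case True
  then show ?thesis by (intro exI[of _ 0]) (simp add: fun_eq_iff)
next
  case False
  let ?r = "tableau_row \<mu>" and ?c = "tableau_col \<mu>"
  let ?c' = "\<lambda>i. ?c (inv \<sigma> i)"
  note inj = stab_alt_nonzero_inj[OF \<sigma> False]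
  note cnt = dominance(2)[OF \<mu> \<mu> inj card_col_perm[OF \<mu> \<sigma>] refl]
  have in_cells: "(?r i, ?c' i) \<in> cells \<mu>" if i: "i \<in> {0..n}" for i
  proof -
    let ?A = "\<lambda>k. {l\<in>{0..n}. ?r l < k \<and> ?c' l = ?c' i}"
    have "insert i (?A (?r i)) \<subseteq> ?A (Suc (?r i))" using i by auto
    then have "card (insert i (?A (?r i))) \<le> card (?A (Suc (?r i)))" by (intro card_mono) auto
    then have "Suc (card (?A (?r i))) \<le> card (?A (Suc (?r i)))" by (subst (asm) card_insert_disjoint) auto
    then have "?r i < col_height \<mu> (?c' i)" unfolding cnt by linarith
    then show ?thesis using cells_iff[OF \<mu>] by blast
  qed
  let ?f = "\<lambda>i. (?r i, ?c i)" and ?g = "\<lambda>i. (?r i, ?c' i)"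
  note f = bij_tableau[OF \<mu>]
  have fin: "finite (cells \<mu>)" using f bij_betw_finite by blast
  have "?g ` {0..n} = cells \<mu>"
    using in_cells bij_betw_same_card[OF f] card_image[OF inj]
    by (intro card_subset_eq[OF fin]) auto
  then have g: "bij_betw ?g {0..n} (cells \<mu>)" using inj by (simp add: bij_betw_def)
  \<comment> \<open>The row permutation that moves every entry to the column of its label.\<close>
  define \<theta> where "\<theta> = the_inv_into {0..n} ?f \<circ> ?g"
  have bij\<theta>: "bij_betw \<theta> {0..n} {0..n}"
    unfolding \<theta>_def by (rule bij_betw_trans[OF g bij_betw_the_inv_into[OF f]])
  have f\<theta>: "?f (\<theta> i) = ?g i" if "i \<in> {0..n}" for i
    unfolding \<theta>_def comp_def using in_cells[OF that] f
    by (intro f_the_inv_into_f_bij_betw) auto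
  define \<rho> where "\<rho> i = (if i \<in> {0..n} then \<theta> i else i)" for i
  have "\<rho> permutes {0..n}"
  proof (rule bij_imp_permutes)
    show "bij_betw \<rho> {0..n} {0..n}"
      using bij\<theta> bij_betw_cong[of "{0..n}" \<theta> \<rho> "{0..n}"] by (simp add: \<rho>_def)
  qed (auto simp: \<rho>_def)
  then have \<rho>: "\<rho> \<in> Sym0 n" by (simp add: Sym0_def)
  then have \<rho>r: "\<rho> \<in> fiber n ?r ?r" using f\<theta> by (auto simp: fiber_def \<rho>_def)
  have \<sigma>in: "\<sigma> i \<in> {0..n}" if "i \<in> {0..n}" for i using Sym0_in[OF \<sigma>] that by blast
  have \<rho>c: "\<rho> \<circ> \<sigma> \<in> fiber n ?c ?c"
    using f\<theta>[OF \<sigma>in] \<sigma>in Sym0_inv_apply(1)[OF \<sigma>] Sym0_comp[OF \<rho> \<sigma>]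
    by (auto simp: fiber_def \<rho>_def)
  note b = bij_Sym0[OF \<rho>]
  have "\<sigma> = inv \<rho> \<circ> (\<rho> \<circ> \<sigma>)" by (simp add: comp_inv_simps[OF b])
  then have "single \<sigma> = gmult n (single (inv \<rho>)) (single (\<rho> \<circ> \<sigma>))"
    using gmult_single_single Sym0_inv[OF \<rho>] Sym0_comp[OF \<rho> \<sigma>] by metis
  then have "?x = gmult n (gmult n (stab_sum n ?r) (single (inv \<rho>))) (gmult n (single (\<rho> \<circ> \<sigma>)) (alt_sum n ?c))"
    by (simp add: gmult_assoc)
  also have "\<dots> = fscale (of_int (sign (\<rho> \<circ> \<sigma>))) (young_symmetrizer n \<mu>)"
    by (simp add: stab_sum_absorb[OF fiber_inv[OF \<rho>r]] alt_sum_absorb[OF \<rho>c] gmult_scale_right young_symmetrizer_eq)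
  finally show ?thesis by blast
qed

lemma young_symmetrizer_closed: "young_symmetrizer n \<mu> \<in> group_algebra n"
  unfolding young_symmetrizer_eq by (intro gmult_closed alt_sum_closed)

text \<open>The coefficient at the identity is \<open>1\<close>: only the identity preserves both rows and columns.\<close>

lemma young_symmetrizer_nonzero:
  assumes "partition_of \<mu> (n + 1)" shows "young_symmetrizer n \<mu> \<noteq> 0"
proof -
  let ?r = "tableau_row \<mu>" and ?c = "tableau_col \<mu>"
  have id: "\<alpha> = id" if "\<alpha> \<in> fiber n ?r ?r" "\<alpha> \<in> fiber n ?c ?c" for \<alpha>
  proof
    fix i
    have \<alpha>: "\<alpha> \<in> Sym0 n" using that by (simp add: fiber_def)
    show "\<alpha> i = id i"
    proof (cases "i \<in> {0..n}")
      case True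
      then have "\<alpha> i \<in> {0..n}" using Sym0_in[OF \<alpha>] by blast
      then show ?thesis
        using that True inj_onD[OF bij_betw_imp_inj_on[OF bij_tableau[OF assms]], of "\<alpha> i" i]
        by (simp add: fiber_def)
    next
      case False
      then show ?thesis using \<alpha> by (simp add: Sym0_def permutes_def)
    qed
  qed
  have "young_symmetrizer n \<mu> id = (\<Sum>\<alpha>\<in>fiber n ?r ?r. alt_sum n ?c \<alpha>)"
    by (simp add: young_symmetrizer_eq gmult_stab_sum wsum_def)
  also have "\<dots> = (\<Sum>\<alpha>\<in>fiber n ?r ?r. if \<alpha> = id then 1 else 0)"
  proof (rule sum.cong[OF refl])
    fix \<alpha> assume \<alpha>: "\<alpha> \<in> fiber n ?r ?r"
    have "id \<in> fiber n ?c ?c" by (simp add: fiber_def)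
    then show "alt_sum n ?c \<alpha> = (if \<alpha> = id then 1 else 0)"
      using id[OF \<alpha>] by (simp add: alt_sum_apply sign_id)
  qed
  also have "\<dots> = 1"
  proof -
    have "id \<in> fiber n ?r ?r" by (simp add: fiber_def)
    then show ?thesis by simp
  qed
  finally have *: "young_symmetrizer n \<mu> id = 1" .
  show ?thesis
  proof
    assume "young_symmetrizer n \<mu> = 0"
    with * show False by simp
  qed
qed


section \<open>Cycle types and the splitting of the group algebra\<close>

subsection \<open>Permutations with the same cycle type are conjugate\<close>

lemma mset_image_eq_imp_bij:
  assumes "finite A" "finite B" "image_mset f (mset_set A) = image_mset g (mset_set B)"
  shows "\<exists>\<phi>. bij_betw \<phi> A B \<and> (\<forall>x\<in>A. g (\<phi> x) = f x)"
  using assms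
proof (induction A arbitrary: B rule: finite_induct)
  case empty
  then have "B = {}" by (simp add: mset_set_empty_iff)
  then show ?case by (auto simp: bij_betw_def)
next
  case (insert x A)
  from insert.prems have "f x \<in># image_mset g (mset_set B)"
    using insert.hyps by (metis image_mset_add_mset mset_set.insert union_single_eq_member)
  then obtain y where y: "y \<in> B" "g y = f x" using insert.prems(1) by auto
  have "mset_set B = add_mset y (mset_set (B - {y}))"
    using y insert.prems(1) by (simp add: mset_set.remove)
  then have "image_mset f (mset_set A) = image_mset g (mset_set (B - {y}))"
    using insert.prems(2) insert.hyps y(2) by simp
  then obtain \<phi> where \<phi>: "bij_betw \<phi> A (B - {y})" "\<And>z. z \<in> A \<Longrightarrow> g (\<phi> z) = f z"
    using insert.IH[of "B - {y}"] insert.prems(1) by blast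
  have "bij_betw (\<phi>(x := y)) A (B - {y})"
    using \<phi>(1) insert.hyps(2) bij_betw_cong[of A "\<phi>(x := y)" \<phi> "B - {y}"] by (metis fun_upd_other)
  then have "bij_betw (\<phi>(x := y)) (insert x A) (insert y (B - {y}))"
    using notIn_Un_bij_betw3[of x A "\<phi>(x := y)" "B - {y}"] insert.hyps(2) by simp
  then have "bij_betw (\<phi>(x := y)) (insert x A) B" using y(1) by (simp add: insert_absorb)
  moreover have "\<forall>z\<in>insert x A. g ((\<phi>(x := y)) z) = f z" using \<phi>(2) y insert.hyps(2) by auto
  ultimately show ?case by blast
qed

definition cycle_type :: "nat \<Rightarrow> perm \<Rightarrow> nat list" where
  "cycle_type n \<alpha> = rev (sorted_list_of_multiset (image_mset card (mset_set (orbit \<alpha> ` {0..n}))))"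

lemma orbit_Sym0:
  assumes "\<alpha> \<in> Sym0 n"
  shows "x \<in> orbit \<alpha> x" "x \<in> {0..n} \<Longrightarrow> orbit \<alpha> x \<subseteq> {0..n}" "finite (orbit \<alpha> x)"
    "y \<in> orbit \<alpha> x \<Longrightarrow> orbit \<alpha> y = orbit \<alpha> x" "y \<in> orbit \<alpha> x \<Longrightarrow> \<exists>k. y = (\<alpha> ^^ k) x"
    "(\<alpha> ^^ k) x \<in> orbit \<alpha> x"
    "(\<alpha> ^^ k) x = (\<alpha> ^^ l) x \<longleftrightarrow> k mod card (orbit \<alpha> x) = l mod card (orbit \<alpha> x)"
proof -
  have perm: "permutation \<alpha>" using assms permutation_permutes unfolding Sym0_def by blast
  have p: "\<alpha> permutes {0..n}" using assms by (simp add: Sym0_def)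
  show 1: "x \<in> orbit \<alpha> x" for x using perm by (rule permutation_self_in_orbit)
  show "x \<in> {0..n} \<Longrightarrow> orbit \<alpha> x \<subseteq> {0..n}" by (rule permutes_orbit_subset[OF p])
  show 4: "y \<in> orbit \<alpha> x \<Longrightarrow> orbit \<alpha> y = orbit \<alpha> x" for x y
    using 1 orbit_trans orbit_swap by (metis subsetI subset_antisym)
  show "y \<in> orbit \<alpha> x \<Longrightarrow> \<exists>k. y = (\<alpha> ^^ k) x" by (auto simp: orbit_altdef)
  show "(\<alpha> ^^ k) x \<in> orbit \<alpha> x" using orbit_altdef_self_in[OF 1] by blast
  define p where "p = funpow_dist1 \<alpha> x x"
  have orb: "orbit \<alpha> x = (\<lambda>m. (\<alpha> ^^ m) x) ` {0..<p}"
    unfolding p_def by (rule orbit_conv_funpow_dist1[OF 1])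
  have inj: "inj_on (\<lambda>m. (\<alpha> ^^ m) x) {0..<p}"
    unfolding p_def by (rule inj_on_funpow_dist1[OF 1])
  show "finite (orbit \<alpha> x)" using orb by simp
  have card: "card (orbit \<alpha> x) = p" using orb card_image[OF inj] by simp
  have per: "(\<alpha> ^^ p) x = x" unfolding p_def by (rule funpow_dist1_prop[OF 1])
  have md: "(\<alpha> ^^ m) x = (\<alpha> ^^ (m mod p)) x" for m by (rule funpow_mod_eq[OF per, symmetric])
  have "p > 0" by (simp add: p_def)
  then show "(\<alpha> ^^ k) x = (\<alpha> ^^ l) x \<longleftrightarrow> k mod card (orbit \<alpha> x) = l mod card (orbit \<alpha> x)"
    unfolding card using md[of k] md[of l] inj_onD[OF inj, of "k mod p" "l mod p"] by auto
qed

lemma cycle_type_partition: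
  assumes "\<alpha> \<in> Sym0 n" shows "partition_of (cycle_type n \<alpha>) (n + 1)"
  unfolding partition_of_def
proof (intro conjI)
  let ?O = "orbit \<alpha> ` {0..n}"
  show "sorted_wrt (\<ge>) (cycle_type n \<alpha>)"
    unfolding cycle_type_def sorted_wrt_rev by simp
  show "0 \<notin> set (cycle_type n \<alpha>)"
    using orbit_Sym0(1,3)[OF assms] by (auto simp: cycle_type_def) (metis empty_iff)
  have "sum_list (cycle_type n \<alpha>) = (\<Sum>C\<in>?O. card C)"
    unfolding cycle_type_def sum_list_rev
    by (simp add: sum_unfold_sum_mset flip: sum_mset_sum_list)
  also have "\<dots> = card (\<Union> ?O)"
    using orbit_Sym0(3,4)[OF assms] by (intro card_Union_disjoint[symmetric]) (auto simp: pairwise_def disjnt_iff, blast+)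
  also have "\<Union> ?O = {0..n}" using orbit_Sym0(1,2)[OF assms] by blast
  finally show "sum_list (cycle_type n \<alpha>) = n + 1" by simp
qed

text \<open>The cycles are matched by a bijection that preserves their lengths. Inside matched cycles, points
  that are equally many steps away from chosen base points correspond to each other.\<close>

lemma same_cycle_type_conjugate:
  assumes \<alpha>: "\<alpha> \<in> Sym0 n" and \<beta>: "\<beta> \<in> Sym0 n" and eq: "cycle_type n \<alpha> = cycle_type n \<beta>"
  obtains \<pi> where "\<pi> \<in> Sym0 n" "\<pi> \<circ> \<alpha> = \<beta> \<circ> \<pi>"
proof -
  let ?A = "orbit \<alpha> ` {0..n}" and ?B = "orbit \<beta> ` {0..n}"
  have "image_mset card (mset_set ?A) = image_mset card (mset_set ?B)"
    using arg_cong[OF eq, of mset] by (simp add: cycle_type_def)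
  then obtain \<Phi> where \<Phi>: "bij_betw \<Phi> ?A ?B" "\<And>C. C \<in> ?A \<Longrightarrow> card (\<Phi> C) = card C"
    using mset_image_eq_imp_bij[of ?A ?B card card] by auto
  define rep :: "nat set \<Rightarrow> nat" where "rep C = (SOME x. x \<in> C)" for C
  define a where "a x = rep (orbit \<alpha> x)" for x
  define b where "b x = rep (\<Phi> (orbit \<alpha> x))" for x
  have a: "a x \<in> orbit \<alpha> x" for x
    unfolding a_def rep_def by (rule someI) (rule orbit_Sym0(1)[OF \<alpha>])
  have \<Phi>orb: "\<exists>y\<in>{0..n}. \<Phi> (orbit \<alpha> x) = orbit \<beta> y" if "x \<in> {0..n}" for x
    using that \<Phi>(1) unfolding bij_betw_def by blast
  have b: "b x \<in> \<Phi> (orbit \<alpha> x)" if x: "x \<in> {0..n}" for x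
  proof -
    obtain y where "\<Phi> (orbit \<alpha> x) = orbit \<beta> y" using \<Phi>orb[OF x] by blast
    then have "y \<in> \<Phi> (orbit \<alpha> x)" using orbit_Sym0(1)[OF \<beta>, of y] by simp
    then show ?thesis unfolding b_def rep_def by (rule someI)
  qed
  have orb_\<Phi>: "orbit \<beta> z = \<Phi> (orbit \<alpha> x)" if x: "x \<in> {0..n}" "z \<in> \<Phi> (orbit \<alpha> x)" for x z
  proof -
    obtain y where y: "\<Phi> (orbit \<alpha> x) = orbit \<beta> y" using \<Phi>orb[OF x(1)] by blast
    show ?thesis using orbit_Sym0(4)[OF \<beta>, of z y] x(2) y by simp
  qed
  have orb_b: "orbit \<beta> (b x) = \<Phi> (orbit \<alpha> x)" if "x \<in> {0..n}" for x
    by (rule orb_\<Phi>[OF that b[OF that]])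
  have orb_a: "orbit \<alpha> (a x) = orbit \<alpha> x" for x by (rule orbit_Sym0(4)[OF \<alpha> a])
  have card: "card (orbit \<beta> (b x)) = card (orbit \<alpha> (a x))" if "x \<in> {0..n}" for x
    using \<Phi>(2) that by (simp add: orb_b orb_a)
  define k where "k x = (LEAST m. (\<alpha> ^^ m) (a x) = x)" for x
  have k: "(\<alpha> ^^ k x) (a x) = x" for x
  proof -
    have "x \<in> orbit \<alpha> (a x)" unfolding orb_a by (rule orbit_Sym0(1)[OF \<alpha>])
    then obtain m where "x = (\<alpha> ^^ m) (a x)" using orbit_Sym0(5)[OF \<alpha>, of x "a x"] by blast
    from this[symmetric] show ?thesis unfolding k_def by (rule LeastI)
  qed
  define \<pi> where "\<pi> x = (if x \<in> {0..n} then (\<beta> ^^ k x) (b x) else x)" for x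
  have inorb: "\<pi> x \<in> \<Phi> (orbit \<alpha> x)" if "x \<in> {0..n}" for x
    using orbit_Sym0(6)[OF \<beta>, of "k x" "b x"] orb_b[OF that] that by (simp add: \<pi>_def)
  have maps: "\<pi> x \<in> {0..n}" if x: "x \<in> {0..n}" for x
  proof -
    obtain y where "y \<in> {0..n}" "\<Phi> (orbit \<alpha> x) = orbit \<beta> y" using \<Phi>orb[OF x] by blast
    then show ?thesis using inorb[OF x] orbit_Sym0(2)[OF \<beta>, of y] by (simp add: subset_iff)
  qed
  have inj: "inj_on \<pi> {0..n}"
  proof (rule inj_onI)
    fix x y assume x: "x \<in> {0..n}" and y: "y \<in> {0..n}" and e: "\<pi> x = \<pi> y"
    have "\<Phi> (orbit \<alpha> x) = \<Phi> (orbit \<alpha> y)"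
      using orb_\<Phi>[OF x inorb[OF x]] orb_\<Phi>[OF y inorb[OF y]] e by simp
    then have o: "orbit \<alpha> x = orbit \<alpha> y"
      by (rule inj_onD[OF bij_betw_imp_inj_on[OF \<Phi>(1)]]) (use x y in blast)+
    then have ab: "a x = a y" "b x = b y" by (simp_all add: a_def b_def)
    have "(\<beta> ^^ k x) (b x) = (\<beta> ^^ k y) (b x)" using e x y ab by (simp add: \<pi>_def)
    then have "k x mod card (orbit \<alpha> (a x)) = k y mod card (orbit \<alpha> (a x))"
      unfolding orbit_Sym0(7)[OF \<beta>] card[OF x] .
    then have "(\<alpha> ^^ k x) (a x) = (\<alpha> ^^ k y) (a x)" unfolding orbit_Sym0(7)[OF \<alpha>] .
    then have "x = (\<alpha> ^^ k y) (a x)" unfolding k[of x] .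
    then show "x = y" unfolding ab(1) k[of y] .
  qed
  have "\<pi> permutes {0..n}"
  proof (rule bij_imp_permutes)
    have "\<pi> ` {0..n} \<subseteq> {0..n}" by (rule image_subsetI) (rule maps)
    then have "\<pi> ` {0..n} = {0..n}" by (rule endo_inj_surj[OF finite_atLeastAtMost _ inj])
    then show "bij_betw \<pi> {0..n} {0..n}" using inj by (simp add: bij_betw_def)
  qed (auto simp: \<pi>_def)
  then have "\<pi> \<in> Sym0 n" by (simp add: Sym0_def)
  moreover have "\<pi> \<circ> \<alpha> = \<beta> \<circ> \<pi>"
  proof
    fix x
    show "(\<pi> \<circ> \<alpha>) x = (\<beta> \<circ> \<pi>) x"
    proof (cases "x \<in> {0..n}")
      case True
      then have \<alpha>x: "\<alpha> x \<in> {0..n}" using \<alpha> by (simp add: Sym0_le_iff)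
      have "\<alpha> x \<in> orbit \<alpha> x" by (rule orbit.base)
      then have "orbit \<alpha> (\<alpha> x) = orbit \<alpha> x" by (rule orbit_Sym0(4)[OF \<alpha>])
      then have ab: "a (\<alpha> x) = a x" "b (\<alpha> x) = b x" by (simp_all add: a_def b_def)
      have "(\<alpha> ^^ k (\<alpha> x)) (a x) = \<alpha> ((\<alpha> ^^ k x) (a x))" using k[of "\<alpha> x"] unfolding k[of x] ab .
      also have "\<dots> = (\<alpha> ^^ Suc (k x)) (a x)" by simp
      finally have "k (\<alpha> x) mod card (orbit \<beta> (b x)) = Suc (k x) mod card (orbit \<beta> (b x))"
        unfolding orbit_Sym0(7)[OF \<alpha>] card[OF True] .
      then have "(\<beta> ^^ k (\<alpha> x)) (b x) = (\<beta> ^^ Suc (k x)) (b x)" unfolding orbit_Sym0(7)[OF \<beta>] .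
      then show ?thesis using True \<alpha>x ab by (simp add: \<pi>_def)
    next
      case False
      then have "\<alpha> x = x" "\<beta> x = x" using \<alpha> \<beta> by (auto simp: Sym0_def permutes_def)
      then show ?thesis using False by (simp add: \<pi>_def)
    qed
  qed
  ultimately show ?thesis using that by blast
qed

lemma finite_partitions: "finite {\<mu>. partition_of \<mu> m}"
proof (rule finite_subset)
  have "length \<mu> \<le> sum_list \<mu>" if "0 \<notin> set \<mu>" for \<mu> :: "nat list"
    using that by (induction \<mu>) auto
  then show "{\<mu>. partition_of \<mu> m} \<subseteq> {\<mu>. set \<mu> \<subseteq> {..m} \<and> length \<mu> \<le> m}"
    using member_le_sum_list by (fastforce simp: partition_of_def)
  show "finite {\<mu>. set \<mu> \<subseteq> {..m} \<and> length \<mu> \<le> m}"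
    by (intro finite_lists_length_le) simp
qed


subsection \<open>Every minimal ideal belongs to a partition\<close>

definition class_fun :: "nat \<Rightarrow> galg \<Rightarrow> bool" where
  "class_fun n z \<longleftrightarrow> z \<in> group_algebra n \<and> (\<forall>\<sigma>\<in>Sym0 n. \<forall>\<gamma>. z (\<sigma> \<circ> \<gamma> \<circ> inv \<sigma>) = z \<gamma>)"

text \<open>Averaging \<open>xx\<^sup>*\<close> over conjugation: the result is central, and positive at the identity.\<close>

lemma minimal_ideal_central_element:
  assumes "minimal_ideal n I"
  obtains z where "z \<in> I" "class_fun n z" "gmult n z z \<noteq> 0"
proof -
  have I: "two_sided_ideal n I" and "I \<noteq> {0}" using assms by (auto simp: minimal_ideal_def)
  then obtain x where x: "x \<in> I" "x \<noteq> 0" by (auto simp: two_sided_ideal_def)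
  have xG: "x \<in> group_algebra n" by (rule ideal_closed(1)[OF I x(1)])
  define w where "w = gmult n x (gadjoint n x)"
  have wI: "w \<in> I" unfolding w_def by (intro ideal_closed(4)[OF I x(1)]) simp
  have wG: "w \<in> group_algebra n" by (rule ideal_closed(1)[OF I wI])
  have w_self: "gadjoint n w = w" unfolding w_def using xG by (simp add: gadjoint_gmult gadjoint_gadjoint)
  define z where "z = (\<Sum>\<sigma>\<in>Sym0 n. gmult n (single \<sigma>) (gmult n w (single (inv \<sigma>))))"
  have zI: "z \<in> I" unfolding z_def
    by (intro ideal_sum_closed[OF I] ideal_closed(3,4)[OF I] wI single_in_group_algebra Sym0_inv)
  have zG: "z \<in> group_algebra n" by (rule ideal_closed(1)[OF I zI])
  have z: "z \<gamma> = (\<Sum>\<sigma>\<in>Sym0 n. w (inv \<sigma> \<circ> \<gamma> \<circ> \<sigma>))" for \<gamma>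
    unfolding z_def sum_fun_apply
    by (intro sum.cong refl) (simp add: gmult_single_left gmult_single_right Sym0_inv wG comp_inv_simps bij_Sym0)
  have "class_fun n z"
    unfolding class_fun_def
  proof (intro conjI ballI allI zG)
    fix \<rho> \<gamma> assume \<rho>: "\<rho> \<in> Sym0 n"
    note b = bij_Sym0[OF \<rho>]
    have "z (\<rho> \<circ> \<gamma> \<circ> inv \<rho>) = (\<Sum>\<sigma>\<in>Sym0 n. w (inv (\<rho> \<circ> \<sigma>) \<circ> (\<rho> \<circ> \<gamma> \<circ> inv \<rho>) \<circ> (\<rho> \<circ> \<sigma>)))"
      unfolding z by (rule sum_Sym0_left[OF \<rho>, symmetric])
    also have "\<dots> = z \<gamma>" unfolding z
      by (intro sum.cong refl) (simp add: o_inv_distrib b bij_Sym0 comp_assoc comp_inv_simps[OF b])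
    finally show "z (\<rho> \<circ> \<gamma> \<circ> inv \<rho>) = z \<gamma>" .
  qed
  moreover have "gadjoint n z = z"
  proof
    fix \<gamma>
    show "gadjoint n z \<gamma> = z \<gamma>"
    proof (cases "\<gamma> \<in> Sym0 n")
      case True
      have "cnj (w (inv \<sigma> \<circ> inv \<gamma> \<circ> \<sigma>)) = w (inv \<sigma> \<circ> \<gamma> \<circ> \<sigma>)" if s: "\<sigma> \<in> Sym0 n" for \<sigma>
      proof -
        have "inv (inv \<sigma> \<circ> \<gamma> \<circ> \<sigma>) = inv \<sigma> \<circ> inv \<gamma> \<circ> \<sigma>"
          using bij_Sym0[OF s] bij_Sym0[OF True]
          by (simp add: o_inv_distrib bij_imp_bij_inv bij_comp comp_assoc comp_inv_simps)
        moreover have "inv \<sigma> \<circ> \<gamma> \<circ> \<sigma> \<in> Sym0 n" by (intro Sym0_comp Sym0_inv s True)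
        ultimately show ?thesis
          using fun_cong[OF w_self, of "inv \<sigma> \<circ> \<gamma> \<circ> \<sigma>"] by (simp add: gadjoint_def)
      qed
      then show ?thesis using True by (simp add: gadjoint_def z)
    next
      case False
      then show ?thesis using zG by (simp add: gadjoint_def group_algebra_def)
    qed
  qed
  moreover have "z \<noteq> 0"
  proof
    assume "z = 0"
    have "z id = (\<Sum>\<sigma>\<in>Sym0 n. w id)"
      unfolding z by (intro sum.cong refl) (simp add: comp_inv_simps bij_Sym0)
    then have "of_nat (card (Sym0 n)) * w id = 0" using \<open>z = 0\<close> by simp
    moreover have "card (Sym0 n) \<noteq> 0" using Sym0_id by (metis card_0_eq empty_iff finite_Sym0)
    ultimately have "w id = 0" by simp
    then have "x = 0" using sum_cmod_sq_eq_0[OF _ xG] unfolding w_def gmult_self_adjoint_at_id by blast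
    then show False using x by simp
  qed
  then have "gmult n z (gadjoint n z) \<noteq> 0" using gmult_adjoint_eq_0[OF zG] by blast
  ultimately show ?thesis using that zI by simp
qed

text \<open>By the conjugacy of permutations with the same cycle type, class functions depend on the cycle
  type alone.\<close>

lemma class_fun_span:
  assumes "class_fun n z"
  shows "z \<in> fvs.span ((\<lambda>\<mu> \<alpha>. if \<alpha> \<in> Sym0 n \<and> cycle_type n \<alpha> = \<mu> then 1 else 0) ` {\<mu>. partition_of \<mu> (n + 1)})"
    (is "_ \<in> fvs.span (?e ` ?P)")
proof -
  define r where "r \<mu> = (SOME \<alpha>. \<alpha> \<in> Sym0 n \<and> cycle_type n \<alpha> = \<mu>)" for \<mu>
  have "z = (\<Sum>\<mu>\<in>?P. fscale (z (r \<mu>)) (?e \<mu>))"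
  proof
    fix \<alpha>
    show "z \<alpha> = (\<Sum>\<mu>\<in>?P. fscale (z (r \<mu>)) (?e \<mu>)) \<alpha>"
    proof (cases "\<alpha> \<in> Sym0 n")
      case True
      have r: "r (cycle_type n \<alpha>) \<in> Sym0 n" "cycle_type n (r (cycle_type n \<alpha>)) = cycle_type n \<alpha>"
        using someI[of "\<lambda>\<beta>. \<beta> \<in> Sym0 n \<and> cycle_type n \<beta> = cycle_type n \<alpha>" \<alpha>] True by (auto simp: r_def)
      then obtain \<pi> where \<pi>: "\<pi> \<in> Sym0 n" "\<pi> \<circ> r (cycle_type n \<alpha>) = \<alpha> \<circ> \<pi>"
        using same_cycle_type_conjugate[OF r(1) True r(2)] by blast
      have "\<pi> \<circ> r (cycle_type n \<alpha>) \<circ> inv \<pi> = \<alpha>"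
        unfolding \<pi>(2) by (simp add: comp_assoc comp_inv_simps[OF bij_Sym0[OF \<pi>(1)]])
      then have "z \<alpha> = z (r (cycle_type n \<alpha>))" using assms \<pi>(1) unfolding class_fun_def by metis
      then show ?thesis
        using True cycle_type_partition[OF True]
        by (simp add: sum_fun_apply finite_partitions if_distrib[of "(*) _"] cong: if_cong)
    next
      case False
      then show ?thesis using assms by (simp add: class_fun_def group_algebra_def sum_fun_apply)
    qed
  qed
  also have "\<dots> \<in> fvs.span (?e ` ?P)"
    by (intro fvs.span_sum fvs.span_scale fvs.span_base imageI)
  finally show ?thesis .
qed

text \<open>The central elements of different minimal ideals annihilate each other but not themselves, hence
  they are linearly independent class functions.\<close>

lemma card_minimal_ideals:
  assumes "finite \<M>" "\<And>I. I \<in> \<M> \<Longrightarrow> minimal_ideal n I"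
  shows "card \<M> \<le> card {\<mu>. partition_of \<mu> (n + 1)}"
proof -
  have "\<exists>z. z \<in> I \<and> class_fun n z \<and> gmult n z z \<noteq> 0" if "I \<in> \<M>" for I
    by (rule minimal_ideal_central_element[OF assms(2)[OF that]]) blast
  then obtain z where z: "\<And>I. I \<in> \<M> \<Longrightarrow> z I \<in> I" "\<And>I. I \<in> \<M> \<Longrightarrow> class_fun n (z I)"
    "\<And>I. I \<in> \<M> \<Longrightarrow> gmult n (z I) (z I) \<noteq> 0" by metis
  have ortho: "gmult n (z I) (z K) = 0" if "I \<in> \<M>" "K \<in> \<M>" "I \<noteq> K" for I K
    using minimal_ideal_prod_zero[OF assms(2)[OF that(1)] assms(2)[OF that(2)] that(3)] z(1) that by blast
  have inj: "inj_on z \<M>"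
  proof (rule inj_onI, rule ccontr)
    fix I K assume "I \<in> \<M>" "K \<in> \<M>" "z I = z K" "I \<noteq> K"
    then show False using ortho[of I K] z(3)[of I] by simp
  qed
  have "fvs.independent (z ` \<M>)"
  proof (rule fvs.independent_if_scalars_zero)
    fix f v assume s: "(\<Sum>x\<in>z ` \<M>. fscale (f x) x) = 0" and "v \<in> z ` \<M>"
    then obtain K where K: "K \<in> \<M>" "v = z K" by blast
    have "0 = gmult n (\<Sum>I\<in>\<M>. fscale (f (z I)) (z I)) (z K)"
      using s by (simp add: sum.reindex[OF inj])
    also have "\<dots> = (\<Sum>I\<in>\<M>. if I = K then fscale (f (z I)) (gmult n (z K) (z K)) else 0)"
      unfolding gmult_sum_left gmult_scale_left
      by (intro sum.cong refl) (use ortho K(1) in \<open>simp add: fvs.scale_zero_right\<close>)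
    also have "\<dots> = fscale (f (z K)) (gmult n (z K) (z K))" using assms(1) K(1) by simp
    finally show "f v = 0" using fvs.scale_eq_0_iff z(3)[OF K(1)] K(2) by metis
  qed (use assms in simp)
  moreover have "z ` \<M> \<subseteq> fvs.span ((\<lambda>\<mu> \<alpha>. if \<alpha> \<in> Sym0 n \<and> cycle_type n \<alpha> = \<mu> then 1 else 0) ` {\<mu>. partition_of \<mu> (n + 1)})"
    using class_fun_span z(2) by blast
  ultimately have "card (z ` \<M>) \<le> card ((\<lambda>\<mu> \<alpha>. if \<alpha> \<in> Sym0 n \<and> cycle_type n \<alpha> = \<mu> then 1 else 0 :: complex) ` {\<mu>. partition_of \<mu> (n + 1)})"
    by (intro conjunct2[OF fvs.independent_span_bound]) (simp_all add: finite_partitions)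
  also have "\<dots> \<le> card {\<mu>. partition_of \<mu> (n + 1)}" by (rule card_image_le[OF finite_partitions])
  finally show ?thesis by (simp add: card_image[OF inj])
qed

text \<open>A two-sided form of \<open>ideal_of_shape\<close>: with the symmetrizers on both sides of an element of the ideal,
  primeness can be applied to either of them.\<close>

definition young_ideal :: "nat \<Rightarrow> nat list \<Rightarrow> galg set \<Rightarrow> bool" where
  "young_ideal n \<nu> I \<longleftrightarrow> minimal_ideal n I \<and>
     (\<exists>x\<in>I. gmult n (stab_sum n (tableau_row \<nu>)) (gmult n x (alt_sum n (tableau_col \<nu>))) \<noteq> 0)"

text \<open>The identity is a sum of elements of minimal ideals. Between the symmetrizers it gives the Young
  symmetrizer, so one of the summands does not vanish there.\<close>

lemma young_ideal_exists:
  assumes "partition_of \<nu> (n + 1)" shows "\<exists>I. young_ideal n \<nu> I"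
proof -
  let ?a = "stab_sum n (tableau_row \<nu>)" and ?b = "alt_sum n (tableau_col \<nu>)"
  have "ideal_sum {I. minimal_ideal n I} = group_algebra n"
    by (rule ideal_sum_eq_group_algebra) (auto simp: minimal_ideal_def)
  then have "single id \<in> ideal_sum {I. minimal_ideal n I}"
    using single_in_group_algebra[OF Sym0_id] by simp
  then obtain x M where x: "single id = sum x M" "finite M" "\<And>I. I \<in> M \<Longrightarrow> minimal_ideal n I \<and> x I \<in> I"
    unfolding ideal_sum_def by blast
  have "young_symmetrizer n \<nu> = gmult n ?a (gmult n (single id) ?b)"
    by (simp add: young_symmetrizer_eq gmult_one_left)
  also have "\<dots> = (\<Sum>I\<in>M. gmult n ?a (gmult n (x I) ?b))"
    by (simp add: x(1) gmult_sum_left gmult_sum_right)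
  finally have "(\<Sum>I\<in>M. gmult n ?a (gmult n (x I) ?b)) \<noteq> 0"
    using young_symmetrizer_nonzero[OF assms] by simp
  then obtain I where "I \<in> M" "gmult n ?a (gmult n (x I) ?b) \<noteq> 0" by (rule sum.not_neutral_contains_not_neutral)
  then show ?thesis using x(3)[of I] unfolding young_ideal_def by blast
qed

lemma young_ideal_prime:
  assumes "young_ideal n \<nu> I" "p \<in> group_algebra n" "y \<in> I" "gmult n p y \<noteq> 0"
  shows "\<exists>\<sigma>\<in>Sym0 n. gmult n p (gmult n (single \<sigma>) (alt_sum n (tableau_col \<nu>))) \<noteq> 0"
proof -
  have I: "minimal_ideal n I" using assms(1) by (simp add: young_ideal_def)
  then have I2: "two_sided_ideal n I" by (simp add: minimal_ideal_def)
  obtain x where x: "x \<in> I"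
    "gmult n (gmult n (stab_sum n (tableau_row \<nu>)) x) (alt_sum n (tableau_col \<nu>)) \<noteq> 0"
    using assms(1) by (auto simp: young_ideal_def gmult_assoc)
  show ?thesis
    by (rule minimal_ideal_prime[OF I assms(2) alt_sum_closed assms(3,4) ideal_closed(3)[OF I2 x(1) stab_sum_closed] x(2)])
qed

text \<open>Primeness combines the row symmetrizer of \<open>\<mu>\<close> with the column antisymmetrizer of \<open>\<nu>\<close>.\<close>

lemma young_ideal_dominance:
  assumes "young_ideal n \<mu> I" "young_ideal n \<nu> I" "partition_of \<mu> (n + 1)" "partition_of \<nu> (n + 1)"
  shows "sum_list (take k \<mu>) \<le> sum_list (take k \<nu>)"
proof -
  have I2: "two_sided_ideal n I" using assms(1) by (simp add: young_ideal_def minimal_ideal_def)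
  obtain x where x: "x \<in> I"
    "gmult n (stab_sum n (tableau_row \<mu>)) (gmult n x (alt_sum n (tableau_col \<mu>))) \<noteq> 0"
    using assms(1) by (auto simp: young_ideal_def)
  have "gmult n x (alt_sum n (tableau_col \<mu>)) \<in> I"
    by (rule ideal_closed(4)[OF I2 x(1) alt_sum_closed])
  from young_ideal_prime[OF assms(2) stab_sum_closed this x(2)] obtain \<sigma> where
    \<sigma>: "\<sigma> \<in> Sym0 n"
      "gmult n (stab_sum n (tableau_row \<mu>)) (gmult n (single \<sigma>) (alt_sum n (tableau_col \<nu>))) \<noteq> 0"
    by blast
  show ?thesis by (rule stab_alt_dominance[OF assms(3,4) \<sigma>])
qed

text \<open>There are at most as many minimal ideals as conjugacy classes, hence as partitions; since
  different partitions give different ideals, no ideal is left over.\<close>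

lemma minimal_ideal_partition:
  assumes "minimal_ideal n I"
  obtains \<nu> where "partition_of \<nu> (n + 1)" "young_ideal n \<nu> I"
proof (rule ccontr)
  assume no: "\<not> thesis"
  let ?P = "{\<mu>. partition_of \<mu> (n + 1)}"
  define f where "f \<mu> = (SOME I. young_ideal n \<mu> I)" for \<mu>
  have f: "young_ideal n \<mu> (f \<mu>)" if "\<mu> \<in> ?P" for \<mu>
    unfolding f_def using young_ideal_exists[of \<mu> n] that by (auto intro: someI_ex)
  have inj: "inj_on f ?P"
  proof (rule inj_onI)
    fix \<mu> \<nu> assume *: "\<mu> \<in> ?P" "\<nu> \<in> ?P" "f \<mu> = f \<nu>"
    then have "young_ideal n \<mu> (f \<nu>)" "young_ideal n \<nu> (f \<nu>)" using f[of \<mu>] f[of \<nu>] by simp_all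
    then have "sum_list (take k \<mu>) = sum_list (take k \<nu>)" for k
      using young_ideal_dominance[of n \<mu> "f \<nu>" \<nu> k] young_ideal_dominance[of n \<nu> "f \<nu>" \<mu> k] *(1,2) by simp
    then show "\<mu> = \<nu>" using partition_dominance_antisym *(1,2) by blast
  qed
  have "I \<notin> f ` ?P" using f no that by blast
  then have "card (insert I (f ` ?P)) = Suc (card ?P)"
    using finite_partitions[of "n + 1"] card_image[OF inj] by simp
  moreover have "card (insert I (f ` ?P)) \<le> card ?P"
    by (rule card_minimal_ideals) (use finite_partitions[of "n + 1"] f assms in \<open>auto simp: young_ideal_def\<close>)
  ultimately show False by simp
qed


subsection \<open>The kernel of the representation on words and its complement\<close>

text \<open>The kernel of the action on the tensor power \<open>n + 1\<close> of \<open>\<complex>\<^sup>N\<close>. Only the letters of \<open>g\<close> are restricted,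
  because those of \<open>h\<close> on \<open>{0..n}\<close> are the same whenever the fiber is not empty.\<close>

definition tensor_kernel :: "nat \<Rightarrow> nat \<Rightarrow> galg set" where
  "tensor_kernel n N = {a\<in>group_algebra n. \<forall>g h :: nat \<Rightarrow> nat. (\<forall>i\<in>{0..n}. g i < N) \<longrightarrow> wsum n g h a = 0}"

lemma wsum_add: "wsum n g h (X + Y) = wsum n g h X + wsum n g h Y"
  by (simp add: wsum_def sum.distrib)

lemma wsum_scale: "wsum n g h (fscale c a) = c * wsum n g h a"
  by (simp add: wsum_def sum_distrib_left)

lemma wsum_gmult_single_left:
  assumes "\<sigma> \<in> Sym0 n"
  shows "wsum n g h (gmult n (single \<sigma>) a) = wsum n (g \<circ> \<sigma>) h a"
proof -
  have "gmult n (single \<sigma>) a = (\<lambda>\<alpha>. a (inv \<sigma> \<circ> \<alpha>))"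
    by (rule ext) (rule gmult_single_left[OF assms])
  then show ?thesis by (simp add: wsum_comp_left[OF assms])
qed

lemma wsum_gmult_single_right:
  assumes "\<sigma> \<in> Sym0 n" "a \<in> group_algebra n"
  shows "wsum n g h (gmult n a (single \<sigma>)) = wsum n g (h \<circ> inv \<sigma>) a"
proof -
  have "gmult n a (single \<sigma>) = (\<lambda>\<alpha>. a (\<alpha> \<circ> inv \<sigma>))"
    by (rule ext) (rule gmult_single_right[OF assms])
  then show ?thesis by (simp add: wsum_comp_right[OF assms(1)])
qed

lemma tensor_kernel_ideal: "two_sided_ideal n (tensor_kernel n N)"
proof (rule two_sided_idealI)
  show "fvs.subspace (tensor_kernel n N)"
  proof (rule fvs.subspaceI)
    have "wsum n g h (0::galg) = 0" for g h :: "nat \<Rightarrow> nat" by (simp add: wsum_def)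
    then show "0 \<in> tensor_kernel n N" by (simp add: tensor_kernel_def)
  qed (simp_all add: tensor_kernel_def group_algebra_add group_algebra_scale wsum_add wsum_scale)
next
  fix a \<sigma> assume a: "a \<in> tensor_kernel n N" and \<sigma>: "\<sigma> \<in> Sym0 n"
  show "gmult n (single \<sigma>) a \<in> tensor_kernel n N"
    using a \<sigma> by (simp add: tensor_kernel_def gmult_closed wsum_gmult_single_left Sym0_le_iff)
  show "gmult n a (single \<sigma>) \<in> tensor_kernel n N"
    using a \<sigma> by (simp add: tensor_kernel_def gmult_closed single_in_group_algebra wsum_gmult_single_right)
qed (auto simp: tensor_kernel_def)

lemma tensor_kernel_adjoint:
  assumes "a \<in> tensor_kernel n N" shows "gadjoint n a \<in> tensor_kernel n N"
  unfolding tensor_kernel_def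
proof (intro CollectI conjI allI impI)
  fix g h :: "nat \<Rightarrow> nat" assume g: "\<forall>i\<in>{0..n}. g i < N"
  have "wsum n g h (gadjoint n a) = wsum n g h (\<lambda>\<alpha>. cnj (a (inv \<alpha>)))"
    unfolding wsum_def by (intro sum.cong refl) (simp add: gadjoint_def fiber_def)
  also have "\<dots> = wsum n h g (\<lambda>\<alpha>. cnj (a \<alpha>))" by (rule wsum_inv)
  also have "\<dots> = cnj (wsum n h g a)" by (simp add: wsum_def)
  also have "wsum n h g a = 0"
  proof (cases "fiber n h g = {}")
    case False
    then obtain \<alpha> where \<alpha>: "\<alpha> \<in> fiber n h g" by blast
    then have "\<alpha> \<in> Sym0 n" by (simp add: fiber_def)
    have "h i < N" if i: "i \<in> {0..n}" for i
    proof -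
      have "inv \<alpha> i \<in> {0..n}" using i \<open>\<alpha> \<in> Sym0 n\<close> by (simp add: Sym0_le_iff Sym0_inv)
      moreover have "h i = g (inv \<alpha> i)"
        using fiber_inv[OF \<alpha>] i by (simp add: fiber_def)
      ultimately show ?thesis using g by simp
    qed
    then show ?thesis using assms by (simp add: tensor_kernel_def)
  qed (simp add: wsum_def)
  finally show "wsum n g h (gadjoint n a) = 0" by simp
qed simp

lemma stab_sum_apply: "stab_sum n f \<alpha> = (if \<alpha> \<in> fiber n f f then 1 else 0)"
  unfolding stab_sum_def sum_fun_apply by (simp add: single_def)

lemma gadjoint_stab_sum: "gadjoint n (stab_sum n f) = stab_sum n f"
proof
  fix \<alpha>
  show "gadjoint n (stab_sum n f) \<alpha> = stab_sum n f \<alpha>"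
  proof (cases "\<alpha> \<in> Sym0 n")
    case True
    have "inv \<alpha> \<in> fiber n f f \<longleftrightarrow> \<alpha> \<in> fiber n f f"
      using fiber_inv[of \<alpha> n f f] fiber_inv[of "inv \<alpha>" n f f] comp_inv_simps(5)[OF bij_Sym0[OF True]] by auto
    then show ?thesis using True by (simp add: gadjoint_def stab_sum_apply)
  next
    case False
    then show ?thesis by (simp add: gadjoint_def stab_sum_apply fiber_def)
  qed
qed

lemma tensor_kernel_stab_sum:
  fixes f :: "nat \<Rightarrow> nat"
  assumes "a \<in> tensor_kernel n N" "\<And>i. i \<in> {0..n} \<Longrightarrow> f i < N"
  shows "gmult n a (stab_sum n f) = 0"
proof -
  let ?a = "gadjoint n a"
  have a: "a \<in> group_algebra n" using assms(1) by (simp add: tensor_kernel_def)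
  have "gmult n (stab_sum n f) ?a = 0"
  proof
    fix \<gamma>
    show "gmult n (stab_sum n f) ?a \<gamma> = 0 \<gamma>"
    proof (cases "\<gamma> \<in> Sym0 n")
      case True
      then show ?thesis
        using tensor_kernel_adjoint[OF assms(1)] assms(2) by (simp add: gmult_stab_sum tensor_kernel_def)
    next
      case False
      then show ?thesis
        using gmult_closed[OF gadjoint_closed[of n a], of "stab_sum n f"] by (simp add: group_algebra_def)
    qed
  qed
  then have "gadjoint n (gmult n (stab_sum n f) ?a) = 0" by (simp add: gadjoint_def fun_eq_iff)
  then show ?thesis
    by (simp add: gadjoint_gmult stab_sum_closed gadjoint_gadjoint a gadjoint_stab_sum)
qed

lemma minimal_ideal_Int:
  assumes "minimal_ideal n I" "two_sided_ideal n K"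
  shows "I \<inter> K = {0} \<or> I \<subseteq> K"
proof -
  have "two_sided_ideal n (I \<inter> K)" using assms by (auto simp: two_sided_ideal_def minimal_ideal_def)
  then have "I \<inter> K = {0} \<or> I \<inter> K = I" using assms(1) unfolding minimal_ideal_def by blast
  then show ?thesis by blast
qed

text \<open>If \<open>\<mu>\<close> has at most \<open>N\<close> rows, the row function is a word in \<open>N\<close> letters, so the kernel annihilates
  the row symmetrizer and with it the irreducible representation of shape \<open>\<mu>\<close>.\<close>

lemma shape_ideal_annihilates_kernel:
  assumes \<mu>: "partition_of \<mu> (n + 1)" "length \<mu> \<le> N" and I: "ideal_of_shape n \<mu> I"
    and x: "x \<in> I" and k: "k \<in> tensor_kernel n N"
  shows "gmult n x k = 0"
proof -
  have min: "minimal_ideal n I" and "two_sided_ideal n I"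
    using I by (auto simp: ideal_of_shape_def minimal_ideal_def)
  obtain a c where a: "a \<in> I" "c \<in> group_algebra n" "gmult n a (gmult n c (young_symmetrizer n \<mu>)) \<noteq> 0"
    using I by (auto simp: ideal_of_shape_def specht_module_def)
  have "\<not> I \<subseteq> tensor_kernel n N"
  proof
    assume "I \<subseteq> tensor_kernel n N"
    then have "gmult n a c \<in> tensor_kernel n N"
      using ideal_closed(4)[OF tensor_kernel_ideal _ a(2)] a(1) by blast
    then have "gmult n (gmult n a c) (stab_sum n (tableau_row \<mu>)) = 0"
      using tableau_rowcol(1)[OF \<mu>(1)] \<mu>(2) by (intro tensor_kernel_stab_sum) (auto intro: less_le_trans)
    then have "gmult n (gmult n (gmult n a c) (stab_sum n (tableau_row \<mu>))) (alt_sum n (tableau_col \<mu>)) = 0"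
      by simp
    then show False using a(3) by (simp add: young_symmetrizer_eq gmult_assoc)
  qed
  then have zero: "I \<inter> tensor_kernel n N = {0}" using minimal_ideal_Int[OF min tensor_kernel_ideal] by blast
  have "gmult n x k \<in> I"
    by (rule ideal_closed(4)[OF \<open>two_sided_ideal n I\<close> x ideal_closed(1)[OF tensor_kernel_ideal k]])
  moreover have "gmult n x k \<in> tensor_kernel n N"
    by (rule ideal_closed(3)[OF tensor_kernel_ideal k ideal_closed(1)[OF \<open>two_sided_ideal n I\<close> x]])
  ultimately show ?thesis using zero by blast
qed

text \<open>Von Neumann's lemma, extended by linearity.\<close>

lemma stab_alt_sandwich:
  assumes \<mu>: "partition_of \<mu> (n + 1)" and x: "x \<in> group_algebra n"
  shows "\<exists>s. gmult n (stab_sum n (tableau_row \<mu>)) (gmult n x (alt_sum n (tableau_col \<mu>)))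
     = fscale s (young_symmetrizer n \<mu>)"
proof -
  let ?a = "stab_sum n (tableau_row \<mu>)" and ?b = "alt_sum n (tableau_col \<mu>)"
  obtain s where s: "\<And>\<sigma>. \<sigma> \<in> Sym0 n \<Longrightarrow>
      gmult n ?a (gmult n (single \<sigma>) ?b) = fscale (s \<sigma>) (young_symmetrizer n \<mu>)"
    using stab_alt_multiple[OF \<mu>] by metis
  have "gmult n ?a (gmult n x ?b) = gmult n ?a (gmult n (\<Sum>\<sigma>\<in>Sym0 n. fscale (x \<sigma>) (single \<sigma>)) ?b)"
    using group_algebra_expand[OF x] by simp
  also have "\<dots> = (\<Sum>\<sigma>\<in>Sym0 n. fscale (x \<sigma>) (fscale (s \<sigma>) (young_symmetrizer n \<mu>)))"
    unfolding gmult_sum_left gmult_sum_right gmult_scale_left gmult_scale_right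
    by (intro sum.cong refl) (simp add: s)
  also have "\<dots> = fscale (\<Sum>\<sigma>\<in>Sym0 n. x \<sigma> * s \<sigma>) (young_symmetrizer n \<mu>)"
    by (simp add: fvs.scale_sum_left)
  finally show ?thesis by blast
qed

text \<open>Conversely, an ideal that acts nontrivially on words in \<open>N\<close> letters is met by the symmetrizer
  of some word; the first column of its tableau must then carry pairwise different letters.\<close>

lemma minimal_ideal_shape:
  assumes I: "minimal_ideal n I" and nk: "\<not> I \<subseteq> tensor_kernel n N"
  shows "\<exists>\<mu>. partition_of \<mu> (n + 1) \<and> length \<mu> \<le> N \<and> ideal_of_shape n \<mu> I"
proof -
  have I2: "two_sided_ideal n I" using I by (simp add: minimal_ideal_def)
  obtain \<nu> where \<nu>: "partition_of \<nu> (n + 1)" "young_ideal n \<nu> I"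
    using minimal_ideal_partition[OF I] by blast
  obtain x where x: "x \<in> I" "x \<notin> tensor_kernel n N" using nk by blast
  then obtain g h :: "nat \<Rightarrow> nat" where g: "\<forall>i\<in>{0..n}. g i < N" "wsum n g h x \<noteq> 0"
    using ideal_closed(1)[OF I2 x(1)] unfolding tensor_kernel_def by blast
  then have "fiber n g h \<noteq> {}" by (auto simp: wsum_def)
  then obtain \<gamma> where \<gamma>: "\<gamma> \<in> Sym0 n" "\<And>i. i \<in> {0..n} \<Longrightarrow> g (\<gamma> i) = h i" by (auto simp: fiber_def)
  have "fiber n g (g \<circ> \<gamma>) = fiber n g h" using \<gamma>(2) by (simp add: fiber_def)
  then have "gmult n (stab_sum n g) x \<gamma> \<noteq> 0" using g(2) by (simp add: gmult_stab_sum[OF \<gamma>(1)] wsum_def)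
  then have "gmult n (stab_sum n g) x \<noteq> 0" by force
  then obtain \<sigma> where \<sigma>: "\<sigma> \<in> Sym0 n"
      "gmult n (stab_sum n g) (gmult n (single \<sigma>) (alt_sum n (tableau_col \<nu>))) \<noteq> 0"
    using young_ideal_prime[OF \<nu>(2) stab_sum_closed x(1)] by blast
  \<comment> \<open>The first column has \<open>length \<nu>\<close> entries, and the letters of \<open>g\<close> on its image under \<open>\<sigma>\<close> are different.\<close>
  have len: "length \<nu> \<le> N"
  proof -
    let ?C = "{i\<in>{0..n}. tableau_col \<nu> (inv \<sigma> i) = 0}"
    have "length \<nu> = col_height \<nu> 0"
    proof -
      have "{r. r < length \<nu> \<and> 0 < \<nu> ! r} = {..<length \<nu>}"
        using \<nu>(1) nth_mem[of _ \<nu>] unfolding partition_of_def by (metis (no_types, lifting) Collect_cong gr0I lessThan_def)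
      then show ?thesis by (simp add: col_height_def)
    qed
    also have "\<dots> = card ?C" by (rule card_col_perm[OF \<nu>(1) \<sigma>(1), symmetric])
    also have "\<dots> \<le> card {..<N}"
      using stab_alt_nonzero_inj[OF \<sigma>] g(1) by (intro card_inj_on_le[of g]) (auto simp: inj_on_def)
    finally show ?thesis by simp
  qed
  let ?y = "young_symmetrizer n \<nu>"
  obtain z where z: "z \<in> I" "gmult n (stab_sum n (tableau_row \<nu>)) (gmult n z (alt_sum n (tableau_col \<nu>))) \<noteq> 0"
    using \<nu>(2) by (auto simp: young_ideal_def)
  obtain s where s: "gmult n (stab_sum n (tableau_row \<nu>)) (gmult n z (alt_sum n (tableau_col \<nu>))) = fscale s ?y"
    using stab_alt_sandwich[OF \<nu>(1) ideal_closed(1)[OF I2 z(1)]] by blast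
  have sy: "fscale s ?y \<in> I" unfolding s[symmetric]
    by (intro ideal_closed(3,4)[OF I2] z stab_sum_closed alt_sum_closed)
  have "s \<noteq> 0" using z(2) s fvs.scale_zero_left by metis
  then have yI: "?y \<in> I" using ideal_closed(5)[OF I2 sy, of "1 / s"] by simp
  note yG = young_symmetrizer_closed[of n \<nu>]
  have "gmult n (gmult n ?y (gadjoint n ?y)) ?y \<noteq> 0"
  proof
    assume "gmult n (gmult n ?y (gadjoint n ?y)) ?y = 0"
    then have "gmult n ?y (gmult n (gadjoint n ?y) (gadjoint n (gadjoint n ?y))) = 0"
      by (simp add: gadjoint_gadjoint[OF yG] gmult_assoc)
    then have "gmult n ?y (gadjoint n ?y) = 0" by (rule gmult_gadjoint_left_eq_0[OF yG gadjoint_closed])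
    then have "?y = 0" by (rule gmult_adjoint_eq_0[OF yG])
    then show False using young_symmetrizer_nonzero[OF \<nu>(1)] by simp
  qed
  moreover have "gmult n ?y (gadjoint n ?y) \<in> I" by (rule ideal_closed(4)[OF I2 yI gadjoint_closed])
  moreover have "?y \<in> specht_module n \<nu>"
    unfolding specht_module_def using gmult_one_left[of n ?y] single_in_group_algebra[OF Sym0_id] by force
  ultimately have "ideal_of_shape n \<nu> I" using I unfolding ideal_of_shape_def by blast
  then show ?thesis using \<nu>(1) len by blast
qed

lemma group_algebra_le_eq:
  "group_algebra_le n N = ideal_sum {I. \<exists>\<mu>. partition_of \<mu> (n + 1) \<and> length \<mu> \<le> N \<and> ideal_of_shape n \<mu> I}"
proof -
  have "(\<forall>I\<in>M. x I \<in> I \<and> (\<exists>\<mu>. partition_of \<mu> (n + 1) \<and> length \<mu> \<le> N \<and> ideal_of_shape n \<mu> I)) \<longleftrightarrow>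
    (\<forall>I\<in>M. I \<in> {I. \<exists>\<mu>. partition_of \<mu> (n + 1) \<and> length \<mu> \<le> N \<and> ideal_of_shape n \<mu> I} \<and> x I \<in> I)"
    for x and M :: "galg set set" by blast
  then show ?thesis unfolding group_algebra_le_def ideal_sum_def by (simp only:)
qed

lemma group_algebra_le_ideal: "two_sided_ideal n (group_algebra_le n N)"
  unfolding group_algebra_le_eq
  by (rule two_sided_ideal_ideal_sum) (auto simp: ideal_of_shape_def minimal_ideal_def)

lemma group_algebra_le_kernel:
  assumes "l \<in> group_algebra_le n N" "k \<in> tensor_kernel n N"
  shows "gmult n l k = 0"
proof -
  obtain x M where l: "l = sum x M"
    "\<And>I. I \<in> M \<Longrightarrow> x I \<in> I \<and> (\<exists>\<mu>. partition_of \<mu> (n + 1) \<and> length \<mu> \<le> N \<and> ideal_of_shape n \<mu> I)"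
    using assms(1) unfolding group_algebra_le_def by blast
  have "gmult n (x I) k = 0" if "I \<in> M" for I
    using l(2)[OF that] shape_ideal_annihilates_kernel assms(2) by blast
  then show ?thesis unfolding l(1) gmult_sum_left by (rule sum.neutral[rule_format])
qed

text \<open>The kernel is closed under the adjoint, so \<open>ll\<^sup>* = 0\<close> for an element \<open>l\<close> of both ideals.\<close>

lemma group_algebra_le_Int_kernel:
  assumes "l \<in> group_algebra_le n N" "l \<in> tensor_kernel n N"
  shows "l = 0"
  using group_algebra_le_kernel[OF assms(1) tensor_kernel_adjoint[OF assms(2)]]
    gmult_adjoint_eq_0 ideal_closed(1)[OF tensor_kernel_ideal assms(2)] by blast

lemma ideal_sumE:
  assumes "a \<in> ideal_sum \<M>"
  obtains y M where "a = sum y M" "finite M" "\<And>I. I \<in> M \<Longrightarrow> I \<in> \<M>" "\<And>I. I \<in> M \<Longrightarrow> y I \<in> I"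
  using assms by (auto simp: ideal_sum_def)

text \<open>Every minimal ideal that is not inside the kernel has a shape with at most \<open>N\<close> parts.\<close>

lemma group_algebra_split:
  assumes "x \<in> group_algebra n"
  obtains k l where "k \<in> tensor_kernel n N" "l \<in> group_algebra_le n N" "x = k + l"
proof -
  let ?S = "{I. \<exists>\<mu>. partition_of \<mu> (n + 1) \<and> length \<mu> \<le> N \<and> ideal_of_shape n \<mu> I}"
  let ?K = "tensor_kernel n N"
  have ids: "two_sided_ideal n I" if "I \<in> insert ?K ?S" for I
    using that tensor_kernel_ideal by (auto simp: ideal_of_shape_def minimal_ideal_def)
  have "ideal_sum (insert ?K ?S) = group_algebra n"
  proof (rule ideal_sum_eq_group_algebra[OF ids])
    fix I assume I: "minimal_ideal n I"
    show "\<exists>K\<in>insert ?K ?S. I \<subseteq> K"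
      using minimal_ideal_shape[OF I, of N] by blast
  qed
  then have "x \<in> ideal_sum (insert ?K ?S)" using assms by simp
  then obtain y M where y: "x = sum y M" "finite M" "\<And>I. I \<in> M \<Longrightarrow> I \<in> insert ?K ?S"
      "\<And>I. I \<in> M \<Longrightarrow> y I \<in> I"
    by (rule ideal_sumE) (rule that)
  have rest: "sum y (M - {?K}) \<in> group_algebra_le n N"
    unfolding group_algebra_le_eq 
  proof (rule ideal_sumI)
    show "finite (M - {?K})" using y(2) by simp
    fix I assume "I \<in> M - {?K}"
    then show "I \<in> ?S" "y I \<in> I" using y(3,4)[of I] by blast+
  qed
  show ?thesis
  proof (cases "?K \<in> M")
    case True
    then have "x = y ?K + sum y (M - {?K})" using y(1,2) by (simp add: sum.remove)
    moreover have "y ?K \<in> ?K" by (rule y(4)[OF True])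
    ultimately show ?thesis by (rule that[OF _ rest, rotated])
  next
    case False
    then have "x = 0 + sum y (M - {?K})" using y(1) by simp
    moreover have "0 \<in> ?K" by (rule fvs.subspace_0[OF ideal_subspace[OF tensor_kernel_ideal]])
    ultimately show ?thesis by (rule that[OF _ rest, rotated])
  qed
qed

text \<open>With more than \<open>n\<close> letters there is an injective word, whose word sums are single coefficients.\<close>

lemma tensor_kernel_trivial:
  assumes "n < N" "a \<in> tensor_kernel n N" shows "a = 0"
proof
  fix \<alpha>
  show "a \<alpha> = 0 \<alpha>"
  proof (cases "\<alpha> \<in> Sym0 n")
    case True
    have "\<beta> = \<alpha>" if "\<beta> \<in> fiber n id \<alpha>" for \<beta>
    proof
      fix i show "\<beta> i = \<alpha> i"
        using that True by (cases "i \<in> {0..n}") (auto simp: fiber_def Sym0_def permutes_def)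
    qed
    then have "fiber n id \<alpha> = {\<alpha>}" using True by (auto simp: fiber_def)
    then have "wsum n id \<alpha> a = a \<alpha>" by (simp add: wsum_def)
    moreover have "wsum n id \<alpha> a = 0" using assms by (simp add: tensor_kernel_def)
    ultimately show ?thesis by simp
  next
    case False
    then show ?thesis using assms(2) by (simp add: tensor_kernel_def group_algebra_def)
  qed
qed


subsection \<open>The functional \<open>\<chi>\<close> counts fixed words\<close>

definition words :: "nat \<Rightarrow> nat \<Rightarrow> (nat \<Rightarrow> nat) set" where
  "words n N = {0..n} \<rightarrow>\<^sub>E {..<N}"

lemma finite_words [simp]: "finite (words n N)"
  by (simp add: words_def finite_PiE)

text \<open>Invariant words are the functions on the set of cycles.\<close>

lemma card_invariant_words:
  assumes "\<gamma> \<in> Sym0 n"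
  shows "card {g\<in>words n N. \<forall>i\<in>{0..n}. g (\<gamma> i) = g i} = N ^ card (orbit \<gamma> ` {0..n})"
proof -
  let ?O = "orbit \<gamma> ` {0..n}"
  let ?W = "{g\<in>words n N. \<forall>i\<in>{0..n}. g (\<gamma> i) = g i}"
  define rep :: "nat set \<Rightarrow> nat" where "rep C = (SOME x. x \<in> C)" for C
  have rep: "rep C \<in> C" "orbit \<gamma> (rep C) = C" "rep C \<in> {0..n}" if C: "C \<in> ?O" for C
  proof -
    obtain x where x: "x \<in> {0..n}" "C = orbit \<gamma> x" using C by blast
    then have "x \<in> C" using orbit_Sym0(1)[OF assms, of x] by simp
    then show 1: "rep C \<in> C" unfolding rep_def by (rule someI)
    show "orbit \<gamma> (rep C) = C" using orbit_Sym0(4)[OF assms, of "rep C" x] 1 x by simp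
    show "rep C \<in> {0..n}" using orbit_Sym0(2)[OF assms x(1)] 1 x(2) by blast
  qed
  have inv: "g ((\<gamma> ^^ k) i) = g i" if "g \<in> ?W" "i \<in> {0..n}" for g k i
  proof (induction k)
    case (Suc k)
    have "(\<gamma> ^^ k) i \<in> {0..n}" by (rule subsetD[OF orbit_Sym0(2)[OF assms that(2)] orbit_Sym0(6)[OF assms]])
    then show ?case using Suc that(1) by simp
  qed simp
  have step: "\<gamma> i \<le> n \<longleftrightarrow> i \<le> n" for i by (rule Sym0_le_iff[OF assms])
  have orb_step: "orbit \<gamma> (\<gamma> i) = orbit \<gamma> i" for i
    by (rule orbit_Sym0(4)[OF assms]) (rule orbit.base)
  have "bij_betw (\<lambda>\<phi>. \<lambda>i\<in>{0..n}. \<phi> (orbit \<gamma> i)) (?O \<rightarrow>\<^sub>E {..<N}) ?W"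
  proof (rule bij_betw_byWitness[where f' = "\<lambda>g. \<lambda>C\<in>?O. g (rep C)"])
    show "\<forall>\<phi>\<in>?O \<rightarrow>\<^sub>E {..<N}. (\<lambda>C\<in>?O. (\<lambda>i\<in>{0..n}. \<phi> (orbit \<gamma> i)) (rep C)) = \<phi>"
    proof
      fix \<phi> assume \<phi>: "\<phi> \<in> ?O \<rightarrow>\<^sub>E {..<N}"
      show "(\<lambda>C\<in>?O. (\<lambda>i\<in>{0..n}. \<phi> (orbit \<gamma> i)) (rep C)) = \<phi>"
      proof
        fix C show "(\<lambda>C\<in>?O. (\<lambda>i\<in>{0..n}. \<phi> (orbit \<gamma> i)) (rep C)) C = \<phi> C"
        proof (cases "C \<in> ?O")
          case True
          then show ?thesis using rep(2,3)[OF True] by simp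
        next
          case False
          then show ?thesis using PiE_arb[OF \<phi> False] by simp
        qed
      qed
    qed
    show "\<forall>g\<in>?W. (\<lambda>i\<in>{0..n}. (\<lambda>C\<in>?O. g (rep C)) (orbit \<gamma> i)) = g"
    proof
      fix g assume g: "g \<in> ?W"
      show "(\<lambda>i\<in>{0..n}. (\<lambda>C\<in>?O. g (rep C)) (orbit \<gamma> i)) = g"
      proof
        fix i show "(\<lambda>i\<in>{0..n}. (\<lambda>C\<in>?O. g (rep C)) (orbit \<gamma> i)) i = g i"
        proof (cases "i \<in> {0..n}")
          case True
          then have C: "orbit \<gamma> i \<in> ?O" by blast
          obtain k where "rep (orbit \<gamma> i) = (\<gamma> ^^ k) i" using orbit_Sym0(5)[OF assms rep(1)[OF C]] by blast
          then show ?thesis using inv[OF g True] True C by simp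
        next
          case False
          then have "g i = undefined" using g PiE_arb[of g "{0..n}" "\<lambda>_. {..<N}" i] by (simp add: words_def)
          then show ?thesis using False by simp
        qed
      qed
    qed
    show "(\<lambda>\<phi>. \<lambda>i\<in>{0..n}. \<phi> (orbit \<gamma> i)) ` (?O \<rightarrow>\<^sub>E {..<N}) \<subseteq> ?W"
    proof (rule image_subsetI)
      fix \<phi> assume \<phi>: "\<phi> \<in> ?O \<rightarrow>\<^sub>E {..<N}"
      have "\<phi> (orbit \<gamma> i) \<in> {..<N}" if "i \<in> {0..n}" for i using PiE_mem[OF \<phi>] that by blast
      then show "(\<lambda>i\<in>{0..n}. \<phi> (orbit \<gamma> i)) \<in> ?W" by (simp add: words_def step orb_step)
    qed
    show "(\<lambda>g. \<lambda>C\<in>?O. g (rep C)) ` ?W \<subseteq> ?O \<rightarrow>\<^sub>E {..<N}"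
    proof (rule image_subsetI)
      fix g assume "g \<in> ?W"
      then have "g \<in> {0..n} \<rightarrow>\<^sub>E {..<N}" by (simp add: words_def)
      then have "g (rep C) \<in> {..<N}" if "C \<in> ?O" for C using PiE_mem rep(3)[OF that] by metis
      then show "(\<lambda>C\<in>?O. g (rep C)) \<in> ?O \<rightarrow>\<^sub>E {..<N}" by (rule restrict_PiE_iff[THEN iffD2, rule_format])
    qed
  qed
  then have "card ?W = card (?O \<rightarrow>\<^sub>E {..<N})" by (simp add: bij_betw_same_card)
  also have "\<dots> = N ^ card ?O" by (simp add: card_funcsetE)
  finally show ?thesis .
qed

lemma chi_perm_count:
  assumes "\<gamma> \<in> Sym0 n" "N \<ge> 1"
  shows "chi_perm (1 / real N) n \<gamma> =
    of_nat (card {g\<in>words n N. \<forall>i\<in>{0..n}. g (\<gamma> i) = g i}) / of_nat N ^ (n + 1)"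
proof -
  let ?c = "card (orbit \<gamma> ` {0..n})"
  have "?c \<le> n + 1" using card_image_le[of "{0..n}" "orbit \<gamma>"] by simp
  then have "complex_of_real ((1 / real N) ^ (n + 1 - ?c)) = of_nat (N ^ ?c) / of_nat N ^ (n + 1)"
    using assms(2) by (simp add: power_diff power_divide)
  then show ?thesis using card_invariant_words[OF assms(1), of N] by (simp add: chi_perm_def perm_length_def)
qed

lemma chi_perm_right_quotient:
  assumes \<alpha>: "\<alpha> \<in> Sym0 n" and \<beta>: "\<beta> \<in> Sym0 n" and N: "N \<ge> 1"
  shows "chi_perm (1 / real N) n (\<alpha> \<circ> inv \<beta>) =
    of_nat (card {g\<in>words n N. \<forall>i\<in>{0..n}. g (\<alpha> i) = g (\<beta> i)}) / of_nat N ^ (n + 1)"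
proof -
  have "(\<forall>i\<in>{0..n}. g (\<alpha> (inv \<beta> i)) = g i) \<longleftrightarrow> (\<forall>i\<in>{0..n}. g (\<alpha> i) = g (\<beta> i))" for g :: "nat \<Rightarrow> nat"
  proof safe
    fix i assume *: "\<forall>i\<in>{0..n}. g (\<alpha> (inv \<beta> i)) = g i" and i: "i \<in> {0..n}"
    have "\<beta> i \<in> {0..n}" using i \<beta> by (simp add: Sym0_le_iff)
    with * have "g (\<alpha> (inv \<beta> (\<beta> i))) = g (\<beta> i)" by blast
    then show "g (\<alpha> i) = g (\<beta> i)" by (simp add: Sym0_inv_apply[OF \<beta>])
  next
    fix i assume *: "\<forall>i\<in>{0..n}. g (\<alpha> i) = g (\<beta> i)" and i: "i \<in> {0..n}"
    have "inv \<beta> i \<in> {0..n}" using i \<beta> by (simp add: Sym0_le_iff Sym0_inv)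
    with * have "g (\<alpha> (inv \<beta> i)) = g (\<beta> (inv \<beta> i))" by blast
    then show "g (\<alpha> (inv \<beta> i)) = g i" by (simp add: Sym0_inv_apply[OF \<beta>])
  qed
  then show ?thesis using chi_perm_count[OF Sym0_comp[OF \<alpha> Sym0_inv[OF \<beta>]] N] by simp
qed

lemma words_reindex:
  assumes \<sigma>: "\<sigma> \<in> Sym0 n" and g: "g \<in> words n N"
  shows "(\<lambda>i\<in>{0..n}. g (\<sigma> i)) \<in> words n N"
    and "(\<lambda>i\<in>{0..n}. (\<lambda>i\<in>{0..n}. g (\<sigma> i)) (inv \<sigma> i)) = g"
proof -
  have E: "g \<in> {0..n} \<rightarrow>\<^sub>E {..<N}" using g by (simp add: words_def)
  have "g (\<sigma> i) \<in> {..<N}" if "i \<in> {0..n}" for i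
    by (rule PiE_mem[OF E]) (use that in \<open>simp add: Sym0_le_iff[OF \<sigma>]\<close>)
  then show "(\<lambda>i\<in>{0..n}. g (\<sigma> i)) \<in> words n N" unfolding words_def by simp
  show "(\<lambda>i\<in>{0..n}. (\<lambda>i\<in>{0..n}. g (\<sigma> i)) (inv \<sigma> i)) = g"
  proof
    fix i
    show "(\<lambda>i\<in>{0..n}. (\<lambda>i\<in>{0..n}. g (\<sigma> i)) (inv \<sigma> i)) i = g i"
    proof (cases "i \<in> {0..n}")
      case True
      then show ?thesis by (simp add: Sym0_le_iff[OF Sym0_inv[OF \<sigma>]] Sym0_inv_apply[OF \<sigma>])
    next
      case False
      then show ?thesis using PiE_arb[OF E False] by simp
    qed
  qed
qed

text \<open>Both quotients are conjugate; here this follows from the count of words.\<close>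

lemma chi_perm_conj:
  assumes \<alpha>: "\<alpha> \<in> Sym0 n" and \<beta>: "\<beta> \<in> Sym0 n" and N: "N \<ge> 1"
  shows "chi_perm (1 / real N) n (inv \<alpha> \<circ> \<beta>) = chi_perm (1 / real N) n (\<beta> \<circ> inv \<alpha>)"
proof -
  let ?A = "{g\<in>words n N. \<forall>i\<in>{0..n}. g (inv \<alpha> (\<beta> i)) = g i}"
  let ?B = "{g\<in>words n N. \<forall>i\<in>{0..n}. g (\<beta> i) = g (\<alpha> i)}"
  let ?f = "\<lambda>g. \<lambda>i\<in>{0..n}. g (inv \<alpha> i)" and ?f' = "\<lambda>g. \<lambda>i\<in>{0..n}. g (\<alpha> i)"
  note ia = Sym0_inv[OF \<alpha>]
  have iia: "inv (inv \<alpha>) = \<alpha>" by (rule comp_inv_simps(5)[OF bij_Sym0[OF \<alpha>]])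
  have f: "?f g \<in> ?B" if "g \<in> ?A" for g
    using that words_reindex(1)[OF ia, of g N]
    by (simp add: Sym0_le_iff[OF \<alpha>] Sym0_le_iff[OF \<beta>] Sym0_inv_apply[OF \<alpha>])
  have f': "?f' g \<in> ?A" if g: "g \<in> ?B" for g
  proof -
    have "g (\<alpha> (inv \<alpha> (\<beta> i))) = g (\<alpha> i)" if "i \<in> {0..n}" for i
      using g that by (simp add: Sym0_inv_apply[OF \<alpha>])
    then show ?thesis
      using words_reindex(1)[OF \<alpha>, of g N] g by (simp add: Sym0_le_iff[OF ia] Sym0_le_iff[OF \<beta>])
  qed
  have "bij_betw ?f ?A ?B"
  proof (rule bij_betw_byWitness[where f' = ?f'])
    show "\<forall>g\<in>?A. ?f' (?f g) = g" using words_reindex(2)[OF ia] unfolding iia by blast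
    show "\<forall>g\<in>?B. ?f (?f' g) = g" using words_reindex(2)[OF \<alpha>] by blast
    show "?f ` ?A \<subseteq> ?B" by (rule image_subsetI) (rule f)
    show "?f' ` ?B \<subseteq> ?A" by (rule image_subsetI) (rule f')
  qed
  then have "card ?A = card ?B" by (rule bij_betw_same_card)
  then show ?thesis
    using chi_perm_count[OF Sym0_comp[OF ia \<beta>] N] chi_perm_right_quotient[OF \<beta> \<alpha> N] by simp
qed

text \<open>A pair \<open>(\<alpha>, \<beta>)\<close> is counted once for each word \<open>g\<close> with \<open>g \<circ> \<alpha> = g \<circ> \<beta>\<close>; the common value \<open>h\<close> of
  the two sides sorts the double sum into squares.\<close>

lemma words_form:
  assumes B: "\<And>A C. finite A \<Longrightarrow> finite C \<Longrightarrow> B (sum X A) (sum Y C) = (\<Sum>\<alpha>\<in>A. \<Sum>\<beta>\<in>C. B (X \<alpha>) (Y \<beta>))"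
    and N: "N \<ge> 1"
  shows "(\<Sum>\<alpha>\<in>Sym0 n. \<Sum>\<beta>\<in>Sym0 n. chi_perm (1 / real N) n (\<alpha> \<circ> inv \<beta>) * B (X \<alpha>) (Y \<beta>)) =
    (\<Sum>g\<in>words n N. \<Sum>h\<in>words n N. B (wsum n g h X) (wsum n g h Y)) / of_nat N ^ (n + 1)"
proof -
  let ?S = "Sym0 n" and ?W = "words n N"
  have in_fiber: "\<alpha> \<in> fiber n g h \<longleftrightarrow> (\<lambda>i\<in>{0..n}. g (\<alpha> i)) = h" if "\<alpha> \<in> ?S" "h \<in> ?W" for \<alpha> g h
  proof
    assume f: "\<alpha> \<in> fiber n g h"
    show "(\<lambda>i\<in>{0..n}. g (\<alpha> i)) = h"
    proof
      fix i show "(\<lambda>i\<in>{0..n}. g (\<alpha> i)) i = h i"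
        using f that(2) PiE_arb[of h "{0..n}" "\<lambda>_. {..<N}" i]
        by (cases "i \<in> {0..n}") (simp_all add: fiber_def words_def)
    qed
  next
    assume "(\<lambda>i\<in>{0..n}. g (\<alpha> i)) = h"
    from this[symmetric] show "\<alpha> \<in> fiber n g h" using that(1) by (simp add: fiber_def)
  qed
  have cnt: "of_nat (card {g\<in>?W. \<forall>i\<in>{0..n}. g (\<alpha> i) = g (\<beta> i)}) =
      (\<Sum>g\<in>?W. \<Sum>h\<in>?W. if \<alpha> \<in> fiber n g h \<and> \<beta> \<in> fiber n g h then 1 else (0::complex))"
    if \<alpha>: "\<alpha> \<in> ?S" and \<beta>: "\<beta> \<in> ?S" for \<alpha> \<beta>
  proof -
    have "(\<Sum>h\<in>?W. if \<alpha> \<in> fiber n g h \<and> \<beta> \<in> fiber n g h then 1 else 0) =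
        (if \<forall>i\<in>{0..n}. g (\<alpha> i) = g (\<beta> i) then 1 else (0::complex))" if g: "g \<in> ?W" for g
    proof -
      let ?g = "\<lambda>i\<in>{0..n}. g (\<alpha> i)"
      have "?g \<in> ?W" by (rule words_reindex(1)[OF \<alpha> g])
      have eq: "\<beta> \<in> fiber n g ?g \<longleftrightarrow> (\<forall>i\<in>{0..n}. g (\<alpha> i) = g (\<beta> i))" using \<beta> by (auto simp: fiber_def)
      have "(\<Sum>h\<in>?W. if \<alpha> \<in> fiber n g h \<and> \<beta> \<in> fiber n g h then 1 else 0) =
          (\<Sum>h\<in>?W. if h = ?g then (if \<beta> \<in> fiber n g ?g then 1 else 0) else (0::complex))"
        using in_fiber[OF \<alpha>] by (intro sum.cong) auto
      then show ?thesis using \<open>?g \<in> ?W\<close> eq by simp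
    qed
    then show ?thesis by (simp add: sum.If_cases flip: Collect_conj_eq) (simp add: Int_def)
  qed
  have "(\<Sum>g\<in>?W. \<Sum>h\<in>?W. B (wsum n g h X) (wsum n g h Y)) =
      (\<Sum>g\<in>?W. \<Sum>h\<in>?W. \<Sum>\<alpha>\<in>?S. \<Sum>\<beta>\<in>?S. (if \<alpha> \<in> fiber n g h \<and> \<beta> \<in> fiber n g h then 1 else 0) * B (X \<alpha>) (Y \<beta>))"
  proof (intro sum.cong refl)
    fix g h
    have f: "fiber n g h \<subseteq> ?S" by (auto simp: fiber_def)
    have "B (wsum n g h X) (wsum n g h Y) = (\<Sum>\<alpha>\<in>fiber n g h. \<Sum>\<beta>\<in>fiber n g h. B (X \<alpha>) (Y \<beta>))"
      unfolding wsum_def by (rule B) auto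
    also have "\<dots> = (\<Sum>\<alpha>\<in>fiber n g h. \<Sum>\<beta>\<in>?S. (if \<alpha> \<in> fiber n g h \<and> \<beta> \<in> fiber n g h then 1 else 0) * B (X \<alpha>) (Y \<beta>))"
      using f by (intro sum.cong refl sum.mono_neutral_cong_left) auto
    also have "\<dots> = (\<Sum>\<alpha>\<in>?S. \<Sum>\<beta>\<in>?S. (if \<alpha> \<in> fiber n g h \<and> \<beta> \<in> fiber n g h then 1 else 0) * B (X \<alpha>) (Y \<beta>))"
      using f by (intro sum.mono_neutral_cong_left) auto
    finally show "B (wsum n g h X) (wsum n g h Y) = \<dots>" .
  qed
  also have "\<dots> = (\<Sum>\<alpha>\<in>?S. \<Sum>\<beta>\<in>?S. (\<Sum>g\<in>?W. \<Sum>h\<in>?W. if \<alpha> \<in> fiber n g h \<and> \<beta> \<in> fiber n g h then 1 else 0) * B (X \<alpha>) (Y \<beta>))"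
    unfolding sum_distrib_right
    by (subst (2) sum.swap, subst sum.swap, subst (3) sum.swap, subst (2) sum.swap) (rule refl)
  also have "\<dots> = (\<Sum>\<alpha>\<in>?S. \<Sum>\<beta>\<in>?S. of_nat (card {g\<in>?W. \<forall>i\<in>{0..n}. g (\<alpha> i) = g (\<beta> i)}) * B (X \<alpha>) (Y \<beta>))"
    by (intro sum.cong refl) (simp add: cnt)
  finally have eq: "(\<Sum>g\<in>?W. \<Sum>h\<in>?W. B (wsum n g h X) (wsum n g h Y)) = \<dots>" .
  show ?thesis unfolding eq sum_divide_distrib
    by (intro sum.cong refl) (simp add: chi_perm_right_quotient[OF _ _ N])
qed

definition chi_form :: "real \<Rightarrow> nat \<Rightarrow> galg \<Rightarrow> galg \<Rightarrow> complex" where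
  "chi_form q n a b = (\<Sum>\<alpha>\<in>Sym0 n. \<Sum>\<beta>\<in>Sym0 n. chi_perm q n (\<alpha> \<circ> inv \<beta>) * (a \<alpha> * cnj (b \<beta>)))"

lemma chi_form_words:
  assumes "N \<ge> 1"
  shows "chi_form (1 / real N) n a b =
    (\<Sum>g\<in>words n N. \<Sum>h\<in>words n N. wsum n g h a * cnj (wsum n g h b)) / of_nat N ^ (n + 1)"
  unfolding chi_form_def
  by (rule words_form[where B = "\<lambda>x y. x * cnj y", OF _ assms]) (simp add: sum_product)

lemma chi_gadjoint_self:
  assumes "N \<ge> 1"
  shows "chi (1 / real N) n (gmult n (gadjoint n a) a) = chi_form (1 / real N) n a a"
proof -
  let ?q = "1 / real N"
  have "chi ?q n (gmult n (gadjoint n a) a) =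
      (\<Sum>\<gamma>\<in>Sym0 n. \<Sum>\<alpha>\<in>Sym0 n. cnj (a (inv \<alpha>)) * a (inv \<alpha> \<circ> \<gamma>) * chi_perm ?q n \<gamma>)"
    by (simp add: chi_def gmult_def gadjoint_def sum_distrib_right)
  also have "\<dots> = (\<Sum>\<gamma>\<in>Sym0 n. \<Sum>\<alpha>\<in>Sym0 n. cnj (a \<alpha>) * a (\<alpha> \<circ> \<gamma>) * chi_perm ?q n \<gamma>)"
    by (rule sum.cong[OF refl]) (rule sum_Sym0_inv)
  also have "\<dots> = (\<Sum>\<alpha>\<in>Sym0 n. \<Sum>\<gamma>\<in>Sym0 n. cnj (a \<alpha>) * a (\<alpha> \<circ> \<gamma>) * chi_perm ?q n (inv \<alpha> \<circ> (\<alpha> \<circ> \<gamma>)))"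
    by (subst sum.swap) (intro sum.cong refl, simp add: comp_inv_simps bij_Sym0)
  also have "\<dots> = (\<Sum>\<alpha>\<in>Sym0 n. \<Sum>\<beta>\<in>Sym0 n. cnj (a \<alpha>) * a \<beta> * chi_perm ?q n (inv \<alpha> \<circ> \<beta>))"
    by (rule sum.cong[OF refl]) (rule sum_Sym0_left)
  also have "\<dots> = (\<Sum>\<alpha>\<in>Sym0 n. \<Sum>\<beta>\<in>Sym0 n. chi_perm ?q n (\<beta> \<circ> inv \<alpha>) * (a \<beta> * cnj (a \<alpha>)))"
    by (intro sum.cong refl) (simp add: chi_perm_conj[OF _ _ assms])
  also have "\<dots> = chi_form ?q n a a" unfolding chi_form_def by (rule sum.swap)
  finally show ?thesis .
qed


section \<open>Complex Hilbert spaces\<close>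

global_interpretation chs: vector_space "scaleC :: complex \<Rightarrow> 'a::complex_hilbert_space \<Rightarrow> 'a"
proof
  fix x :: 'a
  show "1 *\<^sub>C x = x" using scaleC_of_real[of 1 x] by simp
qed (simp_all add: scaleC_add_right scaleC_add_left scaleC_scaleC)

lemma cinner_add_right: "cinner x (y + z) = cinner x y + cinner x z"
  by (metis cinner_add_left cinner_commute complex_cnj_add)

lemma cinner_scaleC_right: "cinner x (c *\<^sub>C y) = cnj c * cinner x y"
  by (metis cinner_scaleC_left cinner_commute complex_cnj_mult)

lemma cinner_zero_left [simp]: "cinner 0 y = 0"
  using cinner_add_left[of 0 0 y] by simp

lemma cinner_zero_right [simp]: "cinner y 0 = 0"
  using cinner_add_right[of y 0 0] by simp

lemma cinner_diff_left: "cinner (x - y) z = cinner x z - cinner y z"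
  using cinner_add_left[of "x - y" y z] by simp

lemma cinner_diff_right: "cinner x (y - z) = cinner x y - cinner x z"
  using cinner_add_right[of x "y - z" z] by simp

lemma cinner_sum_left: "cinner (sum f A) y = (\<Sum>i\<in>A. cinner (f i) y)"
  by (induction A rule: infinite_finite_induct) (auto simp: cinner_add_left)

lemma cinner_sum_right: "cinner y (sum f A) = (\<Sum>i\<in>A. cinner y (f i))"
  by (induction A rule: infinite_finite_induct) (auto simp: cinner_add_right)

lemma cinner_self: "cinner x x = complex_of_real ((norm x)\<^sup>2)"
proof -
  have "Im (cinner x x) = 0" using cinner_commute[of x x] by (simp add: complex_eq_iff)
  then show ?thesis using Re_cinner[of x x] by (simp add: complex_eq_iff power2_norm_eq_inner)
qed

lemma cinner_self_eq_0: "cinner x x = 0 \<Longrightarrow> x = 0"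
  by (simp add: cinner_self)

lemma norm_scaleC: "norm (c *\<^sub>C x) = cmod c * norm x"
proof -
  have "complex_of_real ((norm (c *\<^sub>C x))\<^sup>2) = (c * cnj c) * complex_of_real ((norm x)\<^sup>2)"
    by (simp only: cinner_self[symmetric] cinner_scaleC_left cinner_scaleC_right mult_ac)
  also have "\<dots> = complex_of_real ((cmod c * norm x)\<^sup>2)"
    unfolding complex_norm_square[symmetric] by (simp add: power_mult_distrib)
  finally have "(norm (c *\<^sub>C x))\<^sup>2 = (cmod c * norm x)\<^sup>2" by (simp only: of_real_eq_iff)
  then show ?thesis by simp
qed

lemma cmod_cinner_le: "cmod (cinner x y) \<le> norm x * norm y"
proof (cases "cinner x y = 0")
  case False
  define c where "c = cnj (cinner x y) / cmod (cinner x y)"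
  have c: "cmod c = 1" using False by (simp add: c_def norm_divide)
  have "c * cinner x y = complex_of_real (cmod (cinner x y))"
    using False complex_norm_square[of "cinner x y"] by (simp add: c_def field_simps power2_eq_square)
  then have "cmod (cinner x y) = Re (cinner (c *\<^sub>C x) y)" by (simp add: cinner_scaleC_left)
  also have "\<dots> \<le> norm (c *\<^sub>C x) * norm y" by (simp add: Re_cinner norm_cauchy_schwarz)
  finally show ?thesis by (simp add: norm_scaleC c)
qed simp

lemma cinner_via_inner: "cinner x y = Complex (inner x y) (inner ((- \<i>) *\<^sub>C x) y)"
proof (rule complex_eqI)
  show "Im (cinner x y) = Im (Complex (inner x y) (inner ((- \<i>) *\<^sub>C x) y))"
    by (simp only: Re_cinner[symmetric] cinner_scaleC_left) simp
qed (simp add: Re_cinner)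

lemma bounded_linear_cinner_left: "bounded_linear (\<lambda>x. cinner x y)"
proof (rule bounded_linear_intro[where K = "norm y"])
  show "cinner (r *\<^sub>R x) y = r *\<^sub>R cinner x y" for r x
    by (simp add: cinner_scaleC_left scaleR_conv_of_real flip: scaleC_of_real)
qed (simp_all add: cinner_add_left cmod_cinner_le)

lemma bounded_linear_cinner_right: "bounded_linear (\<lambda>x. cinner y x)"
proof (rule bounded_linear_intro[where K = "norm y"])
  show "cinner y (r *\<^sub>R x) = r *\<^sub>R cinner y x" for r x
    by (simp add: cinner_scaleC_right scaleR_conv_of_real flip: scaleC_of_real)
  show "norm (cinner y x) \<le> norm x * norm y" for x
    using cmod_cinner_le[of y x] by (simp add: mult.commute)
qed (simp_all add: cinner_add_right)

lemma bounded_linear_scaleC: "bounded_linear ((*\<^sub>C) c :: 'a::complex_hilbert_space \<Rightarrow> 'a)"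
proof (rule bounded_linear_intro[where K = "cmod c"])
  show "c *\<^sub>C (r *\<^sub>R x) = r *\<^sub>R (c *\<^sub>C x)" for r and x :: 'a
    by (simp add: scaleC_scaleC mult.commute flip: scaleC_of_real)
qed (simp_all add: scaleC_add_right norm_scaleC mult.commute)

lemmas tendsto_cinner_left = bounded_linear.tendsto[OF bounded_linear_cinner_left]
lemmas tendsto_scaleC = bounded_linear.tendsto[OF bounded_linear_scaleC]

lemma closed_cinner_zero_right: "closed {x. cinner y x = 0}"
  by (intro closed_Collect_eq continuous_intros bounded_linear.continuous_on[OF bounded_linear_cinner_right])

lemma csubspace_closure:
  assumes "chs.subspace V" shows "chs.subspace (closure V)"
proof (rule chs.subspaceI)
  show "0 \<in> closure V" using chs.subspace_0[OF assms] closure_subset by blast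
next
  fix x y assume "x \<in> closure V" "y \<in> closure V"
  then obtain f g where "\<And>k. f k \<in> V" "f \<longlonglongrightarrow> x" "\<And>k. g k \<in> V" "g \<longlonglongrightarrow> y"
    unfolding closure_sequential by metis
  then have "(\<lambda>k. f k + g k) \<longlonglongrightarrow> x + y" "\<And>k. f k + g k \<in> V"
    using chs.subspace_add[OF assms] by (auto intro: tendsto_add)
  then show "x + y \<in> closure V" unfolding closure_sequential by (intro exI[of _ "\<lambda>k. f k + g k"]) simp
next
  fix c x assume "x \<in> closure V"
  then obtain f where "\<And>k. f k \<in> V" "f \<longlonglongrightarrow> x" unfolding closure_sequential by metis
  then have "(\<lambda>k. c *\<^sub>C f k) \<longlonglongrightarrow> c *\<^sub>C x" "\<And>k. c *\<^sub>C f k \<in> V"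
    using chs.subspace_scale[OF assms] by (auto intro: tendsto_scaleC)
  then show "c *\<^sub>C x \<in> closure V" unfolding closure_sequential by (intro exI[of _ "\<lambda>k. c *\<^sub>C f k"]) simp
qed

lemma closure_cspan_subset:
  assumes "S \<subseteq> V" "chs.subspace V" "closed V"
  shows "closure (cspan S) \<subseteq> V"
  using chs.span_minimal[OF assms(1,2)] assms(3) by (rule closure_minimal)

lemma closure_cspan_eq_0:
  assumes "x \<in> closure (cspan S)" "\<And>y. y \<in> S \<Longrightarrow> cinner x y = 0"
  shows "x = 0"
proof -
  have "closure (cspan S) \<subseteq> {y. cinner x y = 0}"
    using assms(2)
    by (intro closure_cspan_subset closed_cinner_zero_right chs.subspaceI)
      (auto simp: cinner_add_right cinner_scaleC_right)
  then show ?thesis using assms(1) cinner_self_eq_0 by blast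
qed

text \<open>Best approximation: the Fourier partial sums of \<open>x\<close> are at least as good as any approximation
  from the span of the same finite part of an orthonormal family.\<close>

lemma fourier_approx:
  fixes e :: "'i \<Rightarrow> 'a::complex_hilbert_space"
  assumes ortho: "\<And>i j. i \<in> I \<Longrightarrow> j \<in> I \<Longrightarrow> cinner (e i) (e j) = of_bool (i = j)"
    and x: "x \<in> closure (cspan (e ` I))" and "\<epsilon> > 0"
  obtains W where "finite W" "W \<subseteq> I"
    "\<And>V. finite V \<Longrightarrow> W \<subseteq> V \<Longrightarrow> V \<subseteq> I \<Longrightarrow> norm (x - (\<Sum>i\<in>V. cinner x (e i) *\<^sub>C e i)) < \<epsilon>"
proof -
  obtain y where y: "y \<in> cspan (e ` I)" "norm (x - y) < \<epsilon>"
    using closure_approachable[of x "cspan (e ` I)"] x \<open>\<epsilon> > 0\<close> by (auto simp: dist_norm norm_minus_commute)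
  obtain S c where S: "finite S" "S \<subseteq> e ` I" "y = (\<Sum>z\<in>S. c z *\<^sub>C z)"
    using y(1) unfolding chs.span_explicit by blast
  obtain W where W: "W \<subseteq> I" "finite W" "S = e ` W"
    using finite_subset_image[OF S(1,2)] by metis
  have "norm (x - (\<Sum>i\<in>V. cinner x (e i) *\<^sub>C e i)) < \<epsilon>"
    if V: "finite V" "W \<subseteq> V" "V \<subseteq> I" for V
  proof -
    define p where "p = (\<Sum>i\<in>V. cinner x (e i) *\<^sub>C e i)"
    have pe: "cinner (x - p) (e j) = 0" if "j \<in> V" for j
    proof -
      have "cinner p (e j) = (\<Sum>i\<in>V. if i = j then cinner x (e i) else 0)"
        unfolding p_def cinner_sum_left cinner_scaleC_left
        using V(3) that ortho by (intro sum.cong refl) (auto simp: subset_iff)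
      also have "\<dots> = cinner x (e j)" using V(1) that by simp
      finally show ?thesis by (simp add: cinner_diff_left)
    qed
    have orth: "cinner (x - p) z = 0" if "z \<in> cspan (e ` V)" for z
      using that by (induction rule: chs.span_induct_alt) (auto simp: cinner_add_right cinner_scaleC_right pe)
    have "p \<in> cspan (e ` V)" unfolding p_def
      by (intro chs.span_sum chs.span_scale chs.span_base imageI)
    moreover have "y \<in> cspan (e ` V)" unfolding S(3) W(3)
      using V(2) by (intro chs.span_sum chs.span_scale chs.span_base) auto
    ultimately have "cinner (x - p) (p - y) = 0" by (intro orth chs.span_diff)
    then have "inner (x - p) (p - y) = 0" by (simp flip: Re_cinner)
    then have "(norm ((x - p) + (p - y)))\<^sup>2 = (norm (x - p))\<^sup>2 + (norm (p - y))\<^sup>2"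
      by (intro norm_add_Pythagorean) (simp add: orthogonal_def)
    then have "(norm (x - p))\<^sup>2 \<le> (norm (x - y))\<^sup>2" by simp
    then have "norm (x - p) \<le> norm (x - y)" by (rule power2_le_imp_le) simp
    then show ?thesis using y(2) by (simp add: p_def)
  qed
  then show ?thesis using that W(1,2) by blast
qed


section \<open>Tensor powers and the permutation unitaries\<close>

locale tensors =
  fixes \<tau> :: "nat \<Rightarrow> (nat \<Rightarrow> 'a::complex_hilbert_space) \<Rightarrow> 't::complex_hilbert_space"
  assumes tensor: "hilbert_tensor_powers \<tau>"
begin

abbreviation "T \<equiv> tensor_power \<tau>"

lemma tensor_cong: "(\<And>i. i \<in> {1..n} \<Longrightarrow> h i = g i) \<Longrightarrow> \<tau> n h = \<tau> n g"
  using tensor unfolding hilbert_tensor_powers_def by blast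

lemma cinner_tensor: "cinner (\<tau> n h) (\<tau> n g) = (\<Prod>i=1..n. cinner (h i) (g i))"
  using tensor unfolding hilbert_tensor_powers_def by blast

lemma tensor_linear: "i \<in> {1..n} \<Longrightarrow> clinear (\<lambda>x. \<tau> n (h(i := x)))"
  using tensor unfolding hilbert_tensor_powers_def by blast

lemma norm_tensor: "norm (\<tau> n h) = (\<Prod>i=1..n. norm (h i))"
proof -
  have "complex_of_real ((norm (\<tau> n h))\<^sup>2) = complex_of_real ((\<Prod>i=1..n. norm (h i))\<^sup>2)"
    using cinner_tensor[of n h h] by (simp add: cinner_self power2_eq_square prod.distrib)
  then have "(norm (\<tau> n h))\<^sup>2 = (\<Prod>i=1..n. norm (h i))\<^sup>2" by (simp only: of_real_eq_iff)
  then show ?thesis by (simp add: prod_nonneg)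
qed

lemma tensor_mem: "\<tau> n h \<in> T n"
  unfolding tensor_power_def by (intro subsetD[OF closure_subset] chs.span_base rangeI)

lemma subspace_T: "chs.subspace (T n)"
  unfolding tensor_power_def by (intro csubspace_closure chs.subspace_span)

lemma closed_T: "closed (T n)"
  unfolding tensor_power_def by simp

lemmas T_zero [simp] = chs.subspace_0[OF subspace_T]
  and T_add = chs.subspace_add[OF subspace_T]
  and T_diff = chs.subspace_diff[OF subspace_T]
  and T_scale = chs.subspace_scale[OF subspace_T]
  and T_sum = chs.subspace_sum[OF subspace_T]

lemma T_eqI:
  assumes "F \<in> T n" "G \<in> T n" "\<And>h. cinner F (\<tau> n h) = cinner G (\<tau> n h)"
  shows "F = G"
proof -
  have "F - G \<in> closure (cspan (range (\<tau> n)))"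
    using T_diff[OF assms(1,2)] by (simp add: tensor_power_def)
  then have "F - G = 0" by (rule closure_cspan_eq_0) (auto simp: cinner_diff_left assms(3))
  then show ?thesis by simp
qed

text \<open>The graph of \<open>U\<^sub>\<sigma>\<close>, described through inner products with elementary tensors. In this form it is
  evidently single-valued, linear, and closed under limits, so that existence of \<open>U\<^sub>\<sigma>\<close> amounts to totality.\<close>

definition perm_rel :: "nat \<Rightarrow> perm \<Rightarrow> 't \<Rightarrow> 't \<Rightarrow> bool" where
  "perm_rel n \<sigma> F G \<longleftrightarrow> F \<in> T n \<and> G \<in> T n \<and>
     (\<forall>h. cinner G (\<tau> n (\<lambda>i. h (inv \<sigma> i))) = cinner F (\<tau> n h))"

lemma perm_relD: "perm_rel n \<sigma> F G \<Longrightarrow> cinner G (\<tau> n (\<lambda>i. h (inv \<sigma> i))) = cinner F (\<tau> n h)"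
  by (simp add: perm_rel_def)

lemma perm_rel_unique:
  assumes "\<sigma> \<in> Sym n" "perm_rel n \<sigma> F G" "perm_rel n \<sigma> F G'"
  shows "G = G'"
proof (rule T_eqI)
  show "G \<in> T n" "G' \<in> T n" using assms by (auto simp: perm_rel_def)
  fix h :: "nat \<Rightarrow> 'a"
  have "cinner H (\<tau> n (\<lambda>i. h (\<sigma> (inv \<sigma> i)))) = cinner F (\<tau> n (\<lambda>i. h (\<sigma> i)))"
    if "perm_rel n \<sigma> F H" for H
    using perm_relD[OF that, of "\<lambda>i. h (\<sigma> i)"] .
  then show "cinner G (\<tau> n h) = cinner G' (\<tau> n h)"
    using assms(2,3) by (simp add: Sym0_inv_apply[OF Sym_subset_Sym0[OF assms(1)]])
qed

lemma perm_rel_lin: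
  "perm_rel n \<sigma> F G \<Longrightarrow> perm_rel n \<sigma> F' G' \<Longrightarrow> perm_rel n \<sigma> (c *\<^sub>C F + F') (c *\<^sub>C G + G')"
  by (simp add: perm_rel_def T_add T_scale cinner_add_left cinner_scaleC_left)

lemma perm_rel_zero: "perm_rel n \<sigma> 0 0"
  by (simp add: perm_rel_def)

lemma perm_rel_diff: "perm_rel n \<sigma> F G \<Longrightarrow> perm_rel n \<sigma> F' G' \<Longrightarrow> perm_rel n \<sigma> (F - F') (G - G')"
  by (simp add: perm_rel_def T_diff cinner_diff_left)

lemma perm_rel_tensor:
  assumes "\<sigma> \<in> Sym n" shows "perm_rel n \<sigma> (\<tau> n h) (\<tau> n (\<lambda>i. h (inv \<sigma> i)))"
proof -
  have "inv \<sigma> permutes {1..n}" using Sym_inv[OF assms] by (simp add: Sym_def)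
  then have "(\<Prod>i=1..n. cinner (h (inv \<sigma> i)) (g (inv \<sigma> i))) = (\<Prod>i=1..n. cinner (h i) (g i))" for g
    using prod.permute[of "inv \<sigma>" "{1..n}" "\<lambda>i. cinner (h i) (g i)"] by (simp add: comp_def)
  then show ?thesis by (simp add: perm_rel_def tensor_mem cinner_tensor)
qed

text \<open>On the span of the elementary tensors the relation preserves inner products with everything;
  so it maps approximating Cauchy sequences to Cauchy sequences and extends to the whole tensor power.\<close>

lemma perm_rel_span:
  assumes "\<sigma> \<in> Sym n" "F' \<in> cspan (range (\<tau> n))"
  shows "\<exists>G'. perm_rel n \<sigma> F' G' \<and> (\<forall>F G. perm_rel n \<sigma> F G \<longrightarrow> cinner G G' = cinner F F')"
  using assms(2)
proof (induction rule: chs.span_induct_alt)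
  case base
  show ?case using perm_rel_zero by (intro exI[of _ 0]) simp
next
  case (step c x y)
  then obtain h where h: "x = \<tau> n h" by blast
  obtain G' where G': "perm_rel n \<sigma> y G'" "\<And>F G. perm_rel n \<sigma> F G \<Longrightarrow> cinner G G' = cinner F y"
    using step.IH by blast
  have "perm_rel n \<sigma> (c *\<^sub>C x + y) (c *\<^sub>C \<tau> n (\<lambda>i. h (inv \<sigma> i)) + G')"
    unfolding h by (intro perm_rel_lin perm_rel_tensor assms(1) G'(1))
  moreover have "cinner G (c *\<^sub>C \<tau> n (\<lambda>i. h (inv \<sigma> i)) + G') = cinner F (c *\<^sub>C x + y)"
    if "perm_rel n \<sigma> F G" for F G
    using that G'(2)[OF that] by (simp add: h cinner_add_right cinner_scaleC_right perm_rel_def)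
  ultimately show ?case by blast
qed

lemma perm_rel_exists:
  assumes \<sigma>: "\<sigma> \<in> Sym n" and F: "F \<in> T n"
  shows "\<exists>G. perm_rel n \<sigma> F G \<and> norm G = norm F"
proof -
  obtain f where f: "\<And>k. f k \<in> cspan (range (\<tau> n))" "f \<longlonglongrightarrow> F"
    using F unfolding tensor_power_def closure_sequential by blast
  obtain g where g: "\<And>k. perm_rel n \<sigma> (f k) (g k)"
    "\<And>k F G. perm_rel n \<sigma> F G \<Longrightarrow> cinner G (g k) = cinner F (f k)"
    using perm_rel_span[OF \<sigma> f(1)] by metis
  have iso: "norm (g k - g l) = norm (f k - f l)" for k l
  proof -
    have "cinner (g k - g l) (g k - g l) = cinner (f k - f l) (f k - f l)"
      using g(2)[OF perm_rel_diff[OF g(1) g(1)]] by (simp add: cinner_diff_right)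
    then have "(norm (g k - g l))\<^sup>2 = (norm (f k - f l))\<^sup>2" by (simp only: cinner_self of_real_eq_iff)
    then show ?thesis by simp
  qed
  have norm_g: "norm (g k) = norm (f k)" for k
  proof -
    have "cinner (g k) (g k) = cinner (f k) (f k)" by (rule g(2)[OF g(1)])
    then have "(norm (g k))\<^sup>2 = (norm (f k))\<^sup>2" by (simp only: cinner_self of_real_eq_iff)
    then show ?thesis by simp
  qed
  have "Cauchy f" using f(2) LIMSEQ_imp_Cauchy by blast
  then have "Cauchy g" unfolding Cauchy_def dist_norm iso .
  then obtain G where G: "g \<longlonglongrightarrow> G" using Cauchy_convergent convergent_def by blast
  have "G \<in> T n" using closed_T G g(1) by (auto simp: closed_sequential_limits perm_rel_def)
  moreover have "cinner G (\<tau> n (\<lambda>i. h (inv \<sigma> i))) = cinner F (\<tau> n h)" for h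
  proof (rule LIMSEQ_unique)
    show "(\<lambda>k. cinner (g k) (\<tau> n (\<lambda>i. h (inv \<sigma> i)))) \<longlonglongrightarrow> cinner G (\<tau> n (\<lambda>i. h (inv \<sigma> i)))"
      by (rule tendsto_cinner_left[OF G])
    show "(\<lambda>k. cinner (g k) (\<tau> n (\<lambda>i. h (inv \<sigma> i)))) \<longlonglongrightarrow> cinner F (\<tau> n h)"
      using tendsto_cinner_left[OF f(2)] g(1) by (simp add: perm_rel_def)
  qed
  moreover have "norm G = norm F"
    using tendsto_norm[OF G] tendsto_norm[OF f(2)] unfolding norm_g by (rule LIMSEQ_unique)
  ultimately show ?thesis using F by (auto simp: perm_rel_def)
qed

abbreviation "U \<equiv> perm_op \<tau>"

lemma perm_op_isometry_unique:
  assumes V: "\<And>h. V (\<tau> n h) = W (\<tau> n h)"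
    "\<And>F G c. F \<in> T n \<Longrightarrow> G \<in> T n \<Longrightarrow> V (c *\<^sub>C F + G) = c *\<^sub>C V F + V G"
    "\<And>F. F \<in> T n \<Longrightarrow> norm (V F) = norm F"
    and W: "\<And>F G c. F \<in> T n \<Longrightarrow> G \<in> T n \<Longrightarrow> W (c *\<^sub>C F + G) = c *\<^sub>C W F + W G"
    "\<And>F. F \<in> T n \<Longrightarrow> norm (W F) = norm F"
    and F: "F \<in> T n"
  shows "V F = (W F :: 't)"
proof -
  have V0: "V 0 = 0" using V(3)[OF T_zero] by simp
  have W0: "W 0 = 0" using W(2)[OF T_zero] by simp
  have span: "cspan (range (\<tau> n)) \<subseteq> T n" by (simp add: tensor_power_def closure_subset)
  have D: "y \<in> T n \<and> V y = W y" if "y \<in> cspan (range (\<tau> n))" for y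
    using that
  proof (induction rule: chs.span_induct_alt)
    case base
    show ?case by (simp add: V0 W0)
  next
    case (step c x y)
    then have "x \<in> T n" "V x = W x" using tensor_mem V(1) by auto
    then show ?case using step.IH by (simp add: V(2) W(1) T_add T_scale)
  qed
  obtain f where f: "\<And>k. f k \<in> cspan (range (\<tau> n))" "f \<longlonglongrightarrow> F"
    using F unfolding tensor_power_def closure_sequential by blast
  have fT: "f k \<in> T n" for k using f(1) span by blast
  have lim: "(\<lambda>k. A (f k)) \<longlonglongrightarrow> A F"
    if A: "\<And>F G c. F \<in> T n \<Longrightarrow> G \<in> T n \<Longrightarrow> A (c *\<^sub>C F + G) = c *\<^sub>C A F + A G"
      "\<And>F. F \<in> T n \<Longrightarrow> norm (A F) = norm F" for A :: "'t \<Rightarrow> 't"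
  proof -
    have "norm (A (f k) - A F) = norm (f k - F)" for k
    proof -
      have "A (f k - F) = A ((-1) *\<^sub>C F + f k)" by simp
      also have "\<dots> = A (f k) - A F" by (subst A(1)) (simp_all add: F fT)
      finally show ?thesis using A(2)[OF T_diff[OF fT F]] by metis
    qed
    then show ?thesis using f(2) unfolding LIMSEQ_iff by simp
  qed
  have "(\<lambda>k. V (f k)) \<longlonglongrightarrow> W F" using lim[OF W] D[OF f(1)] by simp
  with lim[OF V(2,3)] show ?thesis by (rule LIMSEQ_unique)
qed

text \<open>The choice from the graph satisfies the conditions of the definite description, and isometries that
  agree on elementary tensors agree on the tensor power.\<close>

lemma perm_op_eq:
  assumes \<sigma>: "\<sigma> \<in> Sym n"
  shows "U n \<sigma> = (\<lambda>F. if F \<in> T n then (SOME G. perm_rel n \<sigma> F G) else 0)" (is "_ = ?V")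
    and "\<And>F. F \<in> T n \<Longrightarrow> perm_rel n \<sigma> F (U n \<sigma> F)"
    and "\<And>F. F \<in> T n \<Longrightarrow> norm (U n \<sigma> F) = norm F"
proof -
  have rel: "perm_rel n \<sigma> F (?V F)" if "F \<in> T n" for F
    using perm_rel_exists[OF \<sigma> that] someI[of "perm_rel n \<sigma> F"] that by auto
  have nrm: "norm (?V F) = norm F" if "F \<in> T n" for F
    using perm_rel_exists[OF \<sigma> that] perm_rel_unique[OF \<sigma> rel[OF that]] by metis
  have tens: "?V (\<tau> n h) = \<tau> n (\<lambda>i. h (inv \<sigma> i))" for h
    by (rule perm_rel_unique[OF \<sigma> rel[OF tensor_mem] perm_rel_tensor[OF \<sigma>]])
  have lin: "?V (c *\<^sub>C F + G) = c *\<^sub>C ?V F + ?V G" if "F \<in> T n" "G \<in> T n" for F G c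
    by (rule perm_rel_unique[OF \<sigma> rel perm_rel_lin[OF rel rel]]) (simp_all add: that T_add T_scale)
  show eq: "U n \<sigma> = ?V"
    unfolding perm_op_def
  proof (rule the_equality)
    show "(\<forall>h. ?V (\<tau> n h) = \<tau> n (\<lambda>i. h (inv \<sigma> i))) \<and>
      (\<forall>F\<in>T n. \<forall>G\<in>T n. \<forall>c. ?V (c *\<^sub>C F + G) = c *\<^sub>C ?V F + ?V G) \<and>
      (\<forall>F\<in>T n. norm (?V F) = norm F) \<and> (\<forall>F. F \<notin> T n \<longrightarrow> ?V F = 0)"
      using tens lin nrm by auto
  next
    fix V assume V: "(\<forall>h. V (\<tau> n h) = \<tau> n (\<lambda>i. h (inv \<sigma> i))) \<and>
      (\<forall>F\<in>T n. \<forall>G\<in>T n. \<forall>c. V (c *\<^sub>C F + G) = c *\<^sub>C V F + V G) \<and>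
      (\<forall>F\<in>T n. norm (V F) = norm F) \<and> (\<forall>F. F \<notin> T n \<longrightarrow> V F = 0)"
    show "V = ?V"
    proof
      fix F show "V F = ?V F"
      proof (cases "F \<in> T n")
        case True
        show ?thesis
          by (rule perm_op_isometry_unique[of V n ?V, OF _ _ _ lin nrm True]) (use V tens in simp_all)
      qed (use V in simp)
    qed
  qed
  show "\<And>F. F \<in> T n \<Longrightarrow> perm_rel n \<sigma> F (U n \<sigma> F)" "\<And>F. F \<in> T n \<Longrightarrow> norm (U n \<sigma> F) = norm F"
    unfolding eq using rel nrm by blast+
qed

context
  fixes n \<sigma> assumes \<sigma>: "\<sigma> \<in> Sym n"
begin

lemma U_closed: "U n \<sigma> F \<in> T n"
  using perm_op_eq(2)[OF \<sigma>, of F] perm_op_eq(1)[OF \<sigma>] by (cases "F \<in> T n") (auto simp: perm_rel_def)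

lemma U_tensor: "U n \<sigma> (\<tau> n h) = \<tau> n (\<lambda>i. h (inv \<sigma> i))"
  by (rule perm_rel_unique[OF \<sigma> perm_op_eq(2)[OF \<sigma> tensor_mem] perm_rel_tensor[OF \<sigma>]])

lemma U_add: "F \<in> T n \<Longrightarrow> G \<in> T n \<Longrightarrow> U n \<sigma> (F + G) = U n \<sigma> F + U n \<sigma> G"
  using perm_rel_unique[OF \<sigma> perm_op_eq(2)[OF \<sigma>] perm_rel_lin[of n \<sigma> F _ G _ 1, OF perm_op_eq(2)[OF \<sigma>] perm_op_eq(2)[OF \<sigma>]]]
  by (simp add: T_add)

lemma U_zero [simp]: "U n \<sigma> 0 = 0"
  using perm_op_eq(3)[OF \<sigma> T_zero] by simp

lemma U_scale: "F \<in> T n \<Longrightarrow> U n \<sigma> (c *\<^sub>C F) = c *\<^sub>C U n \<sigma> F"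
  using perm_rel_unique[OF \<sigma> perm_op_eq(2)[OF \<sigma>] perm_rel_lin[of n \<sigma> F _ 0 0 c, OF perm_op_eq(2)[OF \<sigma>] perm_rel_zero]]
  by (simp add: T_scale)

lemma U_diff: "F \<in> T n \<Longrightarrow> G \<in> T n \<Longrightarrow> U n \<sigma> (F - G) = U n \<sigma> F - U n \<sigma> G"
  using U_add[of "F - G" G] T_diff by simp

lemma U_sum: "(\<And>i. i \<in> A \<Longrightarrow> f i \<in> T n) \<Longrightarrow> U n \<sigma> (sum f A) = (\<Sum>i\<in>A. U n \<sigma> (f i))"
  by (induction A rule: infinite_finite_induct) (auto simp: U_add T_sum)

lemma norm_U: "F \<in> T n \<Longrightarrow> norm (U n \<sigma> F) = norm F"
  by (rule perm_op_eq(3)[OF \<sigma>])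

lemma cinner_U:
  assumes "F \<in> T n" "G \<in> T n" shows "cinner (U n \<sigma> F) (U n \<sigma> G) = cinner F G"
proof -
  have *: "inner (U n \<sigma> F) (U n \<sigma> G) = inner F G" if "F \<in> T n" for F
    using norm_U[OF that] norm_U[OF assms(2)] norm_U[OF T_add[OF that assms(2)]]
    unfolding dot_norm by (simp add: U_add that assms(2))
  show ?thesis
    unfolding cinner_via_inner using *[OF assms(1)] *[OF T_scale[OF assms(1)], of "- \<i>"]
    by (simp only: U_scale[OF assms(1)])
qed

end

lemma U_comp:
  assumes \<rho>: "\<rho> \<in> Sym n" and \<sigma>: "\<sigma> \<in> Sym n" and F: "F \<in> T n"
  shows "U n \<rho> (U n \<sigma> F) = U n (\<rho> \<circ> \<sigma>) F"
proof (rule perm_rel_unique[OF Sym_comp[OF \<rho> \<sigma>] _ perm_op_eq(2)[OF Sym_comp[OF \<rho> \<sigma>] F]])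
  note 1 = perm_op_eq(2)[OF \<sigma> F] and 2 = perm_op_eq(2)[OF \<rho> U_closed[OF \<sigma>], of F]
  have "inv (\<rho> \<circ> \<sigma>) = inv \<sigma> \<circ> inv \<rho>" by (rule o_inv_distrib[OF bij_Sym[OF \<rho>] bij_Sym[OF \<sigma>]])
  then have "cinner (U n \<rho> (U n \<sigma> F)) (\<tau> n (\<lambda>i. h (inv (\<rho> \<circ> \<sigma>) i))) = cinner F (\<tau> n h)" for h
    using perm_relD[OF 2, of "\<lambda>i. h (inv \<sigma> i)"] perm_relD[OF 1, of h] by simp
  then show "perm_rel n (\<rho> \<circ> \<sigma>) F (U n \<rho> (U n \<sigma> F))"
    using F U_closed[OF \<rho>] by (simp add: perm_rel_def)
qed

end


section \<open>Young subgroups and increasing tuples\<close>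

lemma young_subgroup_iff:
  "\<sigma> \<in> young_subgroup n (ker_partition n u) \<longleftrightarrow> \<sigma> \<in> Sym n \<and> (\<forall>i\<in>{1..n}. u (\<sigma> i) = u i)"
proof
  assume \<sigma>: "\<sigma> \<in> young_subgroup n (ker_partition n u)"
  have "u (\<sigma> i) = u i" if i: "i \<in> {1..n}" for i
  proof -
    let ?V = "{j\<in>{1..n}. u j = u i}"
    have "?V \<in> ker_partition n u" using i unfolding ker_partition_def by blast
    then have "\<sigma> ` ?V = ?V" using \<sigma> by (simp add: young_subgroup_def)
    moreover have "i \<in> ?V" using i by simp
    ultimately have "\<sigma> i \<in> ?V" by blast
    then show ?thesis by simp
  qed
  then show "\<sigma> \<in> Sym n \<and> (\<forall>i\<in>{1..n}. u (\<sigma> i) = u i)" using \<sigma> by (simp add: young_subgroup_def)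
next
  assume *: "\<sigma> \<in> Sym n \<and> (\<forall>i\<in>{1..n}. u (\<sigma> i) = u i)"
  then have p: "\<sigma> permutes {1..n}" by (simp add: Sym_def)
  have "\<sigma> ` {j\<in>{1..n}. u j = u i} = {j\<in>{1..n}. u j = u i}" for i
  proof (rule endo_inj_surj)
    show "\<sigma> ` {j\<in>{1..n}. u j = u i} \<subseteq> {j\<in>{1..n}. u j = u i}"
    proof (rule image_subsetI)
      fix j assume j: "j \<in> {j\<in>{1..n}. u j = u i}"
      then have "\<sigma> j \<in> {1..n}" using permutes_in_image[OF p, of j] by simp
      then show "\<sigma> j \<in> {j\<in>{1..n}. u j = u i}" using j * by simp
    qed
  qed (use permutes_inj_on[OF p] in auto)
  then show "\<sigma> \<in> young_subgroup n (ker_partition n u)"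
    using * by (auto simp: young_subgroup_def ker_partition_def)
qed

text \<open>One block at a time: a permutation that preserves the blocks is the product of a permutation of one
  block and one that preserves the remaining blocks.\<close>

lemma card_block_permutations:
  assumes "finite \<pi>" "\<And>V. V \<in> \<pi> \<Longrightarrow> finite V" "disjoint \<pi>"
  shows "card {\<sigma>. \<sigma> permutes (\<Union>\<pi>) \<and> (\<forall>V\<in>\<pi>. \<sigma> ` V = V)} = (\<Prod>V\<in>\<pi>. fact (card V))"
  using assms
proof (induction \<pi>)
  case empty
  have "{\<sigma>. \<sigma> permutes ({}::'a set)} = {id}" by auto
  then show ?case by simp
next
  case (insert V \<pi>)
  let ?P = "\<lambda>\<pi>. {\<sigma>. \<sigma> permutes (\<Union>\<pi>) \<and> (\<forall>V\<in>\<pi>. \<sigma> ` V = V)}"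
  have disj: "V \<inter> \<Union>\<pi> = {}"
    using insert.prems(2) insert.hyps(2) by (auto simp: disjoint_def)
  have card: "card (?P \<pi>) = (\<Prod>V\<in>\<pi>. fact (card V))"
    using insert.prems by (intro insert.IH) (auto simp: disjoint_def)
  have "bij_betw (\<lambda>(p, \<rho>). p \<circ> \<rho>) ({p. p permutes V} \<times> ?P \<pi>) (?P (insert V \<pi>))"
  proof (rule bij_betw_byWitness[where f' = "\<lambda>\<sigma>. (perm_restrict \<sigma> V, perm_restrict \<sigma> (\<Union>\<pi>))"])
    show "\<forall>x\<in>{p. p permutes V} \<times> ?P \<pi>.
        (\<lambda>\<sigma>. (perm_restrict \<sigma> V, perm_restrict \<sigma> (\<Union>\<pi>))) ((\<lambda>(p, \<rho>). p \<circ> \<rho>) x) = x"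
    proof
      fix x assume "x \<in> {p. p permutes V} \<times> ?P \<pi>"
      then obtain p \<rho> where x: "x = (p, \<rho>)" and p: "p permutes V" and \<rho>: "\<rho> permutes (\<Union>\<pi>)"
        by auto
      have "perm_restrict (p \<circ> \<rho>) V = p"
      proof
        fix x show "perm_restrict (p \<circ> \<rho>) V x = p x"
        proof (cases "x \<in> V")
          case True
          then have "x \<notin> \<Union>\<pi>" using disj by blast
          then show ?thesis using permutes_not_in[OF \<rho>, of x] True by (simp add: perm_restrict_def)
        next
          case False
          then show ?thesis using permutes_not_in[OF p, of x] by (simp add: perm_restrict_def)
        qed
      qed
      moreover have "perm_restrict (p \<circ> \<rho>) (\<Union>\<pi>) = \<rho>"
      proof
        fix x show "perm_restrict (p \<circ> \<rho>) (\<Union>\<pi>) x = \<rho> x"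
        proof (cases "x \<in> \<Union>\<pi>")
          case True
          then have "\<rho> x \<in> \<Union>\<pi>" using permutes_in_image[OF \<rho>, of x] by blast
          then have "\<rho> x \<notin> V" using disj by blast
          then show ?thesis using True permutes_not_in[OF p, of "\<rho> x"] by (simp add: perm_restrict_def)
        next
          case False
          then show ?thesis using permutes_not_in[OF \<rho>, of x] by (simp add: perm_restrict_def)
        qed
      qed
      ultimately show "(\<lambda>\<sigma>. (perm_restrict \<sigma> V, perm_restrict \<sigma> (\<Union>\<pi>))) ((\<lambda>(p, \<rho>). p \<circ> \<rho>) x) = x"
        by (simp add: x)
    qed
    have img: "\<sigma> ` (\<Union>\<pi>) = \<Union>\<pi>" if "\<forall>V\<in>\<pi>. \<sigma> ` V = V" for \<sigma> :: "'a \<Rightarrow> 'a"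
      using that by (simp add: image_Union)
    show "\<forall>\<sigma>\<in>?P (insert V \<pi>). (\<lambda>(p, \<rho>). p \<circ> \<rho>) (perm_restrict \<sigma> V, perm_restrict \<sigma> (\<Union>\<pi>)) = \<sigma>"
    proof
      fix \<sigma> assume "\<sigma> \<in> ?P (insert V \<pi>)"
      then have \<sigma>: "\<sigma> permutes (V \<union> \<Union>\<pi>)" "\<sigma> ` V = V" "\<forall>V\<in>\<pi>. \<sigma> ` V = V" by auto
      have "perm_restrict \<sigma> V (perm_restrict \<sigma> (\<Union>\<pi>) x) = \<sigma> x" for x
      proof (cases "x \<in> \<Union>\<pi>")
        case True
        then have "\<sigma> x \<in> \<Union>\<pi>" using img[OF \<sigma>(3)] by blast
        then have "\<sigma> x \<notin> V" using disj by blast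
        with True show ?thesis by (simp add: perm_restrict_def)
      next
        case False
        then show ?thesis using permutes_not_in[OF \<sigma>(1), of x] by (auto simp: perm_restrict_def)
      qed
      then show "(\<lambda>(p, \<rho>). p \<circ> \<rho>) (perm_restrict \<sigma> V, perm_restrict \<sigma> (\<Union>\<pi>)) = \<sigma>" by auto
    qed
    show "(\<lambda>(p, \<rho>). p \<circ> \<rho>) ` ({p. p permutes V} \<times> ?P \<pi>) \<subseteq> ?P (insert V \<pi>)"
    proof (rule image_subsetI)
      fix x assume "x \<in> {p. p permutes V} \<times> ?P \<pi>"
      then obtain p \<rho> where x: "x = (p, \<rho>)" and p: "p permutes V"
        and \<rho>: "\<rho> permutes (\<Union>\<pi>)" "\<forall>V\<in>\<pi>. \<rho> ` V = V"
        by auto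
      have "(p \<circ> \<rho>) permutes \<Union> (insert V \<pi>)"
        by (intro permutes_compose permutes_subset[OF \<rho>(1)] permutes_subset[OF p]) auto
      moreover have "(p \<circ> \<rho>) ` W = W" if W: "W \<in> insert V \<pi>" for W
      proof (cases "W = V")
        case True
        have "\<rho> ` V = id ` V"
        proof (rule image_cong[OF refl])
          fix y assume "y \<in> V"
          then have "y \<notin> \<Union>\<pi>" using disj by blast
          then show "\<rho> y = id y" using permutes_not_in[OF \<rho>(1)] by simp
        qed
        then show ?thesis using True permutes_image[OF p] by (simp only: image_comp[symmetric]) simp
      next
        case False
        then have "W \<in> \<pi>" using W by simp
        have "p ` W = id ` W"
        proof (rule image_cong[OF refl])
          fix y assume "y \<in> W"
          then have "y \<notin> V" using disj \<open>W \<in> \<pi>\<close> by blast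
          then show "p y = id y" using permutes_not_in[OF p] by simp
        qed
        then show ?thesis using \<rho>(2) \<open>W \<in> \<pi>\<close> by (simp only: image_comp[symmetric]) simp
      qed
      ultimately show "(\<lambda>(p, \<rho>). p \<circ> \<rho>) x \<in> ?P (insert V \<pi>)" by (simp add: x)
    qed
    show "(\<lambda>\<sigma>. (perm_restrict \<sigma> V, perm_restrict \<sigma> (\<Union>\<pi>))) ` ?P (insert V \<pi>) \<subseteq> {p. p permutes V} \<times> ?P \<pi>"
    proof (rule image_subsetI)
      fix \<sigma> assume "\<sigma> \<in> ?P (insert V \<pi>)"
      then have \<sigma>: "\<sigma> permutes (V \<union> \<Union>\<pi>)" "\<sigma> ` V = V" "\<forall>V\<in>\<pi>. \<sigma> ` V = V" by auto
      have bij: "bij_betw \<sigma> S S" if "\<sigma> ` S = S" for S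
        using that permutes_inj_on[OF \<sigma>(1)] by (simp add: bij_betw_def)
      have "perm_restrict \<sigma> S permutes S" if "\<sigma> ` S = S" for S
      proof (rule bij_imp_permutes)
        show "bij_betw (perm_restrict \<sigma> S) S S"
          using bij[OF that] bij_betw_cong[of S \<sigma> "perm_restrict \<sigma> S" S] by (simp add: perm_restrict_def)
      qed (simp add: perm_restrict_def)
      moreover have "perm_restrict \<sigma> (\<Union>\<pi>) ` W = \<sigma> ` W" if "W \<in> \<pi>" for W
        using that by (intro image_cong) (auto simp: perm_restrict_def)
      ultimately show "(perm_restrict \<sigma> V, perm_restrict \<sigma> (\<Union>\<pi>)) \<in> {p. p permutes V} \<times> ?P \<pi>"
        using \<sigma> img[OF \<sigma>(3)] by simp
    qed
  qed
  then have "card (?P (insert V \<pi>)) = card ({p. p permutes V} \<times> ?P \<pi>)"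
    by (rule bij_betw_same_card[symmetric])
  also have "\<dots> = fact (card V) * card (?P \<pi>)"
    using insert.prems(1) by (simp add: card_cartesian_product card_permutations)
  finally show ?case using insert.hyps card by simp
qed

lemma card_young_subgroup: "card (young_subgroup n (ker_partition n u)) = partition_fact (ker_partition n u)"
proof -
  let ?\<pi> = "ker_partition n u"
  have "\<Union>?\<pi> = (\<Union>i\<in>{1..n}. {j\<in>{1..n}. u j = u i})" unfolding ker_partition_def by blast
  also have "\<dots> = {1..n}" by auto
  finally have "\<Union>?\<pi> = {1..n}" .
  then have "young_subgroup n ?\<pi> = {\<sigma>. \<sigma> permutes (\<Union>?\<pi>) \<and> (\<forall>V\<in>?\<pi>. \<sigma> ` V = V)}"
    by (simp add: young_subgroup_def Sym_def)
  moreover have "finite ?\<pi>" by (simp add: ker_partition_def)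
  moreover have "finite V" if "V \<in> ?\<pi>" for V using that by (auto simp: ker_partition_def)
  moreover have "disjoint ?\<pi>" by (auto simp: disjoint_def ker_partition_def)
  ultimately show ?thesis using card_block_permutations[of ?\<pi>] by (simp add: partition_fact_def)
qed

lemma partition_fact_pos: "partition_fact \<pi> > 0"
  by (simp add: partition_fact_def prod_pos)

lemma mset_map_range: "mset (map v [1..<Suc n]) = image_mset v (mset_set {1..n})"
  by (simp only: mset_map mset_upt atLeastLessThanSuc_atLeastAtMost)

text \<open>Both tuples are the sorted list of the same multiset.\<close>

lemma increasing_tuple_unique:
  assumes u: "u \<in> increasing_tuples \<Xi> n" and w: "w \<in> increasing_tuples \<Xi> n"
    and \<rho>: "\<rho> \<in> Sym n" and eq: "w = u \<circ> \<rho>"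
  shows "u = w"
proof -
  have p: "\<rho> permutes {1..n}" using \<rho> by (simp add: Sym_def)
  have sorted: "sorted (map v [1..<Suc n])" if "v \<in> increasing_tuples \<Xi> n" for v
    using that unfolding increasing_tuples_def sorted_iff_nth_mono mono_on_def
    by (auto simp del: upt_Suc)
  have "mset (map w [1..<Suc n]) = image_mset u (image_mset \<rho> (mset_set {1..n}))"
    unfolding mset_map_range eq by (simp add: multiset.map_comp)
  also have "image_mset \<rho> (mset_set {1..n}) = mset_set {1..n}"
    using image_mset_mset_set[OF permutes_inj_on[OF p, of "{1..n}"]] permutes_image[OF p] by simp
  finally have "mset (map w [1..<Suc n]) = mset (map u [1..<Suc n])" unfolding mset_map_range .
  then have l: "map w [1..<Suc n] = map u [1..<Suc n]"
    using properties_for_sort[OF _ sorted[OF w]] sorted_sort_id[OF sorted[OF u]] by simp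
  have "u i = w i" if "i \<in> {1..n}" for i
    using l that by (auto simp del: upt_Suc)
  moreover have "u i = w i" if "i \<notin> {1..n}" for i
    using that u w by (auto simp: increasing_tuples_def PiE_def extensional_def)
  ultimately show ?thesis by (intro ext) blast
qed

lemma increasing_tuple_exists:
  assumes w: "w \<in> {1..n} \<rightarrow>\<^sub>E \<Xi>"
  obtains u \<sigma> where "u \<in> increasing_tuples \<Xi> n" "\<sigma> \<in> Sym n" "w = u \<circ> inv \<sigma>"
proof -
  define xs where "xs = sort (map w [1..<Suc n])"
  have len: "length xs = n" by (simp add: xs_def)
  define u where "u = (\<lambda>i\<in>{1..n}. xs ! (i - 1))"
  have "map u [1..<Suc n] = xs"
    by (rule nth_equalityI) (auto simp: len u_def simp del: upt_Suc)
  then have "image_mset u (mset_set {1..n}) = mset xs" using mset_map_range[of u n] by simp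
  also have "\<dots> = image_mset w (mset_set {1..n})"
    using mset_map_range[of w n] by (simp add: xs_def)
  finally have eq: "image_mset u (mset_set {1..n}) = image_mset w (mset_set {1..n})" .
  obtain p where p: "p permutes {1..n}" "\<forall>x\<in>{1..n}. u x = w (p x)"
    by (rule image_mset_eq_implies_permutes[OF finite_atLeastAtMost eq])
  have uw: "u = w \<circ> p"
  proof
    fix x show "u x = (w \<circ> p) x"
    proof (cases "x \<in> {1..n}")
      case True
      then show ?thesis using p(2) by simp
    next
      case False
      then have "u x = undefined" unfolding u_def by (simp only: restrict_apply if_False)
      then show ?thesis using permutes_not_in[OF p(1) False] PiE_arb[OF w False] by simp
    qed
  qed
  have "u \<in> increasing_tuples \<Xi> n"
    unfolding increasing_tuples_def
  proof (intro CollectI conjI)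
    have "w (p x) \<in> \<Xi>" if "x \<in> {1..n}" for x
      by (rule PiE_mem[OF w]) (use permutes_in_image[OF p(1), of x] that in blast)
    then have "u x \<in> \<Xi>" if "x \<in> {1..n}" for x using that by (simp add: uw)
    moreover have "u x = undefined" if "x \<notin> {1..n}" for x
      unfolding u_def restrict_apply if_not_P[OF that] ..
    ultimately show "u \<in> {1..n} \<rightarrow>\<^sub>E \<Xi>" by (rule PiE_I)
    show "mono_on {1..n} u"
    proof (rule mono_onI)
      fix r s assume "r \<in> {1..n}" "s \<in> {1..n}" "r \<le> s"
      then show "u r \<le> u s"
        using sorted_nth_mono[of xs "r - 1" "s - 1"] len by (auto simp: u_def xs_def)
    qed
  qed
  moreover have "p \<in> Sym n" using p(1) by (simp add: Sym_def)
  moreover have "w = u \<circ> inv p" using uw by (simp add: comp_assoc comp_inv_simps[OF permutes_bij[OF p(1)]])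
  ultimately show ?thesis using that by blast
qed


section \<open>Symmetric tensors\<close>

context tensors
begin

lemma T_scaleR: "F \<in> T n \<Longrightarrow> r *\<^sub>R F \<in> T n"
  using T_scale[of F n "complex_of_real r"] by (simp add: scaleC_of_real)

lemma alg_tensor_mem: "X \<in> alg_tensor \<tau> n \<Longrightarrow> X \<alpha> \<in> T n"
  by (cases "\<alpha> \<in> Sym0 n") (auto simp: alg_tensor_def)

lemma alg_tensor_outside: "X \<in> alg_tensor \<tau> n \<Longrightarrow> \<alpha> \<notin> Sym0 n \<Longrightarrow> X \<alpha> = 0"
  by (simp add: alg_tensor_def)

lemma alg_tensor_zero [simp]: "0 \<in> alg_tensor \<tau> n"
  and alg_tensor_add: "X \<in> alg_tensor \<tau> n \<Longrightarrow> Y \<in> alg_tensor \<tau> n \<Longrightarrow> X + Y \<in> alg_tensor \<tau> n"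
  and alg_tensor_diff: "X \<in> alg_tensor \<tau> n \<Longrightarrow> Y \<in> alg_tensor \<tau> n \<Longrightarrow> X - Y \<in> alg_tensor \<tau> n"
  by (auto simp: alg_tensor_def T_add T_diff)

lemma conj_Sym0_iff:
  assumes "\<sigma> \<in> Sym n" shows "inv \<sigma> \<circ> \<beta> \<circ> \<sigma> \<in> Sym0 n \<longleftrightarrow> \<beta> \<in> Sym0 n"
  using Sym0_comp_iff[OF Sym_subset_Sym0[OF assms]] Sym0_comp_iff[OF Sym0_inv[OF Sym_subset_Sym0[OF assms]]] by simp

text \<open>The fixed points of the action of \<open>S(n)\<close> that conjugates the permutations and permutes the tensor
  factors; \<open>symmetrize\<close> averages over this action and hence projects onto them.\<close>

definition symmetric :: "nat \<Rightarrow> (perm \<Rightarrow> 't) \<Rightarrow> bool" where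
  "symmetric n X \<longleftrightarrow> (\<forall>\<sigma>\<in>Sym n. \<forall>\<beta>\<in>Sym0 n. U n \<sigma> (X (inv \<sigma> \<circ> \<beta> \<circ> \<sigma>)) = X \<beta>)"

lemma symmetrize_alg_tensor:
  assumes X: "X \<in> alg_tensor \<tau> n" shows "symmetrize \<tau> n X \<in> alg_tensor \<tau> n"
proof -
  have "symmetrize \<tau> n X \<beta> \<in> T n" for \<beta>
    unfolding symmetrize_def by (intro T_scaleR T_sum U_closed)
  moreover have "symmetrize \<tau> n X \<beta> = 0" if "\<beta> \<notin> Sym0 n" for \<beta>
  proof -
    have "U n \<sigma> (X (inv \<sigma> \<circ> \<beta> \<circ> \<sigma>)) = 0" if "\<sigma> \<in> Sym n" for \<sigma>
      using alg_tensor_outside[OF X] conj_Sym0_iff[OF that] \<open>\<beta> \<notin> Sym0 n\<close> U_zero[OF that] by metis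
    then show ?thesis unfolding symmetrize_def by simp
  qed
  ultimately show ?thesis by (simp add: alg_tensor_def)
qed

lemma U_scaleR: "\<sigma> \<in> Sym n \<Longrightarrow> F \<in> T n \<Longrightarrow> U n \<sigma> (r *\<^sub>R F) = r *\<^sub>R U n \<sigma> F"
  using U_scale[of \<sigma> n F "complex_of_real r"] by (simp add: scaleC_of_real)

lemma symmetrize_symmetric:
  assumes X: "X \<in> alg_tensor \<tau> n" shows "symmetric n (symmetrize \<tau> n X)"
  unfolding symmetric_def
proof (intro ballI)
  fix \<rho> \<beta> assume \<rho>: "\<rho> \<in> Sym n" and "\<beta> \<in> Sym0 n"
  note b = bij_Sym[OF \<rho>]
  let ?f = "\<lambda>\<sigma>. U n \<sigma> (X (inv \<sigma> \<circ> \<beta> \<circ> \<sigma>))"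
  have "U n \<rho> (symmetrize \<tau> n X (inv \<rho> \<circ> \<beta> \<circ> \<rho>)) =
      (1 / fact n) *\<^sub>R (\<Sum>\<sigma>\<in>Sym n. U n \<rho> (U n \<sigma> (X (inv \<sigma> \<circ> (inv \<rho> \<circ> \<beta> \<circ> \<rho>) \<circ> \<sigma>))))"
    unfolding symmetrize_def by (simp add: U_scaleR[OF \<rho>] U_sum[OF \<rho>] T_sum U_closed)
  also have "(\<Sum>\<sigma>\<in>Sym n. U n \<rho> (U n \<sigma> (X (inv \<sigma> \<circ> (inv \<rho> \<circ> \<beta> \<circ> \<rho>) \<circ> \<sigma>)))) = (\<Sum>\<sigma>\<in>Sym n. ?f (\<rho> \<circ> \<sigma>))"
  proof (rule sum.cong[OF refl])
    fix \<sigma> assume s: "\<sigma> \<in> Sym n"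
    have "inv \<sigma> \<circ> (inv \<rho> \<circ> \<beta> \<circ> \<rho>) \<circ> \<sigma> = inv (\<rho> \<circ> \<sigma>) \<circ> \<beta> \<circ> (\<rho> \<circ> \<sigma>)"
      by (simp add: o_inv_distrib[OF b bij_Sym[OF s]] comp_assoc)
    then show "U n \<rho> (U n \<sigma> (X (inv \<sigma> \<circ> (inv \<rho> \<circ> \<beta> \<circ> \<rho>) \<circ> \<sigma>))) = ?f (\<rho> \<circ> \<sigma>)"
      by (simp add: U_comp[OF \<rho> s alg_tensor_mem[OF X]])
  qed
  also have "\<dots> = (\<Sum>\<sigma>\<in>Sym n. ?f \<sigma>)" by (rule sum_Sym_left[OF \<rho>])
  finally show "U n \<rho> (symmetrize \<tau> n X (inv \<rho> \<circ> \<beta> \<circ> \<rho>)) = symmetrize \<tau> n X \<beta>"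
    unfolding symmetrize_def .
qed

lemma symmetrize_eq_self:
  assumes X: "X \<in> alg_tensor \<tau> n" "symmetric n X" shows "symmetrize \<tau> n X = X"
proof
  fix \<beta> show "symmetrize \<tau> n X \<beta> = X \<beta>"
  proof (cases "\<beta> \<in> Sym0 n")
    case True
    then have "(\<Sum>\<sigma>\<in>Sym n. U n \<sigma> (X (inv \<sigma> \<circ> \<beta> \<circ> \<sigma>))) = (\<Sum>\<sigma>\<in>Sym n. X \<beta>)"
      using X(2) by (intro sum.cong) (auto simp: symmetric_def)
    also have "\<dots> = fact n *\<^sub>R X \<beta>" by (simp add: card_Sym sum_constant_scaleR)
    finally show ?thesis by (simp add: symmetrize_def)
  next
    case False
    then show ?thesis using alg_tensor_outside[OF X(1)] alg_tensor_outside[OF symmetrize_alg_tensor[OF X(1)]] by simp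
  qed
qed

lemma sym_tensor_iff: "X \<in> sym_tensor \<tau> n \<longleftrightarrow> X \<in> alg_tensor \<tau> n \<and> symmetric n X"
  using symmetrize_alg_tensor symmetrize_symmetric symmetrize_eq_self
  unfolding sym_tensor_def by (metis image_iff)

lemma sym_tensor_zero [simp]: "0 \<in> sym_tensor \<tau> n"
  by (simp add: sym_tensor_iff symmetric_def U_zero)

lemma sym_tensor_add: "X \<in> sym_tensor \<tau> n \<Longrightarrow> Y \<in> sym_tensor \<tau> n \<Longrightarrow> X + Y \<in> sym_tensor \<tau> n"
  and sym_tensor_diff: "X \<in> sym_tensor \<tau> n \<Longrightarrow> Y \<in> sym_tensor \<tau> n \<Longrightarrow> X - Y \<in> sym_tensor \<tau> n"
  by (simp_all add: sym_tensor_iff symmetric_def alg_tensor_add alg_tensor_diff U_add U_diff alg_tensor_mem)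

lemma sym_tensor_sum: "(\<And>i. i \<in> A \<Longrightarrow> f i \<in> sym_tensor \<tau> n) \<Longrightarrow> sum f A \<in> sym_tensor \<tau> n"
  by (induction A rule: infinite_finite_induct) (simp_all add: sym_tensor_add)

lemma sym_tensor_conj:
  assumes "X \<in> sym_tensor \<tau> n" "\<sigma> \<in> Sym n" "\<alpha> \<in> Sym0 n"
  shows "U n \<sigma> (X \<alpha>) = X (\<sigma> \<circ> \<alpha> \<circ> inv \<sigma>)"
proof -
  note b = bij_Sym[OF assms(2)] and s = Sym_subset_Sym0[OF assms(2)]
  have "\<sigma> \<circ> \<alpha> \<circ> inv \<sigma> \<in> Sym0 n" by (intro Sym0_comp Sym0_inv s assms(3))
  then have "U n \<sigma> (X (inv \<sigma> \<circ> (\<sigma> \<circ> \<alpha> \<circ> inv \<sigma>) \<circ> \<sigma>)) = X (\<sigma> \<circ> \<alpha> \<circ> inv \<sigma>)"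
    using assms(1,2) by (simp add: sym_tensor_iff symmetric_def)
  moreover have "inv \<sigma> \<circ> (\<sigma> \<circ> \<alpha> \<circ> inv \<sigma>) \<circ> \<sigma> = \<alpha>" by (simp add: comp_assoc comp_inv_simps[OF b])
  ultimately show ?thesis by simp
qed

lemma stensor_sym_tensor:
  assumes "\<eta> \<in> group_algebra n" "F \<in> T n" shows "stensor \<tau> n \<eta> F \<in> sym_tensor \<tau> n"
proof -
  have "(\<lambda>\<alpha>. \<eta> \<alpha> *\<^sub>C F) \<in> alg_tensor \<tau> n"
    using assms by (simp add: alg_tensor_def group_algebra_def T_scale)
  then show ?thesis unfolding stensor_def sym_tensor_def by blast
qed

lemma stensor_apply:
  assumes "F \<in> T n"
  shows "stensor \<tau> n \<eta> F \<beta> = (1 / fact n) *\<^sub>R (\<Sum>\<sigma>\<in>Sym n. \<eta> (inv \<sigma> \<circ> \<beta> \<circ> \<sigma>) *\<^sub>C U n \<sigma> F)"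
  unfolding stensor_def symmetrize_def by (simp add: U_scale assms)

lemma alg_tensor_norm_eq: "alg_tensor_norm n X = L2_set (\<lambda>\<alpha>. norm (X \<alpha>)) (Sym0 n)"
  by (simp add: alg_tensor_norm_def L2_set_def)

lemma norm_le_alg_tensor_norm: "\<alpha> \<in> Sym0 n \<Longrightarrow> norm (X \<alpha>) \<le> alg_tensor_norm n X"
  unfolding alg_tensor_norm_eq by (rule member_le_L2_set) auto

lemma alg_tensor_norm_le: "alg_tensor_norm n X \<le> (\<Sum>\<alpha>\<in>Sym0 n. norm (X \<alpha>))"
  unfolding alg_tensor_norm_eq by (rule L2_set_le_sum) auto

text \<open>Symmetry consists of equations between isometric images of coefficients, which survive limits.\<close>

lemma sym_tensor_closed:
  assumes X: "X \<in> alg_tensor \<tau> n"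
    and approx: "\<And>\<epsilon>. \<epsilon> > 0 \<Longrightarrow> \<exists>Y\<in>sym_tensor \<tau> n. alg_tensor_norm n (X - Y) < \<epsilon>"
  shows "X \<in> sym_tensor \<tau> n"
  unfolding sym_tensor_iff symmetric_def
proof (intro conjI X ballI)
  fix \<sigma> \<beta> assume \<sigma>: "\<sigma> \<in> Sym n" and \<beta>: "\<beta> \<in> Sym0 n"
  let ?\<gamma> = "inv \<sigma> \<circ> \<beta> \<circ> \<sigma>"
  have \<gamma>: "?\<gamma> \<in> Sym0 n" using conj_Sym0_iff[OF \<sigma>] \<beta> by simp
  have small: "norm (U n \<sigma> (X ?\<gamma>) - X \<beta>) < \<epsilon>" if e: "\<epsilon> > 0" for \<epsilon>
  proof -
    obtain Y where Y: "Y \<in> sym_tensor \<tau> n" "alg_tensor_norm n (X - Y) < \<epsilon> / 2"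
      using approx[of "\<epsilon> / 2"] e by auto
    have YT: "Y \<alpha> \<in> T n" for \<alpha> using Y(1) alg_tensor_mem by (simp add: sym_tensor_iff)
    have 1: "norm (X \<alpha> - Y \<alpha>) < \<epsilon> / 2" if "\<alpha> \<in> Sym0 n" for \<alpha>
      using norm_le_alg_tensor_norm[OF that, of "X - Y"] Y(2) by simp
    have "U n \<sigma> (X ?\<gamma>) - X \<beta> = U n \<sigma> (X ?\<gamma> - Y ?\<gamma>) - (X \<beta> - Y \<beta>)"
      using Y(1) \<sigma> \<beta> by (simp add: U_diff[OF \<sigma>] YT alg_tensor_mem[OF X] sym_tensor_iff symmetric_def)
    then have "norm (U n \<sigma> (X ?\<gamma>) - X \<beta>) = norm (U n \<sigma> (X ?\<gamma> - Y ?\<gamma>) - (X \<beta> - Y \<beta>))"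
      by (rule arg_cong)
    also have "\<dots> \<le> norm (U n \<sigma> (X ?\<gamma> - Y ?\<gamma>)) + norm (X \<beta> - Y \<beta>)" by (rule norm_triangle_ineq4)
    also have "norm (U n \<sigma> (X ?\<gamma> - Y ?\<gamma>)) = norm (X ?\<gamma> - Y ?\<gamma>)"
      by (rule norm_U[OF \<sigma> T_diff[OF alg_tensor_mem[OF X] YT]])
    finally have "norm (U n \<sigma> (X ?\<gamma>) - X \<beta>) \<le> norm (X ?\<gamma> - Y ?\<gamma>) + norm (X \<beta> - Y \<beta>)" .
    then show ?thesis using 1[OF \<gamma>] 1[OF \<beta>] by linarith
  qed
  show "U n \<sigma> (X ?\<gamma>) = X \<beta>"
    using small[of "norm (U n \<sigma> (X ?\<gamma>) - X \<beta>)"] by force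
qed

end


section \<open>Coordinates and the decomposition of symmetric tensors\<close>

lemma centralizer_conj:
  assumes "\<eta> \<in> centralizer n \<pi>" "\<sigma> \<in> young_subgroup n \<pi>"
  shows "\<eta> (inv \<sigma> \<circ> \<beta> \<circ> \<sigma>) = \<eta> \<beta>"
proof -
  have \<sigma>: "\<sigma> \<in> Sym0 n" using assms(2) Sym_subset_Sym0 by (simp add: young_subgroup_def)
  have \<eta>: "\<eta> \<in> group_algebra n" using assms(1) by (simp add: centralizer_def)
  have "gmult n (single \<sigma>) \<eta> = gmult n \<eta> (single \<sigma>)" using assms by (simp add: centralizer_def)
  then have "gmult n (single \<sigma>) \<eta> (\<beta> \<circ> \<sigma>) = gmult n \<eta> (single \<sigma>) (\<beta> \<circ> \<sigma>)" by simp
  then show ?thesis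
    by (simp only: gmult_single_left[OF \<sigma>] gmult_single_right[OF \<sigma> \<eta>] comp_assoc
        comp_inv_simps[OF bij_Sym0[OF \<sigma>]] comp_id)
qed

lemma centralizerI:
  assumes \<eta>: "\<eta> \<in> group_algebra n"
    and conj: "\<And>\<sigma> \<beta>. \<sigma> \<in> young_subgroup n \<pi> \<Longrightarrow> \<beta> \<in> Sym0 n \<Longrightarrow> \<eta> (inv \<sigma> \<circ> \<beta> \<circ> \<sigma>) = \<eta> \<beta>"
  shows "\<eta> \<in> centralizer n \<pi>"
  unfolding centralizer_def
proof (intro CollectI conjI \<eta> ballI ext)
  fix \<sigma> \<gamma> assume s: "\<sigma> \<in> young_subgroup n \<pi>"
  then have \<sigma>: "\<sigma> \<in> Sym0 n" using Sym_subset_Sym0 by (simp add: young_subgroup_def)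
  note b = bij_Sym0[OF \<sigma>]
  have "\<eta> (inv \<sigma> \<circ> \<gamma>) = \<eta> (\<gamma> \<circ> inv \<sigma>)"
  proof (cases "\<gamma> \<in> Sym0 n")
    case True
    have "\<gamma> \<circ> inv \<sigma> \<in> Sym0 n" by (intro Sym0_comp Sym0_inv \<sigma> True)
    then have "\<eta> (inv \<sigma> \<circ> (\<gamma> \<circ> inv \<sigma>) \<circ> \<sigma>) = \<eta> (\<gamma> \<circ> inv \<sigma>)" by (rule conj[OF s])
    then show ?thesis by (simp only: comp_assoc comp_inv_simps[OF b] comp_id)
  next
    case False
    then show ?thesis using \<eta> Sym0_comp_iff[OF Sym0_inv[OF \<sigma>]] by (simp add: group_algebra_def)
  qed
  then show "gmult n (single \<sigma>) \<eta> \<gamma> = gmult n \<eta> (single \<sigma>) \<gamma>"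
    by (simp only: gmult_single_left[OF \<sigma>] gmult_single_right[OF \<sigma> \<eta>])
qed

lemma centralizer_subspace: "fvs.subspace (centralizer n \<pi>)"
proof (rule fvs.subspaceI)
  show "0 \<in> centralizer n \<pi>" by (rule centralizerI) simp_all
next
  fix a b assume "a \<in> centralizer n \<pi>" "b \<in> centralizer n \<pi>"
  then show "a + b \<in> centralizer n \<pi>"
    by (intro centralizerI) (simp_all add: centralizer_conj group_algebra_add centralizer_def[THEN eqset_imp_iff])
next
  fix c a assume "a \<in> centralizer n \<pi>"
  then show "fscale c a \<in> centralizer n \<pi>"
    by (intro centralizerI) (simp_all add: centralizer_conj group_algebra_scale centralizer_def[THEN eqset_imp_iff])
qed

lemma centralizer_group_algebra: "\<eta> \<in> centralizer n \<pi> \<Longrightarrow> \<eta> \<in> group_algebra n"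
  by (simp add: centralizer_def)

locale chaos = tensors \<tau>
  for \<tau> :: "nat \<Rightarrow> (nat \<Rightarrow> 'a::complex_hilbert_space) \<Rightarrow> 't::complex_hilbert_space" +
  fixes \<Xi> :: "nat set" and \<xi> :: "nat \<Rightarrow> 'a"
  assumes basis: "orthonormal_basis \<Xi> \<xi>"
begin

abbreviation "tuples n \<equiv> {1..n} \<rightarrow>\<^sub>E \<Xi>"
abbreviation "inc \<equiv> increasing_tuples \<Xi>"
abbreviation "e \<equiv> basis_tensor \<tau> \<xi>"
abbreviation "Yng n u \<equiv> young_subgroup n (ker_partition n u)"
abbreviation "ymult n u \<equiv> partition_fact (ker_partition n u)"

lemma inc_tuples: "u \<in> inc n \<Longrightarrow> u \<in> tuples n"
  by (simp add: increasing_tuples_def)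

lemma e_mem [simp]: "e n u \<in> T n"
  by (simp add: basis_tensor_def tensor_mem)

lemma cinner_e:
  assumes u: "u \<in> tuples n" and w: "w \<in> tuples n"
  shows "cinner (e n u) (e n w) = of_bool (u = w)"
proof -
  have "cinner (e n u) (e n w) = (\<Prod>i=1..n. of_bool (u i = w i))"
    unfolding basis_tensor_def cinner_tensor
    using basis PiE_mem[OF u] PiE_mem[OF w] by (intro prod.cong refl) (simp add: orthonormal_basis_def)
  also have "\<dots> = of_bool (u = w)"
  proof (cases "u = w")
    case False
    then obtain i where "i \<in> {1..n}" "u i \<noteq> w i" using PiE_ext[OF u w] by blast
    then have "(\<Prod>i=1..n. of_bool (u i = w i) :: complex) = 0"
      by (intro prod_zero) (auto intro: bexI[of _ i])
    then show ?thesis using False by simp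
  qed simp
  finally show ?thesis .
qed

lemma U_e: "\<sigma> \<in> Sym n \<Longrightarrow> U n \<sigma> (e n u) = e n (u \<circ> inv \<sigma>)"
  by (simp add: basis_tensor_def U_tensor)

lemma tuples_comp:
  assumes u: "u \<in> tuples n" and "\<sigma> \<in> Sym n" shows "u \<circ> \<sigma> \<in> tuples n"
proof (rule PiE_I)
  have p: "\<sigma> permutes {1..n}" using assms(2) by (simp add: Sym_def)
  fix i
  show "i \<in> {1..n} \<Longrightarrow> (u \<circ> \<sigma>) i \<in> \<Xi>" using PiE_mem[OF u, of "\<sigma> i"] permutes_in_image[OF p, of i] by simp
  show "i \<notin> {1..n} \<Longrightarrow> (u \<circ> \<sigma>) i = undefined"
    using PiE_arb[OF u, of i] permutes_not_in[OF p, of i] by simp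
qed

lemma tensor_slot:
  assumes i: "i \<in> {1..n}" shows "bounded_linear (\<lambda>x. \<tau> n (h(i := x)))"
    and "\<tau> n (h(i := c *\<^sub>C x)) = c *\<^sub>C \<tau> n (h(i := x))"
proof -
  interpret L: Vector_Spaces.linear scaleC scaleC "\<lambda>x. \<tau> n (h(i := x))" by (rule tensor_linear[OF i])
  show "\<tau> n (h(i := c *\<^sub>C x)) = c *\<^sub>C \<tau> n (h(i := x))" by (rule L.scale)
  show "bounded_linear (\<lambda>x. \<tau> n (h(i := x)))"
  proof (rule bounded_linear_intro)
    show "\<tau> n (h(i := x + y)) = \<tau> n (h(i := x)) + \<tau> n (h(i := y))" for x y by (rule L.add)
    show "\<tau> n (h(i := r *\<^sub>R x)) = r *\<^sub>R \<tau> n (h(i := x))" for r x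
      unfolding scaleC_of_real[symmetric] by (rule L.scale)
    show "norm (\<tau> n (h(i := x))) \<le> norm x * (\<Prod>j\<in>{1..n} - {i}. norm (h j))" for x
    proof -
      have "norm (\<tau> n (h(i := x))) = norm ((h(i := x)) i) * (\<Prod>j\<in>{1..n} - {i}. norm ((h(i := x)) j))"
        unfolding norm_tensor using i by (intro prod.remove) auto
      also have "(\<Prod>j\<in>{1..n} - {i}. norm ((h(i := x)) j)) = (\<Prod>j\<in>{1..n} - {i}. norm (h j))"
        by (intro prod.cong) auto
      finally show ?thesis by (simp only: fun_upd_same order_refl)
    qed
  qed
qed

text \<open>Every slot of an elementary tensor can be expanded in the basis, one slot at a time.\<close>

lemma T_eq: "T n = closure (cspan (e n ` tuples n))"
proof
  let ?V = "closure (cspan (e n ` tuples n))"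
  have subV: "chs.subspace ?V" by (intro csubspace_closure chs.subspace_span)
  have step: "\<tau> n h \<in> ?V" if "k \<le> n" "\<And>i. i \<in> {k+1..n} \<Longrightarrow> h i \<in> \<xi> ` \<Xi>" for k h
    using that
  proof (induction k arbitrary: h)
    case 0
    have "\<exists>j. j \<in> \<Xi> \<and> h i = \<xi> j" if "i \<in> {1..n}" for i
    proof -
      have "h i \<in> \<xi> ` \<Xi>" by (rule "0.prems"(2)) (use that in simp)
      then show ?thesis by blast
    qed
    then obtain v where v: "\<And>i. i \<in> {1..n} \<Longrightarrow> v i \<in> \<Xi> \<and> h i = \<xi> (v i)" by metis
    have "restrict v {1..n} \<in> tuples n" using v by auto
    moreover have "\<tau> n h = e n (restrict v {1..n})"
      unfolding basis_tensor_def using v by (intro tensor_cong) simp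
    ultimately have "\<tau> n h \<in> e n ` tuples n" by blast
    then show ?case by (intro subsetD[OF closure_subset] chs.span_base)
  next
    case (Suc k)
    let ?L = "\<lambda>x. \<tau> n (h(Suc k := x))"
    have i: "Suc k \<in> {1..n}" using Suc.prems(1) by simp
    note bl = tensor_slot(1)[OF i, of h]
    have "UNIV = closure (cspan (\<xi> ` \<Xi>))" using basis by (simp add: orthonormal_basis_def)
    also have "\<dots> \<subseteq> ?L -` ?V"
    proof (rule closure_cspan_subset)
      show "\<xi> ` \<Xi> \<subseteq> ?L -` ?V"
      proof (rule image_subsetI)
        fix j assume "j \<in> \<Xi>"
        then have "\<tau> n (h(Suc k := \<xi> j)) \<in> ?V" using Suc.prems by (intro Suc.IH) auto
        then show "\<xi> j \<in> ?L -` ?V" by simp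
      qed
      show "chs.subspace (?L -` ?V)"
      proof (rule chs.subspaceI)
        show "0 \<in> ?L -` ?V" using linear_0[OF bounded_linear.linear[OF bl]] chs.subspace_0[OF subV] by simp
        show "x + y \<in> ?L -` ?V" if "x \<in> ?L -` ?V" "y \<in> ?L -` ?V" for x y
          using that linear_add[OF bounded_linear.linear[OF bl]] chs.subspace_add[OF subV] by simp
        show "c *\<^sub>C x \<in> ?L -` ?V" if "x \<in> ?L -` ?V" for c x
          using that tensor_slot(2)[OF i] chs.subspace_scale[OF subV] by simp
      qed
      show "closed (?L -` ?V)"
        by (intro continuous_closed_vimage closed_closure) (rule linear_continuous_at[OF bl])
    qed
    finally have "h (Suc k) \<in> ?L -` ?V" by blast
    then show ?case by simp
  qed
  show "T n \<subseteq> ?V"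
    unfolding tensor_power_def
    by (intro closure_cspan_subset subV closed_closure) (use step[of n] in auto)
  show "?V \<subseteq> T n"
    by (intro closure_cspan_subset subspace_T closed_T) auto
qed

text \<open>The Fourier coefficients at a basis tensor, one for each permutation, collected into an element of
  the group algebra.\<close>

definition coord :: "nat \<Rightarrow> (perm \<Rightarrow> 't) \<Rightarrow> (nat \<Rightarrow> nat) \<Rightarrow> galg" where
  "coord n X u = (\<lambda>\<alpha>. cinner (X \<alpha>) (e n u))"

lemma coord_add: "coord n (A + B) u = coord n A u + coord n B u"
  and coord_diff: "coord n (A - B) u = coord n A u - coord n B u"
  and coord_zero: "coord n 0 u = 0"
  by (simp_all add: coord_def fun_eq_iff cinner_add_left cinner_diff_left)

lemma coord_sum: "coord n (sum f A) u = (\<Sum>i\<in>A. coord n (f i) u)"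
  by (induction A rule: infinite_finite_induct) (simp_all only: sum.infinite sum.empty sum.insert coord_add coord_zero not_False_eq_True)

lemma coord_group_algebra: "X \<in> alg_tensor \<tau> n \<Longrightarrow> coord n X u \<in> group_algebra n"
  by (simp add: coord_def group_algebra_def alg_tensor_outside)

lemma sym_alg: "X \<in> sym_tensor \<tau> n \<Longrightarrow> X \<in> alg_tensor \<tau> n"
  by (simp add: sym_tensor_iff)

lemma sym_T: "X \<in> sym_tensor \<tau> n \<Longrightarrow> X \<alpha> \<in> T n"
  by (rule alg_tensor_mem[OF sym_alg])

lemma coord_conj:
  assumes "X \<in> sym_tensor \<tau> n" "\<sigma> \<in> Sym n" "\<alpha> \<in> Sym0 n"
  shows "coord n X (u \<circ> inv \<sigma>) (\<sigma> \<circ> \<alpha> \<circ> inv \<sigma>) = coord n X u \<alpha>"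
proof -
  have "coord n X (u \<circ> inv \<sigma>) (\<sigma> \<circ> \<alpha> \<circ> inv \<sigma>) = cinner (U n \<sigma> (X \<alpha>)) (U n \<sigma> (e n u))"
    by (simp only: coord_def sym_tensor_conj[OF assms] U_e[OF assms(2)])
  then show ?thesis using cinner_U[OF assms(2) sym_T[OF assms(1)] e_mem] by (simp add: coord_def)
qed

lemma young_iff:
  assumes u: "u \<in> tuples n"
  shows "\<sigma> \<in> Yng n u \<longleftrightarrow> \<sigma> \<in> Sym n \<and> u \<circ> inv \<sigma> = u"
proof -
  have "(\<forall>i\<in>{1..n}. u (\<sigma> i) = u i) \<longleftrightarrow> u \<circ> inv \<sigma> = u" if \<sigma>: "\<sigma> \<in> Sym n"
  proof
    assume *: "\<forall>i\<in>{1..n}. u (\<sigma> i) = u i"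
    have "u \<circ> \<sigma> = u"
      by (rule PiE_ext[OF tuples_comp[OF u \<sigma>] u]) (use * in simp)
    then have "u \<circ> \<sigma> \<circ> inv \<sigma> = u \<circ> inv \<sigma>" by simp
    then show "u \<circ> inv \<sigma> = u" by (simp add: comp_assoc comp_inv_simps[OF bij_Sym[OF \<sigma>]])
  next
    assume "u \<circ> inv \<sigma> = u"
    then have "u \<circ> inv \<sigma> \<circ> \<sigma> = u \<circ> \<sigma>" by simp
    then have "u \<circ> \<sigma> = u" by (simp add: comp_assoc comp_inv_simps[OF bij_Sym[OF \<sigma>]])
    then show "\<forall>i\<in>{1..n}. u (\<sigma> i) = u i" by (metis comp_apply)
  qed
  then show ?thesis by (auto simp: young_subgroup_iff)
qed

text \<open>A permutation that fixes the tuple \<open>u\<close> fixes its basis tensor, and then symmetry of \<open>X\<close> says that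
  conjugation by it fixes the coordinate at \<open>u\<close>.\<close>

lemma coord_centralizer:
  assumes "X \<in> sym_tensor \<tau> n" "u \<in> tuples n"
  shows "coord n X u \<in> centralizer n (ker_partition n u)"
proof (rule centralizerI[OF coord_group_algebra[OF sym_alg[OF assms(1)]]])
  fix \<sigma> \<beta> assume s: "\<sigma> \<in> Yng n u" and \<beta>: "\<beta> \<in> Sym0 n"
  then have \<sigma>: "\<sigma> \<in> Sym n" "u \<circ> inv \<sigma> = u" using young_iff[OF assms(2)] by auto
  have "inv \<sigma> \<circ> \<beta> \<circ> \<sigma> \<in> Sym0 n" using conj_Sym0_iff[OF \<sigma>(1)] \<beta> by simp
  from coord_conj[OF assms(1) \<sigma>(1) this, of u]
  show "coord n X u (inv \<sigma> \<circ> \<beta> \<circ> \<sigma>) = coord n X u \<beta>"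
    by (simp only: \<sigma>(2) comp_assoc comp_inv_simps[OF bij_Sym[OF \<sigma>(1)]] comp_id)
qed

definition orb :: "nat \<Rightarrow> (nat \<Rightarrow> nat) \<Rightarrow> (nat \<Rightarrow> nat) set" where
  "orb n u = (\<lambda>\<sigma>. u \<circ> inv \<sigma>) ` Sym n"

lemma orb_tuples: "u \<in> tuples n \<Longrightarrow> orb n u \<subseteq> tuples n"
  unfolding orb_def by (rule image_subsetI) (rule tuples_comp[OF _ Sym_inv])

lemma finite_orb [simp]: "finite (orb n u)"
  by (simp add: orb_def)

lemma card_orb_fiber:
  assumes u: "u \<in> tuples n" and w: "w \<in> orb n u"
  shows "card {\<sigma>\<in>Sym n. u \<circ> inv \<sigma> = w} = ymult n u"
proof -
  obtain \<rho> where \<rho>: "\<rho> \<in> Sym n" "w = u \<circ> inv \<rho>" using w by (auto simp: orb_def)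
  note b = bij_Sym[OF \<rho>(1)]
  have eq: "u \<circ> inv (\<rho> \<circ> \<sigma>) = w \<longleftrightarrow> u \<circ> inv \<sigma> = u" if \<sigma>: "\<sigma> \<in> Sym n" for \<sigma>
  proof -
    have i: "inv (\<rho> \<circ> \<sigma>) = inv \<sigma> \<circ> inv \<rho>" by (rule o_inv_distrib[OF b bij_Sym[OF \<sigma>]])
    show ?thesis
    proof
      assume "u \<circ> inv (\<rho> \<circ> \<sigma>) = w"
      then have "u \<circ> inv \<sigma> \<circ> inv \<rho> \<circ> \<rho> = u \<circ> inv \<rho> \<circ> \<rho>" by (simp add: i \<rho>(2) comp_assoc)
      then show "u \<circ> inv \<sigma> = u" by (simp add: comp_assoc comp_inv_simps[OF b])
    next
      assume "u \<circ> inv \<sigma> = u"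
      then have "u \<circ> inv \<sigma> \<circ> inv \<rho> = u \<circ> inv \<rho>" by simp
      then show "u \<circ> inv (\<rho> \<circ> \<sigma>) = w" by (simp add: i \<rho>(2) comp_assoc)
    qed
  qed
  have "bij_betw (\<lambda>\<sigma>. \<rho> \<circ> \<sigma>) (Yng n u) {\<sigma>\<in>Sym n. u \<circ> inv \<sigma> = w}"
  proof (rule bij_betw_byWitness[where f' = "\<lambda>\<sigma>. inv \<rho> \<circ> \<sigma>"])
    show "(\<lambda>\<sigma>. \<rho> \<circ> \<sigma>) ` Yng n u \<subseteq> {\<sigma>\<in>Sym n. u \<circ> inv \<sigma> = w}"
    proof (rule image_subsetI)
      fix \<sigma> assume "\<sigma> \<in> Yng n u"
      then have "\<sigma> \<in> Sym n" "u \<circ> inv \<sigma> = u" using young_iff[OF u] by auto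
      then show "\<rho> \<circ> \<sigma> \<in> {\<sigma>\<in>Sym n. u \<circ> inv \<sigma> = w}" using eq Sym_comp[OF \<rho>(1)] by simp
    qed
    show "(\<lambda>\<sigma>. inv \<rho> \<circ> \<sigma>) ` {\<sigma>\<in>Sym n. u \<circ> inv \<sigma> = w} \<subseteq> Yng n u"
    proof (rule image_subsetI)
      fix \<sigma> assume \<sigma>: "\<sigma> \<in> {\<sigma>\<in>Sym n. u \<circ> inv \<sigma> = w}"
      have s: "inv \<rho> \<circ> \<sigma> \<in> Sym n" using \<sigma> by (intro Sym_comp Sym_inv \<rho>(1)) simp
      have "\<rho> \<circ> (inv \<rho> \<circ> \<sigma>) = \<sigma>" by (rule comp_inv_simps(4)[OF b])
      then show "inv \<rho> \<circ> \<sigma> \<in> Yng n u" using eq[OF s] \<sigma> s young_iff[OF u] by simp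
    qed
  qed (simp_all add: comp_inv_simps[OF b])
  from bij_betw_same_card[OF this] show ?thesis using card_young_subgroup[of n u] by simp
qed

lemma stensor_e:
  "stensor \<tau> n \<eta> (e n u) \<beta> =
    complex_of_real (1 / fact n) *\<^sub>C (\<Sum>\<sigma>\<in>Sym n. \<eta> (inv \<sigma> \<circ> \<beta> \<circ> \<sigma>) *\<^sub>C e n (u \<circ> inv \<sigma>))"
  unfolding stensor_apply[OF e_mem] scaleC_of_real by (simp add: U_e)

lemma coord_stensor_self:
  assumes u: "u \<in> tuples n" and \<eta>: "\<eta> \<in> centralizer n (ker_partition n u)"
  shows "coord n (stensor \<tau> n \<eta> (e n u)) u = fscale (of_nat (ymult n u) / fact n) \<eta>"
proof
  fix \<beta>
  have "(\<Sum>\<sigma>\<in>Sym n. \<eta> (inv \<sigma> \<circ> \<beta> \<circ> \<sigma>) * cinner (e n (u \<circ> inv \<sigma>)) (e n u)) =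
      (\<Sum>\<sigma>\<in>Sym n. if \<sigma> \<in> Yng n u then \<eta> \<beta> else 0)"
    using young_iff[OF u] cinner_e[OF tuples_comp[OF u Sym_inv] u] centralizer_conj[OF \<eta>]
    by (intro sum.cong refl) simp
  also have "\<dots> = (\<Sum>\<sigma>\<in>Yng n u. \<eta> \<beta>)"
    by (rule sum.mono_neutral_cong_right) (auto simp: young_subgroup_def)
  also have "\<dots> = of_nat (ymult n u) * \<eta> \<beta>" by (simp add: card_young_subgroup)
  finally have "(\<Sum>\<sigma>\<in>Sym n. \<eta> (inv \<sigma> \<circ> \<beta> \<circ> \<sigma>) * cinner (e n (u \<circ> inv \<sigma>)) (e n u)) = of_nat (ymult n u) * \<eta> \<beta>" .
  then show "coord n (stensor \<tau> n \<eta> (e n u)) u \<beta> = fscale (of_nat (ymult n u) / fact n) \<eta> \<beta>"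
    by (simp add: coord_def stensor_e cinner_scaleC_left cinner_sum_left)
qed

lemma cinner_orb_other:
  assumes u: "u \<in> inc n" and w: "w \<in> inc n" and "u \<noteq> w" and s: "\<sigma> \<in> Sym n" "\<rho> \<in> Sym n"
  shows "cinner (e n (u \<circ> inv \<sigma>)) (e n (w \<circ> inv \<rho>)) = 0"
proof -
  have "u \<circ> inv \<sigma> \<noteq> w \<circ> inv \<rho>"
  proof
    assume "u \<circ> inv \<sigma> = w \<circ> inv \<rho>"
    then have "u \<circ> inv \<sigma> \<circ> \<rho> = w \<circ> inv \<rho> \<circ> \<rho>" by simp
    then have "w = u \<circ> (inv \<sigma> \<circ> \<rho>)" by (simp add: comp_assoc comp_inv_simps[OF bij_Sym[OF s(2)]])
    then show False using increasing_tuple_unique[OF u w Sym_comp[OF Sym_inv[OF s(1)] s(2)]] assms(3) by blast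
  qed
  then show ?thesis
    using cinner_e[OF tuples_comp[OF inc_tuples[OF u] Sym_inv[OF s(1)]] tuples_comp[OF inc_tuples[OF w] Sym_inv[OF s(2)]]]
    by simp
qed

lemma cinner_stensor_other:
  assumes "u \<in> inc n" "w \<in> inc n" "u \<noteq> w"
  shows "cinner (stensor \<tau> n \<eta> (e n u) \<alpha>) (stensor \<tau> n \<theta> (e n w) \<beta>) = 0"
  unfolding stensor_e cinner_scaleC_left cinner_scaleC_right cinner_sum_left cinner_sum_right
  by (simp add: cinner_orb_other[OF assms])

lemma coord_stensor_other:
  assumes "u \<in> inc n" "w \<in> inc n" "u \<noteq> w"
  shows "coord n (stensor \<tau> n \<eta> (e n u)) w = 0"
proof
  fix \<beta>
  have "cinner (e n (u \<circ> inv \<sigma>)) (e n w) = 0" if "\<sigma> \<in> Sym n" for \<sigma>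
    using cinner_orb_other[OF assms that Sym_id] by simp
  then show "coord n (stensor \<tau> n \<eta> (e n u)) w \<beta> = 0 \<beta>"
    by (simp add: coord_def stensor_e cinner_scaleC_left cinner_sum_left)
qed

text \<open>The normalization inverts the factor in \<open>coord_stensor_self\<close>, that is, it multiplies by the size of
  the orbit of \<open>u\<close>.\<close>

definition comp_coeff :: "nat \<Rightarrow> (perm \<Rightarrow> 't) \<Rightarrow> (nat \<Rightarrow> nat) \<Rightarrow> galg" where
  "comp_coeff n X u = fscale (fact n / of_nat (ymult n u)) (coord n X u)"

abbreviation "component n X u \<equiv> stensor \<tau> n (comp_coeff n X u) (e n u)"

lemma comp_coeff_centralizer:
  "X \<in> sym_tensor \<tau> n \<Longrightarrow> u \<in> tuples n \<Longrightarrow> comp_coeff n X u \<in> centralizer n (ker_partition n u)"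
  unfolding comp_coeff_def by (rule fvs.subspace_scale[OF centralizer_subspace coord_centralizer])

lemma comp_chaos_component: "X \<in> sym_tensor \<tau> n \<Longrightarrow> u \<in> tuples n \<Longrightarrow> component n X u \<in> chaos_component \<tau> \<xi> n u"
  unfolding chaos_component_def using comp_coeff_centralizer by blast

lemma comp_coeff_of_stensor:
  assumes "u \<in> tuples n" "\<eta> \<in> centralizer n (ker_partition n u)" "coord n X u = coord n (stensor \<tau> n \<eta> (e n u)) u"
  shows "comp_coeff n X u = \<eta>"
  using partition_fact_pos[of "ker_partition n u"]
  by (simp add: comp_coeff_def assms(3) coord_stensor_self[OF assms(1,2)])

lemma chaos_component_sym: "u \<in> tuples n \<Longrightarrow> Z \<in> chaos_component \<tau> \<xi> n u \<Longrightarrow> Z \<in> sym_tensor \<tau> n"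
  by (auto simp: chaos_component_def intro!: stensor_sym_tensor centralizer_group_algebra)

text \<open>Each element of the orbit arises from equally many permutations, so that the symmetrization
  collapses to a partial Fourier sum.\<close>

lemma comp_orbit_sum:
  assumes X: "X \<in> sym_tensor \<tau> n" and u: "u \<in> tuples n" and \<beta>: "\<beta> \<in> Sym0 n"
  shows "component n X u \<beta> = (\<Sum>w\<in>orb n u. cinner (X \<beta>) (e n w) *\<^sub>C e n w)"
proof -
  let ?g = "\<lambda>w. coord n X w \<beta> *\<^sub>C e n w"
  let ?c = "fact n / of_nat (ymult n u) :: complex"
  have co: "coord n X u (inv \<sigma> \<circ> \<beta> \<circ> \<sigma>) = coord n X (u \<circ> inv \<sigma>) \<beta>" if \<sigma>: "\<sigma> \<in> Sym n" for \<sigma>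
  proof -
    have "inv \<sigma> \<circ> \<beta> \<circ> \<sigma> \<in> Sym0 n" using conj_Sym0_iff[OF \<sigma>] \<beta> by simp
    from coord_conj[OF X \<sigma> this, of u] show ?thesis
      by (simp only: comp_assoc comp_inv_simps[OF bij_Sym[OF \<sigma>]] comp_id)
  qed
  have "component n X u \<beta> = complex_of_real (1 / fact n) *\<^sub>C (\<Sum>\<sigma>\<in>Sym n. ?c *\<^sub>C ?g (u \<circ> inv \<sigma>))"
    unfolding stensor_e comp_coeff_def by (simp add: co scaleC_scaleC)
  also have "(\<Sum>\<sigma>\<in>Sym n. ?c *\<^sub>C ?g (u \<circ> inv \<sigma>)) =
      (\<Sum>w\<in>orb n u. \<Sum>\<sigma>\<in>{\<sigma>\<in>Sym n. u \<circ> inv \<sigma> = w}. ?c *\<^sub>C ?g (u \<circ> inv \<sigma>))"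
    unfolding orb_def by (rule sum.image_gen) simp
  also have "\<dots> = (\<Sum>w\<in>orb n u. \<Sum>\<sigma>\<in>{\<sigma>\<in>Sym n. u \<circ> inv \<sigma> = w}. ?c *\<^sub>C ?g w)"
    by (intro sum.cong refl) simp
  also have "\<dots> = (\<Sum>w\<in>orb n u. fact n *\<^sub>C ?g w)"
  proof (rule sum.cong[OF refl])
    fix w assume "w \<in> orb n u"
    then have "(\<Sum>\<sigma>\<in>{\<sigma>\<in>Sym n. u \<circ> inv \<sigma> = w}. ?c *\<^sub>C ?g w) = real (ymult n u) *\<^sub>R (?c *\<^sub>C ?g w)"
      by (simp only: sum_constant_scaleR card_orb_fiber[OF u])
    also have "\<dots> = (complex_of_real (real (ymult n u)) * ?c) *\<^sub>C ?g w"
      by (simp only: scaleC_of_real[symmetric] scaleC_scaleC mult.assoc)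
    finally show "(\<Sum>\<sigma>\<in>{\<sigma>\<in>Sym n. u \<circ> inv \<sigma> = w}. ?c *\<^sub>C ?g w) = fact n *\<^sub>C ?g w"
      using partition_fact_pos[of "ker_partition n u"] by simp
  qed
  also have "\<dots> = fact n *\<^sub>C (\<Sum>w\<in>orb n u. ?g w)" by (rule chs.scale_sum_right[symmetric])
  finally show ?thesis by (simp add: scaleC_scaleC coord_def)
qed

lemma orb_disjoint:
  assumes "u \<in> inc n" "w \<in> inc n" "u \<noteq> w" shows "orb n u \<inter> orb n w = {}"
proof (rule ccontr)
  assume "orb n u \<inter> orb n w \<noteq> {}"
  then obtain \<sigma> \<rho> where s: "\<sigma> \<in> Sym n" "\<rho> \<in> Sym n" "u \<circ> inv \<sigma> = w \<circ> inv \<rho>" unfolding orb_def by blast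
  then have "cinner (e n (u \<circ> inv \<sigma>)) (e n (w \<circ> inv \<rho>)) = 1"
    using cinner_e[OF tuples_comp[OF inc_tuples[OF assms(1)] Sym_inv[OF s(1)]]
      tuples_comp[OF inc_tuples[OF assms(2)] Sym_inv[OF s(2)]]] by simp
  then show False using cinner_orb_other[OF assms s(1,2)] by simp
qed

text \<open>The Fourier series of the finitely many coefficients converge, and finite sets of orbits contain
  any given finite set of tuples.\<close>

lemma comp_sum_approx:
  assumes X: "X \<in> sym_tensor \<tau> n" and "\<epsilon> > 0"
  obtains F where "finite F" "F \<subseteq> inc n"
    "\<And>G. finite G \<Longrightarrow> F \<subseteq> G \<Longrightarrow> G \<subseteq> inc n \<Longrightarrow> alg_tensor_norm n (X - (\<Sum>u\<in>G. component n X u)) < \<epsilon>"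
proof -
  let ?d = "\<epsilon> / of_nat (card (Sym0 n))"
  have pos: "card (Sym0 n) > 0" using Sym0_id by (metis card_gt_0_iff empty_iff finite_Sym0)
  then have "?d > 0" using \<open>\<epsilon> > 0\<close> by simp
  define P where "P \<beta> W \<longleftrightarrow> finite W \<and> W \<subseteq> tuples n \<and> (\<forall>V. finite V \<longrightarrow> W \<subseteq> V \<longrightarrow> V \<subseteq> tuples n \<longrightarrow>
      norm (X \<beta> - (\<Sum>w\<in>V. cinner (X \<beta>) (e n w) *\<^sub>C e n w)) < ?d)" for \<beta> W
  have "\<exists>W. P \<beta> W" for \<beta>
  proof -
    have "X \<beta> \<in> closure (cspan (e n ` tuples n))" using sym_T[OF X, of \<beta>] T_eq by simp
    from fourier_approx[OF cinner_e this \<open>?d > 0\<close>] show ?thesis unfolding P_def by (metis (no_types, lifting))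
  qed
  then obtain W where PW: "\<And>\<beta>. P \<beta> (W \<beta>)" by metis
  have W: "finite (W \<beta>)" "W \<beta> \<subseteq> tuples n"
    "\<And>V. finite V \<Longrightarrow> W \<beta> \<subseteq> V \<Longrightarrow> V \<subseteq> tuples n \<Longrightarrow>
      norm (X \<beta> - (\<Sum>w\<in>V. cinner (X \<beta>) (e n w) *\<^sub>C e n w)) < ?d" for \<beta>
    using PW[of \<beta>] unfolding P_def by blast+
  \<comment> \<open>The increasing rearrangement of \<open>w\<close>.\<close>
  define s where "s w = (SOME u. u \<in> inc n \<and> w \<in> orb n u)" for w
  have s: "s w \<in> inc n \<and> w \<in> orb n (s w)" if w: "w \<in> tuples n" for w
  proof -
    obtain u \<sigma> where "u \<in> inc n" "\<sigma> \<in> Sym n" "w = u \<circ> inv \<sigma>" by (rule increasing_tuple_exists[OF w])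
    then have "u \<in> inc n \<and> w \<in> orb n u" by (simp add: orb_def)
    then show ?thesis unfolding s_def by (rule someI[of "\<lambda>u. u \<in> inc n \<and> w \<in> orb n u"])
  qed
  define F where "F = s ` (\<Union>\<beta>\<in>Sym0 n. W \<beta>)"
  have "finite F" using W(1) by (simp add: F_def)
  moreover have "F \<subseteq> inc n"
  proof (unfold F_def, rule image_subsetI)
    fix w assume "w \<in> (\<Union>\<beta>\<in>Sym0 n. W \<beta>)"
    then obtain \<beta> where "w \<in> W \<beta>" by blast
    then show "s w \<in> inc n" using s[of w] subsetD[OF W(2)[of \<beta>]] by simp
  qed
  moreover have "alg_tensor_norm n (X - (\<Sum>u\<in>G. component n X u)) < \<epsilon>"
    if G: "finite G" "F \<subseteq> G" "G \<subseteq> inc n" for G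
  proof -
    let ?V = "\<Union>u\<in>G. orb n u"
    have V1: "finite ?V" using G(1) by simp
    have V2: "?V \<subseteq> tuples n"
    proof (rule UN_least)
      fix u assume "u \<in> G"
      then show "orb n u \<subseteq> tuples n" using G(3) by (intro orb_tuples inc_tuples) blast
    qed
    have "norm ((X - (\<Sum>u\<in>G. component n X u)) \<beta>) < ?d" if \<beta>: "\<beta> \<in> Sym0 n" for \<beta>
    proof -
      have "(\<Sum>u\<in>G. component n X u) \<beta> = (\<Sum>u\<in>G. \<Sum>w\<in>orb n u. cinner (X \<beta>) (e n w) *\<^sub>C e n w)"
        unfolding sum_fun_apply using G(3) inc_tuples by (intro sum.cong refl comp_orbit_sum[OF X _ \<beta>]) auto
      also have "\<dots> = (\<Sum>w\<in>?V. cinner (X \<beta>) (e n w) *\<^sub>C e n w)"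
      proof (rule sum.UNION_disjoint[symmetric])
        show "\<forall>i\<in>G. \<forall>j\<in>G. i \<noteq> j \<longrightarrow> orb n i \<inter> orb n j = {}"
          using orb_disjoint G(3) by (simp add: subset_iff)
      qed (use G(1) in simp_all)
      finally have *: "(\<Sum>u\<in>G. component n X u) \<beta> = (\<Sum>w\<in>?V. cinner (X \<beta>) (e n w) *\<^sub>C e n w)" .
      have "W \<beta> \<subseteq> ?V"
      proof
        fix w assume w: "w \<in> W \<beta>"
        then have "s w \<in> F" using \<beta> unfolding F_def by (intro imageI UN_I)
        moreover have "w \<in> orb n (s w)" using s[of w] subsetD[OF W(2)[of \<beta>] w] by simp
        ultimately show "w \<in> ?V" using G(2) by (intro UN_I) auto
      qed
      then show ?thesis using W(3)[of ?V \<beta>, OF V1 _ V2] * by simp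
    qed
    then have "(\<Sum>\<beta>\<in>Sym0 n. norm ((X - (\<Sum>u\<in>G. component n X u)) \<beta>)) < (\<Sum>\<beta>\<in>Sym0 n. ?d)"
      using pos by (intro sum_strict_mono) (auto simp: card_gt_0_iff)
    also have "\<dots> = \<epsilon>" using pos by (auto simp: card_gt_0_iff)
    finally show ?thesis using alg_tensor_norm_le[of n "X - (\<Sum>u\<in>G. component n X u)"] by linarith
  qed
  ultimately show ?thesis using that by blast
qed

lemma sym_tensor_eq_closed_sum:
  "sym_tensor \<tau> n = closed_sum (alg_tensor_norm n) (alg_tensor \<tau> n) (chaos_component \<tau> \<xi> n) (inc n)"
proof safe
  fix X assume X: "X \<in> sym_tensor \<tau> n"
  show "X \<in> closed_sum (alg_tensor_norm n) (alg_tensor \<tau> n) (chaos_component \<tau> \<xi> n) (inc n)"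
    unfolding closed_sum_def
  proof (intro CollectI conjI allI impI sym_alg[OF X])
    fix \<epsilon> :: real assume "\<epsilon> > 0"
    then obtain F where F: "finite F" "F \<subseteq> inc n"
      "\<And>G. finite G \<Longrightarrow> F \<subseteq> G \<Longrightarrow> G \<subseteq> inc n \<Longrightarrow> alg_tensor_norm n (X - (\<Sum>u\<in>G. component n X u)) < \<epsilon>"
      by (rule comp_sum_approx[OF X]) (rule that)
    have "component n X u \<in> chaos_component \<tau> \<xi> n u" if "u \<in> F" for u
      using that F(2) by (intro comp_chaos_component[OF X] inc_tuples) blast
    then show "\<exists>F v. finite F \<and> F \<subseteq> inc n \<and> (\<forall>u\<in>F. v u \<in> chaos_component \<tau> \<xi> n u) \<and>
        alg_tensor_norm n (X - sum v F) < \<epsilon>"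
      using F(1,2) F(3)[OF F(1) order_refl F(2)]
      by (intro exI[of _ F] exI[of _ "\<lambda>u. component n X u"] conjI ballI)
  qed
next
  fix X assume X: "X \<in> closed_sum (alg_tensor_norm n) (alg_tensor \<tau> n) (chaos_component \<tau> \<xi> n) (inc n)"
  show "X \<in> sym_tensor \<tau> n"
  proof (rule sym_tensor_closed)
    show "X \<in> alg_tensor \<tau> n" using X by (simp add: closed_sum_def)
    fix \<epsilon> :: real assume "\<epsilon> > 0"
    then obtain F v where F: "finite F" "F \<subseteq> inc n" "\<forall>u\<in>F. v u \<in> chaos_component \<tau> \<xi> n u"
      "alg_tensor_norm n (X - sum v F) < \<epsilon>"
      using X unfolding closed_sum_def by blast
    have "sum v F \<in> sym_tensor \<tau> n"
      using F(2,3) inc_tuples chaos_component_sym by (intro sym_tensor_sum) blast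
    with F(4) show "\<exists>Y\<in>sym_tensor \<tau> n. alg_tensor_norm n (X - Y) < \<epsilon>" by blast
  qed
qed

text \<open>Coordinates are continuous and vanish on the components at other tuples.\<close>

lemma sums_wrt_coord:
  assumes s: "sums_wrt (alg_tensor_norm n) v (inc n) X"
    and v: "\<And>w. w \<in> inc n \<Longrightarrow> v w \<in> chaos_component \<tau> \<xi> n w" and u: "u \<in> inc n" and \<alpha>: "\<alpha> \<in> Sym0 n"
  shows "coord n X u \<alpha> = coord n (v u) u \<alpha>"
proof -
  have other: "coord n (v w) u = 0" if "w \<in> inc n" "w \<noteq> u" for w
    using v[OF that(1)] coord_stensor_other[OF that(1) u that(2)] by (auto simp: chaos_component_def)
  have le: "cmod (coord n X u \<alpha> - coord n (v u) u \<alpha>) \<le> alg_tensor_norm n (X - sum v F)"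
    if F: "finite F" "{u} \<subseteq> F" "F \<subseteq> inc n" for F
  proof -
    have "coord n (sum v F) u = (\<Sum>w\<in>F. if w = u then coord n (v u) u else 0)"
      unfolding coord_sum using other F by (intro sum.cong refl) auto
    also have "\<dots> = coord n (v u) u" using F by simp
    finally have "coord n X u \<alpha> - coord n (v u) u \<alpha> = cinner ((X - sum v F) \<alpha>) (e n u)"
      using coord_diff[of n X "sum v F" u] by (simp add: coord_def fun_eq_iff)
    then have "cmod (coord n X u \<alpha> - coord n (v u) u \<alpha>) \<le> norm ((X - sum v F) \<alpha>) * norm (e n u)"
      by (simp only: cmod_cinner_le)
    also have "norm (e n u) = 1"
    proof -
      have "complex_of_real ((norm (e n u))\<^sup>2) = 1"
        using cinner_e[OF inc_tuples[OF u] inc_tuples[OF u]] by (simp add: cinner_self)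
      then have "(norm (e n u))\<^sup>2 = 1" by (simp only: of_real_eq_1_iff)
      then show ?thesis by (simp add: power2_eq_1_iff) (metis norm_ge_zero not_one_le_zero neg_0_le_iff_le)
    qed
    finally show ?thesis using norm_le_alg_tensor_norm[OF \<alpha>, of "X - sum v F"] by linarith
  qed
  have "cmod (coord n X u \<alpha> - coord n (v u) u \<alpha>) \<le> 0"
  proof (rule tendsto_lowerbound[OF s[unfolded sums_wrt_def]])
    show "\<forall>\<^sub>F F in finite_subsets_at_top (inc n).
        cmod (coord n X u \<alpha> - coord n (v u) u \<alpha>) \<le> alg_tensor_norm n (X - sum v F)"
      unfolding eventually_finite_subsets_at_top using le u by (intro exI[of _ "{u}"]) simp
  qed simp
  then show ?thesis by simp
qed

lemma sums_wrt_comp: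
  assumes X: "X \<in> sym_tensor \<tau> n"
  shows "sums_wrt (alg_tensor_norm n) (\<lambda>u. if u \<in> inc n then component n X u else 0) (inc n) X"
  unfolding sums_wrt_def tendsto_iff
proof (intro allI impI)
  fix \<epsilon> :: real assume "\<epsilon> > 0"
  then obtain F where F: "finite F" "F \<subseteq> inc n"
    "\<And>G. finite G \<Longrightarrow> F \<subseteq> G \<Longrightarrow> G \<subseteq> inc n \<Longrightarrow> alg_tensor_norm n (X - (\<Sum>u\<in>G. component n X u)) < \<epsilon>"
    by (rule comp_sum_approx[OF X]) (rule that)
  have "alg_tensor_norm n (X - (\<Sum>u\<in>G. if u \<in> inc n then component n X u else 0)) < \<epsilon>"
    if "finite G" "F \<subseteq> G" "G \<subseteq> inc n" for G
  proof -
    have "(\<Sum>u\<in>G. if u \<in> inc n then component n X u else 0) = (\<Sum>u\<in>G. component n X u)"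
      using that(3) by (intro sum.cong) auto
    then show ?thesis using F(3)[OF that] by simp
  qed
  moreover have "alg_tensor_norm n Z \<ge> 0" for Z :: "perm \<Rightarrow> 't" by (simp add: alg_tensor_norm_def sum_nonneg)
  ultimately show "\<forall>\<^sub>F G in finite_subsets_at_top (inc n).
      dist (alg_tensor_norm n (X - (\<Sum>u\<in>G. if u \<in> inc n then component n X u else 0))) 0 < \<epsilon>"
    unfolding eventually_finite_subsets_at_top using F(1,2) by (intro exI[of _ F]) simp
qed

lemma closed_sum_direct_chaos:
  "closed_sum_direct (alg_tensor_norm n) (alg_tensor \<tau> n) (chaos_component \<tau> \<xi> n) (inc n)"
  unfolding closed_sum_direct_def sym_tensor_eq_closed_sum[symmetric]
proof
  fix X assume X: "X \<in> sym_tensor \<tau> n"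
  let ?v = "\<lambda>u. if u \<in> inc n then component n X u else 0"
  show "\<exists>!v. (\<forall>u\<in>inc n. v u \<in> chaos_component \<tau> \<xi> n u) \<and> (\<forall>u. u \<notin> inc n \<longrightarrow> v u = 0) \<and>
      sums_wrt (alg_tensor_norm n) v (inc n) X"
  proof (rule ex1I[of _ ?v])
    show "(\<forall>u\<in>inc n. ?v u \<in> chaos_component \<tau> \<xi> n u) \<and> (\<forall>u. u \<notin> inc n \<longrightarrow> ?v u = 0) \<and>
        sums_wrt (alg_tensor_norm n) ?v (inc n) X"
      using sums_wrt_comp[OF X] comp_chaos_component[OF X] inc_tuples by simp
  next
    fix v assume v: "(\<forall>u\<in>inc n. v u \<in> chaos_component \<tau> \<xi> n u) \<and> (\<forall>u. u \<notin> inc n \<longrightarrow> v u = 0) \<and>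
        sums_wrt (alg_tensor_norm n) v (inc n) X"
    show "v = ?v"
    proof
      fix u show "v u = ?v u"
      proof (cases "u \<in> inc n")
        case True
        then obtain \<eta> where \<eta>: "\<eta> \<in> centralizer n (ker_partition n u)" "v u = stensor \<tau> n \<eta> (e n u)"
          using v unfolding chaos_component_def by blast
        have "coord n X u = coord n (v u) u"
        proof
          fix \<alpha> show "coord n X u \<alpha> = coord n (v u) u \<alpha>"
          proof (cases "\<alpha> \<in> Sym0 n")
            case True2: True
            show ?thesis using v by (intro sums_wrt_coord[OF _ _ True True2]) auto
          next
            case False
            moreover have "v u \<in> alg_tensor \<tau> n"
              unfolding \<eta>(2) by (intro sym_alg stensor_sym_tensor centralizer_group_algebra[OF \<eta>(1)] e_mem)
            ultimately show ?thesis using sym_alg[OF X] by (simp add: coord_def alg_tensor_outside)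
          qed
        qed
        then have "comp_coeff n X u = \<eta>"
          using comp_coeff_of_stensor[OF inc_tuples[OF True] \<eta>(1), of X] \<eta>(2) by simp
        then show ?thesis using True \<eta>(2) by simp
      qed (use v in simp)
    qed
  qed
qed

definition qdeg :: "real \<Rightarrow> nat \<Rightarrow> (perm \<Rightarrow> 't) \<Rightarrow> (perm \<Rightarrow> 't) \<Rightarrow> complex" where
  "qdeg q n A B = (\<Sum>\<alpha>\<in>Sym0 n. \<Sum>\<beta>\<in>Sym0 n. \<Sum>\<sigma>\<in>Sym n.
     chi_perm q n (\<alpha> \<circ> \<sigma> \<circ> inv \<beta> \<circ> inv \<sigma>) * cinner (A \<alpha>) (U n \<sigma> (B \<beta>)))"

lemma qdeg_zero [simp]: "qdeg q n 0 B = 0" "qdeg q n B 0 = 0"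
  by (simp_all add: qdeg_def)

lemma q_inner_in_degree: "q_inner \<tau> q (in_degree n A) B = qdeg q n A (B n)"
proof -
  have "{m. in_degree n A m \<noteq> 0} = (if A = 0 then {} else {n})" by (auto simp: in_degree_def)
  then show ?thesis
    by (simp add: q_inner_def in_degree_def flip: qdeg_def)
qed

lemma qdeg_chaos_orthogonal:
  assumes u: "u \<in> inc n" and w: "w \<in> inc n" and "u \<noteq> w"
    and A: "A \<in> chaos_component \<tau> \<xi> n u" and B: "B \<in> chaos_component \<tau> \<xi> n w"
  shows "qdeg q n A B = 0"
proof -
  obtain \<eta> \<theta> where \<eta>: "A = stensor \<tau> n \<eta> (e n u)" and \<theta>: "B = stensor \<tau> n \<theta> (e n w)"
    using A B by (auto simp: chaos_component_def)
  have B': "B \<in> sym_tensor \<tau> n" by (rule chaos_component_sym[OF inc_tuples[OF w] B])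
  have "cinner (A \<alpha>) (U n \<sigma> (B \<beta>)) = 0" if "\<sigma> \<in> Sym n" "\<beta> \<in> Sym0 n" for \<alpha> \<beta> \<sigma>
    unfolding sym_tensor_conj[OF B' that] unfolding \<eta> \<theta> by (rule cinner_stensor_other[OF assms(1,2,3)])
  then show ?thesis by (simp add: qdeg_def)
qed

lemma q_orthogonal:
  assumes "u \<in> inc n" "w \<in> inc k" "(n, u) \<noteq> (k, w)"
    "A \<in> chaos_component \<tau> \<xi> n u" "B \<in> chaos_component \<tau> \<xi> k w"
  shows "q_inner \<tau> q (in_degree n A) (in_degree k B) = 0"
proof (cases "n = k")
  case True
  then have "qdeg q n A B = 0" using assms by (intro qdeg_chaos_orthogonal[of u n w]) auto
  then show ?thesis using True unfolding q_inner_in_degree by (simp add: in_degree_def)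
next
  case False
  then show ?thesis unfolding q_inner_in_degree by (simp add: in_degree_def)
qed

end


section \<open>The \<open>q\<close>-inner product at \<open>q = 1/N\<close>\<close>

lemma wsum_cong_fiber: "fiber n g h = fiber n g' h' \<Longrightarrow> wsum n g h X = wsum n g' h' X"
  by (simp add: wsum_def)

lemma wsum_diff: "wsum n g h (X - X') = wsum n g h X - (wsum n g h X' :: 'v::ab_group_add)"
  by (simp add: wsum_def sum_subtractf)

text \<open>The set \<open>words n N\<close> contains the restrictions of all functions with letters below \<open>N\<close>, and word sums depend
  only on these.\<close>

lemma tensor_kernel_words:
  assumes a: "a \<in> group_algebra n"
    and z: "\<And>g h. g \<in> words n N \<Longrightarrow> h \<in> words n N \<Longrightarrow> wsum n g h a = 0"
  shows "a \<in> tensor_kernel n N"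
  unfolding tensor_kernel_def
proof (intro CollectI conjI a allI impI)
  fix g h :: "nat \<Rightarrow> nat" assume g: "\<forall>i\<in>{0..n}. g i < N"
  show "wsum n g h a = 0"
  proof (cases "fiber n g h = {}")
    case False
    then obtain \<alpha> where \<alpha>: "\<alpha> \<in> Sym0 n" "\<forall>i\<in>{0..n}. g (\<alpha> i) = h i" unfolding fiber_def by blast
    have h: "h i < N" if "i \<in> {0..n}" for i
    proof -
      have "\<alpha> i \<in> {0..n}" using that by (simp add: Sym0_le_iff[OF \<alpha>(1)])
      then have "g (\<alpha> i) < N" using g by blast
      then show ?thesis using \<alpha>(2) that by simp
    qed
    have "restrict g {0..n} \<in> words n N" "restrict h {0..n} \<in> words n N"
      using g h by (simp_all add: words_def)
    moreover have "fiber n g h = fiber n (restrict g {0..n}) (restrict h {0..n})"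
      unfolding fiber_def by (rule Collect_cong) (auto simp: Sym0_le_iff)
    ultimately show ?thesis using z wsum_cong_fiber by metis
  qed (simp add: wsum_def)
qed

lemma chi_form_kernel:
  assumes "N \<ge> 1" "a \<in> tensor_kernel n N"
  shows "chi_form (1 / real N) n a b = 0"
proof -
  have "wsum n g h a = 0" if "g \<in> words n N" for g h
  proof -
    have "\<forall>i\<in>{0..n}. g i < N" using that PiE_mem[of g "{0..n}" "\<lambda>_. {..<N}"] by (auto simp: words_def)
    then show ?thesis using assms(2) by (simp add: tensor_kernel_def)
  qed
  then show ?thesis by (simp add: chi_form_words[OF assms(1)])
qed

lemma chi_form_diff_left: "chi_form q n (a - a') b = chi_form q n a b - chi_form q n a' b"
  and chi_form_scale_left: "chi_form q n (fscale c a) b = c * chi_form q n a b"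
  by (simp_all add: chi_form_def algebra_simps sum_subtractf sum_distrib_left)

lemma chi_form_self:
  assumes "N \<ge> 1"
  shows "chi_form (1 / real N) n a a =
    complex_of_real ((\<Sum>g\<in>words n N. \<Sum>h\<in>words n N. (cmod (wsum n g h a))\<^sup>2) / real N ^ (n + 1))"
  unfolding chi_form_words[OF assms] by (simp flip: complex_norm_square)

locale chaos_q = chaos \<tau> \<Xi> \<xi>
  for \<tau> :: "nat \<Rightarrow> (nat \<Rightarrow> 'a::complex_hilbert_space) \<Rightarrow> 't::complex_hilbert_space" and \<Xi> \<xi> +
  fixes N :: nat
  assumes N: "N \<ge> 1"
begin

abbreviation "q \<equiv> 1 / real N"
abbreviation "W n \<equiv> words n N"
abbreviation "ip \<equiv> q_inner \<tau> q"
abbreviation "nrm \<equiv> q_norm \<tau> q"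

text \<open>For a symmetric tensor the twist by \<open>\<sigma>\<close> can be absorbed into the summation over \<open>\<beta>\<close>, so all \<open>n!\<close>
  terms of the sum over \<open>\<sigma>\<close> agree.\<close>

lemma qdeg_symmetric:
  assumes "A \<in> sym_tensor \<tau> n" and B: "B \<in> sym_tensor \<tau> n"
  shows "qdeg q n A B =
    fact n * (\<Sum>\<alpha>\<in>Sym0 n. \<Sum>\<beta>\<in>Sym0 n. chi_perm q n (\<alpha> \<circ> inv \<beta>) * cinner (A \<alpha>) (B \<beta>))"
proof -
  have "qdeg q n A B = (\<Sum>\<alpha>\<in>Sym0 n. \<Sum>\<sigma>\<in>Sym n. \<Sum>\<beta>\<in>Sym0 n.
      chi_perm q n (\<alpha> \<circ> \<sigma> \<circ> inv \<beta> \<circ> inv \<sigma>) * cinner (A \<alpha>) (U n \<sigma> (B \<beta>)))"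
    unfolding qdeg_def by (rule sum.cong[OF refl]) (rule sum.swap)
  also have "\<dots> = (\<Sum>\<alpha>\<in>Sym0 n. \<Sum>\<sigma>\<in>Sym n. \<Sum>\<beta>\<in>Sym0 n. chi_perm q n (\<alpha> \<circ> inv \<beta>) * cinner (A \<alpha>) (B \<beta>))"
  proof (rule sum.cong[OF refl], rule sum.cong[OF refl])
    fix \<alpha> \<sigma> assume \<sigma>: "\<sigma> \<in> Sym n"
    have "(\<Sum>\<beta>\<in>Sym0 n. chi_perm q n (\<alpha> \<circ> \<sigma> \<circ> inv \<beta> \<circ> inv \<sigma>) * cinner (A \<alpha>) (U n \<sigma> (B \<beta>))) =
        (\<Sum>\<beta>\<in>Sym0 n. chi_perm q n (\<alpha> \<circ> inv (\<sigma> \<circ> \<beta> \<circ> inv \<sigma>)) * cinner (A \<alpha>) (B (\<sigma> \<circ> \<beta> \<circ> inv \<sigma>)))"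
    proof (rule sum.cong[OF refl])
      fix \<beta> assume \<beta>: "\<beta> \<in> Sym0 n"
      have "inv (\<sigma> \<circ> \<beta> \<circ> inv \<sigma>) = \<sigma> \<circ> inv \<beta> \<circ> inv \<sigma>"
        using bij_Sym[OF \<sigma>] bij_Sym0[OF \<beta>]
        by (simp add: o_inv_distrib bij_imp_bij_inv bij_comp comp_inv_simps comp_assoc)
      then show "chi_perm q n (\<alpha> \<circ> \<sigma> \<circ> inv \<beta> \<circ> inv \<sigma>) * cinner (A \<alpha>) (U n \<sigma> (B \<beta>)) =
          chi_perm q n (\<alpha> \<circ> inv (\<sigma> \<circ> \<beta> \<circ> inv \<sigma>)) * cinner (A \<alpha>) (B (\<sigma> \<circ> \<beta> \<circ> inv \<sigma>))"
        by (simp only: sym_tensor_conj[OF B \<sigma> \<beta>] comp_assoc)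
    qed
    also have "\<dots> = (\<Sum>\<beta>\<in>Sym0 n. chi_perm q n (\<alpha> \<circ> inv \<beta>) * cinner (A \<alpha>) (B \<beta>))"
      by (rule sum_Sym0_conj[OF Sym_subset_Sym0[OF \<sigma>]])
    finally show "(\<Sum>\<beta>\<in>Sym0 n. chi_perm q n (\<alpha> \<circ> \<sigma> \<circ> inv \<beta> \<circ> inv \<sigma>) * cinner (A \<alpha>) (U n \<sigma> (B \<beta>))) =
        (\<Sum>\<beta>\<in>Sym0 n. chi_perm q n (\<alpha> \<circ> inv \<beta>) * cinner (A \<alpha>) (B \<beta>))" .
  qed
  finally show ?thesis by (simp add: card_Sym sum_distrib_left)
qed

lemma qdeg_words:
  assumes "A \<in> sym_tensor \<tau> n" "B \<in> sym_tensor \<tau> n"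
  shows "qdeg q n A B =
    complex_of_real (fact n / real N ^ (n + 1)) * (\<Sum>g\<in>W n. \<Sum>h\<in>W n. cinner (wsum n g h A) (wsum n g h B))"
proof -
  have "(\<Sum>\<alpha>\<in>Sym0 n. \<Sum>\<beta>\<in>Sym0 n. chi_perm q n (\<alpha> \<circ> inv \<beta>) * cinner (A \<alpha>) (B \<beta>)) =
      (\<Sum>g\<in>W n. \<Sum>h\<in>W n. cinner (wsum n g h A) (wsum n g h B)) / of_nat N ^ (n + 1)"
    by (rule words_form[OF _ N]) (simp only: cinner_sum_left, simp only: cinner_sum_right)
  then show ?thesis unfolding qdeg_symmetric[OF assms] by simp
qed

text \<open>Writing the seminorm as an \<open>L\<^sup>2\<close> norm of word sums makes the triangle inequality an instance of
  Minkowski's inequality.\<close>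

definition degree_norm :: "nat \<Rightarrow> (perm \<Rightarrow> 't) \<Rightarrow> real" where
  "degree_norm n X = L2_set (\<lambda>(g, h). sqrt (fact n / real N ^ (n + 1)) * norm (wsum n g h X)) (W n \<times> W n)"

lemma degree_norm_nonneg [simp]: "degree_norm n X \<ge> 0"
  by (simp add: degree_norm_def L2_set_nonneg)

lemma degree_norm_triangle: "degree_norm n (X + X') \<le> degree_norm n X + degree_norm n X'"
proof -
  let ?c = "sqrt (fact n / real N ^ (n + 1))"
  have "degree_norm n (X + X') \<le> L2_set (\<lambda>p. (\<lambda>(g, h). ?c * norm (wsum n g h X)) p + (\<lambda>(g, h). ?c * norm (wsum n g h X')) p) (W n \<times> W n)"
    unfolding degree_norm_def
    by (rule L2_set_mono)
      (auto simp: wsum_add norm_triangle_ineq simp flip: distrib_left intro!: mult_left_mono)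
  also have "\<dots> \<le> degree_norm n X + degree_norm n X'" unfolding degree_norm_def by (rule L2_set_triangle_ineq)
  finally show ?thesis .
qed

lemma qdeg_self:
  assumes "X \<in> sym_tensor \<tau> n" shows "qdeg q n X X = complex_of_real ((degree_norm n X)\<^sup>2)"
proof -
  let ?c = "fact n / real N ^ (n + 1)"
  have "(degree_norm n X)\<^sup>2 = (\<Sum>(g, h)\<in>W n \<times> W n. ?c * (norm (wsum n g h X))\<^sup>2)"
    unfolding degree_norm_def L2_set_def
    by (subst real_sqrt_pow2) (auto simp: power_mult_distrib intro!: sum_nonneg sum.cong)
  also have "\<dots> = (\<Sum>g\<in>W n. \<Sum>h\<in>W n. ?c * (norm (wsum n g h X))\<^sup>2)"
    by (rule sum.cartesian_product[symmetric])
  also have "\<dots> = ?c * (\<Sum>g\<in>W n. \<Sum>h\<in>W n. (norm (wsum n g h X))\<^sup>2)"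
    by (simp only: sum_distrib_left)
  finally show ?thesis unfolding qdeg_words[OF assms assms] by (simp add: cinner_self)
qed

lemma norm_wsum_le_degree_norm:
  assumes "g \<in> W n" "h \<in> W n"
  shows "sqrt (fact n / real N ^ (n + 1)) * norm (wsum n g h X) \<le> degree_norm n X"
  using member_le_L2_set[of "W n \<times> W n" "(g, h)" "\<lambda>(g, h). sqrt (fact n / real N ^ (n + 1)) * norm (wsum n g h X)"] assms
  by (simp add: degree_norm_def)

lemma degree_norm_le: "\<exists>C. \<forall>X. degree_norm n X \<le> C * (\<Sum>\<alpha>\<in>Sym0 n. norm (X \<alpha>))"
proof (intro exI allI)
  fix X :: "perm \<Rightarrow> 't"
  let ?c = "sqrt (fact n / real N ^ (n + 1))"
  have "degree_norm n X \<le> (\<Sum>(g, h)\<in>W n \<times> W n. ?c * norm (wsum n g h X))"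
    unfolding degree_norm_def by (rule L2_set_le_sum) auto
  also have "\<dots> \<le> (\<Sum>(g, h)\<in>W n \<times> W n. ?c * (\<Sum>\<alpha>\<in>Sym0 n. norm (X \<alpha>)))"
  proof (intro sum_mono, clarify, intro mult_left_mono)
    fix g h
    have "norm (wsum n g h X) \<le> (\<Sum>\<alpha>\<in>fiber n g h. norm (X \<alpha>))" unfolding wsum_def by (rule norm_sum)
    also have "\<dots> \<le> (\<Sum>\<alpha>\<in>Sym0 n. norm (X \<alpha>))" by (rule sum_mono2) (auto simp: fiber_def)
    finally show "norm (wsum n g h X) \<le> (\<Sum>\<alpha>\<in>Sym0 n. norm (X \<alpha>))" .
  qed simp
  also have "\<dots> = (real (card (W n \<times> W n)) * ?c) * (\<Sum>\<alpha>\<in>Sym0 n. norm (X \<alpha>))" by simp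
  finally show "degree_norm n X \<le> (real (card (W n \<times> W n)) * ?c) * (\<Sum>\<alpha>\<in>Sym0 n. norm (X \<alpha>))" .
qed

subsection \<open>The seminorm on finite sums of degrees\<close>

lemma TP_D: "A \<in> TP \<tau> \<Longrightarrow> A n \<in> sym_tensor \<tau> n" "A \<in> TP \<tau> \<Longrightarrow> finite {n. A n \<noteq> 0}"
  by (simp_all add: TP_def alg_direct_sum_def)

lemma TP_zero [simp]: "0 \<in> TP \<tau>"
  by (simp add: TP_def alg_direct_sum_def)

lemma TP_add:
  assumes "A \<in> TP \<tau>" "B \<in> TP \<tau>" shows "A + B \<in> TP \<tau>"
proof -
  have "finite {n. (A + B) n \<noteq> 0}"
    by (rule finite_subset[of _ "{n. A n \<noteq> 0} \<union> {n. B n \<noteq> 0}"]) (use TP_D(2) assms in auto)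
  then show ?thesis using TP_D(1) assms by (simp add: TP_def alg_direct_sum_def sym_tensor_add)
qed

lemma TP_diff:
  assumes "A \<in> TP \<tau>" "B \<in> TP \<tau>" shows "A - B \<in> TP \<tau>"
proof -
  have "finite {n. (A - B) n \<noteq> 0}"
    by (rule finite_subset[of _ "{n. A n \<noteq> 0} \<union> {n. B n \<noteq> 0}"]) (use TP_D(2) assms in auto)
  then show ?thesis using TP_D(1) assms by (simp add: TP_def alg_direct_sum_def sym_tensor_diff)
qed

lemma TP_sum: "(\<And>i. i \<in> F \<Longrightarrow> f i \<in> TP \<tau>) \<Longrightarrow> sum f F \<in> TP \<tau>"
  by (induction F rule: infinite_finite_induct) (simp_all add: TP_add)

lemma in_degree_TP: "X \<in> sym_tensor \<tau> n \<Longrightarrow> in_degree n X \<in> TP \<tau>"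
  by (simp add: TP_def alg_direct_sum_def in_degree_def)

lemma in_degree_add: "in_degree n (X + X') = in_degree n X + (in_degree n X' :: nat \<Rightarrow> perm \<Rightarrow> 't)"
  and in_degree_diff: "in_degree n (X - X') = in_degree n X - (in_degree n X' :: nat \<Rightarrow> perm \<Rightarrow> 't)"
  and in_degree_zero: "in_degree n 0 = (0 :: nat \<Rightarrow> perm \<Rightarrow> 't)"
  by (rule ext, simp add: in_degree_def)+

lemma in_degree_sum: "in_degree n (sum f F) = (\<Sum>i\<in>F. in_degree n (f i :: perm \<Rightarrow> 't))"
  by (induction F rule: infinite_finite_induct)
    (simp_all only: sum.infinite sum.empty sum.insert in_degree_add in_degree_zero not_False_eq_True)

lemma ip_eq_sum:
  assumes "finite M" "{n. A n \<noteq> 0} \<subseteq> M"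
  shows "ip A B = (\<Sum>n\<in>M. qdeg q n (A n) (B n))"
proof -
  have "ip A B = (\<Sum>n | A n \<noteq> 0. qdeg q n (A n) (B n))" by (simp add: q_inner_def qdeg_def)
  also have "\<dots> = (\<Sum>n\<in>M. qdeg q n (A n) (B n))"
    using assms by (intro sum.mono_neutral_left) auto
  finally show ?thesis .
qed

lemma common_support:
  assumes "A \<in> TP \<tau>" "B \<in> TP \<tau>"
  obtains M where "finite M" "{n. A n \<noteq> 0} \<subseteq> M" "{n. B n \<noteq> 0} \<subseteq> M"
    "{n. (A + B) n \<noteq> 0} \<subseteq> M" "{n. (A - B) n \<noteq> 0} \<subseteq> M"
  by (rule that[of "{n. A n \<noteq> 0} \<union> {n. B n \<noteq> 0}"]) (use TP_D(2) assms in auto)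

lemma qdeg_add_left: "qdeg q' n (X + X') Z = qdeg q' n X Z + qdeg q' n X' Z"
  by (simp add: qdeg_def cinner_add_left algebra_simps sum.distrib)

lemma ip_add_left:
  assumes "A \<in> TP \<tau>" "B \<in> TP \<tau>" shows "ip (A + B) C = ip A C + ip B C"
proof -
  obtain M where M: "finite M" "{n. A n \<noteq> 0} \<subseteq> M" "{n. B n \<noteq> 0} \<subseteq> M" "{n. (A + B) n \<noteq> 0} \<subseteq> M"
    by (rule common_support[OF assms])
  show ?thesis
    unfolding ip_eq_sum[OF M(1,2)] ip_eq_sum[OF M(1,3)] ip_eq_sum[OF M(1,4)]
    by (simp add: qdeg_add_left sum.distrib)
qed

lemma ip_commute:
  assumes "A \<in> TP \<tau>" "B \<in> TP \<tau>" shows "ip A B = cnj (ip B A)"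
proof -
  obtain M where M: "finite M" "{n. A n \<noteq> 0} \<subseteq> M" "{n. B n \<noteq> 0} \<subseteq> M"
    by (rule common_support[OF assms])
  have "qdeg q n (A n) (B n) = cnj (qdeg q n (B n) (A n))" for n
    unfolding qdeg_words[OF TP_D(1)[OF assms(1)] TP_D(1)[OF assms(2)]]
      qdeg_words[OF TP_D(1)[OF assms(2)] TP_D(1)[OF assms(1)]]
    by (simp flip: cinner_commute)
  then show ?thesis unfolding ip_eq_sum[OF M(1,2)] ip_eq_sum[OF M(1,3)] by simp
qed

lemma ip_diff_left:
  assumes "A \<in> TP \<tau>" "B \<in> TP \<tau>" shows "ip (A - B) C = ip A C - ip B C"
  using ip_add_left[OF TP_diff[OF assms] assms(2), of C] by simp

lemma ip_add_right:
  assumes "A \<in> TP \<tau>" "B \<in> TP \<tau>" "C \<in> TP \<tau>" shows "ip C (A + B) = ip C A + ip C B"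
  using ip_commute[OF assms(3) TP_add[OF assms(1,2)]] ip_commute[OF assms(3,1)] ip_commute[OF assms(3,2)]
  by (simp add: ip_add_left[OF assms(1,2)])

lemma ip_diff_right:
  assumes "A \<in> TP \<tau>" "B \<in> TP \<tau>" "C \<in> TP \<tau>" shows "ip C (A - B) = ip C A - ip C B"
  using ip_add_right[OF TP_diff[OF assms(1,2)] assms(2,3)] by simp

lemma ip_zero [simp]: "ip 0 B = 0"
  by (simp add: q_inner_def)

lemma ip_sum_left:
  "(\<And>i. i \<in> F \<Longrightarrow> f i \<in> TP \<tau>) \<Longrightarrow> ip (sum f F) B = (\<Sum>i\<in>F. ip (f i) B)"
  by (induction F rule: infinite_finite_induct) (simp_all add: ip_add_left TP_sum)

lemma ip_sum_right:
  assumes "\<And>i. i \<in> F \<Longrightarrow> f i \<in> TP \<tau>" "B \<in> TP \<tau>"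
  shows "ip B (sum f F) = (\<Sum>i\<in>F. ip B (f i))"
  using ip_commute[OF assms(2) TP_sum[of F f]] ip_sum_left[of F f B] ip_commute[OF assms(2) assms(1)] assms(1)
  by simp

lemma nrm_eq:
  assumes "A \<in> TP \<tau>" "finite M" "{n. A n \<noteq> 0} \<subseteq> M"
  shows "nrm A = L2_set (\<lambda>n. degree_norm n (A n)) M" and "ip A A = complex_of_real ((nrm A)\<^sup>2)"
proof -
  have *: "ip A A = complex_of_real (\<Sum>n\<in>M. (degree_norm n (A n))\<^sup>2)"
    unfolding ip_eq_sum[OF assms(2,3)] by (simp add: qdeg_self TP_D(1)[OF assms(1)])
  then show 1: "nrm A = L2_set (\<lambda>n. degree_norm n (A n)) M" by (simp add: q_norm_def L2_set_def)
  show "ip A A = complex_of_real ((nrm A)\<^sup>2)"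
    unfolding * 1 L2_set_def by (simp add: sum_nonneg)
qed

lemma ip_self: "A \<in> TP \<tau> \<Longrightarrow> ip A A = complex_of_real ((nrm A)\<^sup>2)"
  using nrm_eq(2)[of A "{n. A n \<noteq> 0}"] TP_D(2) by blast

lemma nrm_nonneg: "A \<in> TP \<tau> \<Longrightarrow> nrm A \<ge> 0"
  using nrm_eq(1)[of A "{n. A n \<noteq> 0}"] TP_D(2) by (simp add: L2_set_nonneg)

lemma nrm_triangle:
  assumes "A \<in> TP \<tau>" "B \<in> TP \<tau>" shows "nrm (A + B) \<le> nrm A + nrm B"
proof -
  obtain M where M: "finite M" "{n. A n \<noteq> 0} \<subseteq> M" "{n. B n \<noteq> 0} \<subseteq> M" "{n. (A + B) n \<noteq> 0} \<subseteq> M"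
    by (rule common_support[OF assms])
  have "nrm (A + B) = L2_set (\<lambda>n. degree_norm n ((A + B) n)) M" by (rule nrm_eq(1)[OF TP_add[OF assms] M(1,4)])
  also have "\<dots> = L2_set (\<lambda>n. degree_norm n (A n + B n)) M" by (rule L2_set_cong) simp_all
  also have "\<dots> \<le> L2_set (\<lambda>n. degree_norm n (A n) + degree_norm n (B n)) M"
    by (rule L2_set_mono) (simp_all add: degree_norm_triangle)
  also have "\<dots> \<le> L2_set (\<lambda>n. degree_norm n (A n)) M + L2_set (\<lambda>n. degree_norm n (B n)) M"
    by (rule L2_set_triangle_ineq)
  finally show ?thesis using nrm_eq(1)[OF assms(1) M(1,2)] nrm_eq(1)[OF assms(2) M(1,3)] by simp
qed

lemma nrm_minus_commute:
  assumes "A \<in> TP \<tau>" "B \<in> TP \<tau>" shows "nrm (A - B) = nrm (B - A)"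
proof -
  have "ip (A - B) (A - B) = ip (B - A) (B - A)"
    by (simp add: ip_diff_left ip_diff_right TP_diff assms)
  then show ?thesis by (simp add: q_norm_def)
qed

lemma nrm_triangle_sub:
  assumes "A \<in> TP \<tau>" "B \<in> TP \<tau>" "C \<in> TP \<tau>" shows "nrm (A - C) \<le> nrm (A - B) + nrm (B - C)"
  using nrm_triangle[OF TP_diff[OF assms(1,2)] TP_diff[OF assms(2,3)]] by simp

lemma nrm_zero [simp]: "nrm 0 = 0"
  by (simp add: q_norm_def)

lemma nrm_abs_diff:
  assumes "A \<in> TP \<tau>" "B \<in> TP \<tau>" shows "\<bar>nrm A - nrm B\<bar> \<le> nrm (A - B)"
  using nrm_triangle_sub[OF assms TP_zero] nrm_triangle_sub[OF assms(2,1) TP_zero] nrm_minus_commute[OF assms]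
  by simp

lemma nrm_pythagoras:
  assumes "A \<in> TP \<tau>" "B \<in> TP \<tau>" "ip A B = 0" shows "(nrm (A + B))\<^sup>2 = (nrm A)\<^sup>2 + (nrm B)\<^sup>2"
proof -
  have "ip B A = 0" using ip_commute[OF assms(2,1)] assms(3) by simp
  then have "ip (A + B) (A + B) = ip A A + ip B B"
    using assms by (simp add: ip_add_left ip_add_right TP_add)
  then have "complex_of_real ((nrm (A + B))\<^sup>2) = complex_of_real ((nrm A)\<^sup>2 + (nrm B)\<^sup>2)"
    by (simp add: ip_self TP_add assms)
  then show ?thesis by (simp only: of_real_eq_iff)
qed

lemma nrm_in_degree:
  assumes "X \<in> sym_tensor \<tau> n" shows "nrm (in_degree n X) = degree_norm n X"
proof -
  have "{m. in_degree n X m \<noteq> 0} \<subseteq> {n}" by (auto simp: in_degree_def)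
  from nrm_eq(1)[OF in_degree_TP[OF assms] _ this]
  have "nrm (in_degree n X) = L2_set (\<lambda>m. degree_norm m (in_degree n X m)) {n}" by (simp only: finite.emptyI finite.insertI)
  also have "\<dots> = degree_norm n X" by (simp add: in_degree_def)
  finally show ?thesis .
qed

end


section \<open>The chaos components in the Fock space\<close>

context chaos_q
begin

text \<open>For \<open>n < N\<close> the kernel is trivial, and its complement is everything; this is the reason for the case
  distinction in the decomposition theorem.\<close>

definition kernel_complement :: "nat \<Rightarrow> galg set" where
  "kernel_complement n = (if n < N then group_algebra n else group_algebra_le n N)"

lemma two_sided_ideal_group_algebra: "two_sided_ideal n (group_algebra n)"
  by (auto simp: two_sided_ideal_def group_algebra_add gmult_closed)

lemma kernel_complement_ideal: "two_sided_ideal n (kernel_complement n)"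
  by (simp add: kernel_complement_def group_algebra_le_ideal two_sided_ideal_group_algebra)

lemma kernel_complement_Int_kernel: "l \<in> kernel_complement n \<Longrightarrow> l \<in> tensor_kernel n N \<Longrightarrow> l = 0"
  using tensor_kernel_trivial[of n N l] group_algebra_le_Int_kernel[of l n N] by (auto simp: kernel_complement_def split: if_splits)

lemma kernel_complement_split:
  assumes x: "x \<in> group_algebra n" shows "\<exists>l. l \<in> kernel_complement n \<and> x - l \<in> tensor_kernel n N"
proof (cases "n < N")
  case True
  have "0 \<in> tensor_kernel n N" by (rule fvs.subspace_0[OF ideal_subspace[OF tensor_kernel_ideal]])
  then show ?thesis using x True by (intro exI[of _ x]) (simp add: kernel_complement_def)
next
  case False
  obtain k l where kl: "k \<in> tensor_kernel n N" "l \<in> group_algebra_le n N" "x = k + l"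
    by (rule group_algebra_split[OF x])
  then have "x - l = k" by simp
  then show ?thesis using kl False by (intro exI[of _ l]) (simp add: kernel_complement_def)
qed

lemma ideal_diff: "two_sided_ideal n I \<Longrightarrow> a \<in> I \<Longrightarrow> b \<in> I \<Longrightarrow> a - b \<in> I"
  by (rule fvs.subspace_diff[OF ideal_subspace])

definition complement_proj :: "nat \<Rightarrow> galg \<Rightarrow> galg" where
  "complement_proj n x = (SOME l. l \<in> kernel_complement n \<and> x - l \<in> tensor_kernel n N)"

lemma complement_proj: assumes "x \<in> group_algebra n" shows "complement_proj n x \<in> kernel_complement n" "x - complement_proj n x \<in> tensor_kernel n N"
  using someI_ex[OF kernel_complement_split[OF assms]] by (simp_all add: complement_proj_def)

lemma complement_proj_unique:
  assumes x: "x \<in> group_algebra n" and l: "l \<in> kernel_complement n" "x - l \<in> tensor_kernel n N" shows "complement_proj n x = l"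
proof -
  have "complement_proj n x - l \<in> kernel_complement n" by (rule ideal_diff[OF kernel_complement_ideal complement_proj(1)[OF x] l(1)])
  moreover have "(x - l) - (x - complement_proj n x) \<in> tensor_kernel n N"
    by (rule ideal_diff[OF tensor_kernel_ideal l(2) complement_proj(2)[OF x]])
  then have "complement_proj n x - l \<in> tensor_kernel n N" by simp
  ultimately have "complement_proj n x - l = 0" by (rule kernel_complement_Int_kernel)
  then show ?thesis by simp
qed

lemma complement_proj_diff:
  assumes "x \<in> group_algebra n" "y \<in> group_algebra n" shows "complement_proj n (x - y) = complement_proj n x - complement_proj n y"
proof (rule complement_proj_unique[OF group_algebra_diff[OF assms] ideal_diff[OF kernel_complement_ideal complement_proj(1) complement_proj(1)]])
  have "(x - complement_proj n x) - (y - complement_proj n y) \<in> tensor_kernel n N"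
    by (rule ideal_diff[OF tensor_kernel_ideal complement_proj(2)[OF assms(1)] complement_proj(2)[OF assms(2)]])
  then show "x - y - (complement_proj n x - complement_proj n y) \<in> tensor_kernel n N" by (simp add: algebra_simps)
qed (rule assms)+

text \<open>Both summands of the splitting are conjugation invariant, so the splitting commutes with
  conjugation and stays inside the centralizers.\<close>

lemma complement_proj_centralizer:
  assumes x: "x \<in> centralizer n \<pi>" shows "complement_proj n x \<in> centralizer n \<pi>"
  unfolding centralizer_def
proof (intro CollectI conjI ballI)
  have xG: "x \<in> group_algebra n" by (rule centralizer_group_algebra[OF x])
  show lG: "complement_proj n x \<in> group_algebra n" by (rule ideal_closed(1)[OF kernel_complement_ideal complement_proj(1)[OF xG]])
  fix \<sigma> assume s: "\<sigma> \<in> young_subgroup n \<pi>"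
  then have \<sigma>: "single \<sigma> \<in> group_algebra n"
    using Sym_subset_Sym0 single_in_group_algebra by (simp add: young_subgroup_def)
  have comm: "gmult n (single \<sigma>) x = gmult n x (single \<sigma>)" using x s by (simp add: centralizer_def)
  let ?d = "gmult n (single \<sigma>) (complement_proj n x) - gmult n (complement_proj n x) (single \<sigma>)"
  have "?d \<in> kernel_complement n"
    by (intro ideal_diff[OF kernel_complement_ideal] ideal_closed(3,4)[OF kernel_complement_ideal complement_proj(1)[OF xG]] \<sigma>)
  moreover have "gmult n (x - complement_proj n x) (single \<sigma>) - gmult n (single \<sigma>) (x - complement_proj n x) \<in> tensor_kernel n N"
    by (intro ideal_diff[OF tensor_kernel_ideal] ideal_closed(3,4)[OF tensor_kernel_ideal complement_proj(2)[OF xG]] \<sigma>)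
  then have "?d \<in> tensor_kernel n N" by (simp add: gmult_diff_left gmult_diff_right comm)
  ultimately have "?d = 0" by (rule kernel_complement_Int_kernel)
  then show "gmult n (single \<sigma>) (complement_proj n x) = gmult n (complement_proj n x) (single \<sigma>)" by simp
qed

definition coeff_space :: "nat \<Rightarrow> (nat \<Rightarrow> nat) \<Rightarrow> galg set" where
  "coeff_space n u = {\<eta>\<in>centralizer n (ker_partition n u). n \<ge> N \<longrightarrow> \<eta> \<in> group_algebra_le n N}"

lemma coeff_space_eq: "coeff_space n u = centralizer n (ker_partition n u) \<inter> kernel_complement n"
  using centralizer_group_algebra by (auto simp: coeff_space_def kernel_complement_def)

lemma coeff_space_subspace: "fvs.subspace (coeff_space n u)"
  unfolding coeff_space_eq by (intro fvs.subspace_inter centralizer_subspace ideal_subspace[OF kernel_complement_ideal])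

lemma coeff_space_group_algebra: "\<eta> \<in> coeff_space n u \<Longrightarrow> \<eta> \<in> group_algebra n"
  using centralizer_group_algebra[of \<eta> n "ker_partition n u"] by (simp add: coeff_space_def)

definition chaos_vec :: "nat \<Rightarrow> (nat \<Rightarrow> nat) \<Rightarrow> galg \<Rightarrow> nat \<Rightarrow> perm \<Rightarrow> 't" where
  "chaos_vec n u \<eta> = in_degree n (stensor \<tau> n \<eta> (e n u))"

lemma stensor_diff: "stensor \<tau> n (\<eta> - \<theta>) (e n u) = stensor \<tau> n \<eta> (e n u) - stensor \<tau> n \<theta> (e n u)"
  by (rule ext) (simp add: stensor_e chs.scale_left_diff_distrib chs.scale_right_diff_distrib sum_subtractf)

lemma chaos_vec_diff: "chaos_vec n u (\<eta> - \<theta>) = chaos_vec n u \<eta> - chaos_vec n u \<theta>"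
  by (simp only: chaos_vec_def stensor_diff in_degree_diff)

lemma chaos_vec_TP: "\<eta> \<in> group_algebra n \<Longrightarrow> chaos_vec n u \<eta> \<in> TP \<tau>"
  unfolding chaos_vec_def by (intro in_degree_TP stensor_sym_tensor e_mem)

lemma chaos_vec_orthogonal:
  assumes "u \<in> inc n" "w \<in> inc k" "(n, u) \<noteq> (k, w)"
    "\<eta> \<in> centralizer n (ker_partition n u)" "\<theta> \<in> centralizer k (ker_partition k w)"
  shows "ip (chaos_vec n u \<eta>) (chaos_vec k w \<theta>) = 0"
  unfolding chaos_vec_def using assms by (intro q_orthogonal) (auto simp: chaos_component_def)

text \<open>By symmetry of both arguments each permutation in the symmetrized product contributes the same
  amount, and only the coordinate of \<open>X\<close> at \<open>u\<close> enters.\<close>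

lemma qdeg_stensor:
  assumes X: "X \<in> sym_tensor \<tau> n" and \<theta>: "\<theta> \<in> group_algebra n"
  shows "qdeg q n X (stensor \<tau> n \<theta> (e n u)) = fact n * chi_form q n (coord n X u) \<theta>"
proof -
  let ?Y = "stensor \<tau> n \<theta> (e n u)"
  let ?f = "\<lambda>\<alpha> \<beta>. chi_perm q n (\<alpha> \<circ> inv \<beta>) * (coord n X u \<alpha> * cnj (\<theta> \<beta>))"
  have Y: "?Y \<in> sym_tensor \<tau> n" by (intro stensor_sym_tensor \<theta> e_mem)
  have "fact n * (\<Sum>\<alpha>\<in>Sym0 n. \<Sum>\<beta>\<in>Sym0 n. chi_perm q n (\<alpha> \<circ> inv \<beta>) * cinner (X \<alpha>) (?Y \<beta>)) =
      (\<Sum>\<alpha>\<in>Sym0 n. \<Sum>\<beta>\<in>Sym0 n. \<Sum>\<sigma>\<in>Sym n. ?f (inv \<sigma> \<circ> \<alpha> \<circ> \<sigma>) (inv \<sigma> \<circ> \<beta> \<circ> \<sigma>))"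
    unfolding sum_distrib_left
  proof (rule sum.cong[OF refl], rule sum.cong[OF refl])
    fix \<alpha> \<beta> assume \<alpha>: "\<alpha> \<in> Sym0 n" and \<beta>: "\<beta> \<in> Sym0 n"
    have h1: "cinner (X \<alpha>) (?Y \<beta>) = (\<Sum>\<sigma>\<in>Sym n. cinner (X \<alpha>) (e n (u \<circ> inv \<sigma>)) * cnj (\<theta> (inv \<sigma> \<circ> \<beta> \<circ> \<sigma>))) / fact n"
      by (simp add: stensor_e cinner_scaleC_right cinner_sum_right mult.commute)
    have h2: "chi_perm q n (\<alpha> \<circ> inv \<beta>) * (cinner (X \<alpha>) (e n (u \<circ> inv \<sigma>)) * cnj (\<theta> (inv \<sigma> \<circ> \<beta> \<circ> \<sigma>))) =
        ?f (inv \<sigma> \<circ> \<alpha> \<circ> \<sigma>) (inv \<sigma> \<circ> \<beta> \<circ> \<sigma>)" if \<sigma>: "\<sigma> \<in> Sym n" for \<sigma>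
    proof -
      note b = bij_Sym[OF \<sigma>] and s0 = Sym_subset_Sym0[OF \<sigma>]
      have \<alpha>': "inv \<sigma> \<circ> \<alpha> \<circ> \<sigma> \<in> Sym0 n" using conj_Sym0_iff[OF \<sigma>] \<alpha> by simp
      have "coord n X (u \<circ> inv \<sigma>) (\<sigma> \<circ> (inv \<sigma> \<circ> \<alpha> \<circ> \<sigma>) \<circ> inv \<sigma>) = coord n X u (inv \<sigma> \<circ> \<alpha> \<circ> \<sigma>)"
        by (rule coord_conj[OF X \<sigma> \<alpha>'])
      then have 1: "cinner (X \<alpha>) (e n (u \<circ> inv \<sigma>)) = coord n X u (inv \<sigma> \<circ> \<alpha> \<circ> \<sigma>)"
        by (simp only: comp_assoc comp_inv_simps[OF b] comp_id) (simp add: coord_def)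
      have i: "inv (inv \<sigma> \<circ> \<beta> \<circ> \<sigma>) = inv \<sigma> \<circ> inv \<beta> \<circ> \<sigma>"
        using b bij_Sym0[OF \<beta>] by (simp add: o_inv_distrib bij_imp_bij_inv bij_comp comp_inv_simps comp_assoc)
      have "chi_perm q n ((inv \<sigma> \<circ> \<alpha> \<circ> \<sigma>) \<circ> inv (inv \<sigma> \<circ> \<beta> \<circ> \<sigma>)) = chi_perm q n (inv \<sigma> \<circ> (\<alpha> \<circ> inv \<beta> \<circ> \<sigma>))"
        unfolding i by (simp only: comp_assoc comp_inv_simps[OF b])
      also have "\<dots> = chi_perm q n ((\<alpha> \<circ> inv \<beta> \<circ> \<sigma>) \<circ> inv \<sigma>)"
        by (intro chi_perm_conj N s0 Sym0_comp Sym0_inv \<alpha> \<beta>)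
      also have "\<dots> = chi_perm q n (\<alpha> \<circ> inv \<beta>)" by (simp only: comp_assoc comp_inv_simps[OF b] comp_id)
      finally show ?thesis by (simp only: 1)
    qed
    have "fact n * (chi_perm q n (\<alpha> \<circ> inv \<beta>) * cinner (X \<alpha>) (?Y \<beta>)) =
        chi_perm q n (\<alpha> \<circ> inv \<beta>) * (\<Sum>\<sigma>\<in>Sym n. cinner (X \<alpha>) (e n (u \<circ> inv \<sigma>)) * cnj (\<theta> (inv \<sigma> \<circ> \<beta> \<circ> \<sigma>)))"
      unfolding h1 by simp
    also have "\<dots> = (\<Sum>\<sigma>\<in>Sym n. chi_perm q n (\<alpha> \<circ> inv \<beta>) * (cinner (X \<alpha>) (e n (u \<circ> inv \<sigma>)) * cnj (\<theta> (inv \<sigma> \<circ> \<beta> \<circ> \<sigma>))))"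
      by (rule sum_distrib_left)
    also have "\<dots> = (\<Sum>\<sigma>\<in>Sym n. ?f (inv \<sigma> \<circ> \<alpha> \<circ> \<sigma>) (inv \<sigma> \<circ> \<beta> \<circ> \<sigma>))"
      by (rule sum.cong[OF refl h2])
    finally show "fact n * (chi_perm q n (\<alpha> \<circ> inv \<beta>) * cinner (X \<alpha>) (?Y \<beta>)) =
        (\<Sum>\<sigma>\<in>Sym n. ?f (inv \<sigma> \<circ> \<alpha> \<circ> \<sigma>) (inv \<sigma> \<circ> \<beta> \<circ> \<sigma>))" .
  qed
  also have "\<dots> = (\<Sum>\<alpha>\<in>Sym0 n. \<Sum>\<sigma>\<in>Sym n. \<Sum>\<beta>\<in>Sym0 n. ?f (inv \<sigma> \<circ> \<alpha> \<circ> \<sigma>) (inv \<sigma> \<circ> \<beta> \<circ> \<sigma>))"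
    by (rule sum.cong[OF refl]) (rule sum.swap)
  also have "\<dots> = (\<Sum>\<sigma>\<in>Sym n. \<Sum>\<alpha>\<in>Sym0 n. \<Sum>\<beta>\<in>Sym0 n. ?f (inv \<sigma> \<circ> \<alpha> \<circ> \<sigma>) (inv \<sigma> \<circ> \<beta> \<circ> \<sigma>))"
    by (rule sum.swap)
  also have "\<dots> = (\<Sum>\<sigma>\<in>Sym n. chi_form q n (coord n X u) \<theta>)"
  proof (rule sum.cong[OF refl])
    fix \<sigma> assume \<sigma>: "\<sigma> \<in> Sym n"
    have re: "(\<Sum>\<alpha>\<in>Sym0 n. g (inv \<sigma> \<circ> \<alpha> \<circ> \<sigma>)) = (\<Sum>\<alpha>\<in>Sym0 n. g \<alpha>)" for g :: "perm \<Rightarrow> complex"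
      using sum_Sym0_conj[OF Sym0_inv[OF Sym_subset_Sym0[OF \<sigma>]], of g]
      unfolding comp_inv_simps(5)[OF bij_Sym[OF \<sigma>]] .
    show "(\<Sum>\<alpha>\<in>Sym0 n. \<Sum>\<beta>\<in>Sym0 n. ?f (inv \<sigma> \<circ> \<alpha> \<circ> \<sigma>) (inv \<sigma> \<circ> \<beta> \<circ> \<sigma>)) = chi_form q n (coord n X u) \<theta>"
      unfolding chi_form_def re[of "\<lambda>\<alpha>. \<Sum>\<beta>\<in>Sym0 n. ?f \<alpha> (inv \<sigma> \<circ> \<beta> \<circ> \<sigma>)"]
      by (rule sum.cong[OF refl]) (rule re)
  qed
  finally show ?thesis unfolding qdeg_symmetric[OF X Y] by (simp add: card_Sym)
qed

lemma ip_chaos_vec_right: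
  assumes A: "A \<in> TP \<tau>" and \<theta>: "\<theta> \<in> group_algebra n"
  shows "ip A (chaos_vec n u \<theta>) = fact n * chi_form q n (coord n (A n) u) \<theta>"
proof -
  have fin: "finite (insert n {m. A m \<noteq> 0})" using TP_D(2)[OF A] by simp
  have "ip A (chaos_vec n u \<theta>) = (\<Sum>m\<in>insert n {m. A m \<noteq> 0}. if m = n then qdeg q n (A n) (stensor \<tau> n \<theta> (e n u)) else 0)"
    unfolding ip_eq_sum[OF fin subset_insertI] by (intro sum.cong refl) (simp add: chaos_vec_def in_degree_def)
  also have "\<dots> = qdeg q n (A n) (stensor \<tau> n \<theta> (e n u))" by (simp add: sum.delta[OF fin])
  finally show ?thesis using qdeg_stensor[OF TP_D(1)[OF A] \<theta>] by simp
qed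

lemma ip_chaos_vec:
  assumes u: "u \<in> inc n" and \<eta>: "\<eta> \<in> centralizer n (ker_partition n u)" and \<theta>: "\<theta> \<in> group_algebra n"
  shows "ip (chaos_vec n u \<eta>) (chaos_vec n u \<theta>) = of_nat (ymult n u) * chi_form q n \<eta> \<theta>"
proof -
  have "chaos_vec n u \<eta> n = stensor \<tau> n \<eta> (e n u)" by (simp add: chaos_vec_def in_degree_def)
  then show ?thesis
    unfolding ip_chaos_vec_right[OF chaos_vec_TP[OF centralizer_group_algebra[OF \<eta>]] \<theta>]
    by (simp add: coord_stensor_self[OF inc_tuples[OF u] \<eta>] chi_form_scale_left)
qed

lemma nrm_chaos_vec:
  assumes "u \<in> inc n" "\<eta> \<in> centralizer n (ker_partition n u)"
  shows "complex_of_real ((nrm (chaos_vec n u \<eta>))\<^sup>2) = of_nat (ymult n u) * chi q n (gmult n (gadjoint n \<eta>) \<eta>)"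
    and "(nrm (chaos_vec n u \<eta>))\<^sup>2 = real (ymult n u) / real N ^ (n + 1) * (\<Sum>g\<in>W n. \<Sum>h\<in>W n. (cmod (wsum n g h \<eta>))\<^sup>2)"
proof -
  note G = centralizer_group_algebra[OF assms(2)]
  have 1: "complex_of_real ((nrm (chaos_vec n u \<eta>))\<^sup>2) = of_nat (ymult n u) * chi_form q n \<eta> \<eta>"
    using ip_self[OF chaos_vec_TP[OF G]] ip_chaos_vec[OF assms G] by simp
  then show "complex_of_real ((nrm (chaos_vec n u \<eta>))\<^sup>2) = of_nat (ymult n u) * chi q n (gmult n (gadjoint n \<eta>) \<eta>)"
    by (simp only: chi_gadjoint_self[OF N])
  have "complex_of_real ((nrm (chaos_vec n u \<eta>))\<^sup>2) =
      complex_of_real (real (ymult n u) / real N ^ (n + 1) * (\<Sum>g\<in>W n. \<Sum>h\<in>W n. (cmod (wsum n g h \<eta>))\<^sup>2))"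
    unfolding 1 chi_form_self[OF N] by simp
  then show "(nrm (chaos_vec n u \<eta>))\<^sup>2 = real (ymult n u) / real N ^ (n + 1) * (\<Sum>g\<in>W n. \<Sum>h\<in>W n. (cmod (wsum n g h \<eta>))\<^sup>2)"
    by (simp only: of_real_eq_iff)
qed

text \<open>The word sums of an element of the kernel vanish.\<close>

lemma nrm_chaos_vec_kernel:
  assumes "u \<in> inc n" "\<eta> \<in> centralizer n (ker_partition n u)" "\<eta> \<in> tensor_kernel n N"
  shows "nrm (chaos_vec n u \<eta>) = 0"
proof -
  have "ip (chaos_vec n u \<eta>) (chaos_vec n u \<eta>) = 0"
    using ip_chaos_vec[OF assms(1,2) centralizer_group_algebra[OF assms(2)]] chi_form_kernel[OF N assms(3)] by simp
  then show ?thesis by (simp add: q_norm_def)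
qed

text \<open>The word sums of \<open>\<eta>\<close> vanish, which puts it into the kernel as well as into its complement.\<close>

lemma nrm_chaos_vec_eq_0:
  assumes "u \<in> inc n" "\<eta> \<in> coeff_space n u" "nrm (chaos_vec n u \<eta>) = 0"
  shows "\<eta> = 0"
proof -
  have \<eta>: "\<eta> \<in> centralizer n (ker_partition n u)" "\<eta> \<in> kernel_complement n" using assms(2) by (simp_all add: coeff_space_eq)
  have "(\<Sum>g\<in>W n. \<Sum>h\<in>W n. (cmod (wsum n g h \<eta>))\<^sup>2) = 0"
    using nrm_chaos_vec(2)[OF assms(1) \<eta>(1)] assms(3) N partition_fact_pos[of "ker_partition n u"] by simp
  then have "\<forall>g\<in>W n. (\<Sum>h\<in>W n. (cmod (wsum n g h \<eta>))\<^sup>2) = 0"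
    by (subst (asm) sum_nonneg_eq_0_iff) (auto intro: sum_nonneg)
  then have "wsum n g h \<eta> = 0" if "g \<in> W n" "h \<in> W n" for g h
    using that sum_nonneg_eq_0_iff[of "W n" "\<lambda>h. (cmod (wsum n g h \<eta>))\<^sup>2"] by simp
  then have "\<eta> \<in> tensor_kernel n N" by (rule tensor_kernel_words[OF centralizer_group_algebra[OF \<eta>(1)]])
  then show ?thesis by (rule kernel_complement_Int_kernel[OF \<eta>(2)])
qed

text \<open>Completeness of a component: its elements depend linearly, hence continuously, on the finitely
  many word sums, by means of a linear left inverse.\<close>

lemma chaos_vec_complete:
  assumes u: "u \<in> inc n" and \<eta>: "\<And>k. \<eta> k \<in> coeff_space n u"
    and Cau: "\<And>\<epsilon>. \<epsilon> > 0 \<Longrightarrow> \<exists>M. \<forall>j\<ge>M. \<forall>k\<ge>M. nrm (chaos_vec n u (\<eta> j - \<eta> k)) < \<epsilon>"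
  shows "\<exists>\<theta>\<in>coeff_space n u. (\<lambda>k. nrm (chaos_vec n u (\<eta> k - \<theta>))) \<longlonglongrightarrow> 0"
proof -
  define S :: "galg \<Rightarrow> (nat \<Rightarrow> nat) \<times> (nat \<Rightarrow> nat) \<Rightarrow> complex"
    where "S a = (\<lambda>p. if p \<in> W n \<times> W n then wsum n (fst p) (snd p) a else 0)" for a
  let ?D = "\<lambda>p :: (nat \<Rightarrow> nat) \<times> (nat \<Rightarrow> nat). \<lambda>p'. if p' = p then 1 else (0::complex)"
  let ?c = "real (ymult n u) / real N ^ (n + 1)"
  have c: "?c > 0" using N partition_fact_pos[of "ker_partition n u"] by simp
  have lin: "Vector_Spaces.linear fscale fscale S"
    unfolding Vector_Spaces.linear_iff
  proof (intro conjI allI)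
    show "S (x + y) = S x + S y" for x y by (rule ext) (simp add: S_def wsum_add)
    show "S (fscale r x) = fscale r (S x)" for r x by (rule ext) (simp add: S_def wsum_scale)
  qed (rule fvs.vector_space_axioms)+
  interpret vp: vector_space_pair "fscale :: complex \<Rightarrow> galg \<Rightarrow> galg"
    "fscale :: complex \<Rightarrow> ((nat \<Rightarrow> nat) \<times> (nat \<Rightarrow> nat) \<Rightarrow> complex) \<Rightarrow> _" ..
  have inj: "inj_on S (coeff_space n u)"
  proof (rule inj_onI)
    fix a b assume a: "a \<in> coeff_space n u" and b: "b \<in> coeff_space n u" and S: "S a = S b"
    have d: "a - b \<in> coeff_space n u" by (rule fvs.subspace_diff[OF coeff_space_subspace a b])
    have "wsum n g h (a - b) = 0" if "g \<in> W n" "h \<in> W n" for g h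
      using fun_cong[OF S, of "(g, h)"] that by (simp add: S_def wsum_diff)
    then have "a - b \<in> tensor_kernel n N" by (rule tensor_kernel_words[OF coeff_space_group_algebra[OF d]])
    moreover have "a - b \<in> kernel_complement n" using d by (simp add: coeff_space_eq)
    ultimately have "a - b = 0" by (intro kernel_complement_Int_kernel)
    then show "a = b" by simp
  qed
  obtain G where G: "range G \<subseteq> coeff_space n u" "Vector_Spaces.linear fscale fscale G" "\<And>a. a \<in> coeff_space n u \<Longrightarrow> G (S a) = a"
    using vp.linear_exists_left_inverse_on[OF lin coeff_space_subspace inj] by blast
  interpret G: Vector_Spaces.linear "fscale :: complex \<Rightarrow> ((nat \<Rightarrow> nat) \<times> (nat \<Rightarrow> nat) \<Rightarrow> complex) \<Rightarrow> _" fscale G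
    by (rule G(2))
  have G_expand: "G s \<alpha> = (\<Sum>p\<in>W n \<times> W n. s p * G (?D p) \<alpha>)" if s: "\<And>p. p \<notin> W n \<times> W n \<Longrightarrow> s p = 0" for s \<alpha>
  proof -
    have "s = (\<Sum>p\<in>W n \<times> W n. fscale (s p) (?D p))"
    proof
      fix p
      have "(\<Sum>p\<in>W n \<times> W n. fscale (s p) (?D p)) p = (\<Sum>p'\<in>W n \<times> W n. if p = p' then s p' else 0)"
        unfolding sum_fun_apply by (intro sum.cong) auto
      also have "\<dots> = s p" using s[of p] by simp
      finally show "s p = (\<Sum>p\<in>W n \<times> W n. fscale (s p) (?D p)) p" ..
    qed
    from arg_cong[OF this, of G] have "G s = (\<Sum>p\<in>W n \<times> W n. fscale (s p) (G (?D p)))"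
      unfolding G.sum G.scale .
    then show ?thesis by (simp add: sum_fun_apply)
  qed
  have conv: "\<exists>l. (\<lambda>k. S (\<eta> k) p) \<longlonglongrightarrow> l" for p
  proof (cases "p \<in> W n \<times> W n")
    case True
    then obtain g h where p: "p = (g, h)" "g \<in> W n" "h \<in> W n" by auto
    have le: "sqrt ?c * cmod (wsum n g h a) \<le> nrm (chaos_vec n u a)" if a: "a \<in> coeff_space n u" for a
    proof (rule power2_le_imp_le)
      have "(cmod (wsum n g h a))\<^sup>2 \<le> (\<Sum>h\<in>W n. (cmod (wsum n g h a))\<^sup>2)"
        using p(3) by (intro member_le_sum) auto
      also have "\<dots> \<le> (\<Sum>g\<in>W n. \<Sum>h\<in>W n. (cmod (wsum n g h a))\<^sup>2)"
        using p(2) by (intro member_le_sum[of g "W n" "\<lambda>g. \<Sum>h\<in>W n. (cmod (wsum n g h a))\<^sup>2"]) (auto intro: sum_nonneg)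
      finally have b: "(cmod (wsum n g h a))\<^sup>2 \<le> (\<Sum>g\<in>W n. \<Sum>h\<in>W n. (cmod (wsum n g h a))\<^sup>2)" .
      have "a \<in> centralizer n (ker_partition n u)" using a by (simp add: coeff_space_eq)
      note e2 = nrm_chaos_vec(2)[OF u this]
      have "(sqrt ?c * cmod (wsum n g h a))\<^sup>2 = ?c * (cmod (wsum n g h a))\<^sup>2"
        by (simp only: power_mult_distrib real_sqrt_pow2[OF less_imp_le[OF c]])
      also have "\<dots> \<le> (nrm (chaos_vec n u a))\<^sup>2"
        unfolding e2 by (rule mult_left_mono[OF b less_imp_le[OF c]])
      finally show "(sqrt ?c * cmod (wsum n g h a))\<^sup>2 \<le> (nrm (chaos_vec n u a))\<^sup>2" .
      show "0 \<le> nrm (chaos_vec n u a)" by (rule nrm_nonneg[OF chaos_vec_TP[OF coeff_space_group_algebra[OF a]]])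
    qed
    have "Cauchy (\<lambda>k. S (\<eta> k) p)"
    proof (rule metric_CauchyI)
      fix \<epsilon> :: real assume "\<epsilon> > 0"
      then have "sqrt ?c * \<epsilon> > 0" using c by (simp only: mult_pos_pos real_sqrt_gt_0_iff)
      then obtain M where M: "\<forall>j\<ge>M. \<forall>k\<ge>M. nrm (chaos_vec n u (\<eta> j - \<eta> k)) < sqrt ?c * \<epsilon>" using Cau by blast
      have "dist (S (\<eta> j) p) (S (\<eta> k) p) < \<epsilon>" if "j \<ge> M" "k \<ge> M" for j k
      proof -
        have "sqrt ?c * cmod (wsum n g h (\<eta> j - \<eta> k)) < sqrt ?c * \<epsilon>"
          using le[OF fvs.subspace_diff[OF coeff_space_subspace \<eta> \<eta>]] M that by (meson le_less_trans)
        then have "cmod (wsum n g h (\<eta> j - \<eta> k)) < \<epsilon>"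
          by (rule mult_left_less_imp_less) (use c in \<open>simp only: real_sqrt_ge_0_iff less_imp_le\<close>)
        then show ?thesis using True p by (simp add: S_def dist_norm wsum_diff)
      qed
      then show "\<exists>M. \<forall>j\<ge>M. \<forall>k\<ge>M. dist (S (\<eta> j) p) (S (\<eta> k) p) < \<epsilon>" by blast
    qed
    then show ?thesis using Cauchy_convergent convergent_def by blast
  next
    case False
    then have "(\<lambda>k. S (\<eta> k) p) = (\<lambda>_. 0)" by (simp add: S_def)
    then show ?thesis using tendsto_const by metis
  qed
  then obtain s where s: "\<And>p. (\<lambda>k. S (\<eta> k) p) \<longlonglongrightarrow> s p" by metis
  have s0: "s p = 0" if "p \<notin> W n \<times> W n" for p
  proof -
    have "(\<lambda>k. S (\<eta> k) p) = (\<lambda>_. 0)" using that by (simp add: S_def)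
    then show ?thesis using s[of p] LIMSEQ_unique[OF _ tendsto_const] by metis
  qed
  have \<theta>: "G s \<in> coeff_space n u" using G(1) by blast
  have pt: "(\<lambda>k. \<eta> k \<alpha>) \<longlonglongrightarrow> G s \<alpha>" for \<alpha>
  proof -
    have "\<eta> k \<alpha> = (\<Sum>p\<in>W n \<times> W n. S (\<eta> k) p * G (?D p) \<alpha>)" for k
      using G_expand[of "S (\<eta> k)" \<alpha>] G(3)[OF \<eta>] by (simp add: S_def)
    moreover have "(\<lambda>k. \<Sum>p\<in>W n \<times> W n. S (\<eta> k) p * G (?D p) \<alpha>) \<longlonglongrightarrow> G s \<alpha>"
    proof -
      have "G s \<alpha> = (\<Sum>p\<in>W n \<times> W n. s p * G (?D p) \<alpha>)" by (rule G_expand) (rule s0)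
      then show ?thesis by (simp only:) (intro tendsto_intros s)
    qed
    ultimately show ?thesis by simp
  qed
  have "(\<lambda>k. (nrm (chaos_vec n u (\<eta> k - G s)))\<^sup>2) \<longlonglongrightarrow> 0"
  proof -
    have lim: "(\<lambda>k. wsum n g h (\<eta> k - G s)) \<longlonglongrightarrow> 0" for g h :: "nat \<Rightarrow> nat"
    proof -
      have "(\<lambda>k. \<Sum>\<alpha>\<in>fiber n g h. \<eta> k \<alpha> - G s \<alpha>) \<longlonglongrightarrow> (\<Sum>\<alpha>\<in>fiber n g h. G s \<alpha> - G s \<alpha>)"
        by (intro tendsto_intros pt)
      then show ?thesis by (simp add: wsum_def)
    qed
    have "(\<lambda>k. ?c * (\<Sum>g\<in>W n. \<Sum>h\<in>W n. (cmod (wsum n g h (\<eta> k - G s)))\<^sup>2)) \<longlonglongrightarrow>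
        ?c * (\<Sum>g\<in>W n. \<Sum>h\<in>W n. (cmod 0)\<^sup>2)"
      by (intro tendsto_intros lim)
    moreover have "(nrm (chaos_vec n u (\<eta> k - G s)))\<^sup>2 = ?c * (\<Sum>g\<in>W n. \<Sum>h\<in>W n. (cmod (wsum n g h (\<eta> k - G s)))\<^sup>2)" for k
    proof -
      have "\<eta> k - G s \<in> centralizer n (ker_partition n u)"
        using fvs.subspace_diff[OF coeff_space_subspace \<eta> \<theta>] by (simp only: coeff_space_eq Int_iff)
      then show ?thesis by (rule nrm_chaos_vec(2)[OF u])
    qed
    ultimately show ?thesis by simp
  qed
  then have "(\<lambda>k. sqrt ((nrm (chaos_vec n u (\<eta> k - G s)))\<^sup>2)) \<longlonglongrightarrow> sqrt 0" by (rule tendsto_real_sqrt)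
  moreover have "nrm (chaos_vec n u (\<eta> k - G s)) \<ge> 0" for k
    by (rule nrm_nonneg[OF chaos_vec_TP[OF coeff_space_group_algebra[OF fvs.subspace_diff[OF coeff_space_subspace \<eta> \<theta>]]]])
  ultimately show ?thesis using \<theta> by auto
qed

end


section \<open>Orthogonal projection onto finitely many chaos components\<close>

context chaos_q
begin

abbreviation "I \<equiv> Sigma UNIV inc"

definition admissible :: "(nat \<Rightarrow> (nat \<Rightarrow> nat) \<Rightarrow> galg) \<Rightarrow> bool" where
  "admissible \<eta> \<longleftrightarrow> (\<forall>i\<in>I. \<eta> (fst i) (snd i) \<in> coeff_space (fst i) (snd i))"

text \<open>Index pairs \<open>(n, u)\<close> are taken apart with projections, so that families of coefficients can be
  summed over sets of pairs.\<close>

definition family_vec :: "(nat \<Rightarrow> (nat \<Rightarrow> nat) \<Rightarrow> galg) \<Rightarrow> nat \<times> (nat \<Rightarrow> nat) \<Rightarrow> nat \<Rightarrow> perm \<Rightarrow> 't" where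
  "family_vec \<eta> i = chaos_vec (fst i) (snd i) (\<eta> (fst i) (snd i))"

lemma admissibleD:
  assumes "admissible \<eta>" "i \<in> I"
  shows "snd i \<in> inc (fst i)" "\<eta> (fst i) (snd i) \<in> coeff_space (fst i) (snd i)"
    "\<eta> (fst i) (snd i) \<in> centralizer (fst i) (ker_partition (fst i) (snd i))"
    "\<eta> (fst i) (snd i) \<in> group_algebra (fst i)"
proof -
  show c: "\<eta> (fst i) (snd i) \<in> coeff_space (fst i) (snd i)" using assms by (simp only: admissible_def)
  show "\<eta> (fst i) (snd i) \<in> centralizer (fst i) (ker_partition (fst i) (snd i))" using c by (simp add: coeff_space_eq)
  show "\<eta> (fst i) (snd i) \<in> group_algebra (fst i)" by (rule coeff_space_group_algebra[OF c])
qed (use assms(2) in auto)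

lemma admissible_diff:
  assumes "admissible \<eta>" "admissible \<theta>" shows "admissible (\<lambda>n u. \<eta> n u - \<theta> n u)"
  unfolding admissible_def
  by (intro ballI fvs.subspace_diff[OF coeff_space_subspace] admissibleD[OF assms(1)] admissibleD[OF assms(2)])

lemma family_vec_TP: "admissible \<eta> \<Longrightarrow> i \<in> I \<Longrightarrow> family_vec \<eta> i \<in> TP \<tau>"
  unfolding family_vec_def by (intro chaos_vec_TP admissibleD)

lemma family_vec_sum_TP: "admissible \<eta> \<Longrightarrow> F \<subseteq> I \<Longrightarrow> sum (family_vec \<eta>) F \<in> TP \<tau>"
  using family_vec_TP by (intro TP_sum) blast

lemma family_vec_diff: "family_vec (\<lambda>n u. \<eta> n u - \<theta> n u) i = family_vec \<eta> i - family_vec \<theta> i"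
  unfolding family_vec_def by (rule chaos_vec_diff)

lemma family_vec_sum_diff: "sum (family_vec (\<lambda>n u. \<eta> n u - \<theta> n u)) F = sum (family_vec \<eta>) F - sum (family_vec \<theta>) F"
  by (rule trans[OF sum.cong[OF refl family_vec_diff] sum_subtractf])

lemma family_vec_orthogonal:
  assumes "admissible \<eta>" "admissible \<theta>" "i \<in> I" "j \<in> I" "i \<noteq> j"
  shows "ip (family_vec \<eta> i) (family_vec \<theta> j) = 0"
  unfolding family_vec_def
proof (rule chaos_vec_orthogonal)
  show "(fst i, snd i) \<noteq> (fst j, snd j)" using assms(5) by simp
qed (use admissibleD[OF assms(1,3)] admissibleD[OF assms(2,4)] in simp_all)

lemma nrm_family_vec_sum:
  assumes "finite F" "F \<subseteq> I" and \<eta>: "admissible \<eta>"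
  shows "(nrm (sum (family_vec \<eta>) F))\<^sup>2 = (\<Sum>i\<in>F. (nrm (family_vec \<eta> i))\<^sup>2)"
  using assms(1,2)
proof (induction F)
  case (insert i F)
  have F: "F \<subseteq> I" "i \<in> I" using insert.prems by simp_all
  have "ip (family_vec \<eta> i) (sum (family_vec \<eta>) F) = (\<Sum>j\<in>F. ip (family_vec \<eta> i) (family_vec \<eta> j))"
    using F by (intro ip_sum_right family_vec_TP \<eta>) auto
  also have "\<dots> = 0"
    using F insert.hyps by (intro sum.neutral ballI family_vec_orthogonal \<eta>) auto
  finally have "ip (family_vec \<eta> i) (sum (family_vec \<eta>) F) = 0" .
  then have "(nrm (family_vec \<eta> i + sum (family_vec \<eta>) F))\<^sup>2 = (nrm (family_vec \<eta> i))\<^sup>2 + (nrm (sum (family_vec \<eta>) F))\<^sup>2"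
    by (intro nrm_pythagoras family_vec_TP family_vec_sum_TP \<eta> F)
  then show ?case by (simp only: sum.insert[OF insert.hyps(1,2)] insert.IH[OF F(1)])
qed simp

lemma nrm_family_vec_le:
  assumes "finite F" "F \<subseteq> I" "admissible \<eta>" "i \<in> F"
  shows "nrm (family_vec \<eta> i) \<le> nrm (sum (family_vec \<eta>) F)"
proof (rule power2_le_imp_le)
  show "(nrm (family_vec \<eta> i))\<^sup>2 \<le> (nrm (sum (family_vec \<eta>) F))\<^sup>2"
    unfolding nrm_family_vec_sum[OF assms(1-3)] using assms(1,4) by (intro member_le_sum) auto
  show "0 \<le> nrm (sum (family_vec \<eta>) F)" by (intro nrm_nonneg family_vec_sum_TP assms)
qed

text \<open>The coefficients of the orthogonal projection of \<open>A\<close>: first the component in the sense of the Hilbert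
  norm, then its representative modulo null vectors.\<close>

definition proj_coeff :: "(nat \<Rightarrow> perm \<Rightarrow> 't) \<Rightarrow> nat \<Rightarrow> (nat \<Rightarrow> nat) \<Rightarrow> galg" where
  "proj_coeff A n u = complement_proj n (comp_coeff n (A n) u)"

lemma proj_coeff_admissible: assumes A: "A \<in> TP \<tau>" shows "admissible (proj_coeff A)"
  unfolding admissible_def proj_coeff_def coeff_space_eq
proof (intro ballI IntI)
  fix i assume "i \<in> I"
  then have *: "comp_coeff (fst i) (A (fst i)) (snd i) \<in> centralizer (fst i) (ker_partition (fst i) (snd i))"
    by (intro comp_coeff_centralizer TP_D(1)[OF A] inc_tuples) auto
  show "complement_proj (fst i) (comp_coeff (fst i) (A (fst i)) (snd i)) \<in> centralizer (fst i) (ker_partition (fst i) (snd i))"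
    by (rule complement_proj_centralizer[OF *])
  show "complement_proj (fst i) (comp_coeff (fst i) (A (fst i)) (snd i)) \<in> kernel_complement (fst i)"
    by (rule complement_proj(1)[OF centralizer_group_algebra[OF *]])
qed

lemma proj_coeff_diff:
  assumes "A \<in> TP \<tau>" "B \<in> TP \<tau>" "u \<in> inc n"
  shows "proj_coeff (A - B) n u = proj_coeff A n u - proj_coeff B n u"
proof -
  have "comp_coeff n ((A - B) n) u = comp_coeff n (A n) u - comp_coeff n (B n) u"
  proof -
    have "(A - B) n = A n - B n" by simp
    then show ?thesis unfolding comp_coeff_def by (simp only: coord_diff fvs.scale_right_diff_distrib)
  qed
  then show ?thesis
    unfolding proj_coeff_def
    by (simp only:) (intro complement_proj_diff centralizer_group_algebra[OF comp_coeff_centralizer] TP_D inc_tuples assms)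
qed

text \<open>Passing to the representative modulo the kernel does not change inner products, and the
  normalizing factors \<open>n!\<close> and \<open>ker(u)!\<close> cancel.\<close>

lemma ip_proj_coeff:
  assumes A: "A \<in> TP \<tau>" and i: "i \<in> I" and \<theta>: "admissible \<theta>"
  shows "ip A (family_vec \<theta> i) = ip (family_vec (proj_coeff A) i) (family_vec \<theta> i)"
proof -
  obtain n u where nu: "i = (n, u)" "u \<in> inc n" using i by auto
  let ?\<theta> = "\<theta> n u" and ?c = "comp_coeff n (A n) u"
  have \<theta>G: "?\<theta> \<in> group_algebra n" using admissibleD(4)[OF \<theta> i] nu by simp
  have P: "proj_coeff A n u \<in> centralizer n (ker_partition n u)" using admissibleD(3)[OF proj_coeff_admissible[OF A] i] nu by simp
  have G: "?c \<in> group_algebra n"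
    by (intro centralizer_group_algebra[OF comp_coeff_centralizer] TP_D(1)[OF A] inc_tuples nu(2))
  have "chi_form q n (?c - proj_coeff A n u) ?\<theta> = 0"
    unfolding proj_coeff_def by (rule chi_form_kernel[OF N complement_proj(2)[OF G]])
  then have "chi_form q n (proj_coeff A n u) ?\<theta> = chi_form q n ?c ?\<theta>" by (simp only: chi_form_diff_left right_minus_eq)
  moreover have "chi_form q n ?c ?\<theta> = fact n / of_nat (ymult n u) * chi_form q n (coord n (A n) u) ?\<theta>"
    by (simp only: comp_coeff_def chi_form_scale_left)
  ultimately have "of_nat (ymult n u) * chi_form q n (proj_coeff A n u) ?\<theta> = fact n * chi_form q n (coord n (A n) u) ?\<theta>"
    using partition_fact_pos[of "ker_partition n u"] by simp
  then show ?thesis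
    using ip_chaos_vec_right[OF A \<theta>G, of u] ip_chaos_vec[OF nu(2) P \<theta>G] nu(1) by (simp add: family_vec_def)
qed

lemma ip_proj_coeff_residual:
  assumes A: "A \<in> TP \<tau>" and F: "finite F" "F \<subseteq> I" and \<theta>: "admissible \<theta>"
  shows "ip (A - sum (family_vec (proj_coeff A)) F) (sum (family_vec \<theta>) F) = 0"
proof -
  note P = proj_coeff_admissible[OF A]
  have "ip (A - sum (family_vec (proj_coeff A)) F) (family_vec \<theta> i) = 0" if i: "i \<in> F" for i
  proof -
    have "ip (sum (family_vec (proj_coeff A)) F) (family_vec \<theta> i) = (\<Sum>j\<in>F. ip (family_vec (proj_coeff A) j) (family_vec \<theta> i))"
      using F by (intro ip_sum_left family_vec_TP P) auto
    also have "\<dots> = (\<Sum>j\<in>F. if j = i then ip (family_vec (proj_coeff A) i) (family_vec \<theta> i) else 0)"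
    proof (rule sum.cong[OF refl])
      fix j assume j: "j \<in> F"
      have "i \<in> I" "j \<in> I" using F(2) i j by blast+
      then show "ip (family_vec (proj_coeff A) j) (family_vec \<theta> i) = (if j = i then ip (family_vec (proj_coeff A) i) (family_vec \<theta> i) else 0)"
        by (cases "j = i") (simp_all only: if_True if_False family_vec_orthogonal[OF P \<theta>] not_False_eq_True simp_thms)
    qed
    also have "\<dots> = ip (family_vec (proj_coeff A) i) (family_vec \<theta> i)" using F(1) i by simp
    finally show ?thesis
      using ip_proj_coeff[OF A _ \<theta>, of i] F(2) i ip_diff_left[OF A family_vec_sum_TP[OF P F(2)]] by auto
  qed
  then have "(\<Sum>i\<in>F. ip (A - sum (family_vec (proj_coeff A)) F) (family_vec \<theta> i)) = 0" by (intro sum.neutral ballI)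
  moreover have "ip (A - sum (family_vec (proj_coeff A)) F) (sum (family_vec \<theta>) F) = (\<Sum>i\<in>F. ip (A - sum (family_vec (proj_coeff A)) F) (family_vec \<theta> i))"
    using F(2) by (intro ip_sum_right family_vec_TP \<theta> TP_diff A family_vec_sum_TP P) auto
  ultimately show ?thesis by simp
qed

lemma proj_coeff_pythagoras:
  assumes A: "A \<in> TP \<tau>" and F: "finite F" "F \<subseteq> I" and \<theta>: "admissible \<theta>"
  shows "(nrm (A - sum (family_vec \<theta>) F))\<^sup>2 =
    (nrm (A - sum (family_vec (proj_coeff A)) F))\<^sup>2 + (nrm (sum (family_vec (proj_coeff A)) F - sum (family_vec \<theta>) F))\<^sup>2"
proof -
  note P = proj_coeff_admissible[OF A]
  have "ip (A - sum (family_vec (proj_coeff A)) F) (sum (family_vec (proj_coeff A)) F - sum (family_vec \<theta>) F) = 0"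
    unfolding family_vec_sum_diff[symmetric] by (rule ip_proj_coeff_residual[OF A F admissible_diff[OF P \<theta>]])
  from nrm_pythagoras[OF _ _ this] show ?thesis
    by (simp add: TP_diff A family_vec_sum_TP P \<theta> F(2))
qed

lemma proj_coeff_best:
  assumes "A \<in> TP \<tau>" "finite F" "F \<subseteq> I" "admissible \<theta>"
  shows "nrm (A - sum (family_vec (proj_coeff A)) F) \<le> nrm (A - sum (family_vec \<theta>) F)"
  by (rule power2_le_imp_le)
    (use proj_coeff_pythagoras[OF assms] in \<open>simp_all add: nrm_nonneg TP_diff family_vec_sum_TP assms\<close>)

lemma family_vec_zero: "family_vec (\<lambda>n u. 0) i = 0"
  using family_vec_diff[of "\<lambda>n u. 0" "\<lambda>n u. 0" i] by simp

lemma admissible_zero: "admissible (\<lambda>n u. 0)"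
  by (simp add: admissible_def fvs.subspace_0[OF coeff_space_subspace])

lemma proj_coeff_bessel:
  assumes A: "A \<in> TP \<tau>" and F: "finite F" "F \<subseteq> I"
  shows "nrm (sum (family_vec (proj_coeff A)) F) \<le> nrm A"
proof (rule power2_le_imp_le)
  have "sum (family_vec (\<lambda>n u. 0)) F = 0" by (intro sum.neutral ballI family_vec_zero)
  then show "(nrm (sum (family_vec (proj_coeff A)) F))\<^sup>2 \<le> (nrm A)\<^sup>2"
    using proj_coeff_pythagoras[OF A F admissible_zero] by simp
qed (rule nrm_nonneg[OF A])

lemma proj_coeff_mono:
  assumes A: "A \<in> TP \<tau>" and "finite G" "F \<subseteq> G" "G \<subseteq> I"
  shows "nrm (A - sum (family_vec (proj_coeff A)) G) \<le> nrm (A - sum (family_vec (proj_coeff A)) F)"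
proof -
  define \<theta> where "\<theta> n u = (if (n, u) \<in> F then proj_coeff A n u else 0)" for n u
  have \<theta>: "admissible \<theta>"
    using proj_coeff_admissible[OF A] fvs.subspace_0[OF coeff_space_subspace] by (auto simp: admissible_def \<theta>_def)
  have "sum (family_vec \<theta>) G = sum (family_vec (proj_coeff A)) F"
  proof (rule sum.mono_neutral_cong_right[OF assms(2,3)])
    show "\<forall>i\<in>G - F. family_vec \<theta> i = 0" using family_vec_zero by (auto simp: \<theta>_def family_vec_def)
    show "family_vec \<theta> i = family_vec (proj_coeff A) i" if "i \<in> F" for i using that by (simp add: \<theta>_def family_vec_def)
  qed
  then show ?thesis using proj_coeff_best[OF A assms(2,4) \<theta>] by simp
qed

lemma nrm_sum: "(\<And>i. i \<in> F \<Longrightarrow> f i \<in> TP \<tau>) \<Longrightarrow> nrm (sum f F) \<le> (\<Sum>i\<in>F. nrm (f i))"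
proof (induction F rule: infinite_finite_induct)
  case (insert i F)
  have "nrm (f i + sum f F) \<le> nrm (f i) + nrm (sum f F)"
    by (intro nrm_triangle TP_sum insert.prems) simp_all
  moreover have "nrm (sum f F) \<le> (\<Sum>i\<in>F. nrm (f i))" by (intro insert.IH insert.prems) simp
  ultimately show ?case unfolding sum.insert[OF insert.hyps(1,2)] by linarith
qed simp_all

text \<open>The Hilbert norm dominates the \<open>q\<close>-norm on a fixed degree, so that the approximation of symmetric
  tensors carries over; the passage to representatives costs nothing.\<close>

lemma proj_coeff_density_degree:
  assumes X: "X \<in> sym_tensor \<tau> n" and A: "A \<in> TP \<tau>" "A n = X" and "\<epsilon> > 0"
  obtains F where "finite F" "F \<subseteq> inc n" "nrm (in_degree n X - (\<Sum>u\<in>F. chaos_vec n u (proj_coeff A n u))) < \<epsilon>"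
proof -
  obtain K where K: "\<And>X :: perm \<Rightarrow> 't. degree_norm n X \<le> K * (\<Sum>\<alpha>\<in>Sym0 n. norm (X \<alpha>))" using degree_norm_le by blast
  \<comment> \<open>The summand \<open>1\<close> keeps the denominator positive when \<open>K = 0\<close>.\<close>
  let ?d = "\<epsilon> / (\<bar>K\<bar> * real (card (Sym0 n)) + 1)"
  have den: "\<bar>K\<bar> * real (card (Sym0 n)) + 1 > 0" by (simp add: add_nonneg_pos)
  then have "?d > 0" using \<open>\<epsilon> > 0\<close> by simp
  then obtain F where F: "finite F" "F \<subseteq> inc n"
    and G: "\<And>G. finite G \<Longrightarrow> F \<subseteq> G \<Longrightarrow> G \<subseteq> inc n \<Longrightarrow>
      alg_tensor_norm n (X - (\<Sum>u\<in>G. component n X u)) < ?d"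
    by (rule comp_sum_approx[OF X]) (rule that)
  note lt = G[OF F(1) order_refl F(2)]
  let ?S = "\<Sum>u\<in>F. component n X u" and ?c = "\<lambda>u. comp_coeff n X u"
  have u: "u \<in> inc n" "?c u \<in> centralizer n (ker_partition n u)" "?c u \<in> group_algebra n" if "u \<in> F" for u
  proof -
    show u: "u \<in> inc n" using that F(2) by blast
    show c: "?c u \<in> centralizer n (ker_partition n u)" by (rule comp_coeff_centralizer[OF X inc_tuples[OF u]])
    show "?c u \<in> group_algebra n" by (rule centralizer_group_algebra[OF c])
  qed
  have S: "?S \<in> sym_tensor \<tau> n" by (intro sym_tensor_sum stensor_sym_tensor u e_mem)
  note XS = sym_tensor_diff[OF X S]
  have "nrm (in_degree n X - in_degree n ?S) = degree_norm n (X - ?S)"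
    unfolding in_degree_diff[symmetric] by (rule nrm_in_degree[OF XS])
  also have "\<dots> \<le> K * (\<Sum>\<alpha>\<in>Sym0 n. norm ((X - ?S) \<alpha>))" by (rule K)
  also have "\<dots> \<le> \<bar>K\<bar> * (\<Sum>\<alpha>\<in>Sym0 n. norm ((X - ?S) \<alpha>))" by (intro mult_right_mono sum_nonneg) simp_all
  also have "\<dots> \<le> \<bar>K\<bar> * (\<Sum>\<alpha>\<in>Sym0 n. ?d)"
    using lt by (intro mult_left_mono sum_mono order_trans[OF norm_le_alg_tensor_norm less_imp_le[OF lt]]) simp_all
  also have "\<dots> = ?d * (\<bar>K\<bar> * real (card (Sym0 n)))" by (simp only: sum_constant mult_ac)
  also have "\<dots> < ?d * (\<bar>K\<bar> * real (card (Sym0 n)) + 1)" by (rule mult_strict_left_mono[OF _ \<open>?d > 0\<close>]) simp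
  also have "\<dots> = \<epsilon>" using den by simp
  finally have 1: "nrm (in_degree n X - in_degree n ?S) < \<epsilon>" .
  have eq: "in_degree n ?S = (\<Sum>u\<in>F. chaos_vec n u (?c u))" unfolding in_degree_sum chaos_vec_def ..
  have P: "(n, u) \<in> I" "proj_coeff A n u = complement_proj n (?c u)" if "u \<in> F" for u
    using u[OF that] A(2) by (simp_all add: proj_coeff_def)
  have TPd: "chaos_vec n u (?c u - complement_proj n (?c u)) \<in> TP \<tau>" if "u \<in> F" for u
    by (intro chaos_vec_TP group_algebra_diff u[OF that] ideal_closed(1)[OF kernel_complement_ideal complement_proj(1)])
  have "nrm ((\<Sum>u\<in>F. chaos_vec n u (?c u)) - (\<Sum>u\<in>F. chaos_vec n u (proj_coeff A n u))) =
      nrm (\<Sum>u\<in>F. chaos_vec n u (?c u - complement_proj n (?c u)))"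
    unfolding sum_subtractf[symmetric] chaos_vec_diff using P(2) by (intro arg_cong[of _ _ nrm] sum.cong) simp_all
  also have "\<dots> \<le> (\<Sum>u\<in>F. nrm (chaos_vec n u (?c u - complement_proj n (?c u))))" by (rule nrm_sum[OF TPd])
  also have "\<dots> = 0"
  proof (intro sum.neutral ballI nrm_chaos_vec_kernel)
    fix w assume w: "w \<in> F"
    show "w \<in> inc n" by (rule u(1)[OF w])
    show "?c w - complement_proj n (?c w) \<in> centralizer n (ker_partition n w)"
      by (intro fvs.subspace_diff[OF centralizer_subspace] complement_proj_centralizer u(2)[OF w])
    show "?c w - complement_proj n (?c w) \<in> tensor_kernel n N" by (rule complement_proj(2)[OF u(3)[OF w]])
  qed
  finally have 2: "nrm ((\<Sum>u\<in>F. chaos_vec n u (?c u)) - (\<Sum>u\<in>F. chaos_vec n u (proj_coeff A n u))) \<le> 0" .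
  have PT: "chaos_vec n u (proj_coeff A n u) \<in> TP \<tau>" if "u \<in> F" for u
    using family_vec_TP[OF proj_coeff_admissible[OF A(1)] P(1)[OF that]] by (simp add: family_vec_def)
  have "nrm (in_degree n X - (\<Sum>u\<in>F. chaos_vec n u (proj_coeff A n u))) \<le> nrm (in_degree n X - in_degree n ?S) +
      nrm (in_degree n ?S - (\<Sum>u\<in>F. chaos_vec n u (proj_coeff A n u)))"
    by (intro nrm_triangle_sub in_degree_TP X S TP_sum PT)
  then have "nrm (in_degree n X - (\<Sum>u\<in>F. chaos_vec n u (proj_coeff A n u))) < \<epsilon>" using 1 2 by (simp only: eq)
  then show ?thesis using that F by blast
qed

lemma TP_expand:
  assumes "A \<in> TP \<tau>" shows "A = (\<Sum>n | A n \<noteq> 0. in_degree n (A n))"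
proof
  fix m
  have "(\<Sum>n | A n \<noteq> 0. in_degree n (A n)) m = (\<Sum>n | A n \<noteq> 0. in_degree n (A n) m)"
    by (rule sum_fun_apply)
  also have "\<dots> = (\<Sum>n | A n \<noteq> 0. if n = m then A m else 0)"
    by (rule sum.cong[OF refl]) (simp add: in_degree_def)
  also have "\<dots> = A m" using TP_D(2)[OF assms] by simp
  finally show "A m = (\<Sum>n | A n \<noteq> 0. in_degree n (A n)) m" ..
qed

lemma proj_coeff_density:
  assumes A: "A \<in> TP \<tau>" and "\<epsilon> > 0"
  obtains F where "finite F" "F \<subseteq> I" "nrm (A - sum (family_vec (proj_coeff A)) F) < \<epsilon>"
proof -
  let ?M = "{n. A n \<noteq> 0}"
  \<comment> \<open>The summand \<open>1\<close> covers \<open>A = 0\<close>.\<close>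
  let ?d = "\<epsilon> / (real (card ?M) + 1)"
  have d: "?d > 0" using \<open>\<epsilon> > 0\<close> by simp
  define Q where "Q n F \<longleftrightarrow> finite F \<and> F \<subseteq> inc n \<and> nrm (in_degree n (A n) - (\<Sum>u\<in>F. chaos_vec n u (proj_coeff A n u))) < ?d" for n F
  have "\<exists>F. Q n F" for n
  proof -
    obtain F where "finite F" "F \<subseteq> inc n" "nrm (in_degree n (A n) - (\<Sum>u\<in>F. chaos_vec n u (proj_coeff A n u))) < ?d"
      by (rule proj_coeff_density_degree[OF TP_D(1)[OF A] A refl d])
    then show ?thesis unfolding Q_def by blast
  qed
  then obtain F where "\<And>n. Q n (F n)" by metis
  then have F: "finite (F n)" "F n \<subseteq> inc n" "nrm (in_degree n (A n) - (\<Sum>u\<in>F n. chaos_vec n u (proj_coeff A n u))) < ?d" for n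
    unfolding Q_def by blast+
  have M: "finite ?M" by (rule TP_D(2)[OF A])
  have FI: "Sigma ?M F \<subseteq> I" using F(2) by blast
  have "sum (family_vec (proj_coeff A)) (Sigma ?M F) = (\<Sum>n\<in>?M. \<Sum>u\<in>F n. chaos_vec n u (proj_coeff A n u))"
    using M F(1) by (simp add: sum.Sigma family_vec_def case_prod_beta)
  then have eq: "A - sum (family_vec (proj_coeff A)) (Sigma ?M F) =
      (\<Sum>n\<in>?M. in_degree n (A n) - (\<Sum>u\<in>F n. chaos_vec n u (proj_coeff A n u)))"
    using TP_expand[OF A] by (simp only: sum_subtractf)
  have PT: "chaos_vec n u (proj_coeff A n u) \<in> TP \<tau>" if "u \<in> F n" for n u
    using family_vec_TP[OF proj_coeff_admissible[OF A], of "(n, u)"] that F(2)[of n] by (auto simp: family_vec_def)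
  have "nrm (A - sum (family_vec (proj_coeff A)) (Sigma ?M F)) \<le>
      (\<Sum>n\<in>?M. nrm (in_degree n (A n) - (\<Sum>u\<in>F n. chaos_vec n u (proj_coeff A n u))))"
    unfolding eq by (rule nrm_sum) (intro TP_diff in_degree_TP TP_D(1)[OF A] TP_sum PT)
  also have "\<dots> \<le> (\<Sum>n\<in>?M. ?d)" by (intro sum_mono less_imp_le F(3))
  also have "\<dots> = real (card ?M) * ?d" by simp
  also have "\<dots> < (real (card ?M) + 1) * ?d" by (rule mult_strict_right_mono[OF _ d]) simp
  also have "\<dots> = \<epsilon>" by simp
  finally show ?thesis using that[OF _ FI] M F(1) by blast
qed

end


section \<open>The decomposition in the completed Fock space\<close>

context chaos_q
begin

abbreviation "rep \<A> \<equiv> SOME X. X \<in> \<A>"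
abbreviation "fock_Cau \<equiv> fock_Cauchy \<tau> q"
abbreviation "rel \<equiv> fock_rel \<tau> q"
abbreviation "fnorm \<equiv> fock_norm \<tau> q"

lemma fock_Cauchy_TP: "X \<in> fock_Cau \<Longrightarrow> X k \<in> TP \<tau>"
  by (simp add: fock_Cauchy_def)

lemma fock_CauchyD:
  assumes "X \<in> fock_Cau" "\<epsilon> > 0"
  obtains M where "\<And>j k. j \<ge> M \<Longrightarrow> k \<ge> M \<Longrightarrow> nrm (X j - X k) < \<epsilon>"
  using assms unfolding fock_Cauchy_def Cauchy_wrt_def by blast

lemma fock_Cauchy_const: "A \<in> TP \<tau> \<Longrightarrow> (\<lambda>_. A) \<in> fock_Cau"
  by (simp add: fock_Cauchy_def Cauchy_wrt_def)

lemma nrm_diff_diff: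
  assumes "A \<in> TP \<tau>" "B \<in> TP \<tau>" "A' \<in> TP \<tau>" "B' \<in> TP \<tau>"
  shows "nrm ((A - B) - (A' - B')) \<le> nrm (A - A') + nrm (B - B')"
proof -
  have "(A - B) - (A' - B') = (A - A') + (B' - B)" by simp
  then show ?thesis
    using nrm_triangle[OF TP_diff[OF assms(1,3)] TP_diff[OF assms(4,2)]] nrm_minus_commute[OF assms(4,2)]
    by (simp only:)
qed

lemma fock_Cauchy_diff:
  assumes X: "X \<in> fock_Cau" and Y: "Y \<in> fock_Cau"
  shows "(\<lambda>k. X k - Y k) \<in> fock_Cau"
  unfolding fock_Cauchy_def Cauchy_wrt_def
proof (intro CollectI conjI allI impI)
  show "X k - Y k \<in> TP \<tau>" for k by (intro TP_diff fock_Cauchy_TP X Y)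
  fix \<epsilon> :: real assume "\<epsilon> > 0"
  then have "\<epsilon> / 2 > 0" by simp
  obtain M where M: "\<And>j k. j \<ge> M \<Longrightarrow> k \<ge> M \<Longrightarrow> nrm (X j - X k) < \<epsilon> / 2"
    by (rule fock_CauchyD[OF X \<open>\<epsilon> / 2 > 0\<close>]) (rule that)
  obtain M' where M': "\<And>j k. j \<ge> M' \<Longrightarrow> k \<ge> M' \<Longrightarrow> nrm (Y j - Y k) < \<epsilon> / 2"
    by (rule fock_CauchyD[OF Y \<open>\<epsilon> / 2 > 0\<close>]) (rule that)
  have "nrm ((X j - Y j) - (X k - Y k)) < \<epsilon>" if "j \<ge> max M M'" "k \<ge> max M M'" for j k
    using nrm_diff_diff[OF fock_Cauchy_TP[OF X, of j] fock_Cauchy_TP[OF Y, of j]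
        fock_Cauchy_TP[OF X, of k] fock_Cauchy_TP[OF Y, of k]] M[of j k] M'[of j k] that by simp
  then show "\<exists>M. \<forall>j\<ge>M. \<forall>k\<ge>M. nrm ((X j - Y j) - (X k - Y k)) < \<epsilon>" by blast
qed

lemma fock_Cauchy_nrm_convergent:
  assumes X: "X \<in> fock_Cau" shows "\<exists>l. (\<lambda>k. nrm (X k)) \<longlonglongrightarrow> l"
proof -
  have "Cauchy (\<lambda>k. nrm (X k))"
  proof (rule metric_CauchyI)
    fix \<epsilon> :: real assume "\<epsilon> > 0"
    then obtain M where M: "\<And>j k. j \<ge> M \<Longrightarrow> k \<ge> M \<Longrightarrow> nrm (X j - X k) < \<epsilon>"
      by (rule fock_CauchyD[OF X]) (rule that)
    have "dist (nrm (X j)) (nrm (X k)) < \<epsilon>" if "j \<ge> M" "k \<ge> M" for j k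
      using nrm_abs_diff[OF fock_Cauchy_TP[OF X, of j] fock_Cauchy_TP[OF X, of k]] M[OF that]
      by (simp add: dist_real_def)
    then show "\<exists>M. \<forall>j\<ge>M. \<forall>k\<ge>M. dist (nrm (X j)) (nrm (X k)) < \<epsilon>" by blast
  qed
  then show ?thesis using Cauchy_convergent convergent_def by blast
qed

lemma rep_rel:
  assumes X: "X \<in> fock_Cau"
  shows "(X, rep (rel `` {X})) \<in> rel" and "rep (rel `` {X}) \<in> fock_Cau"
proof -
  have "(X, X) \<in> rel" using X by (simp add: fock_rel_def)
  then have "\<exists>Y. Y \<in> rel `` {X}" by blast
  then have "rep (rel `` {X}) \<in> rel `` {X}" by (rule someI_ex)
  then show "(X, rep (rel `` {X})) \<in> rel" by blast
  then show "rep (rel `` {X}) \<in> fock_Cau" unfolding fock_rel_def mem_Collect_eq prod.case by (elim conjE)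
qed

lemma rep_fock_space: assumes "\<A> \<in> fock_space \<tau> q" shows "rep \<A> \<in> fock_Cau"
proof -
  obtain X where "X \<in> fock_Cau" "\<A> = rel `` {X}" using assms unfolding fock_space_def by (rule quotientE)
  then show ?thesis using rep_rel(2) by simp
qed

lemma fock_inner_rep:
  assumes Z: "rep \<A> \<in> fock_Cau"
  shows "(\<lambda>k. nrm ((rep \<A>) k)) \<longlonglongrightarrow> fnorm \<A>"
    and "fock_inner \<tau> q \<A> \<A> = complex_of_real ((fnorm \<A>)\<^sup>2)"
proof -
  obtain l where l: "(\<lambda>k. nrm ((rep \<A>) k)) \<longlonglongrightarrow> l" using fock_Cauchy_nrm_convergent[OF Z] by blast
  have "l \<ge> 0" by (rule LIMSEQ_le_const[OF l]) (use nrm_nonneg[OF fock_Cauchy_TP[OF Z]] in blast)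
  have "(\<lambda>k. complex_of_real ((nrm ((rep \<A>) k))\<^sup>2)) \<longlonglongrightarrow> complex_of_real (l\<^sup>2)"
    by (intro tendsto_intros l)
  then have *: "fock_inner \<tau> q \<A> \<A> = complex_of_real (l\<^sup>2)"
    unfolding fock_inner_def ip_self[OF fock_Cauchy_TP[OF Z]] by (rule limI)
  then have "fnorm \<A> = l" using \<open>l \<ge> 0\<close> by (simp add: fock_norm_def)
  then show "(\<lambda>k. nrm ((rep \<A>) k)) \<longlonglongrightarrow> fnorm \<A>" "fock_inner \<tau> q \<A> \<A> = complex_of_real ((fnorm \<A>)\<^sup>2)"
    using l * by simp_all
qed

abbreviation "fdist \<A> B \<equiv> fnorm (fock_diff \<tau> q \<A> (fock_embed \<tau> q B))"

text \<open>The difference and the embedding in the definition of the distance involve chosen representatives;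
  these differ from the evident ones by null sequences.\<close>

lemma fdist_rep:
  assumes Z: "rep \<A> \<in> fock_Cau" and B: "B \<in> TP \<tau>"
  shows "(\<lambda>k. nrm ((rep \<A>) k - B)) \<longlonglongrightarrow> fdist \<A> B"
proof -
  define Y where "Y = rep (fock_embed \<tau> q B)"
  have Y: "Y \<in> fock_Cau" "((\<lambda>_. B), Y) \<in> rel"
    using rep_rel[OF fock_Cauchy_const[OF B]] by (simp_all only: Y_def fock_embed_def)
  define D where "D = rep (fock_diff \<tau> q \<A> (fock_embed \<tau> q B))"
  note ZY = fock_Cauchy_diff[OF Z Y(1)]
  have deq: "fock_diff \<tau> q \<A> (fock_embed \<tau> q B) = rel `` {\<lambda>k. (rep \<A>) k - Y k}"
    unfolding fock_diff_def Y_def ..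
  have D: "D \<in> fock_Cau" "((\<lambda>k. (rep \<A>) k - Y k), D) \<in> rel"
    using rep_rel[OF ZY] by (simp_all only: D_def deq)
  have lim: "(\<lambda>k. nrm (D k)) \<longlonglongrightarrow> fdist \<A> B"
    using fock_inner_rep(1)[of "fock_diff \<tau> q \<A> (fock_embed \<tau> q B)"] D(1) by (simp only: D_def)
  have le: "\<bar>nrm ((rep \<A>) k - B) - nrm (D k)\<bar> \<le> nrm (B - Y k) + nrm (((rep \<A>) k - Y k) - D k)" for k
  proof -
    note t = fock_Cauchy_TP[OF Z, of k] fock_Cauchy_TP[OF Y(1), of k] fock_Cauchy_TP[OF D(1), of k] B
    have "\<bar>nrm ((rep \<A>) k - B) - nrm (D k)\<bar> \<le> nrm (((rep \<A>) k - B) - D k)"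
      by (intro nrm_abs_diff TP_diff t)
    also have "\<dots> \<le> nrm (((rep \<A>) k - B) - ((rep \<A>) k - Y k)) + nrm (((rep \<A>) k - Y k) - D k)"
      by (intro nrm_triangle_sub TP_diff t)
    also have "((rep \<A>) k - B) - ((rep \<A>) k - Y k) = Y k - B" by simp
    also have "nrm (Y k - B) = nrm (B - Y k)" by (rule nrm_minus_commute[OF t(2,4)])
    finally show ?thesis .
  qed
  have "(\<lambda>k. nrm (B - Y k) + nrm (((rep \<A>) k - Y k) - D k)) \<longlonglongrightarrow> 0 + 0"
    using Y(2) D(2) by (intro tendsto_add) (simp_all only: fock_rel_def mem_Collect_eq prod.case)
  then have "(\<lambda>k. nrm (B - Y k) + nrm (((rep \<A>) k - Y k) - D k)) \<longlonglongrightarrow> 0" by simp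
  then have "(\<lambda>k. nrm ((rep \<A>) k - B) - nrm (D k)) \<longlonglongrightarrow> 0"
    by (rule Lim_null_comparison[rotated]) (simp add: le)
  from tendsto_add[OF this lim] show ?thesis by simp
qed

lemma fdist_nonneg:
  assumes "rep \<A> \<in> fock_Cau" "B \<in> TP \<tau>" shows "fdist \<A> B \<ge> 0"
  by (rule LIMSEQ_le_const[OF fdist_rep[OF assms]])
    (use nrm_nonneg[OF TP_diff[OF fock_Cauchy_TP[OF assms(1)] assms(2)]] in blast)

lemma fdist_triangle:
  assumes Z: "rep \<A> \<in> fock_Cau" and B: "B \<in> TP \<tau>" "B' \<in> TP \<tau>"
  shows "nrm (B - B') \<le> fdist \<A> B + fdist \<A> B'"
proof (rule LIMSEQ_le_const)
  show "(\<lambda>k. nrm ((rep \<A>) k - B) + nrm ((rep \<A>) k - B')) \<longlonglongrightarrow> fdist \<A> B + fdist \<A> B'"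
    by (intro tendsto_add fdist_rep Z B)
  have "nrm (B - B') \<le> nrm ((rep \<A>) k - B) + nrm ((rep \<A>) k - B')" for k
    using nrm_triangle_sub[OF B(1) fock_Cauchy_TP[OF Z, of k] B(2)]
      nrm_minus_commute[OF B(1) fock_Cauchy_TP[OF Z, of k]] by simp
  then show "\<exists>M. \<forall>k\<ge>M. nrm (B - B') \<le> nrm ((rep \<A>) k - B) + nrm ((rep \<A>) k - B')" by blast
qed

lemma fdist_fnorm:
  assumes Z: "rep \<A> \<in> fock_Cau" and B: "B \<in> TP \<tau>"
  shows "\<bar>nrm B - fnorm \<A>\<bar> \<le> fdist \<A> B"
proof (rule LIMSEQ_le)
  show "(\<lambda>k. \<bar>nrm B - nrm ((rep \<A>) k)\<bar>) \<longlonglongrightarrow> \<bar>nrm B - fnorm \<A>\<bar>"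
    by (intro tendsto_intros fock_inner_rep(1) Z)
  show "(\<lambda>k. nrm ((rep \<A>) k - B)) \<longlonglongrightarrow> fdist \<A> B" by (rule fdist_rep[OF Z B])
  have "\<bar>nrm B - nrm ((rep \<A>) k)\<bar> \<le> nrm ((rep \<A>) k - B)" for k
    using nrm_abs_diff[OF fock_Cauchy_TP[OF Z, of k] B] by linarith
  then show "\<exists>M. \<forall>k\<ge>M. \<bar>nrm B - nrm ((rep \<A>) k)\<bar> \<le> nrm ((rep \<A>) k - B)" by blast
qed

lemma fock_sums_family_vec:
  "fock_sums \<tau> q (\<lambda>(n, u). in_degree n (stensor \<tau> n (\<eta> n u) (e n u))) I \<A> \<longleftrightarrow>
    ((\<lambda>F. fdist \<A> (sum (family_vec \<eta>) F)) \<longlongrightarrow> 0) (finite_subsets_at_top I)"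
proof -
  have "(\<lambda>(n, u). in_degree n (stensor \<tau> n (\<eta> n u) (e n u))) = family_vec \<eta>"
    unfolding family_vec_def chaos_vec_def by (rule ext) (simp only: case_prod_beta)
  then show ?thesis unfolding fock_sums_def by (simp only:)
qed

lemma chaos_coeffs_iff:
  "\<eta> \<in> chaos_coeffs \<Xi> N \<longleftrightarrow> admissible \<eta> \<and> (\<forall>n u. u \<notin> inc n \<longrightarrow> \<eta> n u = 0)"
  by (auto simp: chaos_coeffs_def admissible_def coeff_space_def)

text \<open>By Bessel's inequality the coefficients of a Cauchy sequence form Cauchy sequences.\<close>

lemma component_limit:
  assumes Z: "Z \<in> fock_Cau" and u: "u \<in> inc n"
  shows "\<exists>\<theta>\<in>coeff_space n u. (\<lambda>k. nrm (chaos_vec n u (proj_coeff (Z k) n u - \<theta>))) \<longlonglongrightarrow> 0"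
proof (rule chaos_vec_complete[OF u])
  have I: "(n, u) \<in> I" using u by simp
  have P: "admissible (proj_coeff (Z k))" for k by (rule proj_coeff_admissible[OF fock_Cauchy_TP[OF Z]])
  show "proj_coeff (Z k) n u \<in> coeff_space n u" for k using admissibleD(2)[OF P I] by simp
  fix \<epsilon> :: real assume "\<epsilon> > 0"
  then obtain M where M: "\<And>j k. j \<ge> M \<Longrightarrow> k \<ge> M \<Longrightarrow> nrm (Z j - Z k) < \<epsilon>"
    by (rule fock_CauchyD[OF Z]) (rule that)
  have "nrm (chaos_vec n u (proj_coeff (Z j) n u - proj_coeff (Z k) n u)) < \<epsilon>" if "j \<ge> M" "k \<ge> M" for j k
  proof -
    have "nrm (sum (family_vec (proj_coeff (Z j - Z k))) {(n, u)}) \<le> nrm (Z j - Z k)"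
      using I by (intro proj_coeff_bessel TP_diff fock_Cauchy_TP Z) simp_all
    moreover have "sum (family_vec (proj_coeff (Z j - Z k))) {(n, u)} = chaos_vec n u (proj_coeff (Z j) n u - proj_coeff (Z k) n u)"
      using proj_coeff_diff[OF fock_Cauchy_TP[OF Z, of j] fock_Cauchy_TP[OF Z, of k] u] by (simp add: family_vec_def)
    ultimately show ?thesis using M[OF that] by simp
  qed
  then show "\<exists>M. \<forall>j\<ge>M. \<forall>k\<ge>M. nrm (chaos_vec n u (proj_coeff (Z j) n u - proj_coeff (Z k) n u)) < \<epsilon>" by blast
qed

text \<open>The coefficients are the limits of the coefficients of an approximating sequence \<open>Z\<close>. Far out in the
  sequence, the partial sums for \<open>Z k\<close> approximate \<open>Z k\<close> uniformly in \<open>k\<close>, because projections are best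
  approximations and \<open>Z M\<close> is close to \<open>Z k\<close>.\<close>

lemma chaos_exists:
  assumes Z: "rep \<A> \<in> fock_Cau"
  shows "\<exists>\<eta>\<in>chaos_coeffs \<Xi> N. ((\<lambda>F. fdist \<A> (sum (family_vec \<eta>) F)) \<longlongrightarrow> 0) (finite_subsets_at_top I)"
proof -
  define Z where "Z = rep \<A>"
  have Zc: "Z \<in> fock_Cau" using Z by (simp only: Z_def)
  note ZT = fock_Cauchy_TP[OF Zc]
  define R where "R n u \<theta> \<longleftrightarrow> \<theta> \<in> coeff_space n u \<and> (\<lambda>k. nrm (chaos_vec n u (proj_coeff (Z k) n u - \<theta>))) \<longlonglongrightarrow> 0" for n u \<theta>
  define \<eta> where "\<eta> n u = (if u \<in> inc n then SOME \<theta>. R n u \<theta> else 0)" for n u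
  have R: "R n u (\<eta> n u)" if "u \<in> inc n" for n u
  proof -
    have "\<exists>\<theta>. R n u \<theta>" using component_limit[OF Zc that] unfolding R_def by blast
    then have "R n u (SOME \<theta>. R n u \<theta>)" by (rule someI_ex)
    then show ?thesis using that by (simp only: \<eta>_def if_True)
  qed
  have adm: "admissible \<eta>" using R by (auto simp: admissible_def R_def)
  have lim: "(\<lambda>k. nrm (sum (family_vec (proj_coeff (Z k))) G - sum (family_vec \<eta>) G)) \<longlonglongrightarrow> 0" if G: "finite G" "G \<subseteq> I" for G
  proof (rule Lim_null_comparison)
    have "(\<lambda>k. \<Sum>i\<in>G. nrm (family_vec (\<lambda>n u. proj_coeff (Z k) n u - \<eta> n u) i)) \<longlonglongrightarrow> (\<Sum>i\<in>G. 0)"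
    proof (rule tendsto_sum)
      fix i assume "i \<in> G"
      then have "snd i \<in> inc (fst i)" using G(2) by auto
      from R[OF this] show "(\<lambda>k. nrm (family_vec (\<lambda>n u. proj_coeff (Z k) n u - \<eta> n u) i)) \<longlonglongrightarrow> 0"
        by (simp only: R_def family_vec_def)
    qed
    then show "(\<lambda>k. \<Sum>i\<in>G. nrm (family_vec (\<lambda>n u. proj_coeff (Z k) n u - \<eta> n u) i)) \<longlonglongrightarrow> 0" by simp
    have ad: "admissible (\<lambda>n u. proj_coeff (Z k) n u - \<eta> n u)" for k
      by (intro admissible_diff proj_coeff_admissible ZT adm)
    have "norm (nrm (sum (family_vec (proj_coeff (Z k))) G - sum (family_vec \<eta>) G)) \<le>
        (\<Sum>i\<in>G. nrm (family_vec (\<lambda>n u. proj_coeff (Z k) n u - \<eta> n u) i))" for k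
    proof -
      have "nrm (sum (family_vec (\<lambda>n u. proj_coeff (Z k) n u - \<eta> n u)) G) \<le>
          (\<Sum>i\<in>G. nrm (family_vec (\<lambda>n u. proj_coeff (Z k) n u - \<eta> n u) i))"
        using G(2) by (intro nrm_sum family_vec_TP ad) blast
      moreover have "0 \<le> nrm (sum (family_vec (\<lambda>n u. proj_coeff (Z k) n u - \<eta> n u)) G)"
        by (intro nrm_nonneg family_vec_sum_TP ad G)
      ultimately show ?thesis unfolding family_vec_sum_diff by simp
    qed
    then show "\<forall>\<^sub>F k in sequentially. norm (nrm (sum (family_vec (proj_coeff (Z k))) G - sum (family_vec \<eta>) G)) \<le>
        (\<Sum>i\<in>G. nrm (family_vec (\<lambda>n u. proj_coeff (Z k) n u - \<eta> n u) i))" by simp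
  qed
  have "((\<lambda>F. fdist \<A> (sum (family_vec \<eta>) F)) \<longlongrightarrow> 0) (finite_subsets_at_top I)"
    unfolding tendsto_iff
  proof (intro allI impI)
    fix \<epsilon> :: real assume "\<epsilon> > 0"
    then have e4: "\<epsilon> / 4 > 0" by simp
    obtain M where M: "\<And>j k. j \<ge> M \<Longrightarrow> k \<ge> M \<Longrightarrow> nrm (Z j - Z k) < \<epsilon> / 4"
      by (rule fock_CauchyD[OF Zc e4]) (rule that)
    obtain F where F: "finite F" "F \<subseteq> I" "nrm (Z M - sum (family_vec (proj_coeff (Z M))) F) < \<epsilon> / 4"
      by (rule proj_coeff_density[OF ZT e4])
    have "dist (fdist \<A> (sum (family_vec \<eta>) G)) 0 < \<epsilon>" if G: "finite G" "F \<subseteq> G" "G \<subseteq> I" for G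
    proof -
      note PT = family_vec_sum_TP[OF proj_coeff_admissible[OF ZT] G(3)] and \<eta>T = family_vec_sum_TP[OF adm G(3)]
      have "nrm (Z k - sum (family_vec \<eta>) G) \<le> \<epsilon> / 2 + nrm (sum (family_vec (proj_coeff (Z k))) G - sum (family_vec \<eta>) G)"
        if k: "k \<ge> M" for k
      proof -
        have "nrm (Z k - sum (family_vec (proj_coeff (Z k))) G) \<le> nrm (Z k - sum (family_vec (proj_coeff (Z M))) G)"
          by (intro proj_coeff_best ZT G proj_coeff_admissible)
        also have "\<dots> \<le> nrm (Z k - Z M) + nrm (Z M - sum (family_vec (proj_coeff (Z M))) G)"
          by (intro nrm_triangle_sub ZT PT)
        also have "nrm (Z M - sum (family_vec (proj_coeff (Z M))) G) \<le> nrm (Z M - sum (family_vec (proj_coeff (Z M))) F)"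
          by (intro proj_coeff_mono ZT G)
        finally have "nrm (Z k - sum (family_vec (proj_coeff (Z k))) G) \<le> \<epsilon> / 2" using M[OF k order_refl] F(3) by linarith
        moreover have "nrm (Z k - sum (family_vec \<eta>) G) \<le> nrm (Z k - sum (family_vec (proj_coeff (Z k))) G) +
            nrm (sum (family_vec (proj_coeff (Z k))) G - sum (family_vec \<eta>) G)"
          by (intro nrm_triangle_sub ZT PT \<eta>T)
        ultimately show ?thesis by linarith
      qed
      then have ev: "\<exists>K. \<forall>k\<ge>K. nrm (Z k - sum (family_vec \<eta>) G) \<le> \<epsilon> / 2 + nrm (sum (family_vec (proj_coeff (Z k))) G - sum (family_vec \<eta>) G)"
        by blast
      have "fdist \<A> (sum (family_vec \<eta>) G) \<le> \<epsilon> / 2 + 0"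
      proof (rule LIMSEQ_le[OF _ _ ev])
        show "(\<lambda>k. nrm (Z k - sum (family_vec \<eta>) G)) \<longlonglongrightarrow> fdist \<A> (sum (family_vec \<eta>) G)"
          unfolding Z_def by (rule fdist_rep[OF Z \<eta>T])
        show "(\<lambda>k. \<epsilon> / 2 + nrm (sum (family_vec (proj_coeff (Z k))) G - sum (family_vec \<eta>) G)) \<longlonglongrightarrow> \<epsilon> / 2 + 0"
          by (intro tendsto_add tendsto_const lim G)
      qed
      then show ?thesis using fdist_nonneg[OF Z \<eta>T] \<open>\<epsilon> > 0\<close> by simp
    qed
    then show "\<forall>\<^sub>F G in finite_subsets_at_top I. dist (fdist \<A> (sum (family_vec \<eta>) G)) 0 < \<epsilon>"
      unfolding eventually_finite_subsets_at_top using F(1,2) by (intro exI[of _ F]) blast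
  qed
  moreover have "\<eta> \<in> chaos_coeffs \<Xi> N" unfolding chaos_coeffs_iff using adm by (simp add: \<eta>_def)
  ultimately show ?thesis by blast
qed

text \<open>By orthogonality a component of the difference of two expansions is bounded by all large partial
  sums of the difference, which tend to \<open>0\<close>.\<close>

lemma chaos_unique:
  assumes Z: "rep \<A> \<in> fock_Cau"
    and \<eta>: "\<eta> \<in> chaos_coeffs \<Xi> N" "((\<lambda>F. fdist \<A> (sum (family_vec \<eta>) F)) \<longlongrightarrow> 0) (finite_subsets_at_top I)"
    and \<theta>: "\<theta> \<in> chaos_coeffs \<Xi> N" "((\<lambda>F. fdist \<A> (sum (family_vec \<theta>) F)) \<longlongrightarrow> 0) (finite_subsets_at_top I)"
  shows "\<eta> = \<theta>"
proof (rule ext, rule ext)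
  fix n u
  have ad: "admissible \<eta>" "admissible \<theta>" using \<eta>(1) \<theta>(1) by (simp_all add: chaos_coeffs_iff)
  note add = admissible_diff[OF ad]
  show "\<eta> n u = \<theta> n u"
  proof (cases "u \<in> inc n")
    case True
    then have i: "(n, u) \<in> I" by simp
    have "nrm (family_vec (\<lambda>n u. \<eta> n u - \<theta> n u) (n, u)) \<le> 0"
    proof (rule tendsto_lowerbound)
      show "((\<lambda>F. fdist \<A> (sum (family_vec \<eta>) F) + fdist \<A> (sum (family_vec \<theta>) F)) \<longlongrightarrow> 0) (finite_subsets_at_top I)"
        using tendsto_add[OF \<eta>(2) \<theta>(2)] by simp
      have "nrm (family_vec (\<lambda>n u. \<eta> n u - \<theta> n u) (n, u)) \<le> fdist \<A> (sum (family_vec \<eta>) F) + fdist \<A> (sum (family_vec \<theta>) F)"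
        if F: "finite F" "{(n, u)} \<subseteq> F" "F \<subseteq> I" for F
      proof -
        have "nrm (family_vec (\<lambda>n u. \<eta> n u - \<theta> n u) (n, u)) \<le> nrm (sum (family_vec \<eta>) F - sum (family_vec \<theta>) F)"
          unfolding family_vec_sum_diff[symmetric] using F by (intro nrm_family_vec_le add) simp_all
        also have "\<dots> \<le> fdist \<A> (sum (family_vec \<eta>) F) + fdist \<A> (sum (family_vec \<theta>) F)"
          by (intro fdist_triangle Z family_vec_sum_TP ad F)
        finally show ?thesis .
      qed
      then show "\<forall>\<^sub>F F in finite_subsets_at_top I.
          nrm (family_vec (\<lambda>n u. \<eta> n u - \<theta> n u) (n, u)) \<le> fdist \<A> (sum (family_vec \<eta>) F) + fdist \<A> (sum (family_vec \<theta>) F)"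
        unfolding eventually_finite_subsets_at_top using i by (intro exI[of _ "{(n, u)}"]) blast
    qed simp
    moreover have "nrm (family_vec (\<lambda>n u. \<eta> n u - \<theta> n u) (n, u)) \<ge> 0" by (intro nrm_nonneg family_vec_TP add i)
    ultimately have "nrm (chaos_vec n u (\<eta> n u - \<theta> n u)) = 0" by (simp add: family_vec_def)
    moreover have "\<eta> n u - \<theta> n u \<in> coeff_space n u" using admissibleD(2)[OF add i] by (simp only: fst_conv snd_conv)
    ultimately have "\<eta> n u - \<theta> n u = 0" by (intro nrm_chaos_vec_eq_0[OF True])
    then show ?thesis by simp
  next
    case False
    then show ?thesis using \<eta>(1) \<theta>(1) by (simp add: chaos_coeffs_iff)
  qed
qed

text \<open>The norms of the partial sums converge to the norm of the limit, and their squares are the partial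
  sums of the claimed series.\<close>

lemma chaos_norm:
  assumes Z: "rep \<A> \<in> fock_Cau" and \<eta>: "admissible \<eta>"
    and s: "((\<lambda>F. fdist \<A> (sum (family_vec \<eta>) F)) \<longlongrightarrow> 0) (finite_subsets_at_top I)"
  shows "((\<lambda>(n, u). of_nat (ymult n u) * chi q n (gmult n (gadjoint n (\<eta> n u)) (\<eta> n u)))
    has_sum fock_inner \<tau> q \<A> \<A>) I"
  unfolding has_sum_def
proof (rule Lim_transform_eventually)
  let ?F = "finite_subsets_at_top I"
  have "((\<lambda>F. nrm (sum (family_vec \<eta>) F) - fnorm \<A>) \<longlongrightarrow> 0) ?F"
  proof (rule Lim_null_comparison[OF _ s])
    show "\<forall>\<^sub>F F in ?F. norm (nrm (sum (family_vec \<eta>) F) - fnorm \<A>) \<le> fdist \<A> (sum (family_vec \<eta>) F)"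
      by (rule eventually_finite_subsets_at_top_weakI)
        (simp only: real_norm_def fdist_fnorm[OF Z family_vec_sum_TP[OF \<eta>]])
  qed
  then have "((\<lambda>F. nrm (sum (family_vec \<eta>) F)) \<longlongrightarrow> fnorm \<A>) ?F" by (simp only: LIM_zero_iff)
  then show "((\<lambda>F. complex_of_real ((nrm (sum (family_vec \<eta>) F))\<^sup>2)) \<longlongrightarrow> fock_inner \<tau> q \<A> \<A>) ?F"
    unfolding fock_inner_rep(2)[OF Z] by (intro tendsto_intros)
  have "complex_of_real ((nrm (sum (family_vec \<eta>) F))\<^sup>2) =
      (\<Sum>(n, u)\<in>F. of_nat (ymult n u) * chi q n (gmult n (gadjoint n (\<eta> n u)) (\<eta> n u)))"
    if F: "finite F" "F \<subseteq> I" for F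
  proof -
    have "complex_of_real ((nrm (family_vec \<eta> i))\<^sup>2) =
        (case i of (n, u) \<Rightarrow> of_nat (ymult n u) * chi q n (gmult n (gadjoint n (\<eta> n u)) (\<eta> n u)))" if "i \<in> F" for i
    proof -
      have i: "i \<in> I" using that F(2) by blast
      show ?thesis
        unfolding family_vec_def case_prod_beta by (rule nrm_chaos_vec(1)[OF admissibleD(1)[OF \<eta> i] admissibleD(3)[OF \<eta> i]])
    qed
    then show ?thesis
      unfolding nrm_family_vec_sum[OF F \<eta>] of_real_sum by (rule sum.cong[OF refl])
  qed
  then show "\<forall>\<^sub>F F in ?F. complex_of_real ((nrm (sum (family_vec \<eta>) F))\<^sup>2) =
      (\<Sum>(n, u)\<in>F. of_nat (ymult n u) * chi q n (gmult n (gadjoint n (\<eta> n u)) (\<eta> n u)))"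
    by (rule eventually_finite_subsets_at_top_weakI)
qed

theorem fock_decomposition:
  assumes "\<A> \<in> fock_space \<tau> q"
  shows "\<exists>!\<eta>. \<eta> \<in> chaos_coeffs \<Xi> N \<and>
      fock_sums \<tau> q (\<lambda>(n, u). in_degree n (stensor \<tau> n (\<eta> n u) (e n u))) I \<A>"
    and "\<eta> \<in> chaos_coeffs \<Xi> N \<Longrightarrow>
      fock_sums \<tau> q (\<lambda>(n, u). in_degree n (stensor \<tau> n (\<eta> n u) (e n u))) I \<A> \<Longrightarrow>
      ((\<lambda>(n, u). of_nat (ymult n u) * chi q n (gmult n (gadjoint n (\<eta> n u)) (\<eta> n u)))
        has_sum fock_inner \<tau> q \<A> \<A>) I"
proof -
  note Z = rep_fock_space[OF assms]
  show "\<exists>!\<eta>. \<eta> \<in> chaos_coeffs \<Xi> N \<and>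
      fock_sums \<tau> q (\<lambda>(n, u). in_degree n (stensor \<tau> n (\<eta> n u) (e n u))) I \<A>"
    unfolding fock_sums_family_vec
  proof (rule ex_ex1I)
    show "\<exists>\<eta>. \<eta> \<in> chaos_coeffs \<Xi> N \<and> ((\<lambda>F. fdist \<A> (sum (family_vec \<eta>) F)) \<longlongrightarrow> 0) (finite_subsets_at_top I)"
      using chaos_exists[OF Z] by blast
  qed (elim conjE, rule chaos_unique[OF Z])
  show "((\<lambda>(n, u). of_nat (ymult n u) * chi q n (gmult n (gadjoint n (\<eta> n u)) (\<eta> n u)))
        has_sum fock_inner \<tau> q \<A> \<A>) I"
    if "\<eta> \<in> chaos_coeffs \<Xi> N" "fock_sums \<tau> q (\<lambda>(n, u). in_degree n (stensor \<tau> n (\<eta> n u) (e n u))) I \<A>"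
    using that unfolding fock_sums_family_vec chaos_coeffs_iff by (intro chaos_norm[OF Z]) simp_all
qed

section \<open>Completeness of one degree for large \<open>N\<close>\<close>

text \<open>Once there are at least \<open>n + 1\<close> letters, an injective word isolates every single coefficient.\<close>

lemma coefficient_le_degree_norm:
  assumes n: "n < N" and \<alpha>: "\<alpha> \<in> Sym0 n"
  shows "sqrt (fact n / real N ^ (n + 1)) * norm (X \<alpha>) \<le> degree_norm n X"
proof -
  let ?g = "restrict id {0..n}" and ?h = "restrict \<alpha> {0..n}"
  have g: "?g \<in> W n" using n by (auto simp: words_def)
  have "\<alpha> i < N" if "i \<le> n" for i
  proof -
    have "\<alpha> i \<le> n" using that Sym0_le_iff[OF \<alpha>] by simp
    then show ?thesis using n by simp
  qed
  then have h: "?h \<in> W n" by (simp add: words_def)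
  have "fiber n ?g ?h = {\<alpha>}"
  proof (rule equalityI)
    show "{\<alpha>} \<subseteq> fiber n ?g ?h" using \<alpha> by (simp add: fiber_def Sym0_le_iff[OF \<alpha>])
    show "fiber n ?g ?h \<subseteq> {\<alpha>}"
    proof
      fix \<beta> assume "\<beta> \<in> fiber n ?g ?h"
      then have \<beta>: "\<beta> \<in> Sym0 n" and eq: "\<And>i. i \<in> {0..n} \<Longrightarrow> ?g (\<beta> i) = ?h i" by (simp_all add: fiber_def)
      have "\<beta> i = \<alpha> i" for i
      proof (cases "i \<le> n")
        case True
        then show ?thesis using eq[of i] Sym0_le_iff[OF \<beta>] by simp
      next
        case False
        then show ?thesis using \<alpha> \<beta> permutes_not_in[of \<alpha> "{0..n}" i] permutes_not_in[of \<beta> "{0..n}" i]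
          by (simp add: Sym0_def)
      qed
      then have "\<beta> = \<alpha>" by (rule ext)
      then show "\<beta> \<in> {\<alpha>}" by simp
    qed
  qed
  then show ?thesis using norm_wsum_le_degree_norm[OF g h, of X] by (simp only: wsum_def) simp
qed

lemma degree_positive:
  assumes n: "n < N" and X: "X \<in> sym_tensor \<tau> n" and "in_degree n X \<noteq> 0"
  shows "0 < Re (ip (in_degree n X) (in_degree n X))"
proof -
  have "X \<noteq> 0" using assms(3) in_degree_zero by blast
  then have "\<exists>\<alpha>. X \<alpha> \<noteq> 0 \<alpha>" by (rule contrapos_np) (rule ext, blast)
  then obtain \<alpha> where \<alpha>: "X \<alpha> \<noteq> 0" by auto
  then have "\<alpha> \<in> Sym0 n" using alg_tensor_outside[OF sym_alg[OF X]] by blast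
  from coefficient_le_degree_norm[OF n this, of X] have le: "sqrt (fact n / real N ^ (n + 1)) * norm (X \<alpha>) \<le> degree_norm n X" .
  have "0 < sqrt (fact n / real N ^ (n + 1)) * norm (X \<alpha>)" using N \<alpha> by (intro mult_pos_pos) simp_all
  then have "0 < degree_norm n X" using le by (rule less_le_trans)
  then show ?thesis by (simp add: ip_self[OF in_degree_TP[OF X]] nrm_in_degree[OF X])
qed

text \<open>A Cauchy sequence for the \<open>q\<close>-norm converges coefficientwise, its limit is symmetric, and
  convergence of the finitely many coefficients implies convergence in the \<open>q\<close>-norm.\<close>

lemma degree_complete:
  assumes n: "n < N" shows "complete_wrt nrm (in_degree n ` sym_tensor \<tau> n)"
  unfolding complete_wrt_def
proof (intro allI impI, elim conjE)
  fix A assume A: "\<forall>k. A k \<in> in_degree n ` sym_tensor \<tau> n" and Cau: "Cauchy_wrt nrm A"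
  define X where "X k = A k n" for k
  have X: "A k = in_degree n (X k)" "X k \<in> sym_tensor \<tau> n" for k
  proof -
    obtain Y where "A k = in_degree n Y" "Y \<in> sym_tensor \<tau> n" using A by blast
    then show "A k = in_degree n (X k)" "X k \<in> sym_tensor \<tau> n" by (simp_all add: X_def in_degree_def)
  qed
  have d: "nrm (in_degree n (X j) - in_degree n Y) = degree_norm n (X j - Y)" if "Y \<in> sym_tensor \<tau> n" for j Y
    unfolding in_degree_diff[symmetric] by (rule nrm_in_degree[OF sym_tensor_diff[OF X(2) that]])
  define c where "c = sqrt (fact n / real N ^ (n + 1))"
  have c: "c > 0" using N by (simp add: c_def)
  have conv: "\<exists>l. (\<lambda>k. X k \<alpha>) \<longlonglongrightarrow> l" for \<alpha>
  proof (cases "\<alpha> \<in> Sym0 n")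
    case True
    have "Cauchy (\<lambda>k. X k \<alpha>)"
    proof (rule metric_CauchyI)
      fix \<epsilon> :: real assume "\<epsilon> > 0"
      then have "c * \<epsilon> > 0" using c by simp
      then obtain M where M: "\<And>j k. j \<ge> M \<Longrightarrow> k \<ge> M \<Longrightarrow> nrm (A j - A k) < c * \<epsilon>"
        using Cau unfolding Cauchy_wrt_def by blast
      have "dist (X j \<alpha>) (X k \<alpha>) < \<epsilon>" if "j \<ge> M" "k \<ge> M" for j k
      proof -
        have "c * norm ((X j - X k) \<alpha>) \<le> degree_norm n (X j - X k)"
          unfolding c_def by (rule coefficient_le_degree_norm[OF n True])
        also have "\<dots> < c * \<epsilon>" using M[OF that] by (simp only: X(1) d[OF X(2)])
        finally show ?thesis using c by (simp add: dist_norm)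
      qed
      then show "\<exists>M. \<forall>j\<ge>M. \<forall>k\<ge>M. dist (X j \<alpha>) (X k \<alpha>) < \<epsilon>" by blast
    qed
    then show ?thesis using Cauchy_convergent convergent_def by blast
  next
    case False
    then have "X k \<alpha> = 0" for k by (rule alg_tensor_outside[OF sym_alg[OF X(2)]])
    then show ?thesis by (intro exI[of _ 0]) simp
  qed
  define Y where "Y \<alpha> = lim (\<lambda>k. X k \<alpha>)" for \<alpha>
  have Y: "(\<lambda>k. X k \<alpha>) \<longlonglongrightarrow> Y \<alpha>" for \<alpha>
    using conv[of \<alpha>] unfolding Y_def convergent_LIMSEQ_iff[symmetric] convergent_def .
  have "Y \<alpha> \<in> T n" for \<alpha>
    by (rule closed_sequentially[OF closed_T _ Y]) (rule sym_T[OF X(2)])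
  moreover have "Y \<alpha> = 0" if "\<alpha> \<notin> Sym0 n" for \<alpha>
    using Y[of \<alpha>] alg_tensor_outside[OF sym_alg[OF X(2)] that] by (simp add: LIMSEQ_const_iff)
  ultimately have Ya: "Y \<in> alg_tensor \<tau> n" by (simp add: alg_tensor_def)
  have s0: "(\<lambda>k. \<Sum>\<alpha>\<in>Sym0 n. norm ((X k - Y) \<alpha>)) \<longlonglongrightarrow> 0"
  proof -
    have "(\<lambda>k. \<Sum>\<alpha>\<in>Sym0 n. norm (X k \<alpha> - Y \<alpha>)) \<longlonglongrightarrow> (\<Sum>\<alpha>\<in>Sym0 n. norm (Y \<alpha> - Y \<alpha>))"
      by (intro tendsto_intros Y)
    then show ?thesis by simp
  qed
  have Ys: "Y \<in> sym_tensor \<tau> n"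
  proof (rule sym_tensor_closed[OF Ya])
    fix \<epsilon> :: real assume "\<epsilon> > 0"
    from LIMSEQ_D[OF s0 this] obtain k where "norm ((\<Sum>\<alpha>\<in>Sym0 n. norm ((X k - Y) \<alpha>)) - 0) < \<epsilon>" by blast
    then have "(\<Sum>\<alpha>\<in>Sym0 n. norm ((Y - X k) \<alpha>)) < \<epsilon>" by (simp add: norm_minus_commute)
    then have "alg_tensor_norm n (Y - X k) < \<epsilon>" by (rule le_less_trans[OF alg_tensor_norm_le])
    then show "\<exists>Z\<in>sym_tensor \<tau> n. alg_tensor_norm n (Y - Z) < \<epsilon>" using X(2) by blast
  qed
  obtain K where K: "\<And>X :: perm \<Rightarrow> 't. degree_norm n X \<le> K * (\<Sum>\<alpha>\<in>Sym0 n. norm (X \<alpha>))" using degree_norm_le by blast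
  have "(\<lambda>k. nrm (A k - in_degree n Y)) \<longlonglongrightarrow> 0"
  proof (rule Lim_null_comparison)
    show "(\<lambda>k. K * (\<Sum>\<alpha>\<in>Sym0 n. norm ((X k - Y) \<alpha>))) \<longlonglongrightarrow> 0" by (rule tendsto_mult_right_zero[OF s0])
    have "norm (nrm (A k - in_degree n Y)) \<le> K * (\<Sum>\<alpha>\<in>Sym0 n. norm ((X k - Y) \<alpha>))" for k
      unfolding X(1) d[OF Ys] using K[of "X k - Y"] by (simp only: real_norm_def abs_of_nonneg[OF degree_norm_nonneg])
    then show "\<forall>\<^sub>F k in sequentially. norm (nrm (A k - in_degree n Y)) \<le> K * (\<Sum>\<alpha>\<in>Sym0 n. norm ((X k - Y) \<alpha>))"
      by simp
  qed
  then show "\<exists>x\<in>in_degree n ` sym_tensor \<tau> n. (\<lambda>k. nrm (A k - x)) \<longlonglongrightarrow> 0"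
    using Ys by blast
qed

end


theorem mainTheorem4:
  fixes \<tau> :: "nat \<Rightarrow> (nat \<Rightarrow> 'h::{real_inner,complete_space} complexification) \<Rightarrow> 't::complex_hilbert_space"
    and \<Xi> :: "nat set"
    and \<xi> :: "nat \<Rightarrow> 'h complexification"
  assumes tensor: "hilbert_tensor_powers \<tau>"
    and index: "(\<exists>d. \<Xi> = {1..d}) \<or> \<Xi> = {1..}"
    and basis: "orthonormal_basis \<Xi> \<xi>"
  shows
    "TP \<tau> = alg_direct_sum (\<lambda>n. closed_sum (alg_tensor_norm n) (alg_tensor \<tau> n)
                                  (chaos_component \<tau> \<xi> n) (increasing_tuples \<Xi> n)) \<and>
     (\<forall>n. closed_sum_direct (alg_tensor_norm n) (alg_tensor \<tau> n)
            (chaos_component \<tau> \<xi> n) (increasing_tuples \<Xi> n)) \<and>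
     (\<forall>q\<in>Zparam. \<forall>n k. \<forall>u\<in>increasing_tuples \<Xi> n. \<forall>w\<in>increasing_tuples \<Xi> k.
        (n, u) \<noteq> (k, w) \<longrightarrow>
        (\<forall>X\<in>chaos_component \<tau> \<xi> n u. \<forall>Y\<in>chaos_component \<tau> \<xi> k w.
           q_inner \<tau> q (in_degree n X) (in_degree k Y) = 0)) \<and>
     (\<forall>N\<ge>1. \<forall>\<A>\<in>fock_space \<tau> (1 / real N).
       (\<exists>!\<eta>. \<eta> \<in> chaos_coeffs \<Xi> N \<and>
          fock_sums \<tau> (1 / real N)
            (\<lambda>(n, u). in_degree n (stensor \<tau> n (\<eta> n u) (basis_tensor \<tau> \<xi> n u)))
            (Sigma UNIV (increasing_tuples \<Xi>)) \<A>) \<and>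
       (\<forall>\<eta>. \<eta> \<in> chaos_coeffs \<Xi> N \<and>
          fock_sums \<tau> (1 / real N)
            (\<lambda>(n, u). in_degree n (stensor \<tau> n (\<eta> n u) (basis_tensor \<tau> \<xi> n u)))
            (Sigma UNIV (increasing_tuples \<Xi>)) \<A> \<longrightarrow>
          ((\<lambda>(n, u). of_nat (partition_fact (ker_partition n u)) *
                     chi (1 / real N) n (gmult n (gadjoint n (\<eta> n u)) (\<eta> n u)))
             has_sum fock_inner \<tau> (1 / real N) \<A> \<A>) (Sigma UNIV (increasing_tuples \<Xi>)))) \<and>
     (\<forall>n. \<forall>\<^sub>F N in sequentially.
       (\<forall>A\<in>in_degree n ` sym_tensor \<tau> n. A \<noteq> 0 \<longrightarrow> 0 < Re (q_inner \<tau> (1 / real N) A A)) \<and>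
       complete_wrt (q_norm \<tau> (1 / real N)) (in_degree n ` sym_tensor \<tau> n))"
proof (intro conjI)
  interpret chaos \<tau> \<Xi> \<xi> by unfold_locales (rule tensor, rule basis)
  show "TP \<tau> = alg_direct_sum (\<lambda>n. closed_sum (alg_tensor_norm n) (alg_tensor \<tau> n)
      (chaos_component \<tau> \<xi> n) (increasing_tuples \<Xi> n))"
    by (simp only: TP_def flip: sym_tensor_eq_closed_sum)
  show "\<forall>n. closed_sum_direct (alg_tensor_norm n) (alg_tensor \<tau> n)
      (chaos_component \<tau> \<xi> n) (increasing_tuples \<Xi> n)"
    by (intro allI closed_sum_direct_chaos)
  show "\<forall>q\<in>Zparam. \<forall>n k. \<forall>u\<in>increasing_tuples \<Xi> n. \<forall>w\<in>increasing_tuples \<Xi> k.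
        (n, u) \<noteq> (k, w) \<longrightarrow>
        (\<forall>X\<in>chaos_component \<tau> \<xi> n u. \<forall>Y\<in>chaos_component \<tau> \<xi> k w.
           q_inner \<tau> q (in_degree n X) (in_degree k Y) = 0)"
    by (intro ballI allI impI q_orthogonal)
  have at: "chaos_q \<tau> \<Xi> \<xi> N" if "N \<ge> 1" for N by unfold_locales (rule that)
  show "\<forall>N\<ge>1. \<forall>\<A>\<in>fock_space \<tau> (1 / real N).
       (\<exists>!\<eta>. \<eta> \<in> chaos_coeffs \<Xi> N \<and>
          fock_sums \<tau> (1 / real N)
            (\<lambda>(n, u). in_degree n (stensor \<tau> n (\<eta> n u) (basis_tensor \<tau> \<xi> n u)))
            (Sigma UNIV (increasing_tuples \<Xi>)) \<A>) \<and>
       (\<forall>\<eta>. \<eta> \<in> chaos_coeffs \<Xi> N \<and>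
          fock_sums \<tau> (1 / real N)
            (\<lambda>(n, u). in_degree n (stensor \<tau> n (\<eta> n u) (basis_tensor \<tau> \<xi> n u)))
            (Sigma UNIV (increasing_tuples \<Xi>)) \<A> \<longrightarrow>
          ((\<lambda>(n, u). of_nat (partition_fact (ker_partition n u)) *
                     chi (1 / real N) n (gmult n (gadjoint n (\<eta> n u)) (\<eta> n u)))
             has_sum fock_inner \<tau> (1 / real N) \<A> \<A>) (Sigma UNIV (increasing_tuples \<Xi>)))"
  proof (intro allI impI ballI conjI)
    fix N :: nat and \<A> assume N: "1 \<le> N" and A: "\<A> \<in> fock_space \<tau> (1 / real N)"
    note dec = chaos_q.fock_decomposition[OF at[OF N] A]
    show "\<exists>!\<eta>. \<eta> \<in> chaos_coeffs \<Xi> N \<and>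
        fock_sums \<tau> (1 / real N)
          (\<lambda>(n, u). in_degree n (stensor \<tau> n (\<eta> n u) (basis_tensor \<tau> \<xi> n u)))
          (Sigma UNIV (increasing_tuples \<Xi>)) \<A>"
      by (rule dec(1))
    fix \<eta> assume \<eta>: "\<eta> \<in> chaos_coeffs \<Xi> N \<and>
        fock_sums \<tau> (1 / real N)
          (\<lambda>(n, u). in_degree n (stensor \<tau> n (\<eta> n u) (basis_tensor \<tau> \<xi> n u)))
          (Sigma UNIV (increasing_tuples \<Xi>)) \<A>"
    show "((\<lambda>(n, u). of_nat (partition_fact (ker_partition n u)) *
                   chi (1 / real N) n (gmult n (gadjoint n (\<eta> n u)) (\<eta> n u)))
           has_sum fock_inner \<tau> (1 / real N) \<A> \<A>) (Sigma UNIV (increasing_tuples \<Xi>))"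
      by (rule dec(2)[OF conjunct1[OF \<eta>] conjunct2[OF \<eta>]])
  qed
  show "\<forall>n. \<forall>\<^sub>F N in sequentially.
       (\<forall>A\<in>in_degree n ` sym_tensor \<tau> n. A \<noteq> 0 \<longrightarrow> 0 < Re (q_inner \<tau> (1 / real N) A A)) \<and>
       complete_wrt (q_norm \<tau> (1 / real N)) (in_degree n ` sym_tensor \<tau> n)"
  proof (intro allI eventually_sequentiallyI)
    fix n N :: nat assume "n + 1 \<le> N"
    then have N: "1 \<le> N" "n < N" by simp_all
    show "(\<forall>A\<in>in_degree n ` sym_tensor \<tau> n. A \<noteq> 0 \<longrightarrow> 0 < Re (q_inner \<tau> (1 / real N) A A)) \<and>
       complete_wrt (q_norm \<tau> (1 / real N)) (in_degree n ` sym_tensor \<tau> n)"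
      using chaos_q.degree_positive[OF at[OF N(1)] N(2)] chaos_q.degree_complete[OF at[OF N(1)] N(2)] by blast
  qed
qed

end
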